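(* Let $U$ be a $\mathbf{B}_r$-module and $V$ a $\mathbf{B}_1$-module with $V(\emptyset)=\{0\}$. Then $\mathrm{ch}(U\circ V)=\mathrm{ch}(U)\circ\mathrm{ch}(V)$ in $\mathbb{A}(r)$.
   Context: $\mu_r$, $W(r,n)=\mu_r\wr S_n$, $\mathbf{B}_r$ = category of finite sets with free $\mu_r$-action and equivariant bijections ($\mathbf{B}_1$ = finite sets and bijections), $[n]_r=\mu_r\times\{1,\dots,n\}$. A $\mathbf{B}_r$-module is a functor from $\mathbf{B}_r$ to finite-dimensional complex vector spaces, with characteristic $\mathrm{ch}(U)=\sum_n\frac{1}{r^nn!}\sum_{w\in W(r,n)}\mathrm{tr}(w,U([n]_r))p_w\in\mathbb{A}(r)=\mathbb{C}[[p_i(\zeta):i\ge1,\zeta\in\mu_r]]$, where $p_w=\prod p_i(\zeta)^{a_i(\zeta)}$, $a_i(\zeta)$ the number of cycles of $w$ of length $i$ and type $\zeta$ (product of the $\mu_r$-entries along the cycle); for $r=1$, $p_i=p_i(1)$. Substitution: $(U\circ V)(I)=\bigoplus_{\pi}\bigl(U(\pi)\otimes\bigotimes_{\mathcal{O}\in\mu_r\backslash\pi}V(\mathcal{O})\bigr)$ over partitions $\pi$ of $I$ into nonempty blocks permuted by $\mu_r$ with $\mu_r$ acting freely on the blocks; $V(\mathcal{O})=\{(v_J)\in\prod_{J\in\mathcal{O}}V(J): v_{\zeta J}=V(\zeta)(v_J)\}$. Plethysm $\circ:\mathbb{A}(r)\times\mathbb{A}(1)_+\to\mathbb{A}(r)$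 is the unique operation such that $f\mapsto f\circ g$ is a continuous algebra homomorphism, $g\mapsto p_i(\zeta)\circ g$ is a continuous algebra homomorphism, and $p_i(\zeta)\circ p_j=p_{ij}(\zeta^j)$. *)

theory Defs
  imports Complex_Main "HOL-Library.Nat_Bijection"
begin

text \<open>mu_r is written additively as exponents k of the generator zeta = exp(2 pi i/r).
  An object of B_r is modelled as a pair (I, t): a finite set I of naturals together
  with the action t of the generator (t is the identity outside I).  Every finite free
  mu_r-set is isomorphic to one of these, so this full subcategory is equivalent to B_r.\<close>

type_synonym obj = "nat set \<times> (nat \<Rightarrow> nat)"

definition free_obj :: "nat \<Rightarrow> obj \<Rightarrow> bool" where
  "free_obj r X \<longleftrightarrow> (let I = fst X; t = snd X in
     finite I \<and> t ` I \<subseteq> I \<and> (\<forall>x. x \<notin> I \<longrightarrow> t x = x) \<and>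
     (\<forall>x\<in>I. (t ^^ r) x = x) \<and> (\<forall>x\<in>I. \<forall>k. 0 < k \<and> k < r \<longrightarrow> (t ^^ k) x \<noteq> x))"

text \<open>Equivariant bijections (only the restriction of f to the source matters).\<close>
definition morph :: "obj \<Rightarrow> obj \<Rightarrow> (nat \<Rightarrow> nat) \<Rightarrow> bool" where
  "morph X Y f \<longleftrightarrow> bij_betw f (fst X) (fst Y) \<and> (\<forall>x\<in>fst X. f (snd X x) = snd Y (f x))"

definition subspc :: "('i \<Rightarrow> complex) set \<Rightarrow> bool" where
  "subspc W \<longleftrightarrow> (\<lambda>_. 0) \<in> W \<and> (\<forall>u\<in>W. \<forall>v\<in>W. (\<lambda>i. u i + v i) \<in> W) \<and>
                 (\<forall>c. \<forall>u\<in>W. (\<lambda>i. c * u i) \<in> W)"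

definition lincomb :: "('i \<Rightarrow> complex) set \<Rightarrow> (('i \<Rightarrow> complex) \<Rightarrow> complex) \<Rightarrow> 'i \<Rightarrow> complex" where
  "lincomb B c = (\<lambda>i. \<Sum>b\<in>B. c b * b i)"

definition cspan :: "('i \<Rightarrow> complex) set \<Rightarrow> ('i \<Rightarrow> complex) set" where
  "cspan S = {v. \<exists>B c. finite B \<and> B \<subseteq> S \<and> v = lincomb B c}"

definition findim :: "('i \<Rightarrow> complex) set \<Rightarrow> bool" where
  "findim W \<longleftrightarrow> (\<exists>B. finite B \<and> B \<subseteq> W \<and> cspan B = W)"

definition indep :: "('i \<Rightarrow> complex) set \<Rightarrow> bool" where
  "indep B \<longleftrightarrow> (\<forall>c. lincomb B c = (\<lambda>_. 0) \<longrightarrow> (\<forall>b\<in>B. c b = 0))"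

definition is_basis :: "('i \<Rightarrow> complex) set \<Rightarrow> ('i \<Rightarrow> complex) set \<Rightarrow> bool" where
  "is_basis W B \<longleftrightarrow> finite B \<and> B \<subseteq> W \<and> indep B \<and> cspan B = W"

definition linmap :: "('i \<Rightarrow> complex) set \<Rightarrow> (('i \<Rightarrow> complex) \<Rightarrow> ('k \<Rightarrow> complex)) \<Rightarrow> bool" where
  "linmap W g \<longleftrightarrow> (\<forall>u\<in>W. \<forall>v\<in>W. \<forall>c d. g (\<lambda>i. c * u i + d * v i) = (\<lambda>i. c * g u i + d * g v i))"

definition trace :: "('i \<Rightarrow> complex) set \<Rightarrow> (('i \<Rightarrow> complex) \<Rightarrow> ('i \<Rightarrow> complex)) \<Rightarrow> complex" where
  "trace W T = (let B = (SOME B. is_basis W B);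
                    c = (SOME c. \<forall>b\<in>B. T b = lincomb B (c b))
                in \<Sum>b\<in>B. c b b)"

text \<open>A B_r-module: a functor to finite-dimensional complex vector spaces.  sp X is
  the space U(X) and mp X Y f the linear map U(f).\<close>
definition is_module :: "nat \<Rightarrow> (obj \<Rightarrow> ('i \<Rightarrow> complex) set)
     \<Rightarrow> (obj \<Rightarrow> obj \<Rightarrow> (nat \<Rightarrow> nat) \<Rightarrow> ('i \<Rightarrow> complex) \<Rightarrow> ('i \<Rightarrow> complex)) \<Rightarrow> bool" where
  "is_module r sp mp \<longleftrightarrow>
     (\<forall>X. free_obj r X \<longrightarrow> subspc (sp X) \<and> findim (sp X)) \<and>
     (\<forall>X Y f. free_obj r X \<and> free_obj r Y \<and> morph X Y f \<longrightarrow>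
        linmap (sp X) (mp X Y f) \<and> (\<forall>v\<in>sp X. mp X Y f v \<in> sp Y)) \<and>
     (\<forall>X Y f g. free_obj r X \<and> free_obj r Y \<and> morph X Y f \<and> (\<forall>x\<in>fst X. f x = g x) \<longrightarrow>
        (\<forall>v\<in>sp X. mp X Y f v = mp X Y g v)) \<and>
     (\<forall>X. free_obj r X \<longrightarrow> (\<forall>v\<in>sp X. mp X X id v = v)) \<and>
     (\<forall>X Y Z f g. free_obj r X \<and> free_obj r Y \<and> free_obj r Z \<and> morph X Y f \<and> morph Y Z g \<longrightarrow>
        (\<forall>v\<in>sp X. mp X Z (g \<circ> f) v = mp Y Z g (mp X Y f v)))"

definition parts :: "nat \<Rightarrow> obj \<Rightarrow> nat set set set" where
  "parts r X = {\<pi>. \<Union>\<pi> = fst X \<and> (\<forall>J\<in>\<pi>. J \<noteq> {}) \<and>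
      (\<forall>J\<in>\<pi>. \<forall>J'\<in>\<pi>. J \<noteq> J' \<longrightarrow> J \<inter> J' = {}) \<and>
      (\<forall>J\<in>\<pi>. snd X ` J \<in> \<pi>) \<and>
      (\<forall>J\<in>\<pi>. \<forall>k. 0 < k \<and> k < r \<longrightarrow> (snd X ^^ k) ` J \<noteq> J)}"

definition pobj :: "(nat \<Rightarrow> nat) \<Rightarrow> nat set set \<Rightarrow> obj" where
  "pobj t \<pi> = (set_encode ` \<pi>,
     \<lambda>c. if c \<in> set_encode ` \<pi> then set_encode (t ` set_decode c) else c)"

definition blockmap :: "(nat \<Rightarrow> nat) \<Rightarrow> nat \<Rightarrow> nat" where
  "blockmap \<sigma> = (\<lambda>c. set_encode (\<sigma> ` set_decode c))"

definition orbits :: "(nat \<Rightarrow> nat) \<Rightarrow> nat set set \<Rightarrow> nat set set set" where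
  "orbits t \<pi> = {{(t ^^ k) ` J | k. True} | J. J \<in> \<pi>}"

text \<open>V(Ob) = {(v_J) in prod_{J in Ob} V(J) : v_{zeta J} = V(zeta)(v_J)};
  a family (v_J) is encoded as F with F (J, j) = v_J j.  Blocks J are B_1-objects (J, id).\<close>
definition VO :: "(obj \<Rightarrow> ('j \<Rightarrow> complex) set)
     \<Rightarrow> (obj \<Rightarrow> obj \<Rightarrow> (nat \<Rightarrow> nat) \<Rightarrow> ('j \<Rightarrow> complex) \<Rightarrow> ('j \<Rightarrow> complex))
     \<Rightarrow> (nat \<Rightarrow> nat) \<Rightarrow> nat set set \<Rightarrow> (nat set \<times> 'j \<Rightarrow> complex) set" where
  "VO Vsp Vmp t Ob = {F. (\<forall>J\<in>Ob. (\<lambda>j. F (J, j)) \<in> Vsp (J, id)) \<and>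
      (\<forall>J j. J \<notin> Ob \<longrightarrow> F (J, j) = 0) \<and>
      (\<forall>J\<in>Ob. (\<lambda>j. F (t ` J, j)) = Vmp (J, id) (t ` J, id) t (\<lambda>j. F (J, j)))}"

definition ptens :: "nat set set set \<Rightarrow> (nat set set \<Rightarrow> nat set \<times> 'j \<Rightarrow> complex)
     \<Rightarrow> (nat set set \<Rightarrow> nat set \<times> 'j) \<Rightarrow> complex" where
  "ptens \<Omega> F = (\<lambda>x. \<Prod>Ob\<in>\<Omega>. F Ob (x Ob))"

text \<open>The component U(pi) tensor (tensor over orbits Ob of V(Ob)).\<close>
definition Comp :: "(obj \<Rightarrow> ('i \<Rightarrow> complex) set) \<Rightarrow> (obj \<Rightarrow> ('j \<Rightarrow> complex) set)
     \<Rightarrow> (obj \<Rightarrow> obj \<Rightarrow> (nat \<Rightarrow> nat) \<Rightarrow> ('j \<Rightarrow> complex) \<Rightarrow> ('j \<Rightarrow> complex))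
     \<Rightarrow> obj \<Rightarrow> nat set set \<Rightarrow> ('i \<times> (nat set set \<Rightarrow> nat set \<times> 'j) \<Rightarrow> complex) set" where
  "Comp Usp Vsp Vmp X \<pi> = cspan {(\<lambda>(a, x). u a * ptens (orbits (snd X) \<pi>) F x) | u F.
       u \<in> Usp (pobj (snd X) \<pi>) \<and> (\<forall>Ob\<in>orbits (snd X) \<pi>. F Ob \<in> VO Vsp Vmp (snd X) Ob)}"

text \<open>(U o V)(X) = direct sum over pi in parts of Comp; an element is encoded as H with
  H (pi, a, x) the pi-component (and 0 for non-partitions).\<close>
definition comp_sp :: "nat \<Rightarrow> (obj \<Rightarrow> ('i \<Rightarrow> complex) set) \<Rightarrow> (obj \<Rightarrow> ('j \<Rightarrow> complex) set)
     \<Rightarrow> (obj \<Rightarrow> obj \<Rightarrow> (nat \<Rightarrow> nat) \<Rightarrow> ('j \<Rightarrow> complex) \<Rightarrow> ('j \<Rightarrow> complex))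
     \<Rightarrow> obj \<Rightarrow> (nat set set \<times> 'i \<times> (nat set set \<Rightarrow> nat set \<times> 'j) \<Rightarrow> complex) set" where
  "comp_sp r Usp Vsp Vmp X = {H.
      (\<forall>\<pi> a x. \<pi> \<notin> parts r X \<longrightarrow> H (\<pi>, a, x) = 0) \<and>
      (\<forall>\<pi>\<in>parts r X. (\<lambda>(a, x). H (\<pi>, a, x)) \<in> Comp Usp Vsp Vmp X \<pi>)}"

text \<open>sigma_* on V(Ob): (sigma_* F)_{sigma J} = V(sigma|J)(F_J).\<close>
definition VOmap :: "(obj \<Rightarrow> obj \<Rightarrow> (nat \<Rightarrow> nat) \<Rightarrow> ('j \<Rightarrow> complex) \<Rightarrow> ('j \<Rightarrow> complex))
     \<Rightarrow> obj \<Rightarrow> (nat \<Rightarrow> nat) \<Rightarrow> nat set set \<Rightarrow> (nat set \<times> 'j \<Rightarrow> complex) \<Rightarrow> (nat set \<times> 'j \<Rightarrow> complex)" where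
  "VOmap Vmp X \<sigma> Ob F = (\<lambda>(J', j).
      if J' \<in> (\<lambda>J. \<sigma> ` J) ` Ob then
        Vmp (inv_into (fst X) \<sigma> ` J', id) (J', id) \<sigma> (\<lambda>j. F (inv_into (fst X) \<sigma> ` J', j)) j
      else 0)"

text \<open>The map Comp X pi \<rightarrow> Comp Y (sigma pi) induced by sigma: the unique linear map
  acting on pure tensors u \<otimes> (\<otimes>_O F_O) by U(sigma) u \<otimes> (\<otimes>_{sigma Ob} sigma_* F_O).\<close>
definition Phi :: "(obj \<Rightarrow> ('i \<Rightarrow> complex) set)
     \<Rightarrow> (obj \<Rightarrow> obj \<Rightarrow> (nat \<Rightarrow> nat) \<Rightarrow> ('i \<Rightarrow> complex) \<Rightarrow> ('i \<Rightarrow> complex))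
     \<Rightarrow> (obj \<Rightarrow> ('j \<Rightarrow> complex) set)
     \<Rightarrow> (obj \<Rightarrow> obj \<Rightarrow> (nat \<Rightarrow> nat) \<Rightarrow> ('j \<Rightarrow> complex) \<Rightarrow> ('j \<Rightarrow> complex))
     \<Rightarrow> obj \<Rightarrow> obj \<Rightarrow> (nat \<Rightarrow> nat) \<Rightarrow> nat set set
     \<Rightarrow> ('i \<times> (nat set set \<Rightarrow> nat set \<times> 'j) \<Rightarrow> complex)
     \<Rightarrow> ('i \<times> (nat set set \<Rightarrow> nat set \<times> 'j) \<Rightarrow> complex)" where
  "Phi Usp Ump Vsp Vmp X Y \<sigma> \<pi> = (THE g.
      (\<forall>v. v \<notin> Comp Usp Vsp Vmp X \<pi> \<longrightarrow> g v = (\<lambda>_. 0)) \<and>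
      linmap (Comp Usp Vsp Vmp X \<pi>) g \<and>
      (\<forall>u F. u \<in> Usp (pobj (snd X) \<pi>) \<and>
             (\<forall>Ob\<in>orbits (snd X) \<pi>. F Ob \<in> VO Vsp Vmp (snd X) Ob) \<longrightarrow>
         g (\<lambda>(a, x). u a * ptens (orbits (snd X) \<pi>) F x) =
         (\<lambda>(a, x). Ump (pobj (snd X) \<pi>) (pobj (snd Y) ((\<lambda>J. \<sigma> ` J) ` \<pi>)) (blockmap \<sigma>) u a *
             ptens (orbits (snd Y) ((\<lambda>J. \<sigma> ` J) ` \<pi>))
               (\<lambda>Ob'. VOmap Vmp X \<sigma> ((\<lambda>J'. inv_into (fst X) \<sigma> ` J') ` Ob')
                        (F ((\<lambda>J'. inv_into (fst X) \<sigma> ` J') ` Ob'))) x)))"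

definition comp_mp :: "nat \<Rightarrow> (obj \<Rightarrow> ('i \<Rightarrow> complex) set)
     \<Rightarrow> (obj \<Rightarrow> obj \<Rightarrow> (nat \<Rightarrow> nat) \<Rightarrow> ('i \<Rightarrow> complex) \<Rightarrow> ('i \<Rightarrow> complex))
     \<Rightarrow> (obj \<Rightarrow> ('j \<Rightarrow> complex) set)
     \<Rightarrow> (obj \<Rightarrow> obj \<Rightarrow> (nat \<Rightarrow> nat) \<Rightarrow> ('j \<Rightarrow> complex) \<Rightarrow> ('j \<Rightarrow> complex))
     \<Rightarrow> obj \<Rightarrow> obj \<Rightarrow> (nat \<Rightarrow> nat)
     \<Rightarrow> (nat set set \<times> 'i \<times> (nat set set \<Rightarrow> nat set \<times> 'j) \<Rightarrow> complex)
     \<Rightarrow> (nat set set \<times> 'i \<times> (nat set set \<Rightarrow> nat set \<times> 'j) \<Rightarrow> complex)" where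
  "comp_mp r Usp Ump Vsp Vmp X Y \<sigma> H = (\<lambda>(\<pi>', a, x).
      if \<pi>' \<in> parts r Y then
        (let \<pi> = (\<lambda>J'. inv_into (fst X) \<sigma> ` J') ` \<pi>'
         in Phi Usp Ump Vsp Vmp X Y \<sigma> \<pi> (\<lambda>(a, x). H (\<pi>, a, x)) (a, x))
      else 0)"

text \<open>A(r) = C[[p_i(zeta^k) : i \<ge> 1, k < r]].  A monomial is an exponent function
  m with m (i, k) the exponent of p_i(zeta^k); a series is its coefficient function.\<close>
type_synonym fps = "((nat \<times> nat) \<Rightarrow> nat) \<Rightarrow> complex"

definition valid_mon :: "nat \<Rightarrow> ((nat \<times> nat) \<Rightarrow> nat) \<Rightarrow> bool" where
  "valid_mon r m \<longleftrightarrow> finite {q. m q \<noteq> 0} \<and> (\<forall>i k. m (i, k) \<noteq> 0 \<longrightarrow> 1 \<le> i \<and> k < r)"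

definition Aser :: "nat \<Rightarrow> fps set" where
  "Aser r = {f. \<forall>m. f m \<noteq> 0 \<longrightarrow> valid_mon r m}"

definition Aplus :: "fps set" where
  "Aplus = {g \<in> Aser 1. g (\<lambda>_. 0) = 0}"

definition fadd :: "fps \<Rightarrow> fps \<Rightarrow> fps" where "fadd f g = (\<lambda>m. f m + g m)"
definition fscale :: "complex \<Rightarrow> fps \<Rightarrow> fps" where "fscale c f = (\<lambda>m. c * f m)"
definition fmul :: "fps \<Rightarrow> fps \<Rightarrow> fps" where
  "fmul f g = (\<lambda>m. \<Sum>m1\<in>{m1. \<forall>q. m1 q \<le> m q}. f m1 * g (\<lambda>q. m q - m1 q))"
definition fone :: fps where "fone = (\<lambda>m. if m = (\<lambda>_. 0) then 1 else 0)"

definition pvar :: "nat \<Rightarrow> nat \<Rightarrow> fps" where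
  "pvar i k = (\<lambda>m. if m = (\<lambda>q. if q = (i, k) then 1 else 0) then 1 else 0)"

definition fconv :: "(nat \<Rightarrow> fps) \<Rightarrow> fps \<Rightarrow> bool" where
  "fconv fs f \<longleftrightarrow> (\<forall>m. eventually (\<lambda>n. fs n m = f m) sequentially)"

definition pleth_props :: "nat \<Rightarrow> (fps \<Rightarrow> fps \<Rightarrow> fps) \<Rightarrow> bool" where
  "pleth_props r P \<longleftrightarrow>
     (\<forall>g\<in>Aplus.
        (\<forall>f1\<in>Aser r. \<forall>f2\<in>Aser r. P (fadd f1 f2) g = fadd (P f1 g) (P f2 g) \<and>
                                   P (fmul f1 f2) g = fmul (P f1 g) (P f2 g)) \<and>
        (\<forall>c. \<forall>f\<in>Aser r. P (fscale c f) g = fscale c (P f g)) \<and>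
        P fone g = fone \<and>
        (\<forall>fs f. (\<forall>n. fs n \<in> Aser r) \<and> f \<in> Aser r \<and> fconv fs f \<longrightarrow>
                 fconv (\<lambda>n. P (fs n) g) (P f g))) \<and>
     (\<forall>i k. 1 \<le> i \<and> k < r \<longrightarrow>
        (\<forall>g1\<in>Aplus. \<forall>g2\<in>Aplus. P (pvar i k) (fadd g1 g2) = fadd (P (pvar i k) g1) (P (pvar i k) g2) \<and>
                              P (pvar i k) (fmul g1 g2) = fmul (P (pvar i k) g1) (P (pvar i k) g2)) \<and>
        (\<forall>c. \<forall>g\<in>Aplus. P (pvar i k) (fscale c g) = fscale c (P (pvar i k) g)) \<and>
        (\<forall>gs g. (\<forall>n. gs n \<in> Aplus) \<and> g \<in> Aplus \<and> fconv gs g \<longrightarrow>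
                 fconv (\<lambda>n. P (pvar i k) (gs n)) (P (pvar i k) g))) \<and>
     (\<forall>i k j. 1 \<le> i \<and> k < r \<and> 1 \<le> j \<longrightarrow> P (pvar i k) (pvar j 0) = pvar (i * j) ((k * j) mod r)) \<and>
     (\<forall>f g. \<not> (f \<in> Aser r \<and> g \<in> Aplus) \<longrightarrow> P f g = (\<lambda>_. 0))"

definition pleth :: "nat \<Rightarrow> fps \<Rightarrow> fps \<Rightarrow> fps" where
  "pleth r = (THE P. pleth_props r P)"

text \<open>The object [n]_r = mu_r x {1..n}, with (j, a) encoded as prod_encode (j, a).\<close>
definition stdset :: "nat \<Rightarrow> nat \<Rightarrow> nat set" where
  "stdset r n = {prod_encode (j, a) | j a. j < r \<and> 1 \<le> a \<and> a \<le> n}"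

definition stdobj :: "nat \<Rightarrow> nat \<Rightarrow> obj" where
  "stdobj r n = (stdset r n, \<lambda>x. if x \<in> stdset r n
       then (case prod_decode x of (j, a) \<Rightarrow> prod_encode ((j + 1) mod r, a)) else x)"

text \<open>W(r,n) = mu_r wr S_n: pairs (c, s), c a = exponent of the mu_r-entry at a.\<close>
definition wreath :: "nat \<Rightarrow> nat \<Rightarrow> ((nat \<Rightarrow> nat) \<times> (nat \<Rightarrow> nat)) set" where
  "wreath r n = {(c, s). bij_betw s {1..n} {1..n} \<and> (\<forall>a. a \<notin> {1..n} \<longrightarrow> s a = a) \<and>
                         (\<forall>a. c a < r) \<and> (\<forall>a. a \<notin> {1..n} \<longrightarrow> c a = 0)}"

definition wact :: "nat \<Rightarrow> nat \<Rightarrow> (nat \<Rightarrow> nat) \<times> (nat \<Rightarrow> nat) \<Rightarrow> nat \<Rightarrow> nat" where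
  "wact r n w = (\<lambda>x. if x \<in> stdset r n
       then (case prod_decode x of (j, a) \<Rightarrow> prod_encode ((j + fst w a) mod r, snd w a)) else x)"

definition cycles :: "(nat \<Rightarrow> nat) \<Rightarrow> nat \<Rightarrow> nat set set" where
  "cycles s n = {{(s ^^ m) a | m. True} | a. a \<in> {1..n}}"

definition cyc_type :: "nat \<Rightarrow> nat \<Rightarrow> (nat \<Rightarrow> nat) \<times> (nat \<Rightarrow> nat) \<Rightarrow> (nat \<times> nat) \<Rightarrow> nat" where
  "cyc_type r n w = (\<lambda>(i, k). card {C \<in> cycles (snd w) n. card C = i \<and> (\<Sum>a\<in>C. fst w a) mod r = k})"

definition mdeg :: "((nat \<times> nat) \<Rightarrow> nat) \<Rightarrow> nat" where
  "mdeg m = (\<Sum>q\<in>{q. m q \<noteq> 0}. fst q * m q)"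

definition ch :: "nat \<Rightarrow> (obj \<Rightarrow> ('i \<Rightarrow> complex) set)
     \<Rightarrow> (obj \<Rightarrow> obj \<Rightarrow> (nat \<Rightarrow> nat) \<Rightarrow> ('i \<Rightarrow> complex) \<Rightarrow> ('i \<Rightarrow> complex)) \<Rightarrow> fps" where
  "ch r sp mp = (\<lambda>m. if valid_mon r m then
       (let n = mdeg m in
        (1 / (of_nat (r ^ n) * of_nat (fact n))) *
        (\<Sum>w\<in>{w \<in> wreath r n. cyc_type r n w = m}.
            trace (sp (stdobj r n)) (mp (stdobj r n) (stdobj r n) (wact r n w))))
     else 0)"

end

(* The trace of an operator on a finite-dimensional space of functions is the sum of diagonal
   entries in a reduced echelon basis, whose coordinate functionals are point evaluations; such bases
   multiply under tensor products.  Hence the trace of an automorphism s of X on (U o V)(X) is a sum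
   over s-stable partitions pi of the trace of s on U(pi) times, for each orbit c of blocks under
   mu_r and s, the trace on V(J) of the generator of the stabiliser of a block J in c.

   A finite free mu_r-set with an automorphism is determined up to isomorphism by its cycle type m,
   and ch U has coefficient U^(m)/z(m), where U^(m) is the trace at type m and z(m) the order of the
   automorphism group.  A stable partition of type m is, up to the z(m) automorphisms of a model Y of
   type m, a surjective equivariant map X -> Y.  Equivariant maps are counted orbit by orbit, and
   V(empty) = 0 allows one to drop surjectivity, so the exponential formula turns the sum over
   partitions into a coefficient of a product of the series p_i(zeta) o ch V.  The same count
   applied to the unit of substitution computes z(m). *)
theory Submission
  imports Defs "HOL-Library.FuncSet" "HOL-Library.Disjoint_Sets"
begin

section \<open>Traces on spaces of functions\<close>

text \<open>Three objects in the statement are fixed by choice or description, and each forces work.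
  \<open>trace\<close> picks some basis and some matrix, so it has to be freed from that choice.
  \<open>Phi\<close> is the map with prescribed values on pure tensors, so linear maps on the span
  of pure tensors must be written down and shown unique; with evaluations as coordinates such a map
  is a finite sum of values times images of basis vectors. \<open>pleth\<close> is the operation
  with given properties, so an explicit \<open>plet\<close> is built and uniqueness is proved. The
  counting is done for an arbitrary function \<open>v\<close> of cycle types in place of the
  character of V. With \<open>v\<close> the indicator of a single fixed point, the weight of an
  equivariant map tells whether it is bijective. Numbers of isomorphisms follow from this, and they
  supply both normalisations: centraliser orders and the sizes of conjugacy classes in W(r,n). They
  also supply isomorphisms between sets of equal type without constructing any. The hypothesis on V
  enters as the vanishing of \<open>v\<close> at the zero type, the value attached to an orbit with
  empty fibre.\<close>

definition linfun :: "('i \<Rightarrow> complex) set \<Rightarrow> (('i \<Rightarrow> complex) \<Rightarrow> complex) \<Rightarrow> bool" where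
  "linfun W e \<longleftrightarrow> (\<forall>u\<in>W. \<forall>v\<in>W. \<forall>c d. e (\<lambda>i. c * u i + d * v i) = c * e u + d * e v)"

lemma linmap_iff_linfun: "linmap W T \<longleftrightarrow> (\<forall>i. linfun W (\<lambda>u. T u i))"
  unfolding linmap_def linfun_def fun_eq_iff by blast

lemma linfunD:
  "linfun W e \<Longrightarrow> u \<in> W \<Longrightarrow> v \<in> W \<Longrightarrow> e (\<lambda>i. c * u i + d * v i) = c * e u + d * e v"
  unfolding linfun_def by simp

lemma subspc_lin:
  assumes "subspc W" "u \<in> W" "v \<in> W"
  shows "(\<lambda>i. c * u i + d * v i) \<in> W"
proof -
  have "(\<lambda>i. c * u i) \<in> W" "(\<lambda>i. d * v i) \<in> W" using assms unfolding subspc_def by simp_all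
  then show ?thesis using assms(1)[unfolded subspc_def] by simp
qed

lemma subspc_sum:
  assumes "subspc W" "finite K" "\<And>k. k \<in> K \<Longrightarrow> b k \<in> W"
  shows "(\<lambda>i. \<Sum>k\<in>K. c k * b k i) \<in> W"
  using assms(2,3)
proof (induction K rule: finite_induct)
  case empty
  then show ?case using assms(1) by (simp add: subspc_def)
next
  case (insert k K)
  have "(\<lambda>i. c k * b k i + 1 * (\<Sum>k\<in>K. c k * b k i)) \<in> W"
    by (rule subspc_lin[OF assms(1)], rule insert.prems, simp, rule insert.IH, rule insert.prems, simp)
  then show ?case using insert.hyps by simp
qed

lemma linfun_zero: "subspc W \<Longrightarrow> linfun W e \<Longrightarrow> e (\<lambda>_. 0) = 0"
proof -
  assume W: "subspc W" and e: "linfun W e"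
  have z: "(\<lambda>_. 0) \<in> W" using W by (simp add: subspc_def)
  have "e (\<lambda>i. 0 * (\<lambda>_. 0) i + 0 * (\<lambda>_. 0) i) = 0 * e (\<lambda>_. 0) + 0 * e (\<lambda>_. 0)"
    by (rule linfunD[OF e z z])
  then show ?thesis by simp
qed

lemma linfun_sum:
  assumes "subspc W" "linfun W e" "finite K" "\<And>k. k \<in> K \<Longrightarrow> b k \<in> W"
  shows "e (\<lambda>i. \<Sum>k\<in>K. c k * b k i) = (\<Sum>k\<in>K. c k * e (b k))"
  using assms(3,4)
proof (induction K rule: finite_induct)
  case empty
  then show ?case using linfun_zero[OF assms(1,2)] by simp
next
  case (insert k K)
  have s: "(\<lambda>i. \<Sum>k\<in>K. c k * b k i) \<in> W" by (rule subspc_sum) (use assms insert in auto)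
  have "e (\<lambda>i. c k * b k i + 1 * (\<Sum>k\<in>K. c k * b k i)) = c k * e (b k) + 1 * e (\<lambda>i. \<Sum>k\<in>K. c k * b k i)"
    by (rule linfunD[OF assms(2) _ s]) (use insert.prems in auto)
  then show ?case using insert by simp
qed

lemma linmap_sum:
  assumes "subspc W" "linmap W T" "finite K" "\<And>k. k \<in> K \<Longrightarrow> b k \<in> W"
  shows "T (\<lambda>i. \<Sum>k\<in>K. c k * b k i) = (\<lambda>i. \<Sum>k\<in>K. c k * T (b k) i)"
proof
  fix i
  have "linfun W (\<lambda>u. T u i)" using assms(2) by (simp add: linmap_iff_linfun)
  from linfun_sum[OF assms(1) this assms(3,4)]
  show "T (\<lambda>i. \<Sum>k\<in>K. c k * b k i) i = (\<Sum>k\<in>K. c k * T (b k) i)" .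
qed

lemma linmap_zero: "subspc W \<Longrightarrow> linmap W T \<Longrightarrow> T (\<lambda>_. 0) = (\<lambda>_. 0)"
  using linmap_sum[of W T "{}"] by simp

text \<open>A generating family with functionals that reproduce every vector. The reproducing
  formula alone carries the trace formula, and it survives isomorphisms: the image of an echelon
  basis, with pulled-back functionals, is a frame but need not be echelon.\<close>

definition frame :: "('i \<Rightarrow> complex) set \<Rightarrow> 'k set \<Rightarrow> ('k \<Rightarrow> 'i \<Rightarrow> complex)
    \<Rightarrow> ('k \<Rightarrow> ('i \<Rightarrow> complex) \<Rightarrow> complex) \<Rightarrow> bool" where
  "frame W K b e \<longleftrightarrow> finite K \<and> (\<forall>k\<in>K. b k \<in> W \<and> linfun W (e k)) \<and>
     (\<forall>v\<in>W. v = (\<lambda>i. \<Sum>k\<in>K. e k v * b k i))"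

text \<open>Expanding \<open>T (b k)\<close> in the second frame and \<open>b' j\<close> in the
  first turns both sides into the sum over all j and k of
  \<open>e' j (T (b k)) * e k (b' j)\<close>.\<close>

lemma frame_trace_unique:
  assumes W: "subspc W" and T: "linmap W T" "\<And>v. v \<in> W \<Longrightarrow> T v \<in> W"
    and f: "frame W K b e" and f': "frame W K' b' e'"
  shows "(\<Sum>k\<in>K. e k (T (b k))) = (\<Sum>j\<in>K'. e' j (T (b' j)))"
proof -
  have K: "finite K" "finite K'" using f f' by (auto simp: frame_def)
  have b: "b k \<in> W" if "k \<in> K" for k using f that by (auto simp: frame_def)
  have b': "b' k \<in> W" if "k \<in> K'" for k using f' that by (auto simp: frame_def)
  have 1: "e k (T (b k)) = (\<Sum>j\<in>K'. e' j (T (b k)) * e k (b' j))" if "k \<in> K" for k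
  proof -
    have "T (b k) = (\<lambda>i. \<Sum>j\<in>K'. e' j (T (b k)) * b' j i)"
      using f' T(2)[OF b[OF that]] by (auto simp: frame_def)
    then have "e k (T (b k)) = e k (\<lambda>i. \<Sum>j\<in>K'. e' j (T (b k)) * b' j i)" by simp
    also have "\<dots> = (\<Sum>j\<in>K'. e' j (T (b k)) * e k (b' j))"
      by (rule linfun_sum[OF W]) (use f K b' that in \<open>auto simp: frame_def\<close>)
    finally show ?thesis .
  qed
  have 2: "e' j (T (b' j)) = (\<Sum>k\<in>K. e k (b' j) * e' j (T (b k)))" if "j \<in> K'" for j
  proof -
    have "b' j = (\<lambda>i. \<Sum>k\<in>K. e k (b' j) * b k i)"
      using f b'[OF that] by (auto simp: frame_def)
    then have "T (b' j) = T (\<lambda>i. \<Sum>k\<in>K. e k (b' j) * b k i)" by simp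
    also have "\<dots> = (\<lambda>i. \<Sum>k\<in>K. e k (b' j) * T (b k) i)"
      by (rule linmap_sum[OF W T(1) K(1)]) (rule b)
    finally have "e' j (T (b' j)) = e' j (\<lambda>i. \<Sum>k\<in>K. e k (b' j) * T (b k) i)" by simp
    also have "\<dots> = (\<Sum>k\<in>K. e k (b' j) * e' j (T (b k)))"
      by (rule linfun_sum[OF W]) (use f' K T(2) b that in \<open>auto simp: frame_def\<close>)
    finally show ?thesis .
  qed
  have "(\<Sum>k\<in>K. e k (T (b k))) = (\<Sum>k\<in>K. \<Sum>j\<in>K'. e' j (T (b k)) * e k (b' j))"
    using 1 by (rule sum.cong[OF refl])
  also have "\<dots> = (\<Sum>j\<in>K'. \<Sum>k\<in>K. e k (b' j) * e' j (T (b k)))"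
    by (subst sum.swap) (simp add: mult.commute)
  also have "\<dots> = (\<Sum>j\<in>K'. e' j (T (b' j)))"
    using 2 by (intro sum.cong[OF refl]) simp
  finally show ?thesis .
qed

text \<open>Independence makes the coefficients of a vector unique on \<open>B\<close>, and
  uniqueness makes them linear in the vector. The second property identifies whatever coefficients
  \<open>trace\<close> has chosen with the values of \<open>e\<close>.\<close>

lemma basis_frame:
  assumes "is_basis W B"
  obtains e where "frame W B (\<lambda>b. b) e"
    and "\<And>v c. v \<in> W \<Longrightarrow> v = lincomb B c \<Longrightarrow> (\<forall>b\<in>B. c b = e b v)"
proof -
  have fin: "finite B" and sub: "B \<subseteq> W" and ind: "indep B" and sp: "cspan B = W"
    using assms by (auto simp: is_basis_def)
  define e where "e b v = (SOME c. v = lincomb B c) b" for b v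
  have ex: "\<exists>c. v = lincomb B c" if "v \<in> W" for v
  proof -
    from that sp obtain B' c where B': "finite B'" "B' \<subseteq> B" "v = lincomb B' c"
      unfolding cspan_def by blast
    have "lincomb B' c = lincomb B (\<lambda>b. if b \<in> B' then c b else 0)"
      unfolding lincomb_def
      by (rule ext, rule sum.mono_neutral_cong_left) (use B' fin in auto)
    then show ?thesis using B' by metis
  qed
  have uniq: "c b = d b" if "lincomb B c = lincomb B d" "b \<in> B" for c d b
  proof -
    have "lincomb B (\<lambda>b. c b - d b) = (\<lambda>_. 0)"
    proof
      fix i
      have "lincomb B c i = lincomb B d i" using that by simp
      then show "lincomb B (\<lambda>b. c b - d b) i = 0"
        by (simp add: lincomb_def left_diff_distrib sum_subtractf)
    qed
    then show ?thesis using ind that(2) unfolding indep_def by fastforce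
  qed
  have e: "v = lincomb B (\<lambda>b. e b v)" if "v \<in> W" for v
    using someI_ex[OF ex[OF that]] unfolding e_def .
  have eu: "c b = e b v" if "v \<in> W" "v = lincomb B c" "b \<in> B" for v c b
    using uniq[of c "\<lambda>b. e b v" b] e[OF that(1)] that by simp
  have Ws: "subspc W"
    unfolding subspc_def
  proof (intro conjI ballI allI)
    have cl: "lincomb B c \<in> W" for c using sp fin unfolding cspan_def by auto
    show "(\<lambda>_. 0) \<in> W" using cl[of "\<lambda>_. 0"] by (simp add: lincomb_def)
    fix u assume u: "u \<in> W"
    obtain c where c: "u = lincomb B c" using ex[OF u] by blast
    { fix v assume v: "v \<in> W"
      obtain d where d: "v = lincomb B d" using ex[OF v] by blast
      show "(\<lambda>i. u i + v i) \<in> W"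
        using cl[of "\<lambda>b. c b + d b"] c d by (simp add: lincomb_def distrib_right sum.distrib) }
    fix a show "(\<lambda>i. a * u i) \<in> W"
      using cl[of "\<lambda>b. a * c b"] c by (simp add: lincomb_def sum_distrib_left mult.assoc)
  qed
  have lin: "linfun W (e b)" if b: "b \<in> B" for b
    unfolding linfun_def
  proof (intro ballI allI)
    fix u v c d assume u: "u \<in> W" and v: "v \<in> W"
    have "(\<lambda>i. c * u i + d * v i) = lincomb B (\<lambda>b. c * e b u + d * e b v)"
    proof
      fix i
      have "u i = lincomb B (\<lambda>b. e b u) i" "v i = lincomb B (\<lambda>b. e b v) i"
        using e[OF u] e[OF v] by simp_all
      then show "c * u i + d * v i = lincomb B (\<lambda>b. c * e b u + d * e b v) i"
        by (simp add: lincomb_def sum_distrib_left distrib_right sum.distrib mult.assoc)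
    qed
    from eu[OF subspc_lin[OF Ws u v] this b] show "e b (\<lambda>i. c * u i + d * v i) = c * e b u + d * e b v"
      by simp
  qed
  show thesis
  proof (rule that)
    show "frame W B (\<lambda>b. b) e"
      unfolding frame_def using fin sub lin e by (auto simp: lincomb_def)
    show "\<And>v c. v \<in> W \<Longrightarrow> v = lincomb B c \<Longrightarrow> (\<forall>b\<in>B. c b = e b v)" using eu by blast
  qed
qed

text \<open>A reduced echelon basis: the coordinate functionals are evaluations at finitely many
  points, so they extend to tensor products without any quotient construction.\<close>
definition eframe :: "('i \<Rightarrow> complex) set \<Rightarrow> 'i set \<Rightarrow> ('i \<Rightarrow> 'i \<Rightarrow> complex) \<Rightarrow> bool" where
  "eframe W K b \<longleftrightarrow> finite K \<and> (\<forall>k\<in>K. b k \<in> W) \<and>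
     (\<forall>v\<in>W. v = (\<lambda>i. \<Sum>k\<in>K. v k * b k i)) \<and>
     (\<forall>k\<in>K. \<forall>l\<in>K. b k l = (if k = l then 1 else 0))"

lemma eframeD:
  assumes "eframe W K b"
  shows "finite K" "k \<in> K \<Longrightarrow> b k \<in> W" "v \<in> W \<Longrightarrow> v i = (\<Sum>k\<in>K. v k * b k i)"
    "k \<in> K \<Longrightarrow> l \<in> K \<Longrightarrow> b k l = (if k = l then 1 else 0)"
  using assms unfolding eframe_def by (auto dest: fun_cong)

lemma eframe_frame: "eframe W K b \<Longrightarrow> frame W K b (\<lambda>k v. v k)"
  unfolding eframe_def frame_def linfun_def by auto

text \<open>Evaluating a vanishing combination at the pivot \<open>l\<close> isolates the
  coefficient of \<open>b l\<close>. The lemma guarantees that the basis chosen inside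
  \<open>trace\<close> exists.\<close>

lemma eframe_basis:
  assumes W: "subspc W" and f: "eframe W K b"
  shows "is_basis W (b ` K)"
proof -
  have inj: "inj_on b K"
    by (rule inj_onI) (metis eframeD(4)[OF f] one_neq_zero)
  have "indep (b ` K)"
    unfolding indep_def
  proof (intro allI impI ballI)
    fix c x assume c: "lincomb (b ` K) c = (\<lambda>_. 0)" and "x \<in> b ` K"
    then obtain l where l: "l \<in> K" "x = b l" by blast
    have "0 = (\<Sum>k\<in>K. c (b k) * b k l)"
      using fun_cong[OF c, of l] by (simp add: lincomb_def sum.reindex[OF inj])
    also have "\<dots> = (\<Sum>k\<in>K. if k = l then c (b l) else 0)"
      by (rule sum.cong) (use l eframeD(4)[OF f] in auto)
    also have "\<dots> = c (b l)" using l eframeD(1)[OF f] by simp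
    finally show "c x = 0" using l by simp
  qed
  moreover have "cspan (b ` K) = W"
  proof
    show "cspan (b ` K) \<subseteq> W"
    proof
      fix v assume "v \<in> cspan (b ` K)"
      then obtain B c where B: "finite B" "B \<subseteq> b ` K" "v = lincomb B c" unfolding cspan_def by blast
      show "v \<in> W" unfolding B(3) lincomb_def
        by (rule subspc_sum[OF W B(1)]) (use B(2) eframeD(2)[OF f] in blast)
    qed
    show "W \<subseteq> cspan (b ` K)"
    proof
      fix v assume v: "v \<in> W"
      have "v = lincomb (b ` K) (\<lambda>x. v (inv_into K b x))"
      proof
        fix i
        have "lincomb (b ` K) (\<lambda>x. v (inv_into K b x)) i = (\<Sum>k\<in>K. v k * b k i)"
          unfolding lincomb_def by (simp add: sum.reindex[OF inj] inj)
        then show "v i = lincomb (b ` K) (\<lambda>x. v (inv_into K b x)) i"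
          using eframeD(3)[OF f v, of i] by (rule trans[OF _ sym, rotated])
      qed
      then show "v \<in> cspan (b ` K)" unfolding cspan_def using eframeD(1)[OF f] by blast
    qed
  qed
  ultimately show ?thesis
    using eframeD(1,2)[OF f] by (auto simp: is_basis_def)
qed

text \<open>Removes the choices from \<open>trace\<close>: the basis it selects is itself a frame,
  and the matrix it selects must consist of the coordinates of that frame. The basis
  \<open>B0\<close> witnesses that the selection succeeds.\<close>

lemma frame_trace:
  assumes W: "subspc W" and B: "is_basis W B0" and T: "linmap W T" "\<And>v. v \<in> W \<Longrightarrow> T v \<in> W"
    and f: "frame W K b e"
  shows "trace W T = (\<Sum>k\<in>K. e k (T (b k)))"
proof -
  define B where "B = (SOME B. is_basis W B)"
  have BB: "is_basis W B" unfolding B_def by (rule someI[of _ B0]) (rule B)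
  obtain e' where e': "frame W B (\<lambda>b. b) e'"
    "\<And>v c. v \<in> W \<Longrightarrow> v = lincomb B c \<Longrightarrow> (\<forall>b\<in>B. c b = e' b v)"
    using basis_frame[OF BB] by blast
  have inW: "b \<in> W" if "b \<in> B" for b using BB that by (auto simp: is_basis_def)
  define c where "c = (SOME c. \<forall>b\<in>B. T b = lincomb B (c b))"
  have "\<exists>c. \<forall>b\<in>B. T b = lincomb B (c b)"
  proof (rule bchoice, rule ballI)
    fix b assume "b \<in> B"
    then have "T b \<in> W" using inW T by blast
    then have "T b = lincomb B (\<lambda>k. e' k (T b))"
      using e'(1) unfolding frame_def lincomb_def by blast
    then show "\<exists>d. T b = lincomb B d" by blast
  qed
  from someI_ex[OF this] have c: "\<forall>b\<in>B. T b = lincomb B (c b)" unfolding c_def .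
  have "trace W T = (\<Sum>b\<in>B. c b b)" unfolding trace_def B_def c_def Let_def ..
  also have "\<dots> = (\<Sum>b\<in>B. e' b (T b))"
    by (rule sum.cong[OF refl]) (use c e'(2) inW T in blast)
  also have "\<dots> = (\<Sum>k\<in>K. e k (T (b k)))"
    by (rule frame_trace_unique[OF W T e'(1) f])
  finally show ?thesis .
qed

lemma eframe_trace:
  assumes "subspc W" "linmap W T" "\<And>v. v \<in> W \<Longrightarrow> T v \<in> W" "eframe W K b"
  shows "trace W T = (\<Sum>k\<in>K. T (b k) k)"
  using frame_trace[OF assms(1) eframe_basis[OF assms(1,4)] assms(2,3) eframe_frame[OF assms(4)]] .

section \<open>Spans and Gauss-Jordan elimination\<close>

lemma cspan_subspc: "subspc (cspan S)"
proof -
  have 1: "(\<lambda>i. c * u i + d * v i) \<in> cspan S" if uv: "u \<in> cspan S" "v \<in> cspan S" for u v c d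
  proof -
    obtain A p where A: "finite A" "A \<subseteq> S" "u = lincomb A p" using uv(1) unfolding cspan_def by blast
    obtain B q where B: "finite B" "B \<subseteq> S" "v = lincomb B q" using uv(2) unfolding cspan_def by blast
    have u: "u = lincomb (A \<union> B) (\<lambda>b. if b \<in> A then p b else 0)"
      unfolding A(3) lincomb_def
      by (rule ext, rule sum.mono_neutral_cong_left) (use A B in auto)
    have v: "v = lincomb (A \<union> B) (\<lambda>b. if b \<in> B then q b else 0)"
      unfolding B(3) lincomb_def
      by (rule ext, rule sum.mono_neutral_cong_left) (use A B in auto)
    have "(\<lambda>i. c * u i + d * v i) = lincomb (A \<union> B)
        (\<lambda>b. c * (if b \<in> A then p b else 0) + d * (if b \<in> B then q b else 0))"
      by (subst u, subst v) (simp add: lincomb_def sum_distrib_left distrib_right sum.distrib mult.assoc)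
    then show ?thesis unfolding cspan_def using A B by blast
  qed
  have 0: "(\<lambda>_. 0) \<in> cspan S" unfolding cspan_def lincomb_def by (auto intro!: exI[of _ "{}"])
  show ?thesis unfolding subspc_def
  proof (intro conjI ballI allI 0)
    fix u assume u: "u \<in> cspan S"
    fix v assume v: "v \<in> cspan S"
    show "(\<lambda>i. u i + v i) \<in> cspan S" using 1[OF u v, of 1 1] by simp
  next
    fix u c assume u: "u \<in> cspan S"
    show "(\<lambda>i. c * u i) \<in> cspan S" using 1[OF u 0, of c 0] by simp
  qed
qed

lemma cspan_base: "x \<in> S \<Longrightarrow> x \<in> cspan S"
  unfolding cspan_def lincomb_def
  by (auto intro!: exI[of _ "{x}"] exI[of _ "\<lambda>_. 1"])

lemma cspan_least:
  assumes "subspc W" "S \<subseteq> W" shows "cspan S \<subseteq> W"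
proof
  fix v assume "v \<in> cspan S"
  then obtain B c where B: "finite B" "B \<subseteq> S" "v = lincomb B c" unfolding cspan_def by blast
  show "v \<in> W" unfolding B(3) lincomb_def
    by (rule subspc_sum[OF assms(1) B(1)]) (use B(2) assms(2) in blast)
qed

text \<open>Gauss-Jordan elimination, one generator at a time. Pivots are points of the domain, so a
  new pivot is any point at which the reduced generator does not vanish.\<close>

lemma ex_eframe_cspan:
  assumes "finite B"
  shows "\<exists>K b. eframe (cspan B) K b"
  using assms
proof (induction B rule: finite_induct)
  case empty
  have "cspan {} = {\<lambda>_. (0::complex)}" unfolding cspan_def lincomb_def by auto
  then show ?case by (auto simp: eframe_def intro!: exI[of _ "{}"])
next
  case (insert w B)
  then obtain K b where f: "eframe (cspan B) K b" by blast
  let ?W = "cspan (insert w B)"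
  have W: "subspc ?W" by (rule cspan_subspc)
  have sub: "cspan B \<subseteq> ?W" by (rule cspan_least[OF W]) (auto intro: cspan_base)
  have wW: "w \<in> ?W" by (rule cspan_base) simp
  \<comment> \<open>Reduction of \<open>w\<close> by the old basis; it vanishes at all old
    pivots.\<close>
  define w1 where "w1 = (\<lambda>i. w i - (\<Sum>k\<in>K. w k * b k i))"
  have w1W: "w1 \<in> ?W"
  proof -
    have "(\<lambda>i. \<Sum>k\<in>K. w k * b k i) \<in> ?W"
      by (rule subspc_sum[OF W]) (use eframeD[OF f] sub in auto)
    from subspc_lin[OF W wW this, of 1 "-1"] show ?thesis by (simp add: w1_def)
  qed
  have w1K: "w1 l = 0" if "l \<in> K" for l
  proof -
    have "(\<Sum>k\<in>K. w k * b k l) = (\<Sum>k\<in>K. if k = l then w l else 0)"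
      by (rule sum.cong) (use that eframeD(4)[OF f] in auto)
    then show ?thesis using that eframeD(1)[OF f] by (simp add: w1_def)
  qed
  show ?case
  proof (cases "w1 = (\<lambda>_. 0)")
    case True
    have "w i = (\<Sum>k\<in>K. w k * b k i)" for i using fun_cong[OF True, of i] by (simp add: w1_def)
    then have weq: "w = (\<lambda>i. \<Sum>k\<in>K. w k * b k i)" by (rule ext)
    have "(\<lambda>i. \<Sum>k\<in>K. w k * b k i) \<in> cspan B"
      by (rule subspc_sum[OF cspan_subspc]) (use eframeD[OF f] in auto)
    then have "w \<in> cspan B" using weq by metis
    then have "?W \<subseteq> cspan B" by (intro cspan_least cspan_subspc) (auto intro: cspan_base)
    then show ?thesis using sub f by auto
  next
    case False
    then obtain l where l: "w1 l \<noteq> 0" by blast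
    have lK: "l \<notin> K" using l w1K by blast
    define w2 where "w2 = (\<lambda>i. w1 i / w1 l)"
    have w2W: "w2 \<in> ?W"
      using subspc_lin[OF W w1W w1W, of "1 / w1 l" 0] by (simp add: w2_def)
    have w2K: "w2 k = 0" if "k \<in> K" for k using w1K that by (simp add: w2_def)
    have w2l: "w2 l = 1" using l by (simp add: w2_def)
    \<comment> \<open>The new vector is 1 at \<open>l\<close> and 0 at the old pivots; subtracting
      multiples of it clears the column \<open>l\<close> of the old vectors.\<close>
    define b' where "b' k = (if k = l then w2 else (\<lambda>i. b k i - b k l * w2 i))" for k
    have b'W: "b' k \<in> ?W" if "k \<in> insert l K" for k
    proof (cases "k = l")
      case True then show ?thesis using w2W by (simp add: b'_def)
    next
      case False
      then have "b k \<in> ?W" using that eframeD(2)[OF f] sub by auto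
      from subspc_lin[OF W this w2W, of 1 "- b k l"] show ?thesis using False by (simp add: b'_def)
    qed
    have "(\<Sum>k\<in>insert l K. v k * b' k i) = v i" if v: "v \<in> ?W" for v i
    proof -
      \<comment> \<open>The expansion formula is linear in \<open>v\<close>, so it holds on a
        subspace and has to be checked on the old span and on \<open>w\<close>.\<close>
      let ?P = "{v. \<forall>i. (\<Sum>k\<in>insert l K. v k * b' k i) = v i}"
      have "subspc ?P"
        unfolding subspc_def
        by (auto simp: distrib_right sum.distrib sum_distrib_left[symmetric] mult.assoc)
      moreover have inB: "v \<in> ?P" if "v \<in> cspan B" for v
      proof -
        have "(\<Sum>k\<in>insert l K. v k * b' k i) = v i" for i
        proof -
          have "(\<Sum>k\<in>K. v k * b' k i) = (\<Sum>k\<in>K. v k * b k i - v k * b k l * w2 i)"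
            by (rule sum.cong) (use lK in \<open>auto simp: b'_def algebra_simps\<close>)
          also have "\<dots> = v i - v l * w2 i"
            unfolding sum_subtractf sum_distrib_right[symmetric]
            using eframeD(3)[OF f that, symmetric] by simp
          finally show ?thesis using lK eframeD(1)[OF f] by (simp add: b'_def)
        qed
        then show ?thesis by blast
      qed
      moreover have "w \<in> ?P"
      proof -
        have w2P: "w2 \<in> ?P"
        proof -
          have "(\<Sum>k\<in>K. w2 k * b' k i) = 0" for i by (rule sum.neutral) (simp add: w2K)
          then show ?thesis using lK eframeD(1)[OF f] by (simp add: b'_def w2l)
        qed
        have s: "(\<lambda>i. \<Sum>k\<in>K. w k * b k i) \<in> ?P"
          by (rule inB) (rule subspc_sum[OF cspan_subspc], use eframeD[OF f] in auto)
        have "w = (\<lambda>i. w1 l * w2 i + 1 * (\<Sum>k\<in>K. w k * b k i))"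
          using l by (auto simp: w2_def w1_def fun_eq_iff)
        then show ?thesis using subspc_lin[OF \<open>subspc ?P\<close> w2P s, of "w1 l" 1] by metis
      qed
      ultimately have "?W \<subseteq> ?P" by (intro cspan_least) (auto intro: cspan_base)
      then show ?thesis using v by blast
    qed
    moreover have "b' k j = (if k = j then 1 else 0)" if "k \<in> insert l K" "j \<in> insert l K" for k j
      using that lK eframeD(4)[OF f] w2K w2l by (auto simp: b'_def)
    ultimately have "eframe ?W (insert l K) b'"
      unfolding eframe_def using b'W eframeD(1)[OF f] by auto
    then show ?thesis by blast
  qed
qed

lemma ex_eframe: "findim W \<Longrightarrow> \<exists>K b. eframe W K b"
  unfolding findim_def using ex_eframe_cspan by blast

text \<open>The image under \<open>f\<close> of an echelon basis of \<open>W\<close>, with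
  coordinates read off after applying \<open>g\<close>, is a frame of \<open>W'\<close>; in it the
  trace of \<open>T'\<close> becomes that of \<open>T\<close> term by term.\<close>

lemma trace_conj:
  assumes W: "subspc W" and W': "subspc W'" and fd: "findim W"
    and T: "linmap W T" "\<And>v. v \<in> W \<Longrightarrow> T v \<in> W"
    and T': "linmap W' T'" "\<And>v. v \<in> W' \<Longrightarrow> T' v \<in> W'"
    and f: "linmap W f" "\<And>v. v \<in> W \<Longrightarrow> f v \<in> W'"
    and g: "linmap W' g" "\<And>v. v \<in> W' \<Longrightarrow> g v \<in> W"
    and gf: "\<And>v. v \<in> W \<Longrightarrow> g (f v) = v" and fg: "\<And>v. v \<in> W' \<Longrightarrow> f (g v) = v"
    and com: "\<And>v. v \<in> W \<Longrightarrow> T' (f v) = f (T v)"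
    and fd': "findim W'"
  shows "trace W' T' = trace W T"
proof -
  obtain K b where fr: "eframe W K b" using ex_eframe[OF fd] by blast
  obtain K' b' where fr': "eframe W' K' b'" using ex_eframe[OF fd'] by blast
  have "frame W' K (\<lambda>k. f (b k)) (\<lambda>k v. g v k)"
    unfolding frame_def
  proof (intro conjI ballI)
    show "finite K" by (rule eframeD[OF fr])
    fix k assume "k \<in> K"
    then show "f (b k) \<in> W'" by (intro f eframeD[OF fr])
    show "linfun W' (\<lambda>v. g v k)" using g(1) by (simp add: linmap_iff_linfun)
  next
    fix v assume v: "v \<in> W'"
    have "v = f (g v)" using fg[OF v] by simp
    also have "g v = (\<lambda>i. \<Sum>k\<in>K. g v k * b k i)" by (rule ext) (rule eframeD(3)[OF fr g(2)[OF v]])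
    also have "f \<dots> = (\<lambda>i. \<Sum>k\<in>K. g v k * f (b k) i)"
      by (rule linmap_sum[OF W f(1)]) (use eframeD[OF fr] in auto)
    finally show "v = (\<lambda>i. \<Sum>k\<in>K. g v k * f (b k) i)" .
  qed
  from frame_trace[OF W' eframe_basis[OF W' fr'] T' this]
  have "trace W' T' = (\<Sum>k\<in>K. g (T' (f (b k))) k)" .
  also have "\<dots> = (\<Sum>k\<in>K. T (b k) k)"
    by (rule sum.cong) (use com gf T(2) eframeD[OF fr] in auto)
  also have "\<dots> = trace W T" using eframe_trace[OF W T fr] by simp
  finally show ?thesis .
qed

lemma findim_eframe: "subspc W \<Longrightarrow> eframe W K b \<Longrightarrow> findim W"
  using eframe_basis unfolding is_basis_def findim_def by metis

section \<open>Tensor products and cyclic contractions\<close>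

lemma sum_PiE_insert:
  assumes "a \<notin> S"
  shows "(\<Sum>x\<in>PiE (insert a S) K. f x) = (\<Sum>x\<in>PiE S K. \<Sum>k\<in>K a. f (x(a := k)))"
proof -
  have "(\<Sum>x\<in>PiE (insert a S) K. f x) = (\<Sum>(k, x)\<in>K a \<times> PiE S K. f (x(a := k)))"
    unfolding PiE_insert_eq
    by (subst sum.reindex[OF inj_combinator[OF assms]]) (simp add: case_prod_unfold comp_def)
  also have "\<dots> = (\<Sum>k\<in>K a. \<Sum>x\<in>PiE S K. f (x(a := k)))"
    by (rule sum.cartesian_product[symmetric])
  finally show ?thesis by (subst sum.swap)
qed

text \<open>Distributivity: \<open>f\<close> and \<open>g\<close> see disjoint sets of coordinates,
  and a family on the union is a pair of independent families.\<close>

lemma sum_PiE_Un: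
  fixes f g :: "('a \<Rightarrow> 'b) \<Rightarrow> 'c :: comm_semiring_1"
  assumes disj: "A \<inter> B = {}"
    and f: "\<And>x y. (\<And>i. i \<in> A \<Longrightarrow> x i = y i) \<Longrightarrow> f x = f y"
    and g: "\<And>x y. (\<And>i. i \<in> B \<Longrightarrow> x i = y i) \<Longrightarrow> g x = g y"
  shows "(\<Sum>x\<in>PiE (A \<union> B) K. f x * g x) = (\<Sum>x\<in>PiE A K. f x) * (\<Sum>x\<in>PiE B K. g x)"
proof -
  have "(\<Sum>x\<in>PiE (A \<union> B) K. f x * g x) = (\<Sum>(y, z)\<in>PiE A K \<times> PiE B K. f y * g z)"
  proof (rule sum.reindex_bij_witness[of _ "\<lambda>(y, z). \<lambda>i. if i \<in> A then y i else z i"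
        "\<lambda>x. (restrict x A, restrict x B)"])
    fix x assume x: "x \<in> PiE (A \<union> B) K"
    show "(case (restrict x A, restrict x B) of (y, z) \<Rightarrow> \<lambda>i. if i \<in> A then y i else z i) = x"
      using x by (auto simp: fun_eq_iff PiE_def extensional_def)
    show "(restrict x A, restrict x B) \<in> PiE A K \<times> PiE B K" using x by auto
    show "(case (restrict x A, restrict x B) of (y, z) \<Rightarrow> f y * g z) = f x * g x"
      using f[of "restrict x A" x] g[of "restrict x B" x] by simp
  next
    fix p assume p: "p \<in> PiE A K \<times> PiE B K"
    obtain y z where yz: "p = (y, z)" "y \<in> PiE A K" "z \<in> PiE B K" using p by blast
    let ?x = "\<lambda>i. if i \<in> A then y i else z i"
    have "restrict ?x A = y" using yz by (auto simp: fun_eq_iff PiE_def extensional_def)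
    moreover have "restrict ?x B = z"
    proof
      fix i
      show "restrict ?x B i = z i"
        using yz disj by (cases "i \<in> B") (auto simp: PiE_def extensional_def)
    qed
    ultimately show "(\<lambda>x. (restrict x A, restrict x B)) (case p of (y, z) \<Rightarrow> \<lambda>i. if i \<in> A then y i else z i) = p"
      using yz by simp
    show "(case p of (y, z) \<Rightarrow> \<lambda>i. if i \<in> A then y i else z i) \<in> PiE (A \<union> B) K"
      using yz by (auto simp: PiE_def extensional_def)
  qed
  also have "\<dots> = (\<Sum>y\<in>PiE A K. \<Sum>z\<in>PiE B K. f y * g z)"
    by (rule sum.cartesian_product[symmetric])
  finally show ?thesis by (simp add: sum_product)
qed

lemma sum_PiE_UNION:
  fixes f :: "'d \<Rightarrow> ('a \<Rightarrow> 'b) \<Rightarrow> 'c :: comm_semiring_1"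
  assumes "finite D" and "disjoint_family_on cc D"
    and "\<And>d x y. d \<in> D \<Longrightarrow> (\<And>i. i \<in> cc d \<Longrightarrow> x i = y i) \<Longrightarrow> f d x = f d y"
  shows "(\<Sum>x\<in>PiE (\<Union>d\<in>D. cc d) K. \<Prod>d\<in>D. f d x) = (\<Prod>d\<in>D. \<Sum>x\<in>PiE (cc d) K. f d x)"
  using assms
proof (induction D rule: finite_induct)
  case empty
  then show ?case by simp
next
  case (insert d D)
  have "(\<Sum>x\<in>PiE (\<Union>d\<in>insert d D. cc d) K. \<Prod>d\<in>insert d D. f d x)
      = (\<Sum>x\<in>PiE (cc d \<union> (\<Union>d\<in>D. cc d)) K. f d x * (\<Prod>d\<in>D. f d x))"
    using insert.hyps by simp
  also have "\<dots> = (\<Sum>x\<in>PiE (cc d) K. f d x) * (\<Sum>x\<in>PiE (\<Union>d\<in>D. cc d) K. \<Prod>d\<in>D. f d x)"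
  proof (rule sum_PiE_Un)
    show "cc d \<inter> (\<Union>d\<in>D. cc d) = {}"
    proof -
      have "cc d \<inter> cc d' = {}" if "d' \<in> D" for d'
        by (rule disjoint_family_onD[OF insert.prems(1)]) (use that insert.hyps(2) in auto)
      then show ?thesis by blast
    qed
    show "f d x = f d y" if "\<And>i. i \<in> cc d \<Longrightarrow> x i = y i" for x y
      by (rule insert.prems(2)) (use that in auto)
    show "(\<Prod>d\<in>D. f d x) = (\<Prod>d\<in>D. f d y)" if "\<And>i. i \<in> (\<Union>d\<in>D. cc d) \<Longrightarrow> x i = y i" for x y
      by (rule prod.cong[OF refl], rule insert.prems(2)) (use that in auto)
  qed
  also have "(\<Sum>x\<in>PiE (\<Union>d\<in>D. cc d) K. \<Prod>d\<in>D. f d x) = (\<Prod>d\<in>D. \<Sum>x\<in>PiE (cc d) K. f d x)"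
  proof (rule insert.IH)
    show "disjoint_family_on cc D"
      by (rule disjoint_family_on_mono[OF _ insert.prems(1)]) blast
    show "f d' x = f d' y" if "d' \<in> D" "\<And>i. i \<in> cc d' \<Longrightarrow> x i = y i" for d' x y
      by (rule insert.prems(2)) (use that in auto)
  qed
  finally show ?case using insert.hyps by simp
qed

lemma sum_PiE_reindex:
  assumes g: "bij_betw g A B"
  shows "(\<Sum>x\<in>PiE B K. F (\<lambda>a\<in>A. x (g a))) = (\<Sum>y\<in>PiE A (\<lambda>a. K (g a)). F y)"
proof (rule sum.reindex_bij_witness[of _ "\<lambda>y. \<lambda>b\<in>B. y (inv_into A g b)" "\<lambda>x. \<lambda>a\<in>A. x (g a)"])
  have inv: "inv_into A g b \<in> A" "g (inv_into A g b) = b" if "b \<in> B" for b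
    using that g by (auto simp: bij_betw_def inv_into_into f_inv_into_f)
  have inv2: "inv_into A g (g a) = a" "g a \<in> B" if "a \<in> A" for a
    using that g by (auto simp: bij_betw_def)
  fix x assume x: "x \<in> PiE B K"
  show "(\<lambda>b\<in>B. (\<lambda>a\<in>A. x (g a)) (inv_into A g b)) = x"
    using x inv by (auto simp: fun_eq_iff PiE_def extensional_def)
  show "(\<lambda>a\<in>A. x (g a)) \<in> PiE A (\<lambda>a. K (g a))" using x inv2 by auto
  show "F (\<lambda>a\<in>A. x (g a)) = F (\<lambda>a\<in>A. x (g a))" ..
next
  have inv: "inv_into A g b \<in> A" "g (inv_into A g b) = b" if "b \<in> B" for b
    using that g by (auto simp: bij_betw_def inv_into_into f_inv_into_f)
  have inv2: "inv_into A g (g a) = a" "g a \<in> B" if "a \<in> A" for a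
    using that g by (auto simp: bij_betw_def)
  fix y assume y: "y \<in> PiE A (\<lambda>a. K (g a))"
  show "(\<lambda>a\<in>A. (\<lambda>b\<in>B. y (inv_into A g b)) (g a)) = y"
    using y inv2 by (auto simp: fun_eq_iff PiE_def extensional_def)
  show "(\<lambda>b\<in>B. y (inv_into A g b)) \<in> PiE B K"
  proof
    fix b assume b: "b \<in> B"
    have "y (inv_into A g b) \<in> K (g (inv_into A g b))" using y inv[OF b] by (auto simp: PiE_iff)
    then show "(\<lambda>b\<in>B. y (inv_into A g b)) b \<in> K b" using inv[OF b] b by simp
  qed simp
qed

text \<open>An entry of a product of matrices is a sum over paths. The index set may change from
  step to step, and \<open>h\<close> is kept arbitrary so that the induction can absorb the last
  factor into it; with \<open>h\<close> the matrix of a closing edge the sum becomes a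
  trace.\<close>

lemma sum_paths:
  fixes N :: "nat \<Rightarrow> 'a \<Rightarrow> 'a \<Rightarrow> 'c :: comm_semiring_1"
  assumes fin: "\<And>m. finite (I m)"
    and w0: "\<And>k l. k \<in> I 0 \<Longrightarrow> l \<in> I 0 \<Longrightarrow> w 0 k l = (if k = l then 1 else 0)"
    and wS: "\<And>m k l. m < n \<Longrightarrow> k \<in> I 0 \<Longrightarrow> l \<in> I (Suc m) \<Longrightarrow> w (Suc m) k l = (\<Sum>j\<in>I m. w m k j * N m j l)"
  shows "(\<Sum>x\<in>PiE {..n} I. (\<Prod>m<n. N m (x m) (x (Suc m))) * h (x 0) (x n))
    = (\<Sum>k\<in>I 0. \<Sum>l\<in>I n. w n k l * h k l)"
  using wS
proof (induction n arbitrary: h)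
  case 0
  have "(\<Sum>x\<in>PiE {..0} I. h (x 0) (x 0)) = (\<Sum>k\<in>I 0. h k k)"
    using sum_PiE_insert[of 0 "{}" "\<lambda>x. h (x 0) (x 0)" I] by (simp add: atMost_0)
  also have "\<dots> = (\<Sum>k\<in>I 0. \<Sum>l\<in>I 0. if k = l then h k l else 0)"
    using fin by simp
  also have "\<dots> = (\<Sum>k\<in>I 0. \<Sum>l\<in>I 0. w 0 k l * h k l)"
    by (intro sum.cong refl) (simp add: w0)
  finally show ?case by simp
next
  case (Suc n)
  let ?h = "\<lambda>k l. \<Sum>l'\<in>I (Suc n). N n l l' * h k l'"
  have "(\<Sum>x\<in>PiE {..Suc n} I. (\<Prod>m<Suc n. N m (x m) (x (Suc m))) * h (x 0) (x (Suc n)))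
    = (\<Sum>x\<in>PiE {..n} I. \<Sum>l'\<in>I (Suc n). (\<Prod>m<n. N m (x m) (x (Suc m))) * N n (x n) l' * h (x 0) l')"
    unfolding atMost_Suc by (subst sum_PiE_insert) (auto intro!: sum.cong prod.cong)
  also have "\<dots> = (\<Sum>x\<in>PiE {..n} I. (\<Prod>m<n. N m (x m) (x (Suc m))) * ?h (x 0) (x n))"
    by (simp add: sum_distrib_left mult.assoc)
  also have "\<dots> = (\<Sum>k\<in>I 0. \<Sum>l\<in>I n. w n k l * ?h k l)"
    by (rule Suc.IH) (use Suc.prems in auto)
  also have "\<dots> = (\<Sum>k\<in>I 0. \<Sum>l'\<in>I (Suc n). \<Sum>l\<in>I n. w n k l * N n l l' * h k l')"
    unfolding sum_distrib_left by (subst (2) sum.swap) (simp add: mult.assoc)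
  also have "\<dots> = (\<Sum>k\<in>I 0. \<Sum>l'\<in>I (Suc n). w (Suc n) k l' * h k l')"
    by (intro sum.cong refl) (simp add: Suc.prems sum_distrib_right)
  finally show ?case .
qed

section \<open>Composites around cycles of tensor factors\<close>

primrec iter_along :: "('o \<Rightarrow> 'o) \<Rightarrow> ('o \<Rightarrow> 'v \<Rightarrow> 'v) \<Rightarrow> nat \<Rightarrow> 'o \<Rightarrow> 'v \<Rightarrow> 'v" where
  "iter_along s C 0 a v = v"
| "iter_along s C (Suc n) a v = C ((s ^^ n) a) (iter_along s C n a v)"

text \<open>Tensoring the maps \<open>C p\<close> along a cycle permutes the factors cyclically. The
  diagonal entries of this operator are indexed by closed paths of basis indices, and their sum is
  the trace of the composite once around the cycle.\<close>

lemma cycle_trace: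
  fixes C :: "'o \<Rightarrow> ('i \<Rightarrow> complex) \<Rightarrow> ('i \<Rightarrow> complex)"
  assumes bij: "bij_betw (\<lambda>k. (s ^^ k) a) {..<n} c" and n: "0 < n" and ret: "(s ^^ n) a = a"
    and G: "\<And>p. p \<in> c \<Longrightarrow> subspc (G p)" "\<And>p. p \<in> c \<Longrightarrow> eframe (G p) (K p) (b p)"
    and C: "\<And>p. p \<in> c \<Longrightarrow> linmap (G p) (C p)" "\<And>p v. p \<in> c \<Longrightarrow> v \<in> G p \<Longrightarrow> C p v \<in> G (s p)"
  shows "(\<Sum>x\<in>PiE c K. \<Prod>p\<in>c. C p (b p (x p)) (x (s p))) = trace (G a) (iter_along s C n a)"
proof -
  obtain p where p: "n = Suc p" using n gr0_implies_Suc by blast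
  have inc: "(s ^^ m) a \<in> c" for m
  proof -
    have per: "(s ^^ (n * q)) a = a" for q
      by (induction q) (auto simp: funpow_add ret)
    have "(s ^^ m) a = (s ^^ (m mod n + n * (m div n))) a" by simp
    also have "\<dots> = (s ^^ (m mod n)) a" unfolding funpow_add by (simp add: per del: mod_mult_div_eq)
    finally show ?thesis using bij n by (auto simp: bij_betw_def)
  qed
  have ac: "a \<in> c" using inc[of 0] by simp
  define I where "I m = K ((s ^^ m) a)" for m
  define N where "N m k l = C ((s ^^ m) a) (b ((s ^^ m) a) k) l" for m k l
  define w where "w m k l = iter_along s C m a (b a k) l" for m k l
  have it: "iter_along s C m a v \<in> G ((s ^^ m) a)" if "v \<in> G a" for m v
    using that by (induction m) (auto intro: C inc)
  have itl: "linmap (G a) (iter_along s C m a)" for m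
  proof (induction m)
    case 0 show ?case by (simp add: linmap_def)
  next
    case (Suc m)
    show ?case unfolding linmap_def
    proof (intro ballI allI)
      fix u v c d assume u: "u \<in> G a" and v: "v \<in> G a"
      have "iter_along s C m a (\<lambda>i. c * u i + d * v i)
          = (\<lambda>i. c * iter_along s C m a u i + d * iter_along s C m a v i)"
        using Suc u v unfolding linmap_def by blast
      then show "iter_along s C (Suc m) a (\<lambda>i. c * u i + d * v i)
          = (\<lambda>i. c * iter_along s C (Suc m) a u i + d * iter_along s C (Suc m) a v i)"
        using C(1)[OF inc[of m]] it[OF u, of m] it[OF v, of m] unfolding linmap_def by simp
    qed
  qed
  have w0: "w 0 k l = (if k = l then 1 else 0)" if "k \<in> I 0" "l \<in> I 0" for k l
    using that eframeD(4)[OF G(2)[OF ac]] by (simp add: w_def I_def)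
  have wS: "w (Suc m) k l = (\<Sum>j\<in>I m. w m k j * N m j l)" if "k \<in> I 0" for m k l
  proof -
    have k: "b a k \<in> G a" using that eframeD(2)[OF G(2)[OF ac]] by (simp add: I_def)
    have "iter_along s C m a (b a k) = (\<lambda>i. \<Sum>j\<in>I m. w m k j * b ((s ^^ m) a) j i)"
      unfolding w_def I_def by (rule ext) (rule eframeD(3)[OF G(2)[OF inc] it[OF k]])
    then have "w (Suc m) k l = C ((s ^^ m) a) (\<lambda>i. \<Sum>j\<in>I m. w m k j * b ((s ^^ m) a) j i) l"
      by (simp add: w_def)
    also have "\<dots> = (\<Sum>j\<in>I m. w m k j * N m j l)"
      unfolding N_def
      by (subst linmap_sum[OF G(1)[OF inc] C(1)[OF inc]])
        (use eframeD[OF G(2)[OF inc]] in \<open>auto simp: I_def\<close>)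
    finally show ?thesis .
  qed
  have fin: "finite (I m)" for m using eframeD(1)[OF G(2)[OF inc]] by (simp add: I_def)
  \<comment> \<open>The edge from the last position \<open>p\<close> back to 0 is kept apart from
    the open path of length \<open>p\<close>, so that it can serve as \<open>h\<close> in
    \<open>sum_paths\<close>.\<close>
  define F where "F y = (\<Prod>m<p. N m (y m) (y (Suc m))) * N p (y p) (y 0)" for y
  have "(\<Sum>x\<in>PiE c K. \<Prod>q\<in>c. C q (b q (x q)) (x (s q)))
      = (\<Sum>x\<in>PiE c K. F (\<lambda>m\<in>{..<n}. x ((s ^^ m) a)))"
  proof (rule sum.cong[OF refl])
    fix x
    have "(\<Prod>q\<in>c. C q (b q (x q)) (x (s q)))
      = (\<Prod>m<n. N m (x ((s ^^ m) a)) (x ((s ^^ Suc m) a)))"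
      by (subst prod.reindex_bij_betw[OF bij, symmetric]) (simp add: N_def)
    also have "\<dots> = F (\<lambda>m\<in>{..<n}. x ((s ^^ m) a))"
      using ret unfolding F_def p by (simp add: prod.lessThan_Suc)
    finally show "(\<Prod>q\<in>c. C q (b q (x q)) (x (s q))) = F (\<lambda>m\<in>{..<n}. x ((s ^^ m) a))" .
  qed
  also have "\<dots> = (\<Sum>y\<in>PiE {..<n} I. F y)"
    unfolding I_def by (rule sum_PiE_reindex[OF bij])
  also have "\<dots> = (\<Sum>y\<in>PiE {..p} I. (\<Prod>m<p. N m (y m) (y (Suc m))) * N p (y p) (y 0))"
    unfolding F_def p lessThan_Suc_atMost ..
  also have "\<dots> = (\<Sum>k\<in>I 0. \<Sum>l\<in>I p. w p k l * N p l k)"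
    by (rule sum_paths[where h = "\<lambda>k l. N p l k"]) (use fin w0 wS in auto)
  also have "\<dots> = (\<Sum>k\<in>I 0. w n k k)" unfolding p by (rule sum.cong) (simp_all add: wS)
  also have "\<dots> = trace (G a) (iter_along s C n a)"
    unfolding w_def I_def
    by (subst eframe_trace[OF G(1)[OF ac] itl _ G(2)[OF ac]]) (use it[of _ n] ret in auto)
  finally show ?thesis .
qed

text \<open>A permutation of tensor factors splits into cycles with disjoint sets of coordinates, so
  the sum over assignments is the product of the contributions of the cycles.\<close>

lemma cycles_trace:
  fixes C :: "'o \<Rightarrow> ('i \<Rightarrow> complex) \<Rightarrow> ('i \<Rightarrow> complex)"
  assumes D: "finite D" "disjoint_family_on cc D" "\<Omega> = (\<Union>d\<in>D. cc d)"
    and bij: "\<And>d. d \<in> D \<Longrightarrow> bij_betw (\<lambda>k. (s ^^ k) (\<rho> d)) {..<n d} (cc d)"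
    and n: "\<And>d. d \<in> D \<Longrightarrow> 0 < n d" and ret: "\<And>d. d \<in> D \<Longrightarrow> (s ^^ n d) (\<rho> d) = \<rho> d"
    and s: "\<And>p d. d \<in> D \<Longrightarrow> p \<in> cc d \<Longrightarrow> s p \<in> cc d"
    and G: "\<And>p. p \<in> \<Omega> \<Longrightarrow> subspc (G p)" "\<And>p. p \<in> \<Omega> \<Longrightarrow> eframe (G p) (K p) (b p)"
    and C: "\<And>p. p \<in> \<Omega> \<Longrightarrow> linmap (G p) (C p)" "\<And>p v. p \<in> \<Omega> \<Longrightarrow> v \<in> G p \<Longrightarrow> C p v \<in> G (s p)"
  shows "(\<Sum>x\<in>PiE \<Omega> K. \<Prod>p\<in>\<Omega>. C p (b p (x p)) (x (s p)))
    = (\<Prod>d\<in>D. trace (G (\<rho> d)) (iter_along s C (n d) (\<rho> d)))"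
proof -
  have fin: "finite (cc d)" if "d \<in> D" for d using bij[OF that] bij_betw_finite by blast
  have "(\<Sum>x\<in>PiE \<Omega> K. \<Prod>p\<in>\<Omega>. C p (b p (x p)) (x (s p)))
      = (\<Sum>x\<in>PiE \<Omega> K. \<Prod>d\<in>D. \<Prod>p\<in>cc d. C p (b p (x p)) (x (s p)))"
    unfolding D(3)
    by (subst prod.UNION_disjoint[OF D(1)])
      (use fin D(2) in \<open>auto simp: disjoint_family_on_def\<close>)
  also have "\<dots> = (\<Prod>d\<in>D. \<Sum>x\<in>PiE (cc d) K. \<Prod>p\<in>cc d. C p (b p (x p)) (x (s p)))"
    unfolding D(3)
    by (rule sum_PiE_UNION[OF D(1,2)], rule prod.cong[OF refl]) (use s in auto)
  also have "\<dots> = (\<Prod>d\<in>D. trace (G (\<rho> d)) (iter_along s C (n d) (\<rho> d)))"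
  proof (rule prod.cong[OF refl])
    fix d assume d: "d \<in> D"
    have sub: "p \<in> \<Omega>" if "p \<in> cc d" for p using that d D(3) by blast
    show "(\<Sum>x\<in>PiE (cc d) K. \<Prod>p\<in>cc d. C p (b p (x p)) (x (s p)))
        = trace (G (\<rho> d)) (iter_along s C (n d) (\<rho> d))"
      by (rule cycle_trace[OF bij[OF d] n[OF d] ret[OF d]]) (use sub G C in auto)
  qed
  finally show ?thesis .
qed

section \<open>Tensor products inside a space of functions\<close>

definition tens :: "('i \<Rightarrow> complex) set \<Rightarrow> nat set set set \<Rightarrow> (nat set set \<Rightarrow> (nat set \<times> 'j \<Rightarrow> complex) set)
    \<Rightarrow> ('i \<times> (nat set set \<Rightarrow> nat set \<times> 'j) \<Rightarrow> complex) set" where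
  "tens U \<Omega> G = cspan {(\<lambda>(a, x). u a * ptens \<Omega> F x) | u F. u \<in> U \<and> (\<forall>Ob\<in>\<Omega>. F Ob \<in> G Ob)}"

lemma Comp_tens: "Comp Usp Vsp Vmp X \<pi> = tens (Usp (pobj (snd X) \<pi>)) (orbits (snd X) \<pi>) (VO Vsp Vmp (snd X))"
  unfolding Comp_def tens_def ..

lemma tens_subspc: "subspc (tens U \<Omega> G)"
  unfolding tens_def by (rule cspan_subspc)

lemma tens_pure:
  "u \<in> U \<Longrightarrow> (\<And>Ob. Ob \<in> \<Omega> \<Longrightarrow> F Ob \<in> G Ob) \<Longrightarrow> (\<lambda>(a, x). u a * ptens \<Omega> F x) \<in> tens U \<Omega> G"
  unfolding tens_def by (rule cspan_base) blast

lemma tens_least: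
  assumes "subspc P" and "\<And>u F. u \<in> U \<Longrightarrow> (\<And>Ob. Ob \<in> \<Omega> \<Longrightarrow> F Ob \<in> G Ob) \<Longrightarrow> (\<lambda>(a, x). u a * ptens \<Omega> F x) \<in> P"
  shows "tens U \<Omega> G \<subseteq> P"
  unfolding tens_def by (rule cspan_least[OF assms(1)]) (use assms(2) in auto)

lemma sum_prod_scale:
  fixes f :: "'a \<Rightarrow> complex"
  shows "(\<Sum>(a, x)\<in>A \<times> P. (f a * g x) * (p a * q x)) = (\<Sum>a\<in>A. f a * p a) * (\<Sum>x\<in>P. g x * q x)"
  unfolding sum.cartesian_product[symmetric] sum_product by (intro sum.cong refl) (simp add: ac_simps)

text \<open>A product of point evaluations is evaluation at the tuple of points, so products of
  echelon bases are again echelon, with tuples of pivots as pivots. The reproducing identity is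
  linear and is tested on pure tensors, where it splits into the identities of the factors.\<close>

lemma tens_eframe:
  assumes \<Omega>: "finite \<Omega>" and U: "eframe U A bU" and G: "\<And>Ob. Ob \<in> \<Omega> \<Longrightarrow> eframe (G Ob) (K Ob) (b Ob)"
  shows "eframe (tens U \<Omega> G) (A \<times> PiE \<Omega> K) (\<lambda>(a, x) (a', x'). bU a a' * ptens \<Omega> (\<lambda>Ob. b Ob (x Ob)) x')"
  (is "eframe _ ?I ?b")
proof -
  have finI: "finite ?I" using eframeD(1)[OF U] eframeD(1)[OF G] \<Omega> by (auto intro!: finite_PiE)
  let ?P = "{v. \<forall>q. v q = (\<Sum>p\<in>?I. v p * ?b p q)}"
  have "tens U \<Omega> G \<subseteq> ?P"
  proof (rule tens_least)
    show "subspc ?P"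
      unfolding subspc_def
    proof (intro conjI ballI allI)
      show "(\<lambda>_. 0) \<in> ?P" by simp
      fix u v c assume u: "u \<in> ?P"
      { assume v: "v \<in> ?P"
        show "(\<lambda>i. u i + v i) \<in> ?P"
        proof (rule CollectI, rule allI)
          fix q
          have "u q = (\<Sum>p\<in>?I. u p * ?b p q)" "v q = (\<Sum>p\<in>?I. v p * ?b p q)" using u v by blast+
          then show "u q + v q = (\<Sum>p\<in>?I. (u p + v p) * ?b p q)"
            by (simp only: distrib_right sum.distrib)
        qed }
      show "(\<lambda>i. c * u i) \<in> ?P"
      proof (rule CollectI, rule allI)
        fix q
        have "u q = (\<Sum>p\<in>?I. u p * ?b p q)" using u by blast
        then show "c * u q = (\<Sum>p\<in>?I. c * u p * ?b p q)"
          by (simp only: sum_distrib_left mult.assoc)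
      qed
    qed
    fix u F assume u: "u \<in> U" and F: "\<And>Ob. Ob \<in> \<Omega> \<Longrightarrow> F Ob \<in> G Ob"
    have "(\<Sum>p\<in>?I. (case p of (a, x) \<Rightarrow> u a * ptens \<Omega> F x) * ?b p (a', x')) = u a' * ptens \<Omega> F x'" for a' x'
    proof -
      have "(\<Sum>x\<in>PiE \<Omega> K. ptens \<Omega> F x * ptens \<Omega> (\<lambda>Ob. b Ob (x Ob)) x')
          = (\<Prod>Ob\<in>\<Omega>. \<Sum>k\<in>K Ob. F Ob k * b Ob k (x' Ob))"
        unfolding ptens_def prod.distrib[symmetric]
        by (rule prod_sum_PiE[symmetric]) (use \<Omega> eframeD(1)[OF G] in auto)
      also have "\<dots> = ptens \<Omega> F x'"
        unfolding ptens_def by (rule prod.cong[OF refl]) (rule eframeD(3)[OF G F, symmetric])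
      finally have 1: "(\<Sum>x\<in>PiE \<Omega> K. ptens \<Omega> F x * ptens \<Omega> (\<lambda>Ob. b Ob (x Ob)) x') = ptens \<Omega> F x'" .
      have "(\<Sum>p\<in>?I. (case p of (a, x) \<Rightarrow> u a * ptens \<Omega> F x) * ?b p (a', x'))
          = (\<Sum>(a, x)\<in>?I. (u a * ptens \<Omega> F x) * (bU a a' * ptens \<Omega> (\<lambda>Ob. b Ob (x Ob)) x'))"
        by (rule sum.cong) auto
      also have "\<dots> = (\<Sum>a\<in>A. u a * bU a a') * ptens \<Omega> F x'"
        by (simp only: sum_prod_scale 1)
      also have "(\<Sum>a\<in>A. u a * bU a a') = u a'" by (rule eframeD(3)[OF U u, symmetric])
      finally show ?thesis .
    qed
    then show "(\<lambda>(a, x). u a * ptens \<Omega> F x) \<in> ?P" by (auto simp del: case_prod_beta)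
  qed
  moreover have "?b p \<in> tens U \<Omega> G" if "p \<in> ?I" for p
  proof -
    obtain a x where p: "p = (a, x)" "a \<in> A" "x \<in> PiE \<Omega> K" using \<open>p \<in> ?I\<close> by blast
    have "(\<lambda>(a', x'). bU a a' * ptens \<Omega> (\<lambda>Ob. b Ob (x Ob)) x') \<in> tens U \<Omega> G"
      by (rule tens_pure) (use p eframeD(2)[OF U] eframeD(2)[OF G] in \<open>auto simp: PiE_iff\<close>)
    then show ?thesis using p by simp
  qed
  moreover have "?b p q = (if p = q then 1 else 0)" if "p \<in> ?I" "q \<in> ?I" for p q
  proof -
    obtain a x where p: "p = (a, x)" "a \<in> A" "x \<in> PiE \<Omega> K" using \<open>p \<in> ?I\<close> by blast
    obtain a' x' where q: "q = (a', x')" "a' \<in> A" "x' \<in> PiE \<Omega> K" using \<open>q \<in> ?I\<close> by blast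
    have "ptens \<Omega> (\<lambda>Ob. b Ob (x Ob)) x' = (\<Prod>Ob\<in>\<Omega>. if x Ob = x' Ob then 1 else 0)"
      unfolding ptens_def
      by (rule prod.cong[OF refl], rule eframeD(4)[OF G]) (use p q in \<open>auto simp: PiE_iff\<close>)
    also have "\<dots> = (if x = x' then 1 else 0)"
    proof (cases "x = x'")
      case False
      then obtain Ob where "x Ob \<noteq> x' Ob" by blast
      \<comment> \<open>Outside \<open>\<Omega>\<close> both tuples take the same default value, so
        they differ at a genuine factor.\<close>
      then have "Ob \<in> \<Omega>" using p(3) q(3) PiE_arb by metis
      then show ?thesis using \<open>x Ob \<noteq> x' Ob\<close> False \<Omega> by (auto intro!: prod_zero bexI[of _ Ob])
    qed simp
    finally show ?thesis using p q eframeD(4)[OF U p(2) q(2)] by auto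
  qed
  ultimately show ?thesis unfolding eframe_def using finI by blast
qed

text \<open>Justifies the description that defines \<open>Phi\<close>. Existence: send
  \<open>v\<close> to the sum of its values at the pivots times the prescribed images of the basis
  tensors. Uniqueness: two candidates agree on a subspace containing all pure tensors, and both are
  0 off the tensor space. The bijection \<open>s\<close> leads from target factors to source
  factors, as \<open>Phi\<close> looks up preimages.\<close>

lemma tensor_map_ex1:
  fixes U :: "('i \<Rightarrow> complex) set" and A :: "('i \<Rightarrow> complex) \<Rightarrow> 'i \<Rightarrow> complex"
    and G :: "nat set set \<Rightarrow> (nat set \<times> 'j \<Rightarrow> complex) set"
  assumes \<Omega>: "finite \<Omega>" and U: "subspc U" "eframe U AI bU"
    and G: "\<And>Ob. Ob \<in> \<Omega> \<Longrightarrow> subspc (G Ob)" "\<And>Ob. Ob \<in> \<Omega> \<Longrightarrow> eframe (G Ob) (K Ob) (b Ob)"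
    and A: "linmap U A" and s: "bij_betw s \<Omega>' \<Omega>"
    and C: "\<And>Ob. Ob \<in> \<Omega>' \<Longrightarrow> linmap (G (s Ob)) (C Ob)"
  shows "\<exists>!g. (\<forall>v. v \<notin> tens U \<Omega> G \<longrightarrow> g v = (\<lambda>_. 0)) \<and> linmap (tens U \<Omega> G) g \<and>
     (\<forall>u F. u \<in> U \<and> (\<forall>Ob\<in>\<Omega>. F Ob \<in> G Ob) \<longrightarrow>
        g (\<lambda>(a, x). u a * ptens \<Omega> F x) = (\<lambda>(a, x). A u a * ptens \<Omega>' (\<lambda>Ob. C Ob (F (s Ob))) x))"
    (is "\<exists>!g. ?Z g \<and> ?L g \<and> ?T g")
proof (rule ex_ex1I)
  let ?W = "tens U \<Omega> G" and ?I = "AI \<times> PiE \<Omega> K"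
  define im where "im p = (\<lambda>(a', x'). A (bU (fst p)) a' * ptens \<Omega>' (\<lambda>Ob. C Ob (b (s Ob) (snd p (s Ob)))) x')"
    for p
  define g where "g v = (if v \<in> ?W then (\<lambda>q. \<Sum>p\<in>?I. v p * im p q) else (\<lambda>_. 0))" for v
  have "?L g"
    unfolding linmap_def
  proof (intro ballI allI)
    fix u v c d assume u: "u \<in> ?W" and v: "v \<in> ?W"
    have "(\<lambda>i. c * u i + d * v i) \<in> ?W" by (rule subspc_lin[OF tens_subspc u v])
    then show "g (\<lambda>i. c * u i + d * v i) = (\<lambda>i. c * g u i + d * g v i)"
      using u v by (auto simp: g_def fun_eq_iff distrib_right sum.distrib sum_distrib_left mult.assoc)
  qed
  moreover have "?T g"
  proof (intro allI impI)
    fix u F assume uF: "u \<in> U \<and> (\<forall>Ob\<in>\<Omega>. F Ob \<in> G Ob)"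
    then have u: "u \<in> U" and F: "\<And>Ob. Ob \<in> \<Omega> \<Longrightarrow> F Ob \<in> G Ob" by auto
    have inW: "(\<lambda>(a, x). u a * ptens \<Omega> F x) \<in> ?W" by (rule tens_pure[OF u F])
    have 2: "(\<Sum>a\<in>AI. u a * A (bU a) a') = A u a'" for a'
    proof -
      have "u = (\<lambda>i. \<Sum>a\<in>AI. u a * bU a i)" by (rule ext) (rule eframeD(3)[OF U(2) u])
      then have "A u = A (\<lambda>i. \<Sum>a\<in>AI. u a * bU a i)" by (rule arg_cong)
      also have "\<dots> = (\<lambda>i. \<Sum>a\<in>AI. u a * A (bU a) i)"
        by (rule linmap_sum[OF U(1) A]) (use eframeD[OF U(2)] in auto)
      finally show ?thesis by (rule fun_cong[symmetric])
    qed
    have 1: "(\<Sum>x\<in>PiE \<Omega> K. ptens \<Omega> F x * ptens \<Omega>' (\<lambda>Ob. C Ob (b (s Ob) (x (s Ob)))) x')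
        = ptens \<Omega>' (\<lambda>Ob. C Ob (F (s Ob))) x'" for x'
    proof -
      let ?s = "inv_into \<Omega>' s"
      have s1: "?s Ob \<in> \<Omega>'" "s (?s Ob) = Ob" if "Ob \<in> \<Omega>" for Ob
        using s that by (auto simp: bij_betw_def inv_into_into f_inv_into_f)
      have s2: "s Ob \<in> \<Omega>" "?s (s Ob) = Ob" if "Ob \<in> \<Omega>'" for Ob
        using s that by (auto simp: bij_betw_def)
      \<comment> \<open>Once the target product is indexed by source factors, each index
        \<open>k\<close> meets the one map that uses it and the sum over families factors.\<close>
      define f where "f Ob k = F Ob k * C (?s Ob) (b Ob k) (x' (?s Ob))" for Ob k
      have "(\<Sum>x\<in>PiE \<Omega> K. ptens \<Omega> F x * ptens \<Omega>' (\<lambda>Ob. C Ob (b (s Ob) (x (s Ob)))) x')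
        = (\<Sum>x\<in>PiE \<Omega> K. \<Prod>Ob\<in>\<Omega>. f Ob (x Ob))"
      proof (rule sum.cong[OF refl])
        fix x
        have "ptens \<Omega>' (\<lambda>Ob. C Ob (b (s Ob) (x (s Ob)))) x'
          = (\<Prod>Ob\<in>\<Omega>. C (?s Ob) (b Ob (x Ob)) (x' (?s Ob)))"
          unfolding ptens_def
          by (subst prod.reindex_bij_betw[OF s, symmetric]) (auto intro!: prod.cong simp: s2)
        then show "ptens \<Omega> F x * ptens \<Omega>' (\<lambda>Ob. C Ob (b (s Ob) (x (s Ob)))) x' = (\<Prod>Ob\<in>\<Omega>. f Ob (x Ob))"
          by (simp add: ptens_def f_def prod.distrib)
      qed
      also have "\<dots> = (\<Prod>Ob\<in>\<Omega>. \<Sum>k\<in>K Ob. f Ob k)"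
        by (rule prod_sum_PiE[symmetric]) (use \<Omega> eframeD(1)[OF G(2)] in auto)
      also have "\<dots> = (\<Prod>Ob\<in>\<Omega>'. \<Sum>k\<in>K (s Ob). f (s Ob) k)"
        by (rule prod.reindex_bij_betw[OF s, symmetric])
      also have "\<dots> = ptens \<Omega>' (\<lambda>Ob. C Ob (F (s Ob))) x'"
        unfolding ptens_def
      proof (rule prod.cong[OF refl])
        fix Ob assume Ob: "Ob \<in> \<Omega>'"
        have "F (s Ob) = (\<lambda>i. \<Sum>k\<in>K (s Ob). F (s Ob) k * b (s Ob) k i)"
          using eframeD(3)[OF G(2) F, OF s2(1)[OF Ob] s2(1)[OF Ob]] by (rule ext)
        then have "C Ob (F (s Ob)) = C Ob (\<lambda>i. \<Sum>k\<in>K (s Ob). F (s Ob) k * b (s Ob) k i)"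
          by (rule arg_cong)
        also have "\<dots> = (\<lambda>i. \<Sum>k\<in>K (s Ob). F (s Ob) k * C Ob (b (s Ob) k) i)"
          by (rule linmap_sum[OF G(1) C]) (use s2[OF Ob] Ob eframeD[OF G(2)] in auto)
        finally show "(\<Sum>k\<in>K (s Ob). f (s Ob) k) = C Ob (F (s Ob)) (x' Ob)"
          by (simp add: f_def s2[OF Ob])
      qed
      finally show ?thesis .
    qed
    have "g (\<lambda>(a, x). u a * ptens \<Omega> F x) (a', x') = A u a' * ptens \<Omega>' (\<lambda>Ob. C Ob (F (s Ob))) x'" for a' x'
    proof -
      have "g (\<lambda>(a, x). u a * ptens \<Omega> F x) (a', x')
        = (\<Sum>(a, x)\<in>?I. (u a * ptens \<Omega> F x) * (A (bU a) a' * ptens \<Omega>' (\<lambda>Ob. C Ob (b (s Ob) (x (s Ob)))) x'))"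
        using inW by (auto simp: g_def im_def intro!: sum.cong)
      then show ?thesis by (simp only: sum_prod_scale 1 2)
    qed
    then show "g (\<lambda>(a, x). u a * ptens \<Omega> F x) = (\<lambda>(a, x). A u a * ptens \<Omega>' (\<lambda>Ob. C Ob (F (s Ob))) x)"
      by auto
  qed
  moreover have "?Z g" by (simp add: g_def)
  ultimately show "\<exists>g. ?Z g \<and> ?L g \<and> ?T g" by blast
next
  let ?W = "tens U \<Omega> G"
  fix g h assume g: "?Z g \<and> ?L g \<and> ?T g" and h: "?Z h \<and> ?L h \<and> ?T h"
  let ?P = "{v \<in> ?W. g v = h v}"
  have lg: "linmap ?W g" and lh: "linmap ?W h" using g h by auto
  have sc: "subspc ?P"
    unfolding subspc_def
  proof (intro conjI ballI allI)
    show "(\<lambda>_. 0) \<in> ?P" using linmap_zero[OF tens_subspc lg] linmap_zero[OF tens_subspc lh]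
      tens_subspc[of U \<Omega> G] by (simp add: subspc_def)
    fix u c assume u: "u \<in> ?P"
    have lin: "(\<lambda>i. c * u i + d * v i) \<in> ?P" if v: "v \<in> ?P" for v c d
      using subspc_lin[OF tens_subspc, of u U \<Omega> G v c d] lg lh u v unfolding linmap_def by simp
    { fix v assume v: "v \<in> ?P" show "(\<lambda>i. u i + v i) \<in> ?P" using lin[OF v, of 1 1] by simp }
    show "(\<lambda>i. c * u i) \<in> ?P" using lin[OF u, of c 0] by simp
  qed
  have "?W \<subseteq> ?P"
  proof (rule tens_least[OF sc])
    fix u F assume "u \<in> U" and "\<And>Ob. Ob \<in> \<Omega> \<Longrightarrow> F Ob \<in> G Ob"
    then show "(\<lambda>(a, x). u a * ptens \<Omega> F x) \<in> ?P"
      using g h tens_pure[of u U \<Omega> F G] by auto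
  qed
  show "g = h"
  proof
    fix v show "g v = h v" using g h \<open>?W \<subseteq> ?P\<close> by (cases "v \<in> ?W") auto
  qed
qed

section \<open>Series and the exponential formula\<close>

declare split_paired_All [simp del] split_paired_Ex [simp del]

section \<open>Monomials and the convolution of series\<close>

abbreviation msupp :: "((nat \<times> nat) \<Rightarrow> nat) \<Rightarrow> (nat \<times> nat) set" where
  "msupp m \<equiv> {q. m q \<noteq> 0}"

definition mdn :: "((nat \<times> nat) \<Rightarrow> nat) \<Rightarrow> ((nat \<times> nat) \<Rightarrow> nat) set" where
  "mdn m = {m1. \<forall>q. m1 q \<le> m q}"

lemma finite_mdn:
  assumes "finite (msupp m)" shows "finite (mdn m)"
proof -
  have "mdn m \<subseteq> (\<lambda>f. \<lambda>q. if q \<in> msupp m then f q else 0) ` PiE (msupp m) (\<lambda>q. {..m q})"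
  proof
    fix m1 assume m1: "m1 \<in> mdn m"
    have "m1 = (\<lambda>q. if q \<in> msupp m then restrict m1 (msupp m) q else 0)"
      using m1 by (auto simp: fun_eq_iff mdn_def) (metis le_zero_eq)
    moreover have "restrict m1 (msupp m) \<in> PiE (msupp m) (\<lambda>q. {..m q})"
      using m1 by (auto simp: mdn_def)
    ultimately show "m1 \<in> (\<lambda>f. \<lambda>q. if q \<in> msupp m then f q else 0) ` PiE (msupp m) (\<lambda>q. {..m q})"
      by blast
  qed
  then show ?thesis
    by (rule finite_subset) (rule finite_imageI, rule finite_PiE, use assms in auto)
qed

lemma mdn_le: "m1 \<in> mdn m \<Longrightarrow> m1 q \<le> m q"
  by (simp add: mdn_def)

lemma msupp_mdn: "m1 \<in> mdn m \<Longrightarrow> msupp m1 \<subseteq> msupp m"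
  using mdn_le[of m1 m] by (metis (mono_tags, lifting) Collect_mono le_zero_eq)

lemma mdn_diff_diff: "m1 \<in> mdn m \<Longrightarrow> (\<lambda>q. m q - (m q - m1 q)) = m1"
  by (rule ext) (simp add: mdn_le)

lemma mdn_diff: "(\<lambda>q. m q - m1 q) \<in> mdn m"
  by (simp add: mdn_def)

lemma mdn_trans: "a \<in> mdn b \<Longrightarrow> b \<in> mdn c \<Longrightarrow> a \<in> mdn c"
  unfolding mdn_def by (auto intro: order_trans)

lemma fmul_mdn: "fmul f g m = (\<Sum>m1\<in>mdn m. f m1 * g (\<lambda>q. m q - m1 q))"
  unfolding fmul_def mdn_def ..

text \<open>Infinite support leaves infinitely many divisors, one for each variable, and a sum over
  an infinite set is 0 by convention. Hence products always lie in the type \<open>ser\<close>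
  introduced below.\<close>

lemma fmul_infinite: "infinite (msupp m) \<Longrightarrow> fmul f g m = 0"
proof -
  assume inf: "infinite (msupp m)"
  have "inj_on (\<lambda>q. \<lambda>p. if p = q then 1 else 0 :: nat) (msupp m)"
    by (rule inj_onI) (metis one_neq_zero)
  then have "infinite ((\<lambda>q. \<lambda>p. if p = q then 1 else 0 :: nat) ` msupp m)"
    using inf finite_imageD by blast
  moreover have "(\<lambda>q. \<lambda>p. if p = q then 1 else 0 :: nat) ` msupp m \<subseteq> mdn m"
    by (auto simp: mdn_def)
  ultimately have "infinite (mdn m)" using infinite_super by blast
  then show ?thesis by (simp add: fmul_mdn)
qed

lemma fmul_comm: "fmul f g = fmul g f"
proof
  fix m
  show "fmul f g m = fmul g f m"
    unfolding fmul_mdn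
    by (rule sum.reindex_bij_witness[of _ "\<lambda>m1. \<lambda>q. m q - m1 q" "\<lambda>m1. \<lambda>q. m q - m1 q"])
      (simp_all add: mdn_diff mdn_diff_diff mult.commute)
qed

lemma fmul_assoc: "fmul (fmul f g) h = fmul f (fmul g h)"
proof
  fix m
  show "fmul (fmul f g) h m = fmul f (fmul g h) m"
  proof (cases "finite (msupp m)")
    case False
    then show ?thesis by (simp add: fmul_infinite)
  next
    case True
    have fin: "finite (mdn m1)" if "m1 \<in> mdn m" for m1
      using True msupp_mdn[OF that] by (intro finite_mdn) (rule finite_subset)
    have fin': "finite (mdn (\<lambda>q. m q - m1 q))" for m1
      by (rule fin) (simp add: mdn_def)
    have "fmul (fmul f g) h m
        = (\<Sum>(m1, a)\<in>Sigma (mdn m) mdn. f a * g (\<lambda>q. m1 q - a q) * h (\<lambda>q. m q - m1 q))"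
      unfolding fmul_mdn sum_distrib_right
      by (rule sum.Sigma) (use True fin in \<open>auto intro: finite_mdn\<close>)
    \<comment> \<open>A chain of divisors \<open>a\<close> of \<open>m1\<close> of \<open>m\<close>
      is recorded by its first factor \<open>a\<close> and its middle factor, the quotient of
      \<open>m1\<close> by \<open>a\<close>.\<close>
    also have "\<dots> = (\<Sum>(a, b)\<in>Sigma (mdn m) (\<lambda>a. mdn (\<lambda>q. m q - a q)).
        f a * (g b * h (\<lambda>q. m q - a q - b q)))"
    proof (rule sum.reindex_bij_witness[of _ "\<lambda>(a, b). (\<lambda>q. a q + b q, a)" "\<lambda>(m1, a). (a, \<lambda>q. m1 q - a q)"])
      fix p assume "p \<in> Sigma (mdn m) mdn"
      then obtain m1 a where p: "p = (m1, a)" and m1: "m1 \<in> mdn m" and a: "a \<in> mdn m1" by blast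
      have le: "a q \<le> m1 q" "m1 q \<le> m q" for q using a m1 by (simp_all add: mdn_le)
      have eq: "(\<lambda>q. a q + (m1 q - a q)) = m1" "(\<lambda>q. m q - a q - (m1 q - a q)) = (\<lambda>q. m q - m1 q)"
        using le by (auto simp: fun_eq_iff)
      show "(case case p of (m1, a) \<Rightarrow> (a, \<lambda>q. m1 q - a q) of (a, b) \<Rightarrow> (\<lambda>q. a q + b q, a)) = p"
        by (simp add: p eq)
      have "(\<lambda>q. m1 q - a q) \<in> mdn (\<lambda>q. m q - a q)" using le by (simp add: mdn_def diff_le_mono)
      then show "(case p of (m1, a) \<Rightarrow> (a, \<lambda>q. m1 q - a q)) \<in> (SIGMA a:mdn m. mdn (\<lambda>q. m q - a q))"
        using mdn_trans[OF a m1] by (simp add: p)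
      show "(case case p of (m1, a) \<Rightarrow> (a, \<lambda>q. m1 q - a q) of (a, b) \<Rightarrow> f a * (g b * h (\<lambda>q. m q - a q - b q))) =
         (case p of (m1, a) \<Rightarrow> f a * g (\<lambda>q. m1 q - a q) * h (\<lambda>q. m q - m1 q))"
        unfolding p by (simp only: prod.case eq mult.assoc)
    next
      fix p assume "p \<in> (SIGMA a:mdn m. mdn (\<lambda>q. m q - a q))"
      then obtain a b where p: "p = (a, b)" and a: "a \<in> mdn m" and b: "b \<in> mdn (\<lambda>q. m q - a q)" by blast
      have le: "a q + b q \<le> m q" for q using mdn_le[OF a, of q] mdn_le[OF b, of q] by simp
      show "(case case p of (a, b) \<Rightarrow> (\<lambda>q. a q + b q, a) of (m1, a) \<Rightarrow> (a, \<lambda>q. m1 q - a q)) = p"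
        by (simp add: p)
      show "(case p of (a, b) \<Rightarrow> (\<lambda>q. a q + b q, a)) \<in> Sigma (mdn m) mdn"
        using le by (simp add: p mdn_def)
    qed
    also have "\<dots> = fmul f (fmul g h) m"
      unfolding fmul_mdn sum_distrib_left
      by (rule sum.Sigma[symmetric]) (use True fin' in \<open>auto intro: finite_mdn\<close>)
    finally show ?thesis .
  qed
qed

lemma fmul_fone: "(\<And>m. infinite (msupp m) \<Longrightarrow> f m = 0) \<Longrightarrow> fmul fone f = f"
proof
  fix m assume f: "\<And>m. infinite (msupp m) \<Longrightarrow> f m = 0"
  show "fmul fone f m = f m"
  proof (cases "finite (msupp m)")
    case False
    then show ?thesis by (simp add: fmul_infinite f)
  next
    case True
    have "fmul fone f m = (\<Sum>m1\<in>mdn m. if m1 = (\<lambda>_. 0) then f m else 0)"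
      unfolding fmul_mdn by (rule sum.cong) (auto simp: fone_def)
    also have "\<dots> = f m" using finite_mdn[OF True] by (simp add: mdn_def)
    finally show ?thesis .
  qed
qed

text \<open>Series supported on monomials of finite support form a commutative ring under fmul;
  the type makes the library's finite products available.\<close>
typedef ser = "{f :: fps. \<forall>m. infinite (msupp m) \<longrightarrow> f m = 0}"
  morphisms cf Ser
  by (rule exI[of _ "\<lambda>_. 0"]) simp

setup_lifting type_definition_ser

lemma cf_infinite: "infinite (msupp m) \<Longrightarrow> cf f m = 0"
  using cf[of f] by blast

instantiation ser :: comm_ring_1
begin
lift_definition zero_ser :: ser is "\<lambda>_. 0" by simp
lift_definition one_ser :: ser is fone by (auto simp: fone_def)
lift_definition plus_ser :: "ser \<Rightarrow> ser \<Rightarrow> ser" is fadd by (simp add: fadd_def)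
lift_definition minus_ser :: "ser \<Rightarrow> ser \<Rightarrow> ser" is "\<lambda>f g m. f m - g m" by simp
lift_definition uminus_ser :: "ser \<Rightarrow> ser" is "\<lambda>f m. - f m" by simp
lift_definition times_ser :: "ser \<Rightarrow> ser \<Rightarrow> ser" is fmul by (simp add: fmul_infinite)
instance
proof
  fix a b c :: ser
  show "a * b * c = a * (b * c)" by transfer (rule fmul_assoc)
  show "a * b = b * a" by transfer (rule fmul_comm)
  show "1 * a = a" by transfer (rule fmul_fone, simp)
  show "(a + b) * c = a * c + b * c"
    by transfer (simp add: fmul_def fadd_def distrib_right sum.distrib)
  show "a + b + c = a + (b + c)" by transfer (simp add: fadd_def add.assoc)
  show "a + b = b + a" by transfer (simp add: fadd_def add.commute)
  show "0 + a = a" by transfer (simp add: fadd_def)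
  show "- a + a = 0" by transfer (simp add: fadd_def)
  show "a - b = a + - b" by transfer (simp add: fadd_def)
  show "(0 :: ser) \<noteq> 1" by transfer (auto simp: fone_def fun_eq_iff)
qed
end

lemma cf_times: "cf (f * g) m = (\<Sum>m1\<in>mdn m. cf f m1 * cf g (\<lambda>q. m q - m1 q))"
  by (simp add: times_ser.rep_eq fmul_mdn)

lemma cf_one: "cf 1 m = (if m = (\<lambda>_. 0) then 1 else 0)"
  by (simp add: one_ser.rep_eq fone_def)

lemma cf_Ser: "(\<And>m. infinite (msupp m) \<Longrightarrow> f m = 0) \<Longrightarrow> cf (Ser f) = f"
  by (rule Ser_inverse) simp

text \<open>The order of the centraliser in the wreath product of an element of cycle type m.\<close>
definition zcent :: "nat \<Rightarrow> ((nat \<times> nat) \<Rightarrow> nat) \<Rightarrow> complex" where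
  "zcent r m = (\<Prod>q\<in>msupp m. of_nat (r * fst q) ^ m q * fact (m q))"

lemma zcent_superset:
  "finite Q \<Longrightarrow> msupp m \<subseteq> Q \<Longrightarrow> zcent r m = (\<Prod>q\<in>Q. of_nat (r * fst q) ^ m q * fact (m q))"
  unfolding zcent_def by (rule prod.mono_neutral_left) auto

lemma zcent_0 [simp]: "zcent r (\<lambda>_. 0) = 1"
  by (simp add: zcent_def)

lemma zcent_nonzero: "1 \<le> r \<Longrightarrow> valid_mon r m \<Longrightarrow> zcent r m \<noteq> 0"
proof -
  assume r: "1 \<le> r" and m: "valid_mon r m"
  have "of_nat (r * fst q) ^ m q * fact (m q) \<noteq> (0 :: complex)" if "q \<in> msupp m" for q
  proof -
    have "1 \<le> fst q" using m that unfolding valid_mon_def by (cases q) auto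
    then show ?thesis using r by simp
  qed
  moreover have "finite (msupp m)" using m by (simp add: valid_mon_def)
  ultimately show ?thesis unfolding zcent_def by (subst prod_zero_iff) blast+
qed

section \<open>Sets whose elements carry types\<close>

definition tcount :: "('c \<Rightarrow> nat \<times> nat) \<Rightarrow> 'c set \<Rightarrow> (nat \<times> nat) \<Rightarrow> nat" where
  "tcount \<tau> S = (\<lambda>q. card {C \<in> S. \<tau> C = q})"

lemma msupp_tcount: "msupp (tcount \<tau> S) \<subseteq> \<tau> ` S"
proof
  fix q assume "q \<in> msupp (tcount \<tau> S)"
  then have "{C \<in> S. \<tau> C = q} \<noteq> {}" unfolding tcount_def by (metis (mono_tags, lifting) card.empty mem_Collect_eq)
  then show "q \<in> \<tau> ` S" by blast
qed

lemma finite_msupp_tcount: "finite S \<Longrightarrow> finite (msupp (tcount \<tau> S))"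
  by (rule finite_subset[OF msupp_tcount]) simp

lemma tcount_diff:
  "finite S \<Longrightarrow> S1 \<subseteq> S \<Longrightarrow> tcount \<tau> (S - S1) = (\<lambda>q. tcount \<tau> S q - tcount \<tau> S1 q)"
proof
  fix q assume fin: "finite S" and sub: "S1 \<subseteq> S"
  have "{C \<in> S - S1. \<tau> C = q} = {C \<in> S. \<tau> C = q} - {C \<in> S1. \<tau> C = q}" by blast
  then show "tcount \<tau> (S - S1) q = tcount \<tau> S q - tcount \<tau> S1 q"
    unfolding tcount_def using fin sub by (simp add: card_Diff_subset finite_subset Collect_mono_iff subset_iff)
qed

lemma tcount_mono: "finite S \<Longrightarrow> S1 \<subseteq> S \<Longrightarrow> tcount \<tau> S1 \<in> mdn (tcount \<tau> S)"
  unfolding mdn_def tcount_def by (auto intro!: card_mono)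

lemma tcount_empty: "tcount \<tau> {} = (\<lambda>_. 0)"
  by (simp add: tcount_def)

text \<open>Inside each class of elements of equal type the choice is independent of the
  others.\<close>

lemma card_subsets_tcount:
  assumes fin: "finite S" and \<mu>: "\<mu> \<in> mdn (tcount \<tau> S)"
  shows "card {S1. S1 \<subseteq> S \<and> tcount \<tau> S1 = \<mu>} = (\<Prod>q\<in>\<tau> ` S. tcount \<tau> S q choose \<mu> q)"
proof -
  let ?P = "PiE (\<tau> ` S) (\<lambda>q. {A. A \<subseteq> {C \<in> S. \<tau> C = q} \<and> card A = \<mu> q})"
  have "bij_betw (\<lambda>S1. \<lambda>q\<in>\<tau> ` S. {C \<in> S1. \<tau> C = q}) {S1. S1 \<subseteq> S \<and> tcount \<tau> S1 = \<mu>} ?P"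
  proof (rule bij_betw_byWitness[where f' = "\<lambda>A. \<Union>q\<in>\<tau> ` S. A q"])
    show "\<forall>a\<in>{S1. S1 \<subseteq> S \<and> tcount \<tau> S1 = \<mu>}. (\<Union>q\<in>\<tau> ` S. (\<lambda>q\<in>\<tau> ` S. {C \<in> a. \<tau> C = q}) q) = a" by auto
    show "\<forall>A\<in>?P. (\<lambda>q\<in>\<tau> ` S. {C \<in> (\<Union>q\<in>\<tau> ` S. A q). \<tau> C = q}) = A"
    proof
      fix A assume A: "A \<in> ?P"
      show "(\<lambda>q\<in>\<tau> ` S. {C \<in> (\<Union>q\<in>\<tau> ` S. A q). \<tau> C = q}) = A"
      proof
        fix q
        have *: "A p \<subseteq> {C \<in> S. \<tau> C = p}" if "p \<in> \<tau> ` S" for p using A that by (auto simp: PiE_iff)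
        show "(\<lambda>q\<in>\<tau> ` S. {C \<in> (\<Union>q\<in>\<tau> ` S. A q). \<tau> C = q}) q = A q"
        proof (cases "q \<in> \<tau> ` S")
          case True
          have "{C \<in> \<Union> (A ` \<tau> ` S). \<tau> C = q} = A q"
          proof
            show "{C \<in> \<Union> (A ` \<tau> ` S). \<tau> C = q} \<subseteq> A q"
            proof
              fix C assume C: "C \<in> {C \<in> \<Union> (A ` \<tau> ` S). \<tau> C = q}"
              then obtain p where p: "p \<in> \<tau> ` S" "C \<in> A p" by blast
              then have "\<tau> C = p" using *[OF p(1)] by blast
              then show "C \<in> A q" using C p by simp
            qed
            show "A q \<subseteq> {C \<in> \<Union> (A ` \<tau> ` S). \<tau> C = q}"
            proof
              fix C assume C: "C \<in> A q"
              then have "\<tau> C = q" using *[OF True] by blast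
              then show "C \<in> {C \<in> \<Union> (A ` \<tau> ` S). \<tau> C = q}"
                using True C by (intro CollectI conjI UnionI[of "A q"] imageI)
            qed
          qed
          then show ?thesis using True by simp
        next
          case False
          then show ?thesis using PiE_arb[OF A] by simp
        qed
      qed
    qed
    show "(\<lambda>S1. \<lambda>q\<in>\<tau> ` S. {C \<in> S1. \<tau> C = q}) ` {S1. S1 \<subseteq> S \<and> tcount \<tau> S1 = \<mu>} \<subseteq> ?P"
      by (auto simp: tcount_def)
    show "(\<lambda>A. \<Union>q\<in>\<tau> ` S. A q) ` ?P \<subseteq> {S1. S1 \<subseteq> S \<and> tcount \<tau> S1 = \<mu>}"
    proof (rule image_subsetI, rule CollectI, rule conjI)
      fix A assume A: "A \<in> ?P"
      have *: "A p \<subseteq> {C \<in> S. \<tau> C = p}" "card (A p) = \<mu> p" if "p \<in> \<tau> ` S" for p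
        using A that by (auto simp: PiE_iff)
      show sub: "(\<Union>q\<in>\<tau> ` S. A q) \<subseteq> S" using * by blast
      show "tcount \<tau> (\<Union>q\<in>\<tau> ` S. A q) = \<mu>"
      proof
        fix q
        show "tcount \<tau> (\<Union>q\<in>\<tau> ` S. A q) q = \<mu> q"
        proof (cases "q \<in> \<tau> ` S")
          case True
          have "{C \<in> (\<Union>q\<in>\<tau> ` S. A q). \<tau> C = q} = A q" using * True by fastforce
          then show ?thesis using *(2)[OF True] by (simp add: tcount_def)
        next
          case False
          then have "{C \<in> S. \<tau> C = q} = {}" by blast
          then have "tcount \<tau> S q = 0" unfolding tcount_def by (simp only: card.empty)
          then have "\<mu> q = 0" using \<mu> unfolding mdn_def by (metis (mono_tags) le_zero_eq mem_Collect_eq)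
          moreover have "{C \<in> (\<Union>q\<in>\<tau> ` S. A q). \<tau> C = q} = {}" using False sub by blast
          ultimately show ?thesis unfolding tcount_def by (simp only: card.empty)
        qed
      qed
    qed
  qed
  then have "card {S1. S1 \<subseteq> S \<and> tcount \<tau> S1 = \<mu>} = card ?P" by (rule bij_betw_same_card)
  also have "\<dots> = (\<Prod>q\<in>\<tau> ` S. card {A. A \<subseteq> {C \<in> S. \<tau> C = q} \<and> card A = \<mu> q})"
    by (rule card_PiE) (use fin in simp)
  also have "\<dots> = (\<Prod>q\<in>\<tau> ` S. tcount \<tau> S q choose \<mu> q)"
    by (rule prod.cong[OF refl]) (use fin in \<open>simp add: n_subsets tcount_def\<close>)
  finally show ?thesis .
qed

text \<open>Type by type this is the binomial coefficient as a quotient of factorials, the powers of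
  \<open>r * fst q\<close> being multiplicative. It makes \<open>zcent\<close> the right
  normalisation for exponential generating functions in several types.\<close>

lemma zcent_subsets:
  assumes fin: "finite S" and \<mu>: "\<mu> \<in> mdn (tcount \<tau> S)"
  shows "of_nat (card {S1. S1 \<subseteq> S \<and> tcount \<tau> S1 = \<mu>}) * (zcent r \<mu> * zcent r (\<lambda>q. tcount \<tau> S q - \<mu> q))
    = zcent r (tcount \<tau> S)"
proof -
  let ?M = "tcount \<tau> S"
  have le: "\<mu> q \<le> ?M q" for q using \<mu> by (simp add: mdn_def)
  have "zcent r \<mu> = (\<Prod>q\<in>\<tau> ` S. of_nat (r * fst q) ^ \<mu> q * fact (\<mu> q))"
    by (rule zcent_superset) (use fin msupp_mdn[OF \<mu>] msupp_tcount[of \<tau> S] in auto)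
  moreover have "zcent r (\<lambda>q. ?M q - \<mu> q)
      = (\<Prod>q\<in>\<tau> ` S. of_nat (r * fst q) ^ (?M q - \<mu> q) * fact (?M q - \<mu> q))"
    by (rule zcent_superset) (use fin msupp_tcount[of \<tau> S] in auto)
  moreover have "zcent r ?M = (\<Prod>q\<in>\<tau> ` S. of_nat (r * fst q) ^ ?M q * fact (?M q))"
    by (rule zcent_superset) (use fin msupp_tcount[of \<tau> S] in auto)
  moreover have "of_nat (?M q choose \<mu> q) * ((of_nat (r * fst q) ^ \<mu> q * fact (\<mu> q)) *
      (of_nat (r * fst q) ^ (?M q - \<mu> q) * fact (?M q - \<mu> q)))
      = (of_nat (r * fst q) ^ ?M q * fact (?M q) :: complex)" for q
  proof -
    have "of_nat (?M q choose \<mu> q) * (fact (\<mu> q) * fact (?M q - \<mu> q)) = (fact (?M q) :: complex)"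
      using binomial_fact_lemma[OF le, of q] by (metis of_nat_fact of_nat_mult mult.commute)
    moreover have "of_nat (r * fst q) ^ \<mu> q * of_nat (r * fst q) ^ (?M q - \<mu> q) = (of_nat (r * fst q) ^ ?M q :: complex)"
      using le by (simp add: power_add[symmetric])
    moreover have "x * ((p * a) * (y * b)) = (p * y) * (x * (a * b))" for x p a y b :: complex
      by (simp add: ac_simps)
    ultimately show ?thesis by (simp only:)
  qed
  ultimately show ?thesis
    by (simp only: card_subsets_tcount[OF fin \<mu>] of_nat_prod prod.distrib[symmetric])
qed

text \<open>A function into \<open>insert c T\<close> is its fibre over \<open>c\<close> together
  with a function into \<open>T\<close> on the rest. \<open>H\<close> receives the remaining domain
  explicitly, so that it also applies to functions defined only there.\<close>

lemma sum_funcset_insert: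
  fixes F :: "'a set \<Rightarrow> 'c :: comm_semiring_1" and H :: "'a set \<Rightarrow> ('a \<Rightarrow> 'b) \<Rightarrow> 'c"
  assumes "c \<notin> T" and "finite S" and "finite T"
    and H: "\<And>\<psi> \<psi>' A. (\<And>x. x \<in> A \<Longrightarrow> \<psi> x = \<psi>' x) \<Longrightarrow> H A \<psi> = H A \<psi>'"
  shows "(\<Sum>\<psi>\<in>S \<rightarrow>\<^sub>E insert c T. F {x \<in> S. \<psi> x = c} * H {x \<in> S. \<psi> x \<noteq> c} \<psi>)
    = (\<Sum>S1\<in>Pow S. F S1 * (\<Sum>\<psi>\<in>(S - S1) \<rightarrow>\<^sub>E T. H (S - S1) \<psi>))"
proof -
  have "(\<Sum>S1\<in>Pow S. F S1 * (\<Sum>\<psi>\<in>(S - S1) \<rightarrow>\<^sub>E T. H (S - S1) \<psi>))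
    = (\<Sum>S1\<in>Pow S. \<Sum>\<psi>\<in>{\<psi> \<in> S \<rightarrow>\<^sub>E insert c T. {x \<in> S. \<psi> x = c} = S1}. F {x \<in> S. \<psi> x = c} * H {x \<in> S. \<psi> x \<noteq> c} \<psi>)"
  proof (rule sum.cong[OF refl])
    fix S1 assume S1: "S1 \<in> Pow S"
    have "(\<Sum>\<psi>\<in>{\<psi> \<in> S \<rightarrow>\<^sub>E insert c T. {x \<in> S. \<psi> x = c} = S1}. F {x \<in> S. \<psi> x = c} * H {x \<in> S. \<psi> x \<noteq> c} \<psi>)
      = (\<Sum>\<psi>\<in>(S - S1) \<rightarrow>\<^sub>E T. F S1 * H (S - S1) \<psi>)"
    proof (rule sum.reindex_bij_witness[of _ "\<lambda>\<psi> x. if x \<in> S1 then c else \<psi> x" "\<lambda>\<psi>. restrict \<psi> (S - S1)"])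
      fix \<psi> assume \<psi>: "\<psi> \<in> {\<psi> \<in> S \<rightarrow>\<^sub>E insert c T. {x \<in> S. \<psi> x = c} = S1}"
      then have eq: "\<psi> x = c \<longleftrightarrow> x \<in> S1" if "x \<in> S" for x using that by blast
      have pe: "\<psi> \<in> S \<rightarrow>\<^sub>E insert c T" using \<psi> by blast
      show "(\<lambda>x. if x \<in> S1 then c else restrict \<psi> (S - S1) x) = \<psi>"
        using PiE_arb[OF pe] eq S1 by (auto simp: fun_eq_iff)
      show "restrict \<psi> (S - S1) \<in> (S - S1) \<rightarrow>\<^sub>E T"
        using pe eq by (auto simp: PiE_iff)
      have "{x \<in> S. \<psi> x = c} = S1" "{x \<in> S. \<psi> x \<noteq> c} = S - S1" using \<psi> by auto
      then show "F S1 * H (S - S1) (restrict \<psi> (S - S1)) = F {x \<in> S. \<psi> x = c} * H {x \<in> S. \<psi> x \<noteq> c} \<psi>"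
        using H[of "S - S1" "restrict \<psi> (S - S1)" \<psi>] by simp
    next
      fix \<psi> assume \<psi>: "\<psi> \<in> (S - S1) \<rightarrow>\<^sub>E T"
      show "restrict (\<lambda>x. if x \<in> S1 then c else \<psi> x) (S - S1) = \<psi>"
        using PiE_arb[OF \<psi>] by (auto simp: fun_eq_iff)
      have nc: "\<psi> x \<noteq> c" if "x \<in> S - S1" for x using \<psi> that assms(1) by (auto simp: PiE_iff)
      have "(\<lambda>x. if x \<in> S1 then c else \<psi> x) \<in> S \<rightarrow>\<^sub>E insert c T"
        using \<psi> S1 PiE_arb[OF \<psi>] by (auto simp: PiE_iff extensional_def)
      moreover have "{x \<in> S. (if x \<in> S1 then c else \<psi> x) = c} = S1"
        using nc S1 by auto
      ultimately show "(\<lambda>x. if x \<in> S1 then c else \<psi> x) \<in> {\<psi> \<in> S \<rightarrow>\<^sub>E insert c T. {x \<in> S. \<psi> x = c} = S1}"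
        by blast
    qed
    then show "F S1 * (\<Sum>\<psi>\<in>(S - S1) \<rightarrow>\<^sub>E T. H (S - S1) \<psi>) = (\<Sum>\<psi>\<in>{\<psi> \<in> S \<rightarrow>\<^sub>E insert c T. {x \<in> S. \<psi> x = c} = S1}. F {x \<in> S. \<psi> x = c} * H {x \<in> S. \<psi> x \<noteq> c} \<psi>)"
      by (simp add: sum_distrib_left)
  qed
  also have "\<dots> = (\<Sum>\<psi>\<in>S \<rightarrow>\<^sub>E insert c T. F {x \<in> S. \<psi> x = c} * H {x \<in> S. \<psi> x \<noteq> c} \<psi>)"
    by (rule sum.group) (use assms in \<open>auto intro!: finite_PiE\<close>)
  finally show ?thesis ..
qed

text \<open>The product rule for exponential generating functions: distributing a typed set over the
  labels in \<open>T\<close> corresponds to multiplying series. The induction splits off the fibre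
  over one label, groups the candidates for it by type, and meets the convolution in
  \<open>cf_times\<close>.\<close>

lemma exponential_formula:
  assumes "finite T" "finite S"
  shows "(\<Sum>\<psi>\<in>S \<rightarrow>\<^sub>E T. \<Prod>c\<in>T. zcent r (tcount \<tau> {x \<in> S. \<psi> x = c}) * cf (E c) (tcount \<tau> {x \<in> S. \<psi> x = c}))
    = zcent r (tcount \<tau> S) * cf (\<Prod>c\<in>T. E c) (tcount \<tau> S)"
  using assms
proof (induction T arbitrary: S rule: finite_induct)
  case empty
  show ?case
  proof (cases "S = {}")
    case True
    then show ?thesis by (simp add: tcount_empty cf_one)
  next
    case False
    then obtain x where x: "x \<in> S" by blast
    have "tcount \<tau> S (\<tau> x) \<noteq> 0" using x empty by (auto simp: tcount_def card_eq_0_iff)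
    then have "tcount \<tau> S \<noteq> (\<lambda>_. 0)" by metis
    moreover have "S \<rightarrow>\<^sub>E ({} :: 'a set) = {}" using x by (auto simp: PiE_iff)
    ultimately show ?thesis by (simp add: cf_one)
  qed
next
  case (insert c T)
  let ?w = "\<lambda>c A. zcent r (tcount \<tau> A) * cf (E c) (tcount \<tau> A)"
  let ?M = "tcount \<tau> S"
  have "(\<Sum>\<psi>\<in>S \<rightarrow>\<^sub>E insert c T. \<Prod>d\<in>insert c T. ?w d {x \<in> S. \<psi> x = d})
    = (\<Sum>\<psi>\<in>S \<rightarrow>\<^sub>E insert c T. ?w c {x \<in> S. \<psi> x = c} *
        (\<Prod>d\<in>T. ?w d {x \<in> {x \<in> S. \<psi> x \<noteq> c}. \<psi> x = d}))"
  proof (rule sum.cong[OF refl])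
    fix \<psi>
    have "(\<Prod>d\<in>T. ?w d {x \<in> S. \<psi> x = d}) = (\<Prod>d\<in>T. ?w d {x \<in> {x \<in> S. \<psi> x \<noteq> c}. \<psi> x = d})"
    proof (rule prod.cong[OF refl])
      fix d assume "d \<in> T"
      then have "{x \<in> S. \<psi> x = d} = {x \<in> {x \<in> S. \<psi> x \<noteq> c}. \<psi> x = d}" using insert.hyps by blast
      then show "?w d {x \<in> S. \<psi> x = d} = ?w d {x \<in> {x \<in> S. \<psi> x \<noteq> c}. \<psi> x = d}" by simp
    qed
    then show "(\<Prod>d\<in>insert c T. ?w d {x \<in> S. \<psi> x = d}) = ?w c {x \<in> S. \<psi> x = c} *
        (\<Prod>d\<in>T. ?w d {x \<in> {x \<in> S. \<psi> x \<noteq> c}. \<psi> x = d})"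
      using insert.hyps by simp
  qed
  also have "\<dots> = (\<Sum>S1\<in>Pow S. ?w c S1 * (\<Sum>\<psi>\<in>(S - S1) \<rightarrow>\<^sub>E T. \<Prod>d\<in>T. ?w d {x \<in> S - S1. \<psi> x = d}))"
  proof (rule sum_funcset_insert[where H = "\<lambda>A \<psi>. \<Prod>d\<in>T. ?w d {x \<in> A. \<psi> x = d}"])
    fix \<psi> \<psi>' :: "'b \<Rightarrow> 'a" and A assume eq: "\<And>x. x \<in> A \<Longrightarrow> \<psi> x = \<psi>' x"
    have "{x \<in> A. \<psi> x = d} = {x \<in> A. \<psi>' x = d}" for d using eq by auto
    then show "(\<Prod>d\<in>T. ?w d {x \<in> A. \<psi> x = d}) = (\<Prod>d\<in>T. ?w d {x \<in> A. \<psi>' x = d})" by simp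
  qed (use insert in auto)
  also have "\<dots> = (\<Sum>S1\<in>Pow S. ?w c S1 * (zcent r (tcount \<tau> (S - S1)) * cf (\<Prod>d\<in>T. E d) (tcount \<tau> (S - S1))))"
    by (rule sum.cong[OF refl], subst insert.IH) (use insert.prems in simp_all)
  also have "\<dots> = (\<Sum>S1\<in>Pow S. (\<lambda>\<mu>. zcent r \<mu> * zcent r (\<lambda>q. ?M q - \<mu> q) *
      (cf (E c) \<mu> * cf (\<Prod>d\<in>T. E d) (\<lambda>q. ?M q - \<mu> q))) (tcount \<tau> S1))"
    (is "_ = (\<Sum>S1\<in>Pow S. ?h (tcount \<tau> S1))")
    by (rule sum.cong[OF refl]) (use insert.prems in \<open>simp add: tcount_diff\<close>)
  also have "\<dots> = (\<Sum>\<mu>\<in>mdn ?M. \<Sum>S1\<in>{S1 \<in> Pow S. tcount \<tau> S1 = \<mu>}. ?h (tcount \<tau> S1))"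
    by (rule sum.group[symmetric])
      (use insert.prems in \<open>auto intro!: finite_mdn finite_msupp_tcount tcount_mono\<close>)
  also have "\<dots> = (\<Sum>\<mu>\<in>mdn ?M. zcent r ?M * (cf (E c) \<mu> * cf (\<Prod>d\<in>T. E d) (\<lambda>q. ?M q - \<mu> q)))"
  proof (rule sum.cong[OF refl])
    fix \<mu> assume \<mu>: "\<mu> \<in> mdn ?M"
    have "(\<Sum>S1\<in>{S1 \<in> Pow S. tcount \<tau> S1 = \<mu>}. ?h (tcount \<tau> S1)) = (\<Sum>S1\<in>{S1 \<in> Pow S. tcount \<tau> S1 = \<mu>}. ?h \<mu>)"
      by (rule sum.cong) auto
    also have "\<dots> = of_nat (card {S1. S1 \<subseteq> S \<and> tcount \<tau> S1 = \<mu>}) * ?h \<mu>" by simp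
    also have "\<dots> = zcent r ?M * (cf (E c) \<mu> * cf (\<Prod>d\<in>T. E d) (\<lambda>q. ?M q - \<mu> q))"
      by (subst zcent_subsets[OF insert.prems \<mu>, symmetric]) (simp only: mult.assoc)
    finally show "(\<Sum>S1\<in>{S1 \<in> Pow S. tcount \<tau> S1 = \<mu>}. ?h (tcount \<tau> S1))
        = zcent r ?M * (cf (E c) \<mu> * cf (\<Prod>d\<in>T. E d) (\<lambda>q. ?M q - \<mu> q))" .
  qed
  also have "\<dots> = zcent r ?M * cf (\<Prod>d\<in>insert c T. E d) ?M"
    using insert.hyps by (simp add: cf_times sum_distrib_left)
  finally show ?case .
qed

section \<open>Free cyclic-group sets with an automorphism\<close>

lemma funpow_app: "(f ^^ a) ((f ^^ b) x) = (f ^^ (a + b)) x"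
  by (simp add: funpow_add)

text \<open>On a finite set non-negative exponents reach the whole group orbit, and one order of the
  two generators is enough once they commute.\<close>

definition orb :: "('a \<Rightarrow> 'a) \<Rightarrow> ('a \<Rightarrow> 'a) \<Rightarrow> 'a \<Rightarrow> 'a set" where
  "orb t s x = {(t ^^ a) ((s ^^ b) x) | a b. True}"

lemma orbE: "y \<in> orb t s x \<Longrightarrow> \<exists>a b. y = (t ^^ a) ((s ^^ b) x)"
  unfolding orb_def by blast

definition cyc :: "('a \<Rightarrow> 'a) \<Rightarrow> ('a \<Rightarrow> 'a) \<Rightarrow> 'a set \<Rightarrow> 'a set set" where
  "cyc t s X = orb t s ` X"

text \<open>The number of \<open>t\<close>-orbits in \<open>C\<close>, hence the length of the cycle
  that \<open>s\<close> induces on them.\<close>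

definition clen :: "nat \<Rightarrow> 'a set \<Rightarrow> nat" where
  "clen r C = card C div r"

text \<open>The twist of the cycle: after one turn, \<open>s\<close> has become the translation by
  this power of \<open>t\<close>. For wreath products it is the sum of the exponents along the
  cycle, modulo \<open>r\<close>.\<close>

definition csh :: "nat \<Rightarrow> ('a \<Rightarrow> 'a) \<Rightarrow> ('a \<Rightarrow> 'a) \<Rightarrow> 'a set \<Rightarrow> nat" where
  "csh r t s C = (THE k. k < r \<and> (\<forall>x\<in>C. (s ^^ clen r C) x = (t ^^ k) x))"

definition ctype :: "nat \<Rightarrow> ('a \<Rightarrow> 'a) \<Rightarrow> ('a \<Rightarrow> 'a) \<Rightarrow> 'a set \<Rightarrow> nat \<times> nat" where
  "ctype r t s C = (clen r C, csh r t s C)"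

definition gtype :: "nat \<Rightarrow> 'a set \<Rightarrow> ('a \<Rightarrow> 'a) \<Rightarrow> ('a \<Rightarrow> 'a) \<Rightarrow> (nat \<times> nat) \<Rightarrow> nat" where
  "gtype r X t s = tcount (ctype r t s) (cyc t s X)"

locale gset =
  fixes r :: nat and X :: "'a set" and t s :: "'a \<Rightarrow> 'a"
  assumes r: "1 \<le> r" and fin: "finite X"
    and tbij: "bij_betw t X X" and sbij: "bij_betw s X X"
    and comm: "x \<in> X \<Longrightarrow> t (s x) = s (t x)"
    and tr: "x \<in> X \<Longrightarrow> (t ^^ r) x = x"
    and free: "x \<in> X \<Longrightarrow> 0 < k \<Longrightarrow> k < r \<Longrightarrow> (t ^^ k) x \<noteq> x"
begin

lemma tX [simp]: "x \<in> X \<Longrightarrow> t x \<in> X" using tbij by (auto simp: bij_betw_def)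
lemma sX [simp]: "x \<in> X \<Longrightarrow> s x \<in> X" using sbij by (auto simp: bij_betw_def)
lemma tpX [simp]: "x \<in> X \<Longrightarrow> (t ^^ k) x \<in> X" by (induction k) auto
lemma spX [simp]: "x \<in> X \<Longrightarrow> (s ^^ k) x \<in> X" by (induction k) auto

lemma comm1: "x \<in> X \<Longrightarrow> s ((t ^^ a) x) = (t ^^ a) (s x)"
  by (induction a) (simp_all add: comm[symmetric])

lemma commp: "x \<in> X \<Longrightarrow> (s ^^ b) ((t ^^ a) x) = (t ^^ a) ((s ^^ b) x)"
  by (induction b) (simp_all add: comm1)

lemma tp_inj: "x \<in> X \<Longrightarrow> y \<in> X \<Longrightarrow> (t ^^ a) x = (t ^^ a) y \<Longrightarrow> x = y"
  using bij_betw_funpow[OF tbij, of a] by (auto simp: bij_betw_def inj_on_def)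

lemma sp_inj: "x \<in> X \<Longrightarrow> y \<in> X \<Longrightarrow> (s ^^ a) x = (s ^^ a) y \<Longrightarrow> x = y"
  using bij_betw_funpow[OF sbij, of a] by (auto simp: bij_betw_def inj_on_def)

lemma tr_mult: "x \<in> X \<Longrightarrow> (t ^^ (r * q)) x = x"
  by (induction q) (simp_all add: funpow_add tr)

lemma t_mod: "x \<in> X \<Longrightarrow> (t ^^ (a mod r)) x = (t ^^ a) x"
proof -
  assume x: "x \<in> X"
  have "(t ^^ a) x = (t ^^ (a mod r + r * (a div r))) x" by simp
  also have "\<dots> = (t ^^ (a mod r)) x" unfolding funpow_add comp_apply by (simp only: tr_mult[OF x])
  finally show ?thesis ..
qed

lemma t_eq_lt: "x \<in> X \<Longrightarrow> a < r \<Longrightarrow> b < r \<Longrightarrow> (t ^^ a) x = (t ^^ b) x \<Longrightarrow> a = b"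
proof (induction a b rule: linorder_wlog)
  case (le a b)
  have "(t ^^ a) ((t ^^ (b - a)) x) = (t ^^ a) x"
    unfolding funpow_app le_add_diff_inverse[OF le(1)] by (rule le(5)[symmetric])
  then have "(t ^^ (b - a)) x = x" by (rule tp_inj[rotated 2]) (use le in auto)
  moreover have "b - a < r" using le(4) by (rule less_imp_diff_less)
  ultimately have "\<not> 0 < b - a" using free[OF le(2), of "b - a"] by blast
  then show ?case using le by simp
next
  case (sym a b)
  show ?case by (rule sym(1)[symmetric]) (use sym in auto)
qed

lemma t_eq_iff: "x \<in> X \<Longrightarrow> (t ^^ a) x = (t ^^ b) x \<longleftrightarrow> a mod r = b mod r"
  using t_eq_lt[of x "a mod r" "b mod r"] r by (metis t_mod mod_less_divisor zero_less_one less_le_trans)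

lemma s_period: "x \<in> X \<Longrightarrow> \<exists>n>0. (s ^^ n) x = x"
proof -
  assume x: "x \<in> X"
  have "\<not> inj_on (\<lambda>k. (s ^^ k) x) (UNIV :: nat set)"
  proof
    assume inj: "inj_on (\<lambda>k. (s ^^ k) x) (UNIV :: nat set)"
    have "range (\<lambda>k. (s ^^ k) x) \<subseteq> X" using x by auto
    then have "finite (range (\<lambda>k. (s ^^ k) x))" using fin by (rule finite_subset)
    then show False using finite_imageD[OF _ inj] by simp
  qed
  then obtain a b :: nat where ab: "(s ^^ a) x = (s ^^ b) x" "a < b"
    unfolding inj_on_def by (metis linorder_neqE_nat)
  then have "(s ^^ a) ((s ^^ (b - a)) x) = (s ^^ a) x"
    by (simp add: funpow_app)
  then show ?thesis using sp_inj[of "(s ^^ (b - a)) x" x a] x ab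
    by (intro exI[of _ "b - a"]) auto
qed

lemma orb_self: "x \<in> orb t s x"
  unfolding orb_def by (rule CollectI, rule exI[of _ 0], rule exI[of _ 0]) simp

lemma orbI: "(t ^^ a) ((s ^^ b) x) \<in> orb t s x"
  unfolding orb_def by blast

lemma orb_subX: "x \<in> X \<Longrightarrow> orb t s x \<subseteq> X"
  unfolding orb_def by auto

lemma orb_sub: "x \<in> X \<Longrightarrow> y \<in> orb t s x \<Longrightarrow> orb t s y \<subseteq> orb t s x"
proof
  fix z assume x: "x \<in> X" and "y \<in> orb t s x" and "z \<in> orb t s y"
  then obtain a b c d where "y = (t ^^ a) ((s ^^ b) x)" "z = (t ^^ c) ((s ^^ d) y)"
    unfolding orb_def by auto
  then have "z = (t ^^ (c + a)) ((s ^^ (d + b)) x)" using x by (simp add: commp funpow_add)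
  then show "z \<in> orb t s x" using orbI by metis
qed

text \<open>Every step can be undone by further forward steps: \<open>s\<close> has a period at
  \<open>x\<close>, and \<open>t\<close> has order \<open>r\<close>.\<close>

lemma orb_eq: "x \<in> X \<Longrightarrow> y \<in> orb t s x \<Longrightarrow> orb t s y = orb t s x"
proof -
  assume x: "x \<in> X" and y: "y \<in> orb t s x"
  then have yX: "y \<in> X" using orb_subX by blast
  obtain a b where ab: "y = (t ^^ a) ((s ^^ b) x)" using y unfolding orb_def by auto
  obtain n where n: "0 < n" "(s ^^ n) x = x" using s_period[OF x] by blast
  \<comment> \<open>Multiples of the periods that dominate \<open>b\<close> and \<open>a\<close>, so
    that \<open>n * b - b\<close> and \<open>r * a - a\<close> act as inverse exponents.\<close>
  have le: "b \<le> n * b" "a \<le> r * a" using n(1) r by auto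
  have nq: "(s ^^ (n * q)) x = x" for q by (induction q) (simp_all add: funpow_add n)
  have ra: "(t ^^ (r * a - a)) ((t ^^ a) z) = z" if "z \<in> X" for z
    unfolding funpow_app le_add_diff_inverse2[OF le(2)] by (rule tr_mult[OF that])
  have "(s ^^ (n * b - b)) ((s ^^ b) x) = x"
    unfolding funpow_app le_add_diff_inverse2[OF le(1)] by (rule nq)
  then have "(t ^^ (r * a - a)) ((s ^^ (n * b - b)) y) = x"
    using x by (simp add: ab commp ra)
  then have "x \<in> orb t s y" using orbI by metis
  then show ?thesis using orb_sub[OF x y] orb_sub[OF yX] by blast
qed

lemma cyc_mem: "C \<in> cyc t s X \<Longrightarrow> x \<in> C \<Longrightarrow> x \<in> X \<and> C = orb t s x"
proof -
  assume "C \<in> cyc t s X" and x: "x \<in> C"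
  then obtain z where z: "z \<in> X" "C = orb t s z" unfolding cyc_def by blast
  then show ?thesis using orb_eq[OF z(1), of x] orb_subX[OF z(1)] x by blast
qed

lemma orb_cyc: "x \<in> X \<Longrightarrow> orb t s x \<in> cyc t s X"
  unfolding cyc_def by blast

lemma cyc_ne: "C \<in> cyc t s X \<Longrightarrow> C \<noteq> {}"
  unfolding cyc_def using orb_self by blast

lemma cyc_subX: "C \<in> cyc t s X \<Longrightarrow> C \<subseteq> X"
  using cyc_mem by blast

lemma cyc_eq: "C \<in> cyc t s X \<Longrightarrow> D \<in> cyc t s X \<Longrightarrow> x \<in> C \<Longrightarrow> x \<in> D \<Longrightarrow> C = D"
  using cyc_mem by metis

lemma finite_cyc: "finite (cyc t s X)"
  unfolding cyc_def using fin by simp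

lemma finite_in_cyc: "C \<in> cyc t s X \<Longrightarrow> finite C"
  using cyc_subX fin finite_subset by blast

lemma Union_cyc: "\<Union> (cyc t s X) = X"
  using orb_cyc orb_self cyc_subX by blast

lemma disjoint_cyc: "pairwise disjnt (cyc t s X)"
  unfolding pairwise_def disjnt_def using cyc_eq by blast

lemma cyc_t: "C \<in> cyc t s X \<Longrightarrow> x \<in> C \<Longrightarrow> (t ^^ a) ((s ^^ b) x) \<in> C"
  using cyc_mem orbI by blast

text \<open>Each full block of \<open>L\<close> steps of \<open>s\<close> is traded for
  \<open>k\<close> steps of \<open>t\<close>. Here \<open>L\<close> may be any return length, so the
  formula also applies to a point of a target set that satisfies the relation of a source
  orbit.\<close>

lemma normal_form:
  assumes x: "x \<in> X" and L: "(s ^^ L) x = (t ^^ k) x"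
  shows "(t ^^ a) ((s ^^ b) x) = (t ^^ ((a + k * (b div L)) mod r)) ((s ^^ (b mod L)) x)"
proof -
  have Lq: "(s ^^ (L * q)) x = (t ^^ (k * q)) x" for q
  proof (induction q)
    case (Suc q)
    have "(s ^^ (L * Suc q)) x = (s ^^ (L * q)) ((s ^^ L) x)"
      by (simp only: mult_Suc_right add.commute[of L] funpow_add comp_apply)
    also have "\<dots> = (t ^^ k) ((t ^^ (k * q)) x)" using x by (simp add: L commp Suc)
    also have "\<dots> = (t ^^ (k * Suc q)) x" by (simp only: mult_Suc_right funpow_add comp_apply)
    finally show ?case .
  qed simp
  have "(s ^^ b) x = (s ^^ (b mod L + L * (b div L))) x" by simp
  also have "\<dots> = (t ^^ (k * (b div L))) ((s ^^ (b mod L)) x)"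
    unfolding funpow_add comp_apply by (simp only: Lq commp[OF x])
  finally have "(t ^^ a) ((s ^^ b) x) = (t ^^ (a + k * (b div L))) ((s ^^ (b mod L)) x)"
    by (simp only: funpow_add comp_apply)
  also have "\<dots> = (t ^^ ((a + k * (b div L)) mod r)) ((s ^^ (b mod L)) x)"
    using x by (simp only: t_mod spX)
  finally show ?thesis .
qed

text \<open>\<open>L\<close> is the least positive power of \<open>s\<close> that acts on
  \<open>x\<close> as a power of \<open>t\<close>. Minimality makes the coordinates (a, b) unique,
  and \<open>normal_form\<close> makes them exhaustive.\<close>

lemma cyc_ex:
  assumes x: "x \<in> X"
  obtains L k where "0 < L" "k < r" "(s ^^ L) x = (t ^^ k) x"
    "bij_betw (\<lambda>(a, b). (t ^^ a) ((s ^^ b) x)) ({..<r} \<times> {..<L}) (orb t s x)"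
proof -
  let ?P = "\<lambda>L. 0 < L \<and> (\<exists>k. (s ^^ L) x = (t ^^ k) x)"
  define L where "L = (LEAST L. ?P L)"
  have "\<exists>L. ?P L" using s_period[OF x] by (metis funpow_0)
  then have PL: "?P L" unfolding L_def by (rule LeastI_ex)
  have least: "\<not> ?P M" if "M < L" for M using that not_less_Least unfolding L_def by blast
  obtain k0 where "(s ^^ L) x = (t ^^ k0) x" using PL by blast
  then have k: "(s ^^ L) x = (t ^^ (k0 mod r)) x" using t_mod[OF x] by simp
  let ?f = "\<lambda>(a, b). (t ^^ a) ((s ^^ b) x)"
  \<comment> \<open>Equal points with different \<open>b\<close> would give a return length below
    \<open>L\<close>, namely the difference.\<close>
  have inj1: "b = b'" if eq: "(t ^^ a) ((s ^^ b) x) = (t ^^ a') ((s ^^ b') x)" and "b \<le> b'" "b' < L" "a < r" for a b a' b'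
  proof (rule ccontr)
    assume "b \<noteq> b'"
    have "(t ^^ a) ((s ^^ b) x) = (t ^^ a') ((s ^^ b) ((s ^^ (b' - b)) x))"
      using eq \<open>b \<le> b'\<close> by (simp add: funpow_app)
    then have "(s ^^ b) ((t ^^ a) x) = (s ^^ b) ((t ^^ a') ((s ^^ (b' - b)) x))"
      using x by (simp add: commp)
    then have "(t ^^ a) x = (t ^^ a') ((s ^^ (b' - b)) x)" using sp_inj x by (metis spX tpX)
    then have "(t ^^ (r * a' - a')) ((t ^^ a) x) = (t ^^ (r * a' - a')) ((t ^^ a') ((s ^^ (b' - b)) x))" by simp
    also have "\<dots> = (s ^^ (b' - b)) x"
      using tr_mult[of "(s ^^ (b' - b)) x" a'] x r
      by (simp add: funpow_app)
    finally have "(s ^^ (b' - b)) x = (t ^^ (r * a' - a' + a)) x"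
      by (simp add: funpow_add)
    then have "?P (b' - b)" using \<open>b \<noteq> b'\<close> \<open>b \<le> b'\<close> by auto
    moreover have "b' - b < L" using \<open>b' < L\<close> by (rule less_imp_diff_less)
    ultimately show False using least by blast
  qed
  have inj: "inj_on ?f ({..<r} \<times> {..<L})"
  proof (rule inj_onI)
    fix p q assume pq: "p \<in> {..<r} \<times> {..<L}" "q \<in> {..<r} \<times> {..<L}" "?f p = ?f q"
    obtain a b a' b' where ab: "p = (a, b)" "q = (a', b')" by (cases p, cases q)
    have "b = b'"
      using inj1[of a b a' b'] inj1[of a' b' a b] pq ab by (cases "b \<le> b'") auto
    moreover have "a = a'"
      by (rule t_eq_lt[of "(s ^^ b) x"]) (use pq ab x \<open>b = b'\<close> in auto)
    ultimately show "p = q" using ab by simp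
  qed
  have "?f ` ({..<r} \<times> {..<L}) = orb t s x"
  proof
    show "?f ` ({..<r} \<times> {..<L}) \<subseteq> orb t s x" using orbI by auto
    show "orb t s x \<subseteq> ?f ` ({..<r} \<times> {..<L})"
    proof
      fix y assume "y \<in> orb t s x"
      then obtain a b where y: "y = (t ^^ a) ((s ^^ b) x)" unfolding orb_def by blast
      have "y = ?f ((a + (k0 mod r) * (b div L)) mod r, b mod L)"
        unfolding y by (simp only: prod.case normal_form[OF x k, of a b])
      moreover have "((a + (k0 mod r) * (b div L)) mod r, b mod L) \<in> {..<r} \<times> {..<L}"
        using r PL by auto
      ultimately show "y \<in> ?f ` ({..<r} \<times> {..<L})" by blast
    qed
  qed
  then have "bij_betw ?f ({..<r} \<times> {..<L}) (orb t s x)" using inj by (simp add: bij_betw_def)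
  then show thesis using that[of L "k0 mod r"] PL k r by auto
qed

text \<open>The orbit has \<open>r * L\<close> points, which identifies \<open>clen\<close>. The
  return relation at \<open>x\<close> spreads over the orbit by commutation, and freeness makes its
  exponent below \<open>r\<close> unique, which identifies \<open>csh\<close>.\<close>

lemma cyc_struct:
  assumes C: "C \<in> cyc t s X" and x: "x \<in> C"
  shows "0 < clen r C" "csh r t s C < r" "(s ^^ clen r C) x = (t ^^ csh r t s C) x"
    "bij_betw (\<lambda>(a, b). (t ^^ a) ((s ^^ b) x)) ({..<r} \<times> {..<clen r C}) C" "card C = r * clen r C"
proof -
  have xX: "x \<in> X" and Co: "C = orb t s x" using cyc_mem[OF C x] by auto
  obtain L k where L: "0 < L" "k < r" "(s ^^ L) x = (t ^^ k) x"
    "bij_betw (\<lambda>(a, b). (t ^^ a) ((s ^^ b) x)) ({..<r} \<times> {..<L}) (orb t s x)"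
    using cyc_ex[OF xX] by metis
  have cardC: "card C = r * L" using bij_betw_same_card[OF L(4)] Co by (simp add: card_cartesian_product)
  then have Lc: "clen r C = L" using r by (simp add: clen_def)
  have all: "\<forall>y\<in>C. (s ^^ L) y = (t ^^ k) y"
  proof
    fix y assume "y \<in> C"
    then obtain a b where y: "y = (t ^^ a) ((s ^^ b) x)" unfolding Co orb_def by blast
    have "(s ^^ L) y = (t ^^ a) ((s ^^ b) ((s ^^ L) x))"
      unfolding y using xX by (simp add: commp) (metis add.commute comp_apply funpow_add)
    also have "\<dots> = (t ^^ a) ((t ^^ k) ((s ^^ b) x))" using xX by (simp add: L(3) commp)
    also have "\<dots> = (t ^^ k) y" unfolding y by (metis add.commute comp_apply funpow_add)
    finally show "(s ^^ L) y = (t ^^ k) y" .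
  qed
  have "csh r t s C = k"
    unfolding csh_def Lc
  proof (rule the_equality)
    show "k < r \<and> (\<forall>x\<in>C. (s ^^ L) x = (t ^^ k) x)" using L all by blast
    fix k' assume "k' < r \<and> (\<forall>x\<in>C. (s ^^ L) x = (t ^^ k') x)"
    then show "k' = k" using t_eq_lt[OF xX, of k' k] L x by auto
  qed
  then show "0 < clen r C" "csh r t s C < r" "(s ^^ clen r C) x = (t ^^ csh r t s C) x"
    "bij_betw (\<lambda>(a, b). (t ^^ a) ((s ^^ b) x)) ({..<r} \<times> {..<clen r C}) C" "card C = r * clen r C"
    using L Lc Co cardC by auto
qed

lemma csh_eqI:
  assumes C: "C \<in> cyc t s X" and x: "x \<in> C" and "k < r" and "(s ^^ clen r C) x = (t ^^ k) x"
  shows "csh r t s C = k"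
  using t_eq_lt[of x k "csh r t s C"] cyc_struct[OF C x] assms cyc_mem[OF C x] by metis

text \<open>All relations at a point are multiples of the basic one: the normal form of
  \<open>(s ^^ d) x\<close> must be that of \<open>(t ^^ e) x\<close>, which has no power of
  \<open>s\<close> left.\<close>

lemma cyc_stab:
  assumes C: "C \<in> cyc t s X" and x: "x \<in> C" and eq: "(s ^^ d) x = (t ^^ e) x"
  shows "\<exists>j. d = clen r C * j \<and> e mod r = (csh r t s C * j) mod r"
proof -
  let ?L = "clen r C" and ?k = "csh r t s C"
  have xX: "x \<in> X" using cyc_mem[OF C x] by auto
  note st = cyc_struct[OF C x]
  let ?f = "\<lambda>(a, b). (t ^^ a) ((s ^^ b) x)"
  have "?f ((?k * (d div ?L)) mod r, d mod ?L) = (s ^^ d) x"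
    using normal_form[OF xX st(3), of 0 d] by simp
  also have "\<dots> = ?f (e mod r, 0)" using eq t_mod[OF xX] by simp
  finally have "((?k * (d div ?L)) mod r, d mod ?L) = (e mod r, 0)"
    using st(4) r st(1) unfolding bij_betw_def
    by (intro inj_onD[of ?f "{..<r} \<times> {..<?L}"]) auto
  then show ?thesis by (metis Pair_inject mult_div_mod_eq add_0_right)
qed

text \<open>A relation holds at all points of an orbit or at none, since the condition found in
  \<open>cyc_stab\<close> does not mention the point.\<close>

lemma cyc_fix_set:
  assumes C: "C \<in> cyc t s X"
  shows "{x \<in> C. (s ^^ d) x = (t ^^ e) x}
    = (if \<exists>j. d = clen r C * j \<and> e mod r = (csh r t s C * j) mod r then C else {})"
proof -
  have "(s ^^ (clen r C * j)) x = (t ^^ e) x" if x: "x \<in> C" and e: "e mod r = (csh r t s C * j) mod r" for x j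
  proof -
    have xX: "x \<in> X" using cyc_mem[OF C x] by auto
    have "(s ^^ (clen r C * j)) x = (t ^^ ((csh r t s C * j) mod r)) x"
      using normal_form[OF xX cyc_struct(3)[OF C x], of 0 "clen r C * j"] cyc_struct(1)[OF C x] by simp
    then show ?thesis using t_mod[OF xX] e by metis
  qed
  then have 1: "(s ^^ d) x = (t ^^ e) x" if "\<exists>j. d = clen r C * j \<and> e mod r = (csh r t s C * j) mod r" "x \<in> C" for x
    using that by blast
  show ?thesis
  proof (cases "\<exists>j. d = clen r C * j \<and> e mod r = (csh r t s C * j) mod r")
    case True
    then show ?thesis using 1[OF True] by (simp only: if_True) blast
  next
    case False
    then show ?thesis using cyc_stab[OF C, of _ d e] by (simp only: if_False) blast
  qed
qed

lemma card_sum: "card X = (\<Sum>C\<in>cyc t s X. r * clen r C)"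
proof -
  have "card X = (\<Sum>C\<in>cyc t s X. card C)"
    using card_Union_disjoint[OF disjoint_cyc finite_in_cyc] Union_cyc by simp
  also have "\<dots> = (\<Sum>C\<in>cyc t s X. r * clen r C)"
    by (rule sum.cong[OF refl]) (use cyc_struct(5) cyc_ne in blast)
  finally show ?thesis .
qed

lemma gtype_valid: "valid_mon r (gtype r X t s)"
  unfolding valid_mon_def
proof (intro conjI allI impI)
  show "finite (msupp (gtype r X t s))" unfolding gtype_def by (rule finite_msupp_tcount[OF finite_cyc])
  fix i k assume "gtype r X t s (i, k) \<noteq> 0"
  then have "(i, k) \<in> ctype r t s ` cyc t s X" using msupp_tcount unfolding gtype_def by blast
  then obtain C where C: "C \<in> cyc t s X" "i = clen r C" "k = csh r t s C" unfolding ctype_def by auto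
  obtain x where "x \<in> C" using cyc_ne[OF C(1)] by blast
  then show "1 \<le> i" "k < r" using cyc_struct(1,2)[OF C(1), of x] C by auto
qed

text \<open>The weight \<open>fst q\<close> of a variable is the number of \<open>t\<close>-orbits
  in a cycle of that type, so the degree counts all \<open>t\<close>-orbits.\<close>

lemma mdeg_gtype: "r * mdeg (gtype r X t s) = card X"
proof -
  let ?\<tau> = "ctype r t s"
  have "mdeg (gtype r X t s) = (\<Sum>q\<in>?\<tau> ` cyc t s X. fst q * gtype r X t s q)"
    unfolding mdeg_def
    by (rule sum.mono_neutral_left) (use finite_cyc msupp_tcount[of ?\<tau> "cyc t s X"] in \<open>auto simp: gtype_def\<close>)
  also have "\<dots> = (\<Sum>q\<in>?\<tau> ` cyc t s X. \<Sum>C\<in>{C \<in> cyc t s X. ?\<tau> C = q}. clen r C)"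
  proof (rule sum.cong[OF refl])
    fix q
    have "(\<Sum>C\<in>{C \<in> cyc t s X. ?\<tau> C = q}. clen r C) = (\<Sum>C\<in>{C \<in> cyc t s X. ?\<tau> C = q}. fst q)"
      by (rule sum.cong) (auto simp: ctype_def)
    then show "fst q * gtype r X t s q = (\<Sum>C\<in>{C \<in> cyc t s X. ?\<tau> C = q}. clen r C)"
      by (simp add: gtype_def tcount_def)
  qed
  also have "\<dots> = (\<Sum>C\<in>cyc t s X. clen r C)"
    by (rule sum.group) (use finite_cyc in auto)
  finally show ?thesis by (simp add: card_sum sum_distrib_left)
qed

lemma gset_id: "gset r X t id"
  using r fin tbij tr free by (simp add: gset_def)

end

section \<open>Equivariant maps, described orbit by orbit\<close>

definition ghom :: "'a set \<Rightarrow> ('a \<Rightarrow> 'a) \<Rightarrow> ('a \<Rightarrow> 'a) \<Rightarrow> 'b set \<Rightarrow> ('b \<Rightarrow> 'b) \<Rightarrow> ('b \<Rightarrow> 'b) \<Rightarrow> ('a \<Rightarrow> 'b) set" where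
  "ghom X t s Y t' s' = {\<phi> \<in> X \<rightarrow>\<^sub>E Y. \<forall>x\<in>X. \<phi> (t x) = t' (\<phi> x) \<and> \<phi> (s x) = s' (\<phi> x)}"

locale gset_pair = A: gset r X t s + B: gset r Y t' s'
  for r and X :: "'a set" and t s and Y :: "'b set" and t' s'
begin

lemma hom_pow: "\<phi> \<in> ghom X t s Y t' s' \<Longrightarrow> x \<in> X \<Longrightarrow> \<phi> ((t ^^ a) ((s ^^ b) x)) = (t' ^^ a) ((s' ^^ b) (\<phi> x))"
proof -
  assume \<phi>: "\<phi> \<in> ghom X t s Y t' s'" and x: "x \<in> X"
  have 1: "\<phi> ((s ^^ b) x) = (s' ^^ b) (\<phi> x)"
    by (induction b) (use \<phi> x in \<open>auto simp: ghom_def\<close>)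
  show ?thesis by (induction a) (use \<phi> x in \<open>auto simp: ghom_def 1\<close>)
qed

lemma hom_in: "\<phi> \<in> ghom X t s Y t' s' \<Longrightarrow> x \<in> X \<Longrightarrow> \<phi> x \<in> Y"
  by (auto simp: ghom_def)

lemma hom_image: "\<phi> \<in> ghom X t s Y t' s' \<Longrightarrow> C \<in> cyc t s X \<Longrightarrow> x \<in> C \<Longrightarrow> \<phi> ` C = orb t' s' (\<phi> x)"
proof -
  assume \<phi>: "\<phi> \<in> ghom X t s Y t' s'" and C: "C \<in> cyc t s X" and x: "x \<in> C"
  have x': "x \<in> X" "C = orb t s x" using A.cyc_mem[OF C x] by auto
  show ?thesis
  proof
    show "\<phi> ` C \<subseteq> orb t' s' (\<phi> x)" using hom_pow[OF \<phi> x'(1)] unfolding x'(2) orb_def by auto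
    show "orb t' s' (\<phi> x) \<subseteq> \<phi> ` C"
    proof
      fix y assume "y \<in> orb t' s' (\<phi> x)"
      then obtain a b where "y = (t' ^^ a) ((s' ^^ b) (\<phi> x))" unfolding orb_def by blast
      then have "y = \<phi> ((t ^^ a) ((s ^^ b) x))" using hom_pow[OF \<phi> x'(1)] by simp
      then show "y \<in> \<phi> ` C" using A.cyc_t[OF C x] by blast
    qed
  qed
qed

lemma hom_image_cyc: "\<phi> \<in> ghom X t s Y t' s' \<Longrightarrow> C \<in> cyc t s X \<Longrightarrow> \<phi> ` C \<in> cyc t' s' Y"
  using A.cyc_ne hom_image hom_in A.cyc_mem B.orb_cyc by (metis ex_in_conv)

lemma finite_ghom: "finite (ghom X t s Y t' s')"
  unfolding ghom_def using A.fin B.fin by (auto intro!: finite_subset[OF _ finite_PiE[of X "\<lambda>_. Y"]])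

definition rep :: "'a set \<Rightarrow> 'a" where "rep C = (SOME x. x \<in> C)"

lemma rep_in: "C \<in> cyc t s X \<Longrightarrow> rep C \<in> C"
  unfolding rep_def using A.cyc_ne some_in_eq by blast

lemma rep_X: "C \<in> cyc t s X \<Longrightarrow> rep C \<in> X"
  using rep_in A.cyc_mem by blast

text \<open>An orbit \<open>C\<close> is presented by one generator \<open>rep C\<close> and one
  relation: \<open>clen\<close> steps of \<open>s\<close> equal \<open>csh\<close> steps of
  \<open>t\<close>. An equivariant map is therefore an independent choice, for each orbit, of a
  point of \<open>Y\<close> satisfying that relation.\<close>

lemma hom_bij:
  "bij_betw (\<lambda>\<phi>. \<lambda>C\<in>cyc t s X. \<phi> (rep C)) (ghom X t s Y t' s')
    (PiE (cyc t s X) (\<lambda>C. {y \<in> Y. (s' ^^ clen r C) y = (t' ^^ csh r t s C) y}))"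
  (is "bij_betw ?F ?H ?P")
  unfolding bij_betw_def
proof (intro conjI equalityI)
  have repo: "x = (t ^^ a) ((s ^^ b) (rep C)) \<Longrightarrow> C \<in> cyc t s X \<Longrightarrow> orb t s x = C" for x a b C
    using A.cyc_mem[OF _ A.cyc_t[OF _ rep_in]] by blast
  have repe: "\<exists>a b. x = (t ^^ a) ((s ^^ b) (rep (orb t s x)))" if x: "x \<in> X" for x
  proof -
    have "orb t s x = orb t s (rep (orb t s x))"
      using A.cyc_mem[OF A.orb_cyc[OF x] rep_in[OF A.orb_cyc[OF x]]] by blast
    then have "x \<in> orb t s (rep (orb t s x))" using A.orb_self[of x] by blast
    then show ?thesis by (rule orbE)
  qed
  show "inj_on ?F ?H"
  proof (rule inj_onI)
    fix \<phi> \<phi>' assume \<phi>: "\<phi> \<in> ?H" and \<phi>': "\<phi>' \<in> ?H" and eq: "?F \<phi> = ?F \<phi>'"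
    have reps: "\<phi> (rep C) = \<phi>' (rep C)" if "C \<in> cyc t s X" for C
      using fun_cong[OF eq, of C] that by simp
    show "\<phi> = \<phi>'"
    proof
      fix x
      show "\<phi> x = \<phi>' x"
      proof (cases "x \<in> X")
        case True
        obtain a b where x: "x = (t ^^ a) ((s ^^ b) (rep (orb t s x)))" using repe[OF True] by blast
        have oc: "orb t s x \<in> cyc t s X" by (rule A.orb_cyc[OF True])
        have "\<phi> ((t ^^ a) ((s ^^ b) (rep (orb t s x)))) = \<phi>' ((t ^^ a) ((s ^^ b) (rep (orb t s x))))"
          by (simp only: hom_pow[OF \<phi> rep_X[OF oc]] hom_pow[OF \<phi>' rep_X[OF oc]] reps[OF oc])
        then show ?thesis unfolding x[symmetric] .
      next
        case False
        then show ?thesis using \<phi> \<phi>' by (auto simp: ghom_def PiE_def extensional_def)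
      qed
    qed
  qed
  show "?F ` ?H \<subseteq> ?P"
  proof
    fix f assume "f \<in> ?F ` ?H"
    then obtain \<phi> where f: "f = ?F \<phi>" and \<phi>: "\<phi> \<in> ?H" by blast
    have "\<phi> (rep C) \<in> Y \<and> (s' ^^ clen r C) (\<phi> (rep C)) = (t' ^^ csh r t s C) (\<phi> (rep C))" if C: "C \<in> cyc t s X" for C
      using hom_pow[OF \<phi> rep_X[OF C], of 0 "clen r C"] hom_pow[OF \<phi> rep_X[OF C], of "csh r t s C" 0]
        A.cyc_struct(3)[OF C rep_in[OF C]] hom_in[OF \<phi> rep_X[OF C]] by simp
    then show "f \<in> ?P" unfolding f by auto
  qed
  show "?P \<subseteq> ?F ` ?H"
  proof
    fix \<eta> assume \<eta>: "\<eta> \<in> ?P"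
    have \<eta>Y: "\<eta> C \<in> Y" and \<eta>s: "(s' ^^ clen r C) (\<eta> C) = (t' ^^ csh r t s C) (\<eta> C)" if "C \<in> cyc t s X" for C
      using \<eta> that by (auto simp: PiE_iff)
    \<comment> \<open>Normal-form coordinates of \<open>x\<close> relative to the representative of
      its orbit.\<close>
    define pos where "pos x = inv_into ({..<r} \<times> {..<clen r (orb t s x)}) (\<lambda>(a, b). (t ^^ a) ((s ^^ b) (rep (orb t s x)))) x" for x
    define \<phi> where "\<phi> = (\<lambda>x\<in>X. (t' ^^ fst (pos x)) ((s' ^^ snd (pos x)) (\<eta> (orb t s x))))"
    \<comment> \<open>Well-definedness: the same reduction of exponents is valid for
      \<open>rep C\<close> in \<open>X\<close> and for its prospective image in \<open>Y\<close>, as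
      both satisfy the relation of \<open>C\<close>.\<close>
    have ev: "\<phi> ((t ^^ a) ((s ^^ b) (rep C))) = (t' ^^ a) ((s' ^^ b) (\<eta> C))" if C: "C \<in> cyc t s X" for a b C
    proof -
      let ?L = "clen r C" and ?k = "csh r t s C" and ?x = "(t ^^ a) ((s ^^ b) (rep C))"
      note st = A.cyc_struct[OF C rep_in[OF C]]
      have o: "orb t s ?x = C" using repo[OF refl C] .
      have "?x = (t ^^ ((a + ?k * (b div ?L)) mod r)) ((s ^^ (b mod ?L)) (rep C))"
        by (rule A.normal_form[OF rep_X[OF C] st(3)])
      then have "pos ?x = ((a + ?k * (b div ?L)) mod r, b mod ?L)"
        unfolding pos_def o
        using st(4) st(1) A.r unfolding bij_betw_def
        by (intro inv_into_f_eq) auto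
      then have "\<phi> ?x = (t' ^^ ((a + ?k * (b div ?L)) mod r)) ((s' ^^ (b mod ?L)) (\<eta> C))"
        unfolding \<phi>_def using rep_X[OF C] o by simp
      also have "\<dots> = (t' ^^ a) ((s' ^^ b) (\<eta> C))"
        by (rule B.normal_form[OF \<eta>Y[OF C] \<eta>s[OF C], symmetric])
      finally show ?thesis .
    qed
    have "\<phi> \<in> ?H"
      unfolding ghom_def
    proof (rule CollectI, intro conjI ballI)
      have "\<phi> x \<in> Y" if x: "x \<in> X" for x
        unfolding \<phi>_def using x \<eta>Y[OF A.orb_cyc[OF x]] by simp
      then show "\<phi> \<in> X \<rightarrow>\<^sub>E Y" by (auto simp: \<phi>_def)
      fix x assume x: "x \<in> X"
      let ?C = "orb t s x"
      have C: "?C \<in> cyc t s X" by (rule A.orb_cyc[OF x])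
      obtain a b where xe: "x = (t ^^ a) ((s ^^ b) (rep ?C))" using repe[OF x] by blast
      have e0: "\<phi> x = (t' ^^ a) ((s' ^^ b) (\<eta> ?C))" by (subst xe) (rule ev[OF C])
      have "t x = (t ^^ Suc a) ((s ^^ b) (rep ?C))" by (subst xe) simp
      then show "\<phi> (t x) = t' (\<phi> x)" using ev[OF C, of "Suc a" b] e0 by simp
      have "s x = (t ^^ a) ((s ^^ Suc b) (rep ?C))"
        by (subst xe) (simp add: A.comm1 rep_X[OF C])
      then show "\<phi> (s x) = s' (\<phi> x)"
        using ev[OF C, of a "Suc b"] e0 \<eta>Y[OF C] by (simp add: B.comm1)
    qed
    moreover have "?F \<phi> = \<eta>"
    proof
      fix C show "?F \<phi> C = \<eta> C"
        using ev[of C 0 0] PiE_arb[OF \<eta>] by (cases "C \<in> cyc t s X") auto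
    qed
    ultimately show "\<eta> \<in> ?F ` ?H" by blast
  qed
qed

text \<open>The number of equivariant maps from the orbit \<open>C\<close> to the orbit
  \<open>c\<close>, counted by the image of a generator.\<close>

definition cfit :: "'a set \<Rightarrow> 'b set \<Rightarrow> nat" where
  "cfit C c = card {y \<in> c. (s' ^^ clen r C) y = (t' ^^ csh r t s C) y}"

text \<open>Equivariant maps are grouped by the map they induce on orbits; over a fixed one the
  images of the generators are independent.\<close>

lemma sum_ghom:
  fixes G :: "('a set \<Rightarrow> 'b set) \<Rightarrow> complex"
  shows "(\<Sum>\<phi>\<in>ghom X t s Y t' s'. G (\<lambda>C\<in>cyc t s X. \<phi> ` C))
    = (\<Sum>\<psi>\<in>cyc t s X \<rightarrow>\<^sub>E cyc t' s' Y. of_nat (\<Prod>C\<in>cyc t s X. cfit C (\<psi> C)) * G \<psi>)"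
proof -
  let ?P = "PiE (cyc t s X) (\<lambda>C. {y \<in> Y. (s' ^^ clen r C) y = (t' ^^ csh r t s C) y})"
  let ?g = "\<lambda>\<eta>. \<lambda>C\<in>cyc t s X. orb t' s' (\<eta> C)"
  have "(\<Sum>\<phi>\<in>ghom X t s Y t' s'. G (\<lambda>C\<in>cyc t s X. \<phi> ` C))
      = (\<Sum>\<phi>\<in>ghom X t s Y t' s'. G (?g (\<lambda>C\<in>cyc t s X. \<phi> (rep C))))"
  proof (rule sum.cong[OF refl])
    fix \<phi> assume \<phi>: "\<phi> \<in> ghom X t s Y t' s'"
    have "(\<lambda>C\<in>cyc t s X. \<phi> ` C) = ?g (\<lambda>C\<in>cyc t s X. \<phi> (rep C))"
      using hom_image[OF \<phi> _ rep_in] by (auto simp: fun_eq_iff)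
    then show "G (\<lambda>C\<in>cyc t s X. \<phi> ` C) = G (?g (\<lambda>C\<in>cyc t s X. \<phi> (rep C)))" by simp
  qed
  also have "\<dots> = (\<Sum>\<eta>\<in>?P. G (?g \<eta>))"
    by (rule sum.reindex_bij_betw[OF hom_bij])
  also have "\<dots> = (\<Sum>\<psi>\<in>cyc t s X \<rightarrow>\<^sub>E cyc t' s' Y. \<Sum>\<eta>\<in>{\<eta> \<in> ?P. ?g \<eta> = \<psi>}. G (?g \<eta>))"
  proof (rule sum.group[symmetric])
    show "finite ?P" using A.finite_cyc B.fin by (auto intro!: finite_PiE)
    show "finite (cyc t s X \<rightarrow>\<^sub>E cyc t' s' Y)" using A.finite_cyc B.finite_cyc by (auto intro!: finite_PiE)
    show "?g ` ?P \<subseteq> cyc t s X \<rightarrow>\<^sub>E cyc t' s' Y" using B.orb_cyc by (auto simp: PiE_iff)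
  qed
  also have "\<dots> = (\<Sum>\<psi>\<in>cyc t s X \<rightarrow>\<^sub>E cyc t' s' Y. of_nat (\<Prod>C\<in>cyc t s X. cfit C (\<psi> C)) * G \<psi>)"
  proof (rule sum.cong[OF refl])
    fix \<psi> assume \<psi>: "\<psi> \<in> cyc t s X \<rightarrow>\<^sub>E cyc t' s' Y"
    let ?Q = "PiE (cyc t s X) (\<lambda>C. {y \<in> \<psi> C. (s' ^^ clen r C) y = (t' ^^ csh r t s C) y})"
    have \<psi>c: "\<psi> C \<in> cyc t' s' Y" if "C \<in> cyc t s X" for C using \<psi> that by auto
    have "{\<eta> \<in> ?P. ?g \<eta> = \<psi>} = ?Q"
    proof (intro equalityI subsetI)
      fix \<eta> assume \<eta>: "\<eta> \<in> {\<eta> \<in> ?P. ?g \<eta> = \<psi>}"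
      then have \<eta>P: "\<eta> \<in> ?P" and g: "?g \<eta> = \<psi>" by auto
      have "\<eta> C \<in> \<psi> C" if "C \<in> cyc t s X" for C
        using fun_cong[OF g, of C] that B.orb_self[of "\<eta> C"] by simp
      then show "\<eta> \<in> ?Q" using \<eta>P by (auto simp: PiE_iff)
    next
      fix \<eta> assume \<eta>: "\<eta> \<in> ?Q"
      have m: "\<eta> C \<in> \<psi> C" if "C \<in> cyc t s X" for C using \<eta> that by (auto simp: PiE_iff)
      have "\<eta> \<in> ?P" using \<eta> B.cyc_mem[OF \<psi>c] by (auto simp: PiE_iff)
      moreover have "?g \<eta> = \<psi>"
      proof
        fix C show "?g \<eta> C = \<psi> C"
          using B.cyc_mem[OF \<psi>c m] PiE_arb[OF \<psi>] by (cases "C \<in> cyc t s X") auto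
      qed
      ultimately show "\<eta> \<in> {\<eta> \<in> ?P. ?g \<eta> = \<psi>}" by blast
    qed
    moreover have "card ?Q = (\<Prod>C\<in>cyc t s X. cfit C (\<psi> C))"
      unfolding cfit_def by (rule card_PiE[OF A.finite_cyc])
    moreover have "(\<Sum>\<eta>\<in>{\<eta> \<in> ?P. ?g \<eta> = \<psi>}. G (?g \<eta>)) = (\<Sum>\<eta>\<in>{\<eta> \<in> ?P. ?g \<eta> = \<psi>}. G \<psi>)"
      by (rule sum.cong) auto
    ultimately show "(\<Sum>\<eta>\<in>{\<eta> \<in> ?P. ?g \<eta> = \<psi>}. G (?g \<eta>)) = of_nat (\<Prod>C\<in>cyc t s X. cfit C (\<psi> C)) * G \<psi>"
      by simp
  qed
  finally show ?thesis .
qed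

end

section \<open>Counting equivariant maps\<close>

text \<open>The substitution p_j \<mapsto> p_(ij)(zeta^(kj)) with q = (i, k), on exponent functions: it sends the
  monomial l in the variables (j, 0) to ppush r q l; ppull is its left inverse.\<close>
definition ppush :: "nat \<Rightarrow> nat \<times> nat \<Rightarrow> ((nat \<times> nat) \<Rightarrow> nat) \<Rightarrow> (nat \<times> nat) \<Rightarrow> nat" where
  "ppush r q l = (\<lambda>p. if fst q dvd fst p \<and> snd p = (snd q * (fst p div fst q)) mod r
     then l (fst p div fst q, 0) else 0)"

definition ppull :: "nat \<Rightarrow> nat \<times> nat \<Rightarrow> ((nat \<times> nat) \<Rightarrow> nat) \<Rightarrow> (nat \<times> nat) \<Rightarrow> nat" where
  "ppull r q m = (\<lambda>p. if snd p = 0 then m (fst q * fst p, (snd q * fst p) mod r) else 0)"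

abbreviation pmap :: "nat \<Rightarrow> nat \<times> nat \<Rightarrow> nat \<times> nat \<Rightarrow> nat \<times> nat" where
  "pmap r q p \<equiv> (fst q * fst p, (snd q * fst p) mod r)"

lemma msupp_ppush: "msupp (ppush r q l) \<subseteq> pmap r q ` msupp l"
proof
  fix p assume "p \<in> msupp (ppush r q l)"
  then have p: "fst q dvd fst p" "snd p = (snd q * (fst p div fst q)) mod r" "l (fst p div fst q, 0) \<noteq> 0"
    by (auto simp: ppush_def split: if_splits)
  then have "p = pmap r q (fst p div fst q, 0)" by (cases p) auto
  then show "p \<in> pmap r q ` msupp l" using p(3) by blast
qed

lemma ppull_ppush:
  assumes "1 \<le> fst q" "\<And>i k. k \<noteq> 0 \<Longrightarrow> l (i, k) = 0"
  shows "ppull r q (ppush r q l) = l"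
  using assms by (auto simp: ppull_def ppush_def fun_eq_iff)

lemma valid_mon_1_snd: "valid_mon 1 l \<Longrightarrow> k \<noteq> 0 \<Longrightarrow> l (i, k) = 0"
  unfolding valid_mon_def by fastforce

lemma ppush_ppull_support:
  assumes f: "\<forall>m. infinite (msupp m) \<longrightarrow> f m = 0" and inf: "infinite (msupp m)"
  shows "(if m = ppush r q (ppull r q m) then f (ppull r q m) else 0) = 0"
proof -
  { assume m: "m = ppush r q (ppull r q m)"
    have "infinite (msupp (ppull r q m))"
    proof
      assume "finite (msupp (ppull r q m))"
      then have "finite (msupp (ppush r q (ppull r q m)))"
        using finite_subset[OF msupp_ppush] by blast
      then show False using m inf by simp
    qed
    then have "f (ppull r q m) = 0" using f by blast }
  then show ?thesis by simp
qed

text \<open>The plethysm p_i(zeta^k) o g on coefficients, for q = (i, k). The equation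
  \<open>m = ppush r q (ppull r q m)\<close> says that the monomial \<open>m\<close> is in the image
  of the substitution.\<close>

lift_definition psub :: "nat \<Rightarrow> nat \<times> nat \<Rightarrow> ser \<Rightarrow> ser" is
  "\<lambda>r q g m. if m = ppush r q (ppull r q m) then g (ppull r q m) else 0"
  using ppush_ppull_support by blast

lemma cf_psub: "cf (psub r q g) m = (if m = ppush r q (ppull r q m) then cf g (ppull r q m) else 0)"
  by (simp add: psub.rep_eq)

abbreviation mdelta :: "nat \<times> nat \<Rightarrow> (nat \<times> nat) \<Rightarrow> nat" where
  "mdelta q \<equiv> (\<lambda>p. if p = q then 1 else 0)"

lemma msupp_mdelta: "msupp (mdelta q) = {q}" by auto

lift_definition pv :: "nat \<times> nat \<Rightarrow> ser" is "\<lambda>q m. if m = mdelta q then 1 else 0"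
  using msupp_mdelta by auto

lemma cf_pv: "cf (pv q) m = (if m = mdelta q then 1 else 0)"
  by (simp add: pv.rep_eq)

lemma psub_pv:
  assumes "1 \<le> i" "k < r" "1 \<le> j"
  shows "psub r (i, k) (pv (j, 0)) = pv (i * j, (k * j) mod r)"
proof -
  let ?q = "(i, k)"
  have push: "ppush r ?q (mdelta (j, 0)) = mdelta (i * j, (k * j) mod r)"
    using assms by (auto simp: ppush_def fun_eq_iff elim!: dvdE)
  have pull: "ppull r ?q (mdelta (i * j, (k * j) mod r)) = mdelta (j, 0)"
    using assms by (auto simp: ppull_def fun_eq_iff)
  have "cf (psub r ?q (pv (j, 0))) m = cf (pv (i * j, (k * j) mod r)) m" for m
    unfolding cf_psub cf_pv using push pull by auto
  then show ?thesis by (metis cf_inverse ext)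
qed

lemma cf_pv_times:
  assumes "finite (msupp m)"
  shows "cf (pv q * f) m = (if 1 \<le> m q then cf f (\<lambda>p. m p - mdelta q p) else 0)"
proof -
  have "cf (pv q * f) m = (\<Sum>m1\<in>mdn m. if m1 = mdelta q then cf f (\<lambda>p. m p - mdelta q p) else 0)"
    unfolding cf_times by (rule sum.cong) (auto simp: cf_pv)
  also have "\<dots> = (if mdelta q \<in> mdn m then cf f (\<lambda>p. m p - mdelta q p) else 0)"
    using finite_mdn[OF assms] by simp
  also have "mdelta q \<in> mdn m \<longleftrightarrow> 1 \<le> m q" by (auto simp: mdn_def)
  finally show ?thesis .
qed

lemma cf_prod_pv:
  assumes "finite T"
  shows "cf (\<Prod>c\<in>T. pv (\<tau> c)) m = (if m = tcount \<tau> T then 1 else 0)"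
  using assms
proof (induction T arbitrary: m rule: finite_induct)
  case empty
  then show ?case by (simp add: cf_one tcount_empty)
next
  case (insert c T)
  have tc: "tcount \<tau> (insert c T) p = tcount \<tau> T p + mdelta (\<tau> c) p" for p
  proof (cases "\<tau> c = p")
    case True
    then have "{C \<in> insert c T. \<tau> C = p} = insert c {C \<in> T. \<tau> C = p}" by blast
    then show ?thesis using True insert.hyps by (simp add: tcount_def)
  next
    case False
    then have "{C \<in> insert c T. \<tau> C = p} = {C \<in> T. \<tau> C = p}" by blast
    then show ?thesis using False by (simp add: tcount_def)
  qed
  show ?case
  proof (cases "finite (msupp m)")
    case False
    moreover have "finite (msupp (tcount \<tau> (insert c T)))"
      using insert.hyps by (intro finite_msupp_tcount) simp
    ultimately have "m \<noteq> tcount \<tau> (insert c T)" by metis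
    then show ?thesis using cf_infinite[OF False] by simp
  next
    case True
    have "(1 \<le> m (\<tau> c) \<and> (\<lambda>p. m p - mdelta (\<tau> c) p) = tcount \<tau> T) \<longleftrightarrow> m = tcount \<tau> (insert c T)"
    proof
      assume a: "1 \<le> m (\<tau> c) \<and> (\<lambda>p. m p - mdelta (\<tau> c) p) = tcount \<tau> T"
      show "m = tcount \<tau> (insert c T)"
      proof
        fix p
        have "m p - mdelta (\<tau> c) p = tcount \<tau> T p" using a by (metis (no_types, lifting))
        then show "m p = tcount \<tau> (insert c T) p" using a unfolding tc by (auto split: if_splits)
      qed
    next
      assume "m = tcount \<tau> (insert c T)"
      then have "m p = tcount \<tau> T p + mdelta (\<tau> c) p" for p using tc by simp
      then show "1 \<le> m (\<tau> c) \<and> (\<lambda>p. m p - mdelta (\<tau> c) p) = tcount \<tau> T" by auto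
    qed
    then show ?thesis using insert.hyps by (auto simp: cf_pv_times[OF True] insert.IH)
  qed
qed

lemma prod_tcount:
  fixes f :: "nat \<times> nat \<Rightarrow> 'c :: comm_monoid_mult"
  assumes "finite S"
  shows "(\<Prod>C\<in>S. f (\<tau> C)) = (\<Prod>q\<in>msupp (tcount \<tau> S). f q ^ tcount \<tau> S q)"
proof -
  have "(\<Prod>C\<in>S. f (\<tau> C)) = (\<Prod>q\<in>\<tau> ` S. \<Prod>C\<in>{C \<in> S. \<tau> C = q}. f (\<tau> C))"
    by (rule prod.group[symmetric]) (use assms in auto)
  also have "\<dots> = (\<Prod>q\<in>\<tau> ` S. f q ^ tcount \<tau> S q)"
    by (rule prod.cong[OF refl]) (simp add: tcount_def)
  also have "\<dots> = (\<Prod>q\<in>msupp (tcount \<tau> S). f q ^ tcount \<tau> S q)"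
    by (rule prod.mono_neutral_right) (use assms msupp_tcount[of \<tau> S] in auto)
  finally show ?thesis .
qed

text \<open>A variable of weight j becomes one of weight i j, so its factor r i j is r i times the
  factor j of the case r = 1. The surplus, one r i per cycle, is the number \<open>cfit\<close> of
  ways to map a fitting cycle.\<close>

lemma zcent_ppush:
  assumes q: "1 \<le> fst q" and l: "valid_mon 1 l"
  shows "zcent r (ppush r q l) = (\<Prod>p\<in>msupp (ppush r q l). of_nat (r * fst q) ^ ppush r q l p) * zcent 1 l"
proof -
  have l0: "snd p = 0" if "p \<in> msupp l" for p
    using valid_mon_1_snd[OF l, of "snd p" "fst p"] that by auto
  have inj: "inj_on (pmap r q) (msupp l)"
    by (rule inj_onI) (use l0 q in \<open>auto simp: prod_eq_iff\<close>)
  have val: "ppush r q l (pmap r q p) = l p" if "p \<in> msupp l" for p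
    using l0[OF that] q by (cases p) (auto simp: ppush_def)
  have supp: "msupp (ppush r q l) = pmap r q ` msupp l"
  proof
    show "msupp (ppush r q l) \<subseteq> pmap r q ` msupp l" by (rule msupp_ppush)
    show "pmap r q ` msupp l \<subseteq> msupp (ppush r q l)" using val by auto
  qed
  have "zcent r (ppush r q l) = (\<Prod>p\<in>msupp l. of_nat (r * (fst q * fst p)) ^ l p * fact (l p))"
    unfolding zcent_def supp by (subst prod.reindex[OF inj]) (simp add: val)
  also have "\<dots> = (\<Prod>p\<in>msupp l. of_nat (r * fst q) ^ l p) * zcent 1 l"
    unfolding zcent_def prod.distrib[symmetric]
    by (rule prod.cong) (simp_all add: power_mult_distrib)
  also have "(\<Prod>p\<in>msupp l. of_nat (r * fst q) ^ l p) = (\<Prod>p\<in>msupp (ppush r q l). of_nat (r * fst q) ^ ppush r q l p)"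
    unfolding supp by (subst prod.reindex[OF inj]) (simp add: val)
  finally show ?thesis .
qed

text \<open>The cycle type of the stabiliser of a point of c acting on the fibre over that point.\<close>
definition fibtype :: "nat \<Rightarrow> ('a set \<Rightarrow> 'b set) \<Rightarrow> 'a set set \<Rightarrow> 'b set \<Rightarrow> (nat \<times> nat) \<Rightarrow> nat" where
  "fibtype r \<psi> S c = (\<lambda>p. if snd p = 0 then card {C \<in> S. \<psi> C = c \<and> clen r C = clen r c * fst p} else 0)"

section \<open>The weighted count of equivariant maps\<close>

context gset_pair
begin

text \<open>By \<open>cyc_fix_set\<close> either every point of \<open>c\<close> is an admissible
  image of a generator or none is.\<close>

lemma cfit_eq:
  assumes C: "C \<in> cyc t s X" and c: "c \<in> cyc t' s' Y"
  shows "cfit C c = (if clen r c dvd clen r C \<and> csh r t s C = (csh r t' s' c * (clen r C div clen r c)) mod r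
    then r * clen r c else 0)"
proof -
  obtain x where x: "x \<in> C" using A.cyc_ne[OF C] by blast
  obtain y where y: "y \<in> c" using B.cyc_ne[OF c] by blast
  have K: "csh r t s C mod r = csh r t s C" using A.cyc_struct(2)[OF C x] by simp
  have iff: "(\<exists>j. clen r C = clen r c * j \<and> csh r t s C mod r = (csh r t' s' c * j) mod r)
    \<longleftrightarrow> clen r c dvd clen r C \<and> csh r t s C = (csh r t' s' c * (clen r C div clen r c)) mod r"
    unfolding K using B.cyc_struct(1)[OF c y] by (auto simp: dvd_def)
  show ?thesis
    unfolding cfit_def B.cyc_fix_set[OF c] iff using B.cyc_struct(5)[OF c y] by simp
qed

text \<open>The contribution of one fibre. If every orbit in \<open>S1\<close> can map to
  \<open>c\<close>, the factors \<open>cfit\<close> are the ratio of the two centraliser orders in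
  \<open>zcent_ppush\<close>. If some orbit does not fit, the left side has a factor 0, and on the
  right the type of that orbit puts the monomial outside the image of the substitution.\<close>

lemma fibre_weight:
  assumes c: "c \<in> cyc t' s' Y" and S1: "S1 \<subseteq> cyc t s X"
    and g: "\<And>l. valid_mon 1 l \<Longrightarrow> cf g l = v l / zcent 1 l"
  shows "of_nat (\<Prod>C\<in>S1. cfit C c) * v (\<lambda>p. if snd p = 0 then card {C \<in> S1. clen r C = clen r c * fst p} else 0)
    = zcent r (tcount (ctype r t s) S1) * cf (psub r (ctype r t' s' c) g) (tcount (ctype r t s) S1)"
    (is "_ * v ?l = zcent r ?m * cf (psub r ?q g) ?m")
proof -
  let ?\<tau> = "ctype r t s"
  let ?fit = "\<lambda>C. clen r c dvd clen r C \<and> csh r t s C = (csh r t' s' c * (clen r C div clen r c)) mod r"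
  have fin: "finite S1" using S1 A.finite_cyc finite_subset by blast
  obtain y where y: "y \<in> c" using B.cyc_ne[OF c] by blast
  have i: "1 \<le> fst ?q" using B.cyc_struct(1)[OF c y] by (simp add: ctype_def)
  have i0: "0 < clen r c" using B.cyc_struct(1)[OF c y] .
  have L0: "0 < clen r C" if "C \<in> S1" for C
    using A.cyc_struct(1) A.cyc_ne that S1 by blast
  show ?thesis
  proof (cases "\<forall>C\<in>S1. ?fit C")
    case False
    then obtain C where C: "C \<in> S1" "\<not> ?fit C" by blast
    have "cfit C c = 0" using cfit_eq[of C c] C S1 c by auto
    then have z: "(\<Prod>C\<in>S1. cfit C c) = 0" using C fin by (auto simp: prod_zero_iff)
    have "?m (?\<tau> C) \<noteq> 0" using C fin by (auto simp: tcount_def card_eq_0_iff)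
    moreover have "ppush r ?q (ppull r ?q ?m) (?\<tau> C) = 0"
      using C(2) by (auto simp: ppush_def ctype_def)
    ultimately have "?m \<noteq> ppush r ?q (ppull r ?q ?m)" by metis
    then show ?thesis unfolding z cf_psub by simp
  next
    case True
    \<comment> \<open>The length of a fitting orbit determines its twist, so passing from types to
      lengths loses nothing.\<close>
    have pull: "ppull r ?q ?m = ?l"
    proof
      fix p
      show "ppull r ?q ?m p = ?l p"
      proof (cases "snd p = 0")
        case True': True
        have "{C \<in> S1. ?\<tau> C = pmap r ?q p} = {C \<in> S1. clen r C = clen r c * fst p}"
          using True i0 by (auto simp: ctype_def)
        then show ?thesis using True' by (simp add: ppull_def tcount_def)
      qed (simp add: ppull_def)
    qed
    have push: "?m = ppush r ?q ?l"
    proof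
      fix p
      show "?m p = ppush r ?q ?l p"
      proof (cases "fst ?q dvd fst p \<and> snd p = (snd ?q * (fst p div fst ?q)) mod r")
        case True': True
        have "{C \<in> S1. ?\<tau> C = p} = {C \<in> S1. clen r C = clen r c * (fst p div fst ?q)}"
          using True True' i0 by (auto simp: ctype_def prod_eq_iff)
        then show ?thesis using True' by (simp add: ppush_def tcount_def)
      next
        case False
        then have "{C \<in> S1. ?\<tau> C = p} = {}" using True by (auto simp: ctype_def)
        then have "?m p = 0" unfolding tcount_def by (simp only: card.empty)
        then show ?thesis using False by (auto simp: ppush_def)
      qed
    qed
    have l: "valid_mon 1 ?l"
      unfolding valid_mon_def
    proof (intro conjI allI impI)
      have "msupp ?l \<subseteq> (\<lambda>C. (clen r C div clen r c, 0)) ` S1"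
      proof
        fix p assume "p \<in> msupp ?l"
        then have p: "snd p = 0" "card {C \<in> S1. clen r C = clen r c * fst p} \<noteq> 0" by (auto split: if_splits)
        then have "{C \<in> S1. clen r C = clen r c * fst p} \<noteq> {}" by (metis card.empty)
        then obtain C where "C \<in> S1" "clen r C = clen r c * fst p" by blast
        then show "p \<in> (\<lambda>C. (clen r C div clen r c, 0)) ` S1"
          using p i0 by (intro image_eqI[of _ _ C]) (auto simp: prod_eq_iff)
      qed
      then show "finite (msupp ?l)" by (rule finite_subset) (use fin in simp)
      fix j k assume a: "?l (j, k) \<noteq> 0"
      then show "k < 1" by (auto split: if_splits)
      have "{C \<in> S1. clen r C = clen r c * j} \<noteq> {}" 
      proof
        assume "{C \<in> S1. clen r C = clen r c * j} = {}"
        then show False using a by (simp only: fst_conv card.empty if_cancel)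
      qed
      then show "1 \<le> j" using L0 by (cases j) auto
    qed
    have "(\<Prod>C\<in>S1. cfit C c) = (\<Prod>C\<in>S1. r * clen r c)"
      by (rule prod.cong[OF refl]) (use cfit_eq S1 c True in auto)
    then have "of_nat (\<Prod>C\<in>S1. cfit C c) = (\<Prod>C\<in>S1. of_nat (r * fst ?q) :: complex)"
      by (simp add: ctype_def)
    also have "\<dots> = (\<Prod>p\<in>msupp ?m. of_nat (r * fst ?q) ^ ?m p)"
      using prod_tcount[OF fin, of "\<lambda>_. of_nat (r * fst ?q) :: complex" ?\<tau>] .
    finally have P: "of_nat (\<Prod>C\<in>S1. cfit C c) = (\<Prod>p\<in>msupp ?m. of_nat (r * fst ?q) ^ ?m p :: complex)" .
    have "zcent r ?m = (\<Prod>p\<in>msupp ?m. of_nat (r * fst ?q) ^ ?m p) * zcent 1 ?l"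
      using zcent_ppush[OF i l, of r] unfolding push[symmetric] .
    moreover have "cf (psub r ?q g) ?m = v ?l / zcent 1 ?l"
      unfolding cf_psub pull push[symmetric] using g[OF l] by simp
    ultimately show ?thesis using P zcent_nonzero[OF _ l] by simp
  qed
qed

text \<open>Maps are summed over the induced maps of orbits, fibre by fibre, and the exponential
  formula collects the fibres. \<open>v\<close> stays arbitrary, since it is taken to be a character
  in one application and an indicator function in another.\<close>

theorem ghom_sum:
  assumes g: "\<And>l. valid_mon 1 l \<Longrightarrow> cf g l = v l / zcent 1 l"
  shows "(\<Sum>\<phi>\<in>ghom X t s Y t' s'. \<Prod>c\<in>cyc t' s' Y. v (fibtype r (\<lambda>C. \<phi> ` C) (cyc t s X) c))
    = zcent r (gtype r X t s) * cf (\<Prod>c\<in>cyc t' s' Y. psub r (ctype r t' s' c) g) (gtype r X t s)"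
proof -
  let ?S = "cyc t s X" and ?T = "cyc t' s' Y" and ?\<tau> = "ctype r t s"
  define G where "G \<psi> = (\<Prod>c\<in>?T. v (fibtype r \<psi> ?S c))" for \<psi> :: "'a set \<Rightarrow> 'b set"
  have "(\<Sum>\<phi>\<in>ghom X t s Y t' s'. \<Prod>c\<in>?T. v (fibtype r (\<lambda>C. \<phi> ` C) ?S c))
    = (\<Sum>\<phi>\<in>ghom X t s Y t' s'. G (\<lambda>C\<in>?S. \<phi> ` C))"
  proof (rule sum.cong[OF refl])
    fix \<phi> :: "'a \<Rightarrow> 'b"
    have "fibtype r (\<lambda>C. \<phi> ` C) ?S c = fibtype r (\<lambda>C\<in>?S. \<phi> ` C) ?S c" for c
      unfolding fibtype_def by (intro ext if_cong refl arg_cong[where f = card]) auto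
    then show "(\<Prod>c\<in>?T. v (fibtype r (\<lambda>C. \<phi> ` C) ?S c)) = G (\<lambda>C\<in>?S. \<phi> ` C)" by (simp add: G_def)
  qed
  also have "\<dots> = (\<Sum>\<psi>\<in>?S \<rightarrow>\<^sub>E ?T. of_nat (\<Prod>C\<in>?S. cfit C (\<psi> C)) * G \<psi>)" by (rule sum_ghom)
  also have "\<dots> = (\<Sum>\<psi>\<in>?S \<rightarrow>\<^sub>E ?T. \<Prod>c\<in>?T. zcent r (tcount ?\<tau> {C \<in> ?S. \<psi> C = c}) *
      cf (psub r (ctype r t' s' c) g) (tcount ?\<tau> {C \<in> ?S. \<psi> C = c}))"
  proof (rule sum.cong[OF refl])
    fix \<psi> assume \<psi>: "\<psi> \<in> ?S \<rightarrow>\<^sub>E ?T"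
    have "(\<Prod>C\<in>?S. cfit C (\<psi> C)) = (\<Prod>c\<in>?T. \<Prod>C\<in>{C \<in> ?S. \<psi> C = c}. cfit C (\<psi> C))"
      by (rule prod.group[symmetric]) (use \<psi> A.finite_cyc B.finite_cyc in auto)
    also have "\<dots> = (\<Prod>c\<in>?T. \<Prod>C\<in>{C \<in> ?S. \<psi> C = c}. cfit C c)"
      by (intro prod.cong refl) simp
    finally have "of_nat (\<Prod>C\<in>?S. cfit C (\<psi> C)) * G \<psi>
      = (\<Prod>c\<in>?T. of_nat (\<Prod>C\<in>{C \<in> ?S. \<psi> C = c}. cfit C c) * v (fibtype r \<psi> ?S c))"
      unfolding G_def prod.distrib by (simp add: of_nat_prod)
    also have "\<dots> = (\<Prod>c\<in>?T. zcent r (tcount ?\<tau> {C \<in> ?S. \<psi> C = c}) *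
      cf (psub r (ctype r t' s' c) g) (tcount ?\<tau> {C \<in> ?S. \<psi> C = c}))"
    proof (rule prod.cong[OF refl])
      fix c assume c: "c \<in> ?T"
      have "fibtype r \<psi> ?S c = (\<lambda>p. if snd p = 0 then card {C \<in> {C \<in> ?S. \<psi> C = c}. clen r C = clen r c * fst p} else 0)"
        unfolding fibtype_def by (intro ext if_cong refl arg_cong[where f = card]) auto
      then show "of_nat (\<Prod>C\<in>{C \<in> ?S. \<psi> C = c}. cfit C c) * v (fibtype r \<psi> ?S c)
        = zcent r (tcount ?\<tau> {C \<in> ?S. \<psi> C = c}) * cf (psub r (ctype r t' s' c) g) (tcount ?\<tau> {C \<in> ?S. \<psi> C = c})"
        using fibre_weight[OF c _ g, of "{C \<in> ?S. \<psi> C = c}"] by auto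
    qed
    finally show "of_nat (\<Prod>C\<in>?S. cfit C (\<psi> C)) * G \<psi>
      = (\<Prod>c\<in>?T. zcent r (tcount ?\<tau> {C \<in> ?S. \<psi> C = c}) *
      cf (psub r (ctype r t' s' c) g) (tcount ?\<tau> {C \<in> ?S. \<psi> C = c}))" .
  qed
  also have "\<dots> = zcent r (tcount ?\<tau> ?S) * cf (\<Prod>c\<in>?T. psub r (ctype r t' s' c) g) (tcount ?\<tau> ?S)"
    by (rule exponential_formula[OF B.finite_cyc A.finite_cyc])
  finally show ?thesis unfolding gtype_def .
qed

section \<open>Isomorphisms and centralisers\<close>

definition giso :: "('a \<Rightarrow> 'b) set" where
  "giso = {\<phi> \<in> ghom X t s Y t' s'. bij_betw \<phi> X Y}"

lemma hom_clen:
  assumes \<phi>: "\<phi> \<in> ghom X t s Y t' s'" and C: "C \<in> cyc t s X"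
  shows "\<exists>j. clen r C = clen r (\<phi> ` C) * j \<and> csh r t s C mod r = (csh r t' s' (\<phi> ` C) * j) mod r"
proof -
  obtain x where x: "x \<in> C" using A.cyc_ne[OF C] by blast
  have xX: "x \<in> X" using A.cyc_mem[OF C x] by auto
  have "(s' ^^ clen r C) (\<phi> x) = (t' ^^ csh r t s C) (\<phi> x)"
    using hom_pow[OF \<phi> xX, of 0 "clen r C"] hom_pow[OF \<phi> xX, of "csh r t s C" 0] A.cyc_struct(3)[OF C x] by simp
  then show ?thesis
    by (rule B.cyc_stab[OF hom_image_cyc[OF \<phi> C] imageI[OF x]])
qed

text \<open>Over each target orbit there must lie a single orbit, of the same length. In this form
  bijectivity is a product of conditions on fibre types, as \<open>ghom_sum\<close>
  requires.\<close>

lemma hom_bij_iff: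
  assumes \<phi>: "\<phi> \<in> ghom X t s Y t' s'"
  shows "bij_betw \<phi> X Y \<longleftrightarrow> (\<forall>c\<in>cyc t' s' Y. fibtype r (\<lambda>C. \<phi> ` C) (cyc t s X) c = mdelta (1, 0))"
proof
  assume bij: "bij_betw \<phi> X Y"
  show "\<forall>c\<in>cyc t' s' Y. fibtype r (\<lambda>C. \<phi> ` C) (cyc t s X) c = mdelta (1, 0)"
  proof
    fix c assume c: "c \<in> cyc t' s' Y"
    obtain y where y: "y \<in> c" using B.cyc_ne[OF c] by blast
    have "y \<in> Y" using B.cyc_mem[OF c y] by auto
    then obtain x where x: "x \<in> X" "\<phi> x = y" using bij by (auto simp: bij_betw_def)
    let ?C = "orb t s x"
    have C: "?C \<in> cyc t s X" by (rule A.orb_cyc[OF x(1)])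
    have im: "\<phi> ` ?C = c" using hom_image[OF \<phi> C A.orb_self] x B.cyc_mem[OF c y] by simp
    have len: "clen r ?C = clen r c"
      unfolding clen_def im[symmetric]
      by (subst card_image) (use bij A.orb_subX[OF x(1)] in \<open>auto simp: bij_betw_def intro: inj_on_subset\<close>)
    have uniq: "D = ?C" if "D \<in> cyc t s X" "\<phi> ` D = c" for D
      using inj_on_image_eq_iff[of \<phi> X D ?C] bij A.cyc_subX[OF that(1)] A.cyc_subX[OF C] that im
      by (auto simp: bij_betw_def)
    have sets: "{D \<in> cyc t s X. \<phi> ` D = c \<and> clen r D = clen r c * j} = (if j = 1 then {?C} else {})" for j
    proof (intro equalityI subsetI)
      fix D assume D: "D \<in> {D \<in> cyc t s X. \<phi> ` D = c \<and> clen r D = clen r c * j}"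
      then have DC: "D = ?C" using uniq by blast
      then have "clen r c = clen r c * j" using D len by simp
      then have "j = 1" using B.cyc_struct(1)[OF c y] by simp
      then show "D \<in> (if j = 1 then {?C} else {})" using DC by simp
    next
      fix D assume "D \<in> (if j = 1 then {?C} else {})"
      then have "j = 1" "D = ?C" by (auto split: if_splits)
      then show "D \<in> {D \<in> cyc t s X. \<phi> ` D = c \<and> clen r D = clen r c * j}"
        using C im len by simp
    qed
    show "fibtype r (\<lambda>C. \<phi> ` C) (cyc t s X) c = mdelta (1, 0)"
      unfolding fibtype_def sets by (auto simp: fun_eq_iff prod_eq_iff)
  qed
next
  assume all: "\<forall>c\<in>cyc t' s' Y. fibtype r (\<lambda>C. \<phi> ` C) (cyc t s X) c = mdelta (1, 0)"
  have one: "card {C \<in> cyc t s X. \<phi> ` C = c \<and> clen r C = clen r c * j} = (if j = 1 then 1 else 0)"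
    if "c \<in> cyc t' s' Y" for c j
    using fun_cong[OF all[rule_format, OF that], of "(j, 0)"] by (simp add: fibtype_def)
  have len: "clen r C = clen r (\<phi> ` C)" if C: "C \<in> cyc t s X" for C
  proof -
    obtain j where j: "clen r C = clen r (\<phi> ` C) * j" using hom_clen[OF \<phi> C] by blast
    then have "C \<in> {D \<in> cyc t s X. \<phi> ` D = \<phi> ` C \<and> clen r D = clen r (\<phi> ` C) * j}" using C by simp
    then have "card {D \<in> cyc t s X. \<phi> ` D = \<phi> ` C \<and> clen r D = clen r (\<phi> ` C) * j} \<noteq> 0"
      using A.finite_cyc by (auto simp: card_eq_0_iff)
    then have "j = 1" using one[OF hom_image_cyc[OF \<phi> C], of j] by (auto split: if_splits)
    then show ?thesis using j by simp
  qed
  have inj: "inj_on (\<lambda>C. \<phi> ` C) (cyc t s X)"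
  proof (rule inj_onI)
    fix C D assume C: "C \<in> cyc t s X" and D: "D \<in> cyc t s X" and eq: "\<phi> ` C = \<phi> ` D"
    have "card {E \<in> cyc t s X. \<phi> ` E = \<phi> ` C \<and> clen r E = clen r (\<phi> ` C) * 1} = 1"
      using one[OF hom_image_cyc[OF \<phi> C], of 1] by simp
    then obtain E where E: "{E \<in> cyc t s X. \<phi> ` E = \<phi> ` C \<and> clen r E = clen r (\<phi> ` C) * 1} = {E}"
      by (rule card_1_singletonE)
    have mem: "C \<in> {E \<in> cyc t s X. \<phi> ` E = \<phi> ` C \<and> clen r E = clen r (\<phi> ` C) * 1}"
      "D \<in> {E \<in> cyc t s X. \<phi> ` E = \<phi> ` C \<and> clen r E = clen r (\<phi> ` C) * 1}"
    proof -
      have 1: "clen r C = clen r (\<phi> ` C)" by (rule len[OF C])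
      have 2: "clen r D = clen r (\<phi> ` C)" unfolding eq by (rule len[OF D])
      show "C \<in> {E \<in> cyc t s X. \<phi> ` E = \<phi> ` C \<and> clen r E = clen r (\<phi> ` C) * 1}"
        unfolding mult_1_right by (rule CollectI, intro conjI C 1 refl)
      show "D \<in> {E \<in> cyc t s X. \<phi> ` E = \<phi> ` C \<and> clen r E = clen r (\<phi> ` C) * 1}"
        unfolding mult_1_right by (rule CollectI, intro conjI D 2 eq[symmetric])
    qed
    show "C = D" using mem[unfolded E] by simp
  qed
  \<comment> \<open>Injectivity comes from counting: the image orbits are distinct and have the
    lengths of their sources, so \<open>X\<close> has at most as many points as \<open>Y\<close>,
    onto which it maps.\<close>
  have "card X = (\<Sum>C\<in>cyc t s X. r * clen r (\<phi> ` C))"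
    unfolding A.card_sum
  proof (rule sum.cong[OF refl])
    fix C assume "C \<in> cyc t s X"
    from len[OF this] show "r * clen r C = r * clen r (\<phi> ` C)" by (rule arg_cong)
  qed
  also have "\<dots> = (\<Sum>c\<in>(\<lambda>C. \<phi> ` C) ` cyc t s X. r * clen r c)"
    by (simp add: sum.reindex[OF inj])
  also have "\<dots> \<le> (\<Sum>c\<in>cyc t' s' Y. r * clen r c)"
    by (rule sum_mono2) (use B.finite_cyc hom_image_cyc[OF \<phi>] in auto)
  also have "\<dots> = card Y" by (rule B.card_sum[symmetric])
  finally have le: "card X \<le> card Y" .
  have surj: "\<phi> ` X = Y"
  proof
    show "\<phi> ` X \<subseteq> Y" using hom_in[OF \<phi>] by auto
    show "Y \<subseteq> \<phi> ` X"
    proof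
      fix y assume y: "y \<in> Y"
      have "card {C \<in> cyc t s X. \<phi> ` C = orb t' s' y \<and> clen r C = clen r (orb t' s' y) * 1} = 1"
        using one[OF B.orb_cyc[OF y], of 1] by simp
      then have "{C \<in> cyc t s X. \<phi> ` C = orb t' s' y \<and> clen r C = clen r (orb t' s' y) * 1} \<noteq> {}"
        by (metis card.empty zero_neq_one)
      then obtain C where "C \<in> cyc t s X" "\<phi> ` C = orb t' s' y" by blast
      then show "y \<in> \<phi> ` X" using B.orb_self[of y] A.cyc_subX by blast
    qed
  qed
  moreover have "inj_on \<phi> X"
    using surj le A.fin card_image_le[OF A.fin, of \<phi>] by (intro eq_card_imp_inj_on) auto
  ultimately show "bij_betw \<phi> X Y" by (simp add: bij_betw_def)
qed

text \<open>\<open>ghom_sum\<close> is applied to the series p_1, and p_i(zeta^k) o p_1 is the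
  variable itself. The product over the orbits of \<open>Y\<close> is then the monomial of its type,
  with coefficient 1 or 0. For \<open>Y\<close> equal to \<open>X\<close> the value is the order of
  the automorphism group.\<close>

theorem card_giso: "of_nat (card giso) = (if gtype r X t s = gtype r Y t' s' then zcent r (gtype r X t s) else 0)"
proof -
  let ?v = "\<lambda>l. if l = mdelta (1, 0) then 1 else 0 :: complex"
  have "of_nat (card giso) = (\<Sum>\<phi>\<in>giso. 1 :: complex)" by simp
  also have "\<dots> = (\<Sum>\<phi>\<in>ghom X t s Y t' s'. if bij_betw \<phi> X Y then 1 else (0::complex))"
    unfolding giso_def by (rule sum.inter_filter[OF finite_ghom])
  also have "\<dots> = (\<Sum>\<phi>\<in>ghom X t s Y t' s'. \<Prod>c\<in>cyc t' s' Y. ?v (fibtype r (\<lambda>C. \<phi> ` C) (cyc t s X) c))"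
  proof (rule sum.cong[OF refl])
    fix \<phi> assume "\<phi> \<in> ghom X t s Y t' s'"
    from hom_bij_iff[OF this] show "(if bij_betw \<phi> X Y then 1 else (0::complex))
      = (\<Prod>c\<in>cyc t' s' Y. ?v (fibtype r (\<lambda>C. \<phi> ` C) (cyc t s X) c))"
      using B.finite_cyc by (auto intro!: prod.neutral[symmetric] prod_zero)
  qed
  also have "\<dots> = zcent r (gtype r X t s) * cf (\<Prod>c\<in>cyc t' s' Y. psub r (ctype r t' s' c) (pv (1, 0))) (gtype r X t s)"
  proof (rule ghom_sum)
    fix l assume "valid_mon 1 l"
    have "zcent 1 (mdelta (1, 0)) = 1" unfolding zcent_def msupp_mdelta by simp
    then show "cf (pv (1, 0)) l = ?v l / zcent 1 l" by (simp add: cf_pv)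
  qed
  also have "(\<Prod>c\<in>cyc t' s' Y. psub r (ctype r t' s' c) (pv (1, 0))) = (\<Prod>c\<in>cyc t' s' Y. pv (ctype r t' s' c))"
  proof (rule prod.cong[OF refl])
    fix c assume c: "c \<in> cyc t' s' Y"
    obtain y where y: "y \<in> c" using B.cyc_ne[OF c] by blast
    show "psub r (ctype r t' s' c) (pv (1, 0)) = pv (ctype r t' s' c)"
      using B.cyc_struct(1,2)[OF c y] by (simp add: ctype_def psub_pv)
  qed
  also have "cf \<dots> (gtype r X t s) = (if gtype r X t s = gtype r Y t' s' then 1 else 0)"
    using cf_prod_pv[OF B.finite_cyc] by (simp add: gtype_def)
  finally show ?thesis by simp
qed

text \<open>No isomorphism is constructed: their number is the nonzero \<open>zcent\<close>.\<close>

lemma giso_ex: "gtype r X t s = gtype r Y t' s' \<Longrightarrow> \<exists>\<phi>. \<phi> \<in> giso"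
proof -
  assume "gtype r X t s = gtype r Y t' s'"
  then have "of_nat (card giso) \<noteq> (0 :: complex)"
    using card_giso zcent_nonzero[OF A.r A.gtype_valid] by simp
  then show ?thesis by (metis card.empty ex_in_conv of_nat_0)
qed

lemma giso_gtype: "\<phi> \<in> giso \<Longrightarrow> gtype r X t s = gtype r Y t' s'"
proof (rule ccontr)
  assume \<phi>: "\<phi> \<in> giso" and "gtype r X t s \<noteq> gtype r Y t' s'"
  then have "card giso = 0" using card_giso by simp
  moreover have "finite giso" unfolding giso_def using finite_ghom by simp
  ultimately show False using \<phi> by simp
qed

end

section \<open>Stable partitions\<close>

lemma image_funpow:
  fixes f :: "'a \<Rightarrow> 'a"
  shows "((`) f ^^ k) J = (f ^^ k) ` J"
  by (induction k) (simp_all add: image_comp comp_def)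

lemma gset_iso:
  assumes "gset r X t s" and f: "bij_betw f X Y"
    and eq: "\<And>x. x \<in> X \<Longrightarrow> f (t x) = t' (f x)" "\<And>x. x \<in> X \<Longrightarrow> f (s x) = s' (f x)"
  shows "gset r Y t' s'"
proof -
  interpret A: gset r X t s by fact
  have fY: "f x \<in> Y" if "x \<in> X" for x using f that by (auto simp: bij_betw_def)
  have ex: "\<exists>x\<in>X. y = f x" if "y \<in> Y" for y using f that by (auto simp: bij_betw_def)
  have inj: "x = x'" if "x \<in> X" "x' \<in> X" "f x = f x'" for x x'
    using f that by (auto simp: bij_betw_def inj_on_def)
  have pow: "f ((t ^^ k) x) = (t' ^^ k) (f x)" if "x \<in> X" for k x
    using that by (induction k) (auto simp: eq)
  have finY: "finite Y" using f A.fin bij_betw_finite by blast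
  have bij: "bij_betw p' Y Y" if p: "bij_betw p X X" "\<And>x. x \<in> X \<Longrightarrow> f (p x) = p' (f x)" for p p'
  proof -
    have "inj_on p' Y"
    proof (rule inj_onI)
      fix y z assume "y \<in> Y" "z \<in> Y" and e: "p' y = p' z"
      then obtain x x' where x: "x \<in> X" "y = f x" "x' \<in> X" "z = f x'" using ex by metis
      then have "f (p x) = f (p x')" using p(2) e by simp
      then have "p x = p x'" by (intro inj) (use p(1) x in \<open>auto simp: bij_betw_def\<close>)
      then show "y = z" using p(1) x by (auto simp: bij_betw_def inj_on_def)
    qed
    moreover have "p' ` Y \<subseteq> Y"
    proof
      fix z assume "z \<in> p' ` Y"
      then obtain x where "x \<in> X" "z = p' (f x)" using ex by blast
      then show "z \<in> Y" using p fY by (metis bij_betwE)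
    qed
    ultimately show ?thesis using endo_inj_surj[OF finY] by (simp add: bij_betw_def)
  qed
  show ?thesis
  proof
    show "1 \<le> r" by (rule A.r)
    show "finite Y" by (rule finY)
    show "bij_betw t' Y Y" by (rule bij[OF A.tbij eq(1)])
    show "bij_betw s' Y Y" by (rule bij[OF A.sbij eq(2)])
    fix y assume "y \<in> Y"
    then obtain x where x: "x \<in> X" "y = f x" using ex by blast
    have "f (t (s x)) = f (s (t x))" using A.comm[OF x(1)] by simp
    then show "t' (s' y) = s' (t' y)" using x by (simp add: eq)
    show "(t' ^^ r) y = y" using pow[OF x(1), of r] A.tr x by simp
    fix k assume k: "0 < k" "k < r"
    show "(t' ^^ k) y \<noteq> y"
    proof
      assume "(t' ^^ k) y = y"
      then have "f ((t ^^ k) x) = f x" using pow[OF x(1)] x by simp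
      then show False using inj[of "(t ^^ k) x" x] A.free[OF x(1) k] x by simp
    qed
  qed
qed

lemma gtype_iso:
  assumes X: "gset r X t s" and f: "bij_betw f X Y"
    and eq: "\<And>x. x \<in> X \<Longrightarrow> f (t x) = t' (f x)" "\<And>x. x \<in> X \<Longrightarrow> f (s x) = s' (f x)"
  shows "gtype r X t s = gtype r Y t' s'"
proof -
  interpret gset_pair r X t s Y t' s'
    by (intro gset_pair.intro X gset_iso[OF X f eq])
  have "restrict f X \<in> giso"
    unfolding giso_def ghom_def
    using f eq by (auto simp: bij_betw_def intro: A.tX A.sX inj_on_restrict_eq[THEN iffD2])
  then show ?thesis by (rule giso_gtype)
qed

section \<open>Stable partitions and their blocks\<close>

definition gparts :: "nat \<Rightarrow> 'a set \<Rightarrow> ('a \<Rightarrow> 'a) \<Rightarrow> ('a \<Rightarrow> 'a) \<Rightarrow> 'a set set set" where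
  "gparts r X t s = {\<pi>. \<Union>\<pi> = X \<and> (\<forall>J\<in>\<pi>. J \<noteq> {}) \<and>
      (\<forall>J\<in>\<pi>. \<forall>J'\<in>\<pi>. J \<noteq> J' \<longrightarrow> J \<inter> J' = {}) \<and> (\<forall>J\<in>\<pi>. t ` J \<in> \<pi>) \<and> (\<forall>J\<in>\<pi>. s ` J \<in> \<pi>) \<and>
      (\<forall>J\<in>\<pi>. \<forall>k. 0 < k \<and> k < r \<longrightarrow> (t ^^ k) ` J \<noteq> J)}"

definition blk :: "'a set set \<Rightarrow> 'a \<Rightarrow> 'a set" where
  "blk \<pi> x = (THE J. J \<in> \<pi> \<and> x \<in> J)"

context gset
begin

lemma finite_gparts: "finite (gparts r X t s)"
proof (rule finite_subset)
  show "gparts r X t s \<subseteq> Pow (Pow X)" unfolding gparts_def by auto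
qed (use fin in simp)

context
  fixes \<pi> assumes \<pi>: "\<pi> \<in> gparts r X t s"
begin

lemma block_sub: "J \<in> \<pi> \<Longrightarrow> J \<subseteq> X" using \<pi> unfolding gparts_def by blast
lemma block_ne: "J \<in> \<pi> \<Longrightarrow> J \<noteq> {}" using \<pi> unfolding gparts_def by blast
lemma block_eq: "J \<in> \<pi> \<Longrightarrow> J' \<in> \<pi> \<Longrightarrow> x \<in> J \<Longrightarrow> x \<in> J' \<Longrightarrow> J = J'" using \<pi> unfolding gparts_def by blast
lemma block_t: "J \<in> \<pi> \<Longrightarrow> t ` J \<in> \<pi>" using \<pi> unfolding gparts_def by blast
lemma block_s: "J \<in> \<pi> \<Longrightarrow> s ` J \<in> \<pi>" using \<pi> unfolding gparts_def by blast

lemma blk_eq: "J \<in> \<pi> \<Longrightarrow> x \<in> J \<Longrightarrow> blk \<pi> x = J"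
  unfolding blk_def using block_eq by (intro the_equality) auto

lemma blk_in: "x \<in> X \<Longrightarrow> blk \<pi> x \<in> \<pi> \<and> x \<in> blk \<pi> x"
proof -
  assume "x \<in> X"
  then obtain J where "J \<in> \<pi>" "x \<in> J" using \<pi> unfolding gparts_def by blast
  then show ?thesis using blk_eq by metis
qed

lemma finite_gpart: "finite \<pi>"
  by (rule finite_subset[of _ "Pow X"]) (use block_sub fin in auto)

lemma gset_gpart: "gset r \<pi> ((`) t) ((`) s)"
proof
  show "1 \<le> r" by (rule r)
  show "finite \<pi>" by (rule finite_gpart)
  have bij: "bij_betw ((`) f) \<pi> \<pi>" if "bij_betw f X X" "\<And>J. J \<in> \<pi> \<Longrightarrow> f ` J \<in> \<pi>" for f
  proof -
    have "inj_on ((`) f) \<pi>"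
    proof (rule inj_onI)
      fix J J' assume "J \<in> \<pi>" "J' \<in> \<pi>" "f ` J = f ` J'"
      then show "J = J'"
        using inj_on_image_eq_iff[of f X J J'] block_sub that(1) by (auto simp: bij_betw_def)
    qed
    then show ?thesis using endo_inj_surj[OF finite_gpart] that(2) by (simp add: bij_betw_def image_subset_iff)
  qed
  show "bij_betw ((`) t) \<pi> \<pi>" by (rule bij[OF tbij block_t])
  show "bij_betw ((`) s) \<pi> \<pi>" by (rule bij[OF sbij block_s])
  fix J assume J: "J \<in> \<pi>"
  show "t ` s ` J = s ` t ` J" unfolding image_image
    by (rule image_cong[OF refl]) (use block_sub[OF J] comm in blast)
  have "(t ^^ r) ` J = J" using tr block_sub[OF J] by force
  then show "((`) t ^^ r) J = J" by (simp add: image_funpow)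
  fix k assume "0 < k" "k < r"
  then show "((`) t ^^ k) J \<noteq> J" unfolding image_funpow using \<pi> J unfolding gparts_def by blast
qed

lemma quo_hom: "(\<lambda>x\<in>X. blk \<pi> x) \<in> ghom X t s \<pi> ((`) t) ((`) s)"
  unfolding ghom_def
proof (rule CollectI, intro conjI ballI)
  show "(\<lambda>x\<in>X. blk \<pi> x) \<in> X \<rightarrow>\<^sub>E \<pi>" using blk_in by auto
  fix x assume x: "x \<in> X"
  have b: "blk \<pi> x \<in> \<pi>" "x \<in> blk \<pi> x" using blk_in[OF x] by auto
  show "(\<lambda>x\<in>X. blk \<pi> x) (t x) = t ` (\<lambda>x\<in>X. blk \<pi> x) x"
    using x blk_eq[OF block_t[OF b(1)] imageI[OF b(2)]] by simp
  show "(\<lambda>x\<in>X. blk \<pi> x) (s x) = s ` (\<lambda>x\<in>X. blk \<pi> x) x"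
    using x blk_eq[OF block_s[OF b(1)] imageI[OF b(2)]] by simp
qed

text \<open>The stabiliser of a block J in the group generated by t and s is generated by this
  permutation, where c is the orbit of J.\<close>
definition btau :: "'a set set \<Rightarrow> 'a \<Rightarrow> 'a" where
  "btau c = (t ^^ (r - csh r ((`) t) ((`) s) c)) \<circ> (s ^^ clen r c)"

text \<open>After \<open>clen\<close> steps of \<open>s\<close> the block has become its translate
  by \<open>csh\<close> steps of \<open>t\<close>, and \<open>r - csh\<close> further steps bring it
  back. Within a single block no translation acts, hence the parameters 1 and
  \<open>id\<close>.\<close>

lemma btau_gset:
  assumes c: "c \<in> cyc ((`) t) ((`) s) \<pi>" and J: "J \<in> c"
  shows "gset 1 J id (btau c)"
proof -
  interpret P: gset r \<pi> "(`) t" "(`) s" by (rule gset_gpart)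
  let ?i = "clen r c" and ?k = "csh r ((`) t) ((`) s) c"
  have J\<pi>: "J \<in> \<pi>" using P.cyc_mem[OF c J] by auto
  note sub = block_sub[OF J\<pi>]
  note st = P.cyc_struct[OF c J]
  have "(s ^^ ?i) ` J = (t ^^ ?k) ` J" using st(3) by (simp add: image_funpow)
  then have "btau c ` J = (t ^^ (r - ?k)) ` (t ^^ ?k) ` J" unfolding btau_def image_comp[symmetric] by simp
  also have "\<dots> = (\<lambda>x. x) ` J" unfolding image_image
    by (rule image_cong[OF refl]) (use sub tr st(2) in \<open>auto simp: funpow_app subset_iff\<close>)
  finally have im: "btau c ` J = J" by simp
  have finJ: "finite J" using sub fin finite_subset by blast
  show ?thesis
  proof
    show "finite J" by (rule finJ)
    show "bij_betw (btau c) J J"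
      using im finite_surj_inj[OF finJ, of "btau c"] by (simp add: bij_betw_def)
  qed auto
qed

lemma btau_pow: "x \<in> X \<Longrightarrow> (btau c ^^ j) x = (t ^^ ((r - csh r ((`) t) ((`) s) c) * j)) ((s ^^ (clen r c * j)) x)"
proof (induction j)
  case (Suc j)
  then show ?case
    by (simp add: btau_def commp funpow_app add.commute)
qed simp

text \<open>Orbits of \<open>X\<close> lying over \<open>c\<close> correspond to cycles of
  \<open>btau c\<close> on \<open>J\<close> by intersection with \<open>J\<close>, and lengths
  shrink by the factor \<open>clen r c\<close>.\<close>

lemma fibtype_quo:
  assumes c: "c \<in> cyc ((`) t) ((`) s) \<pi>" and J: "J \<in> c"
  shows "fibtype r (\<lambda>C. (\<lambda>x\<in>X. blk \<pi> x) ` C) (cyc t s X) c = gtype 1 J id (btau c)"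
proof -
  interpret P: gset r \<pi> "(`) t" "(`) s" by (rule gset_gpart)
  interpret Q: gset_pair r X t s \<pi> "(`) t" "(`) s" ..
  let ?i = "clen r c" and ?k = "csh r ((`) t) ((`) s) c"
  let ?q = "\<lambda>x\<in>X. blk \<pi> x"
  interpret T: gset 1 J id "btau c" by (rule btau_gset[OF c J])
  have J\<pi>: "J \<in> \<pi>" using P.cyc_mem[OF c J] by auto
  note sub = block_sub[OF J\<pi>]
  note st = P.cyc_struct[OF c J]
  have inX: "x \<in> X" if "x \<in> J" for x using sub that by blast
  have qx: "?q x = J" if "x \<in> J" for x using blk_eq[OF J\<pi> that] inX[OF that] by simp
  have orbT: "orb id (btau c) x = {(btau c ^^ b) x | b. True}" for x unfolding orb_def by simp
  \<comment> \<open>The definition of \<open>btau\<close> solved for the power of \<open>s\<close>: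
    translations by \<open>csh\<close> and by \<open>r - csh\<close> combine to full turns.\<close>
  have ts: "(s ^^ (?i * j)) x = (t ^^ (?k * j)) ((btau c ^^ j) x)" if x: "x \<in> J" for x j
  proof -
    have "(t ^^ (?k * j)) ((btau c ^^ j) x) = (t ^^ (?k * j + (r - ?k) * j)) ((s ^^ (?i * j)) x)"
      unfolding btau_pow[OF inX[OF x]] funpow_app ..
    also have "?k * j + (r - ?k) * j = r * j" using st(2) by (simp flip: add_mult_distrib)
    finally show ?thesis using tr_mult[of "(s ^^ (?i * j)) x" j] inX[OF x] by simp
  qed
  \<comment> \<open>A product of powers of \<open>t\<close> and \<open>s\<close> that takes a point
    of \<open>J\<close> into \<open>J\<close> fixes the block, so by \<open>cyc_stab\<close> it acts
    as a power of \<open>btau c\<close>.\<close>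
  have inter: "C \<inter> J = orb id (btau c) x" if C: "C \<in> cyc t s X" and x: "x \<in> C \<inter> J" for C x
  proof
    have xC: "x \<in> C" and xJ: "x \<in> J" using x by auto
    show "orb id (btau c) x \<subseteq> C \<inter> J"
      unfolding orbT using T.spX[OF xJ] cyc_t[OF C xC] btau_pow[OF inX[OF xJ]] by auto
    show "C \<inter> J \<subseteq> orb id (btau c) x"
    proof
      fix y assume y: "y \<in> C \<inter> J"
      then have "y \<in> orb t s x" using cyc_mem[OF C xC] by blast
      then obtain a b where ab: "y = (t ^^ a) ((s ^^ b) x)" using orbE by metis
      have "((`) t ^^ a) (((`) s ^^ b) J) = J"
      proof -
        have "((`) t ^^ a) (((`) s ^^ b) J) \<in> \<pi>" using J\<pi> by simp
        moreover have "y \<in> ((`) t ^^ a) (((`) s ^^ b) J)" unfolding image_funpow ab using xJ by blast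
        ultimately show ?thesis using block_eq[OF _ J\<pi>] y by blast
      qed
      then have "((`) t ^^ (r * a - a)) (((`) t ^^ a) (((`) s ^^ b) J)) = ((`) t ^^ (r * a - a)) J" by simp
      moreover have le: "a \<le> r * a" using r by simp
      ultimately have "((`) s ^^ b) J = ((`) t ^^ (r * a - a)) J"
        unfolding funpow_app le_add_diff_inverse2[OF le] using P.tr_mult J\<pi> by simp
      from P.cyc_stab[OF c J this] obtain j where j: "b = ?i * j" "(r * a - a) mod r = (?k * j) mod r" by blast
      let ?z = "(btau c ^^ j) x"
      have zX: "?z \<in> X" using inX[OF T.spX[OF xJ]] .
      have "y = (t ^^ (a + ?k * j)) ?z" unfolding ab j(1) ts[OF xJ] funpow_app ..
      moreover have "(a + ?k * j) mod r = (r * a) mod r"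
      proof -
        have "(a + ?k * j) mod r = (a + (r * a - a)) mod r" using j(2) by (metis mod_add_right_eq)
        then show ?thesis using le by simp
      qed
      ultimately have "y = (t ^^ (r * a)) ?z" using t_eq_iff[OF zX] by simp
      then have "y = ?z" using tr_mult[OF zX] by simp
      then show "y \<in> orb id (btau c) x" unfolding orbT by blast
    qed
  qed
  \<comment> \<open>A full cycle of \<open>btau c\<close> is a return of \<open>C\<close>;
    conversely a return of \<open>C\<close> projects to one of \<open>c\<close> and so is a return
    of \<open>btau c\<close>. Divisibility in both directions gives equality.\<close>
  have len: "clen r C = ?i * card (C \<inter> J)" if C: "C \<in> cyc t s X" and x: "x \<in> C \<inter> J" for C x
  proof -
    have xC: "x \<in> C" and xJ: "x \<in> J" using x by auto
    let ?D = "C \<inter> J"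
    have D: "?D \<in> cyc id (btau c) J" using inter[OF C x] T.orb_cyc[OF xJ] by simp
    have n: "clen 1 ?D = card ?D" by (simp add: clen_def)
    have "(btau c ^^ card ?D) x = x"
      using T.cyc_struct(2,3)[OF D x] unfolding n by simp
    then have "(s ^^ (?i * card ?D)) x = (t ^^ (?k * card ?D)) x" using ts[OF xJ, of "card ?D"] by simp
    from cyc_stab[OF C xC this] have d1: "clen r C dvd ?i * card ?D" by auto
    obtain j where j: "clen r C = clen r (?q ` C) * j" "csh r t s C mod r = (csh r ((`) t) ((`) s) (?q ` C) * j) mod r"
      using Q.hom_clen[OF quo_hom C] by blast
    have qC: "?q ` C = c"
      using Q.hom_image[OF quo_hom C xC] qx[OF xJ] P.cyc_mem[OF c J] by simp
    have "(s ^^ (?i * j)) x = (t ^^ (?k * j)) x"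
      using cyc_struct(3)[OF C xC] j unfolding qC using t_eq_iff[OF inX[OF xJ], of "csh r t s C" "?k * j"] by simp
    then have "(t ^^ (?k * j)) ((btau c ^^ j) x) = (t ^^ (?k * j)) x" using ts[OF xJ] by simp
    then have "(btau c ^^ j) x = (id ^^ 0) x" using tp_inj[OF inX[OF T.spX[OF xJ]] inX[OF xJ]] by simp
    from T.cyc_stab[OF D x this] have "card ?D dvd j" unfolding n by auto
    moreover have "j dvd card ?D" using d1 st(1) unfolding j(1) qC by simp
    ultimately have "j = card ?D" by (simp add: dvd_antisym)
    then show ?thesis using j(1) qC by simp
  qed
  show ?thesis
  proof
    fix p
    show "fibtype r (\<lambda>C. ?q ` C) (cyc t s X) c p = gtype 1 J id (btau c) p"
    proof (cases "snd p = 0")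
      case False
      have "{D \<in> cyc id (btau c) J. ctype 1 id (btau c) D = p} = {}"
      proof (rule ccontr)
        assume "\<not> ?thesis"
        then obtain D where D: "D \<in> cyc id (btau c) J" "ctype 1 id (btau c) D = p" by blast
        obtain x where "x \<in> D" using T.cyc_ne[OF D(1)] by blast
        then show False using T.cyc_struct(2)[OF D(1)] D(2) False by (auto simp: ctype_def)
      qed
      then have "gtype 1 J id (btau c) p = 0" unfolding gtype_def tcount_def by (simp only: card.empty)
      then show ?thesis using False by (simp add: fibtype_def)
    next
      case True
      let ?A = "{C \<in> cyc t s X. ?q ` C = c \<and> clen r C = ?i * fst p}"
      let ?B = "{D \<in> cyc id (btau c) J. ctype 1 id (btau c) D = p}"
      have meet: "\<exists>x. x \<in> C \<inter> J" if "C \<in> cyc t s X" "?q ` C = c" for C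
      proof -
        have "J \<in> ?q ` C" using that J by simp
        then obtain x where x: "x \<in> C" "?q x = J" by blast
        then show ?thesis using blk_in cyc_mem[OF that(1) x(1)] by auto
      qed
      have ct: "ctype 1 id (btau c) D = (card D, 0)" if D: "D \<in> cyc id (btau c) J" for D
      proof -
        obtain x where "x \<in> D" using T.cyc_ne[OF D] by blast
        then show ?thesis using T.cyc_struct(2)[OF D] by (simp add: ctype_def clen_def)
      qed
      have "bij_betw (\<lambda>C. C \<inter> J) ?A ?B"
        unfolding bij_betw_def
      proof (intro conjI equalityI)
        show "inj_on (\<lambda>C. C \<inter> J) ?A"
        proof (rule inj_onI)
          fix C D assume C: "C \<in> ?A" and D: "D \<in> ?A" and eq: "C \<inter> J = D \<inter> J"
          obtain x where "x \<in> C \<inter> J" using meet C by blast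
          then show "C = D" using cyc_eq[of C D x] C D eq by blast
        qed
        show "(\<lambda>C. C \<inter> J) ` ?A \<subseteq> ?B"
        proof
          fix D assume "D \<in> (\<lambda>C. C \<inter> J) ` ?A"
          then obtain C where C: "C \<in> cyc t s X" "?q ` C = c" "clen r C = ?i * fst p" and D: "D = C \<inter> J" by blast
          obtain x where x: "x \<in> C \<inter> J" using meet C by blast
          have Dc: "D \<in> cyc id (btau c) J" using inter[OF C(1) x] T.orb_cyc[OF IntD2[OF x]] D by (simp only:)
          have "card D = fst p" using len[OF C(1) x] C(3) st(1) D by simp
          then show "D \<in> ?B" using ct[OF Dc] Dc True by (simp add: prod_eq_iff)
        qed
        show "?B \<subseteq> (\<lambda>C. C \<inter> J) ` ?A"
        proof
          fix D assume "D \<in> ?B"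
          then have D: "D \<in> cyc id (btau c) J" "card D = fst p" using ct by auto
          obtain x where x: "x \<in> D" using T.cyc_ne[OF D(1)] by blast
          have xJ: "x \<in> J" and Do: "D = orb id (btau c) x" using T.cyc_mem[OF D(1) x] by auto
          let ?C = "orb t s x"
          have C: "?C \<in> cyc t s X" by (rule orb_cyc[OF inX[OF xJ]])
          have xCJ: "x \<in> ?C \<inter> J" using xJ orb_self by blast
          have DC: "?C \<inter> J = D" using inter[OF C xCJ] Do by simp
          have "?q ` ?C = c" using Q.hom_image[OF quo_hom C orb_self] qx[OF xJ] P.cyc_mem[OF c J] by simp
          moreover have "clen r ?C = ?i * fst p" using len[OF C xCJ] DC D(2) by simp
          ultimately show "D \<in> (\<lambda>C. C \<inter> J) ` ?A" using C DC by blast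
        qed
      qed
      then have "card ?A = card ?B" by (rule bij_betw_same_card)
      then show ?thesis using True by (simp add: fibtype_def gtype_def tcount_def)
    qed
  qed
qed

end

end

section \<open>Surjections as quotients followed by isomorphisms\<close>

context gset_pair
begin

lemma giso_cyc_bij:
  assumes \<phi>: "\<phi> \<in> giso"
  shows "bij_betw ((`) \<phi>) (cyc t s X) (cyc t' s' Y)"
proof -
  have h: "\<phi> \<in> ghom X t s Y t' s'" and b: "bij_betw \<phi> X Y" using \<phi> by (auto simp: giso_def)
  have "inj_on ((`) \<phi>) (cyc t s X)"
    by (rule inj_onI) (use b A.cyc_subX in \<open>metis bij_betw_def inj_on_image_eq_iff\<close>)
  moreover have "(`) \<phi> ` cyc t s X = cyc t' s' Y"
  proof
    show "(`) \<phi> ` cyc t s X \<subseteq> cyc t' s' Y" using hom_image_cyc[OF h] by auto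
    show "cyc t' s' Y \<subseteq> (`) \<phi> ` cyc t s X"
    proof
      fix c assume "c \<in> cyc t' s' Y"
      then obtain y where y: "y \<in> Y" "c = orb t' s' y" unfolding cyc_def by blast
      then obtain x where x: "x \<in> X" "\<phi> x = y" using b by (auto simp: bij_betw_def)
      have "\<phi> ` orb t s x = c" using hom_image[OF h A.orb_cyc[OF x(1)] A.orb_self] x y by simp
      then show "c \<in> (`) \<phi> ` cyc t s X" using A.orb_cyc[OF x(1)] by blast
    qed
  qed
  ultimately show ?thesis by (simp add: bij_betw_def)
qed

lemma giso_clen:
  assumes "\<phi> \<in> giso" "C \<in> cyc t s X" shows "clen r (\<phi> ` C) = clen r C"
  unfolding clen_def
  by (subst card_image) (use assms A.cyc_subX in \<open>auto simp: giso_def bij_betw_def intro: inj_on_subset\<close>)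

text \<open>Fibres are indexed by points of \<open>Y\<close>, so they are all nonempty exactly for
  surjective maps, the case in which this is a partition into nonempty blocks.\<close>

definition gker :: "('a \<Rightarrow> 'b) \<Rightarrow> 'a set set" where
  "gker \<phi> = (\<lambda>y. {x \<in> X. \<phi> x = y}) ` Y"

lemma gker_gparts:
  assumes \<phi>: "\<phi> \<in> ghom X t s Y t' s'" and surj: "\<phi> ` X = Y"
  shows "gker \<phi> \<in> gparts r X t s"
proof -
  have fib: "f ` {x \<in> X. \<phi> x = y} = {x \<in> X. \<phi> x = f' y}"
    if y: "y \<in> Y" and f: "bij_betw f X X" "bij_betw f' Y Y" "\<And>x. x \<in> X \<Longrightarrow> \<phi> (f x) = f' (\<phi> x)" for y f f'
  proof
    show "f ` {x \<in> X. \<phi> x = y} \<subseteq> {x \<in> X. \<phi> x = f' y}" using f by (auto simp: bij_betw_def)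
    show "{x \<in> X. \<phi> x = f' y} \<subseteq> f ` {x \<in> X. \<phi> x = y}"
    proof
      fix x assume x: "x \<in> {x \<in> X. \<phi> x = f' y}"
      then have "x \<in> X" by blast
      then have "x \<in> f ` X" unfolding bij_betw_imp_surj_on[OF f(1)] .
      then obtain z where z: "z \<in> X" "f z = x" by (metis imageE)
      have "f' (\<phi> z) = f' y" using f(3)[OF z(1)] z x by simp
      moreover have "\<phi> z \<in> Y" using surj z(1) by blast
      ultimately have "\<phi> z = y" using inj_onD[OF bij_betw_imp_inj_on[OF f(2)]] y by blast
      then show "x \<in> f ` {x \<in> X. \<phi> x = y}" using z by blast
    qed
  qed
  have ht: "\<phi> (t x) = t' (\<phi> x)" and hs: "\<phi> (s x) = s' (\<phi> x)" if "x \<in> X" for x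
    using \<phi> that by (auto simp: ghom_def)
  have fne: "\<exists>x\<in>X. \<phi> x = y" if "y \<in> Y" for y using surj that by blast
  show ?thesis
    unfolding gparts_def
  proof (rule CollectI, intro conjI ballI impI allI)
    show "\<Union> (gker \<phi>) = X" unfolding gker_def using surj by auto
    fix J assume "J \<in> gker \<phi>"
    then obtain y where y: "y \<in> Y" "J = {x \<in> X. \<phi> x = y}" unfolding gker_def by blast
    show "J \<noteq> {}" using fne y by blast
    have "t ` J = {x \<in> X. \<phi> x = t' y}" unfolding y(2) by (rule fib[OF y(1) A.tbij B.tbij]) (rule ht)
    then show "t ` J \<in> gker \<phi>" unfolding gker_def using B.tX[OF y(1)] by (intro image_eqI[of _ _ "t' y"])
    have "s ` J = {x \<in> X. \<phi> x = s' y}" unfolding y(2) by (rule fib[OF y(1) A.sbij B.sbij]) (rule hs)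
    then show "s ` J \<in> gker \<phi>" unfolding gker_def using B.sX[OF y(1)] by (intro image_eqI[of _ _ "s' y"])
    { fix J' assume "J' \<in> gker \<phi>" "J \<noteq> J'" then show "J \<inter> J' = {}" unfolding gker_def y(2) by blast }
    fix k assume k: "0 < k \<and> k < r"
    show "(t ^^ k) ` J \<noteq> J"
    proof
      assume eq: "(t ^^ k) ` J = J"
      obtain x where x: "x \<in> X" "\<phi> x = y" using fne y by blast
      then have "(t ^^ k) x \<in> J" using eq y by blast
      then have "(t' ^^ k) y = y" using hom_pow[OF \<phi> x(1), of k 0] x y by simp
      then show False using B.free[OF y(1)] k by blast
    qed
  qed
qed

lemma gker_blk:
  assumes \<phi>: "\<phi> \<in> ghom X t s Y t' s'" and surj: "\<phi> ` X = Y" and x: "x \<in> X"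
  shows "blk (gker \<phi>) x = {z \<in> X. \<phi> z = \<phi> x}"
  by (rule A.blk_eq[OF gker_gparts[OF \<phi> surj]]) (use hom_in[OF \<phi> x] x in \<open>auto simp: gker_def\<close>)

text \<open>The value does not depend on the chosen point, because a block is a fibre of the
  map.\<close>

definition gfac :: "('a \<Rightarrow> 'b) \<Rightarrow> 'a set \<Rightarrow> 'b" where
  "gfac \<phi> = (\<lambda>J\<in>gker \<phi>. \<phi> (SOME x. x \<in> J))"

lemma gfac_fib:
  assumes "\<phi> \<in> ghom X t s Y t' s'" and surj: "\<phi> ` X = Y" and y: "y \<in> Y"
  shows "gfac \<phi> {x \<in> X. \<phi> x = y} = y"
proof -
  obtain x where x: "x \<in> X" "\<phi> x = y" using surj y by blast
  then have "x \<in> {x \<in> X. \<phi> x = y}" by (intro CollectI conjI)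
  then have "(SOME z. z \<in> {x \<in> X. \<phi> x = y}) \<in> {x \<in> X. \<phi> x = y}" by (rule someI)
  then show ?thesis using y unfolding gfac_def gker_def by auto
qed

lemma gfac_giso:
  assumes \<phi>: "\<phi> \<in> ghom X t s Y t' s'" and surj: "\<phi> ` X = Y"
  shows "gfac \<phi> \<in> gset_pair.giso (gker \<phi>) ((`) t) ((`) s) Y t' s'"
proof -
  note kp = gker_gparts[OF \<phi> surj]
  interpret P: gset r "gker \<phi>" "(`) t" "(`) s" by (rule A.gset_gpart[OF kp])
  interpret Q: gset_pair r "gker \<phi>" "(`) t" "(`) s" Y t' s' ..
  have fx: "gfac \<phi> (blk (gker \<phi>) x) = \<phi> x" if "x \<in> X" for x
    unfolding gker_blk[OF \<phi> surj that] by (rule gfac_fib[OF \<phi> surj hom_in[OF \<phi> that]])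
  have ex: "\<exists>x\<in>X. J = blk (gker \<phi>) x" if "J \<in> gker \<phi>" for J
    using A.blk_eq[OF kp that] A.block_ne[OF kp that] A.block_sub[OF kp that] by blast
  have q: "blk (gker \<phi>) (t x) = t ` blk (gker \<phi>) x" "blk (gker \<phi>) (s x) = s ` blk (gker \<phi>) x" if "x \<in> X" for x
    using A.quo_hom[OF kp] that unfolding ghom_def by auto
  show ?thesis
    unfolding Q.giso_def ghom_def
  proof (rule CollectI, intro conjI CollectI ballI)
    show "gfac \<phi> \<in> gker \<phi> \<rightarrow>\<^sub>E Y"
    proof
      fix J assume "J \<in> gker \<phi>"
      then show "gfac \<phi> J \<in> Y" using ex fx hom_in[OF \<phi>] by metis
    qed (simp add: gfac_def)
    fix J assume "J \<in> gker \<phi>"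
    then obtain x where x: "x \<in> X" "J = blk (gker \<phi>) x" using ex by blast
    show "gfac \<phi> (t ` J) = t' (gfac \<phi> J)"
      unfolding x(2) q(1)[OF x(1), symmetric] fx[OF x(1)] fx[OF A.tX[OF x(1)]]
      using \<phi> x(1) by (simp add: ghom_def)
    show "gfac \<phi> (s ` J) = s' (gfac \<phi> J)"
      unfolding x(2) q(2)[OF x(1), symmetric] fx[OF x(1)] fx[OF A.sX[OF x(1)]]
      using \<phi> x(1) by (simp add: ghom_def)
  next
    show "bij_betw (gfac \<phi>) (gker \<phi>) Y"
    proof (rule bij_betwI[of _ _ _ "\<lambda>y. {x \<in> X. \<phi> x = y}"])
      show "gfac \<phi> \<in> gker \<phi> \<rightarrow> Y" using ex fx hom_in[OF \<phi>] by (metis Pi_I)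
      show "(\<lambda>y. {x \<in> X. \<phi> x = y}) \<in> Y \<rightarrow> gker \<phi>" unfolding gker_def by blast
      show "gfac \<phi> {x \<in> X. \<phi> x = y} = y" if "y \<in> Y" for y by (rule gfac_fib[OF \<phi> surj that])
      fix J assume "J \<in> gker \<phi>"
      then obtain y where "y \<in> Y" "J = {x \<in> X. \<phi> x = y}" unfolding gker_def by blast
      then show "{x \<in> X. \<phi> x = gfac \<phi> J} = J" by (simp only: gfac_fib[OF \<phi> surj])
    qed
  qed
qed

definition part_weight :: "(((nat \<times> nat) \<Rightarrow> nat) \<Rightarrow> complex) \<Rightarrow> 'a set set \<Rightarrow> complex" where
  "part_weight v \<pi> = (\<Prod>c\<in>cyc ((`) t) ((`) s) \<pi>. v (fibtype r (\<lambda>C. (\<lambda>x\<in>X. blk \<pi> x) ` C) (cyc t s X) c))"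

text \<open>A surjection is a quotient by a stable partition followed by an isomorphism, in exactly
  one way. A partition of the type of \<open>Y\<close> thus occurs \<open>zcent\<close> many times
  and any other never, while the weight depends on the partition alone.\<close>

theorem gparts_sum:
  assumes g: "\<And>l. valid_mon 1 l \<Longrightarrow> cf g l = v l / zcent 1 l" and v0: "v (\<lambda>_. 0) = 0"
  shows "zcent r (gtype r Y t' s') *
      (\<Sum>\<pi>\<in>{\<pi> \<in> gparts r X t s. gtype r \<pi> ((`) t) ((`) s) = gtype r Y t' s'}. part_weight v \<pi>)
    = zcent r (gtype r X t s) * cf (\<Prod>c\<in>cyc t' s' Y. psub r (ctype r t' s' c) g) (gtype r X t s)"
proof -
  let ?W = "\<lambda>\<phi>. \<Prod>c\<in>cyc t' s' Y. v (fibtype r (\<lambda>C. \<phi> ` C) (cyc t s X) c)"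
  let ?H = "ghom X t s Y t' s'"
  let ?I = "\<lambda>\<pi>. gset_pair.giso \<pi> ((`) t) ((`) s) Y t' s'"
  let ?m = "gtype r Y t' s'"
  have pair: "gset_pair r \<pi> ((`) t) ((`) s) Y t' s'" if "\<pi> \<in> gparts r X t s" for \<pi>
    by (intro gset_pair.intro A.gset_gpart[OF that] B.gset_axioms)
  have "zcent r (gtype r X t s) * cf (\<Prod>c\<in>cyc t' s' Y. psub r (ctype r t' s' c) g) (gtype r X t s)
    = (\<Sum>\<phi>\<in>?H. ?W \<phi>)" by (rule ghom_sum[OF g, symmetric])
  also have "\<dots> = (\<Sum>\<phi>\<in>{\<phi> \<in> ?H. \<phi> ` X = Y}. ?W \<phi>)"
  \<comment> \<open>A point outside the image lies in an orbit with empty fibre, whose weight is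
    \<open>v\<close> at the zero type.\<close>
  proof (rule sum.mono_neutral_right[OF finite_ghom])
    show "\<forall>\<phi>\<in>?H - {\<phi> \<in> ?H. \<phi> ` X = Y}. ?W \<phi> = 0"
    proof
      fix \<phi> assume \<phi>: "\<phi> \<in> ?H - {\<phi> \<in> ?H. \<phi> ` X = Y}"
      then obtain y where y: "y \<in> Y" "y \<notin> \<phi> ` X" using hom_in[of \<phi>] by blast
      have "{C \<in> cyc t s X. \<phi> ` C = orb t' s' y \<and> clen r C = clen r (orb t' s' y) * j} = {}" for j
        using y(2) B.orb_self[of y] A.cyc_subX by blast
      then have "fibtype r (\<lambda>C. \<phi> ` C) (cyc t s X) (orb t' s' y) = (\<lambda>_. 0)"
        unfolding fibtype_def by (simp only: card.empty if_cancel)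
      then show "?W \<phi> = 0"
        using B.orb_cyc[OF y(1)] B.finite_cyc v0
        by (intro prod_zero bexI[of _ "orb t' s' y"]) simp_all
    qed
  qed auto
  also have "\<dots> = (\<Sum>(\<pi>, f)\<in>Sigma (gparts r X t s) ?I. part_weight v \<pi>)"
  proof (rule sum.reindex_bij_witness[of _ "\<lambda>(\<pi>, f). \<lambda>x\<in>X. f (blk \<pi> x)" "\<lambda>\<phi>. (gker \<phi>, gfac \<phi>)"])
    fix \<phi> assume \<phi>: "\<phi> \<in> {\<phi> \<in> ?H. \<phi> ` X = Y}"
    then have h: "\<phi> \<in> ?H" "\<phi> ` X = Y" by auto
    have fx: "gfac \<phi> (blk (gker \<phi>) x) = \<phi> x" if "x \<in> X" for x
      unfolding gker_blk[OF h that] by (rule gfac_fib[OF h hom_in[OF h(1) that]])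
    have pe: "\<phi> \<in> X \<rightarrow>\<^sub>E Y" using h(1) by (simp add: ghom_def)
    show "(case (gker \<phi>, gfac \<phi>) of (\<pi>, f) \<Rightarrow> \<lambda>x\<in>X. f (blk \<pi> x)) = \<phi>"
    proof
      fix x show "(case (gker \<phi>, gfac \<phi>) of (\<pi>, f) \<Rightarrow> \<lambda>x\<in>X. f (blk \<pi> x)) x = \<phi> x"
        using fx[of x] PiE_arb[OF pe, of x] by (cases "x \<in> X") (simp_all only: prod.case restrict_apply if_True if_False not_False_eq_True simp_thms)
    qed
    show "(gker \<phi>, gfac \<phi>) \<in> Sigma (gparts r X t s) ?I"
      using gker_gparts[OF h] gfac_giso[OF h] by blast
    note kp = gker_gparts[OF h]
    interpret Q: gset_pair r "gker \<phi>" "(`) t" "(`) s" Y t' s' by (rule pair[OF kp])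
    let ?q = "\<lambda>x\<in>X. blk (gker \<phi>) x" and ?f = "gfac \<phi>"
    have fi: "?f \<in> Q.giso" by (rule gfac_giso[OF h])
    \<comment> \<open>The weight is moved from the orbits of \<open>Y\<close> to those of the
      quotient along \<open>gfac \<phi>\<close>, which preserves lengths.\<close>
    have "?W \<phi> = (\<Prod>c\<in>cyc ((`) t) ((`) s) (gker \<phi>). v (fibtype r (\<lambda>C. \<phi> ` C) (cyc t s X) (?f ` c)))"
      by (rule prod.reindex_bij_betw[OF Q.giso_cyc_bij[OF fi], symmetric])
    also have "\<dots> = part_weight v (gker \<phi>)"
      unfolding part_weight_def
    proof (rule prod.cong[OF refl])
      fix c assume c: "c \<in> cyc ((`) t) ((`) s) (gker \<phi>)"
      interpret R: gset_pair r X t s "gker \<phi>" "(`) t" "(`) s" ..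
      have "\<phi> ` C = ?f ` c \<longleftrightarrow> ?q ` C = c" if C: "C \<in> cyc t s X" for C
      proof -
        have "\<phi> ` C = ?f ` ?q ` C" unfolding image_image
          by (rule image_cong[OF refl]) (use A.cyc_subX[OF C] fx in auto)
        moreover have "?f ` ?q ` C = ?f ` c \<longleftrightarrow> ?q ` C = c"
          using Q.giso_cyc_bij[OF fi] R.hom_image_cyc[OF A.quo_hom[OF kp] C] c
          by (auto simp: bij_betw_def inj_on_def)
        ultimately show ?thesis by simp
      qed
      then have sets: "{C \<in> cyc t s X. \<phi> ` C = ?f ` c \<and> clen r C = clen r (?f ` c) * j}
        = {C \<in> cyc t s X. ?q ` C = c \<and> clen r C = clen r c * j}" for j
        unfolding Q.giso_clen[OF fi c] by blast
      show "v (fibtype r (\<lambda>C. \<phi> ` C) (cyc t s X) (?f ` c)) = v (fibtype r (\<lambda>C. ?q ` C) (cyc t s X) c)"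
        unfolding fibtype_def sets ..
    qed
    finally show "(case (gker \<phi>, gfac \<phi>) of (\<pi>, f) \<Rightarrow> part_weight v \<pi>) = ?W \<phi>" by simp
  next
    fix p assume "p \<in> Sigma (gparts r X t s) ?I"
    then obtain \<pi> f where p: "p = (\<pi>, f)" and \<pi>: "\<pi> \<in> gparts r X t s" and f: "f \<in> ?I \<pi>" by blast
    interpret Q: gset_pair r \<pi> "(`) t" "(`) s" Y t' s' by (rule pair[OF \<pi>])
    have fh: "f \<in> ghom \<pi> ((`) t) ((`) s) Y t' s'" and fb: "bij_betw f \<pi> Y" using f by (auto simp: Q.giso_def)
    let ?\<phi> = "\<lambda>x\<in>X. f (blk \<pi> x)"
    have q: "blk \<pi> (t x) = t ` blk \<pi> x" "blk \<pi> (s x) = s ` blk \<pi> x" if "x \<in> X" for x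
      using A.quo_hom[OF \<pi>] that unfolding ghom_def by auto
    have h: "?\<phi> \<in> ?H"
      unfolding ghom_def
      using A.blk_in[OF \<pi>] Q.hom_in[OF fh] q fh by (auto simp: ghom_def)
    have ex: "\<exists>x\<in>X. J = blk \<pi> x" if "J \<in> \<pi>" for J
      using A.blk_eq[OF \<pi> that] A.block_ne[OF \<pi> that] A.block_sub[OF \<pi> that] by blast
    have surj: "?\<phi> ` X = Y"
    proof
      show "?\<phi> ` X \<subseteq> Y" using hom_in[OF h] by blast
      show "Y \<subseteq> ?\<phi> ` X"
      proof
        fix y assume "y \<in> Y"
        then obtain J where J: "J \<in> \<pi>" "f J = y" using fb by (auto simp: bij_betw_def)
        obtain x where "x \<in> X" "J = blk \<pi> x" using ex[OF J(1)] by blast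
        then show "y \<in> ?\<phi> ` X" using J by (intro image_eqI[of _ _ x]) simp_all
      qed
    qed
    show "(case p of (\<pi>, f) \<Rightarrow> \<lambda>x\<in>X. f (blk \<pi> x)) \<in> {\<phi> \<in> ?H. \<phi> ` X = Y}"
      unfolding p prod.case using h surj by blast
    have fibJ: "{x \<in> X. ?\<phi> x = f J} = J" if J: "J \<in> \<pi>" for J
    proof
      show "{x \<in> X. ?\<phi> x = f J} \<subseteq> J"
      proof
        fix x assume "x \<in> {x \<in> X. ?\<phi> x = f J}"
        then have "x \<in> X" "f (blk \<pi> x) = f J" by auto
        then show "x \<in> J" using fb A.blk_in[OF \<pi>, of x] J unfolding bij_betw_def inj_on_def by blast
      qed
      show "J \<subseteq> {x \<in> X. ?\<phi> x = f J}" using A.blk_eq[OF \<pi> J] A.block_sub[OF \<pi> J] by auto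
    qed
    have k: "gker ?\<phi> = \<pi>"
    proof -
      have "gker ?\<phi> = (\<lambda>J. {x \<in> X. ?\<phi> x = f J}) ` \<pi>"
        unfolding gker_def using fb by (auto simp: bij_betw_def)
      also have "\<dots> = (\<lambda>J. J) ` \<pi>" by (rule image_cong[OF refl]) (rule fibJ)
      finally show ?thesis by simp
    qed
    have "gfac ?\<phi> = f"
    proof
      fix J show "gfac ?\<phi> J = f J"
      proof (cases "J \<in> \<pi>")
        case True
        then have "gfac ?\<phi> {x \<in> X. ?\<phi> x = f J} = f J"
          by (intro gfac_fib[OF h surj] Q.hom_in[OF fh])
        then show ?thesis by (simp only: fibJ[OF True])
      next
        case False
        then show ?thesis unfolding gfac_def k using fh by (auto simp: ghom_def PiE_def extensional_def)
      qed
    qed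
    then show "(gker (case p of (\<pi>, f) \<Rightarrow> \<lambda>x\<in>X. f (blk \<pi> x)), gfac (case p of (\<pi>, f) \<Rightarrow> \<lambda>x\<in>X. f (blk \<pi> x))) = p"
      unfolding p prod.case k by simp
  qed
  also have "\<dots> = (\<Sum>\<pi>\<in>gparts r X t s. \<Sum>f\<in>?I \<pi>. part_weight v \<pi>)"
  proof (rule sum.Sigma[symmetric])
    show "finite (gparts r X t s)" by (rule A.finite_gparts)
    show "\<forall>\<pi>\<in>gparts r X t s. finite (?I \<pi>)"
      using gset_pair.finite_ghom[OF pair] gset_pair.giso_def[OF pair] by auto
  qed
  also have "\<dots> = (\<Sum>\<pi>\<in>gparts r X t s. if gtype r \<pi> ((`) t) ((`) s) = ?m then zcent r ?m * part_weight v \<pi> else 0)"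
  proof (rule sum.cong[OF refl])
    fix \<pi> assume \<pi>: "\<pi> \<in> gparts r X t s"
    have "(\<Sum>f\<in>?I \<pi>. part_weight v \<pi>) = of_nat (card (?I \<pi>)) * part_weight v \<pi>" by simp
    also have "\<dots> = (if gtype r \<pi> ((`) t) ((`) s) = ?m then zcent r ?m * part_weight v \<pi> else 0)"
      unfolding gset_pair.card_giso[OF pair[OF \<pi>]] by simp
    finally show "(\<Sum>f\<in>?I \<pi>. part_weight v \<pi>) = (if gtype r \<pi> ((`) t) ((`) s) = ?m then zcent r ?m * part_weight v \<pi> else 0)" .
  qed
  also have "\<dots> = zcent r ?m * (\<Sum>\<pi>\<in>{\<pi> \<in> gparts r X t s. gtype r \<pi> ((`) t) ((`) s) = ?m}. part_weight v \<pi>)"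
    unfolding sum_distrib_left by (rule sum.inter_filter[OF A.finite_gparts, symmetric])
  finally show ?thesis ..
qed

end

section \<open>Plethysm\<close>

lemma mon_neq_0: "m \<noteq> (\<lambda>_. 0 :: nat) \<Longrightarrow> \<exists>q. m q \<noteq> 0"
  by (simp add: fun_eq_iff)

lemma valid_mon_finite: "valid_mon r m \<Longrightarrow> finite (msupp m)"
  by (simp add: valid_mon_def)

lemma valid_mon_fst: "valid_mon r m \<Longrightarrow> m q \<noteq> 0 \<Longrightarrow> 1 \<le> fst q \<and> snd q < r"
  unfolding valid_mon_def by (cases q) simp

lemma valid_mon_add: "valid_mon r m1 \<Longrightarrow> valid_mon r m2 \<Longrightarrow> valid_mon r (\<lambda>q. m1 q + m2 q)"
proof -
  assume v: "valid_mon r m1" "valid_mon r m2"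
  have "msupp (\<lambda>q. m1 q + m2 q) \<subseteq> msupp m1 \<union> msupp m2" by auto
  then have "finite (msupp (\<lambda>q. m1 q + m2 q))"
    by (rule finite_subset) (use v valid_mon_finite in blast)
  then show ?thesis using v unfolding valid_mon_def by auto
qed

lemma valid_mon_mdn: "valid_mon r m \<Longrightarrow> m1 \<in> mdn m \<Longrightarrow> valid_mon r m1"
proof -
  assume v: "valid_mon r m" and m1: "m1 \<in> mdn m"
  have "finite (msupp m1)" using msupp_mdn[OF m1] valid_mon_finite[OF v] by (rule finite_subset)
  moreover have "1 \<le> i \<and> k < r" if "m1 (i, k) \<noteq> 0" for i k
    using valid_mon_fst[OF v, of "(i, k)"] mdn_le[OF m1, of "(i, k)"] that by simp
  ultimately show ?thesis unfolding valid_mon_def by blast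
qed

lemma valid_mon_0: "valid_mon r (\<lambda>_. 0)"
  by (simp add: valid_mon_def)

lemma valid_mon_mdelta: "1 \<le> i \<Longrightarrow> k < r \<Longrightarrow> valid_mon r (mdelta (i, k))"
  by (auto simp: valid_mon_def)

lemma mdeg_superset: "finite Q \<Longrightarrow> msupp m \<subseteq> Q \<Longrightarrow> mdeg m = (\<Sum>q\<in>Q. fst q * m q)"
  unfolding mdeg_def by (rule sum.mono_neutral_left) auto

lemma mdeg_add:
  assumes "finite (msupp m1)" "finite (msupp m2)"
  shows "mdeg (\<lambda>q. m1 q + m2 q) = mdeg m1 + mdeg m2"
proof -
  let ?Q = "msupp m1 \<union> msupp m2"
  have f: "finite ?Q" using assms by blast
  have "mdeg (\<lambda>q. m1 q + m2 q) = (\<Sum>q\<in>?Q. fst q * (m1 q + m2 q))"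
    by (rule mdeg_superset[OF f]) auto
  also have "\<dots> = (\<Sum>q\<in>?Q. fst q * m1 q) + (\<Sum>q\<in>?Q. fst q * m2 q)"
    by (simp add: distrib_left sum.distrib)
  also have "\<dots> = mdeg m1 + mdeg m2"
    by (subst (1 2) mdeg_superset[OF f]) auto
  finally show ?thesis .
qed

lemma mdeg_ge: "finite (msupp m) \<Longrightarrow> fst q * m q \<le> mdeg m"
proof (cases "m q = 0")
  case False
  assume "finite (msupp m)"
  then show ?thesis unfolding mdeg_def
    by (intro member_le_sum[of q "msupp m" "\<lambda>q. fst q * m q"]) (use False in simp_all)
qed simp

lemma mdeg_mdelta: "mdeg (mdelta q) = fst q"
  unfolding mdeg_def msupp_mdelta by simp

section \<open>The degree filtration\<close>

definition monset :: "nat \<Rightarrow> nat \<Rightarrow> ((nat \<times> nat) \<Rightarrow> nat) set" where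
  "monset r N = {m. valid_mon r m \<and> mdeg m \<le> N}"

text \<open>Each index has \<open>r\<close> variables, and a variable occurring in a monomial of
  degree at most \<open>N\<close> has index and exponent at most \<open>N\<close>.\<close>

lemma finite_monset: "finite (monset r N)"
proof -
  let ?Q = "{1..N} \<times> {..<r}"
  have "monset r N \<subseteq> (\<lambda>f. \<lambda>q. if q \<in> ?Q then f q else 0) ` PiE ?Q (\<lambda>_. {..N})"
  proof
    fix m assume "m \<in> monset r N"
    then have v: "valid_mon r m" and d: "mdeg m \<le> N" by (auto simp: monset_def)
    have b: "fst q * m q \<le> N" for q using mdeg_ge[OF valid_mon_finite[OF v], of q] d by simp
    have z: "m q = 0" if "q \<notin> ?Q" for q
    proof (rule ccontr)
      assume nz: "m q \<noteq> 0"
      then have 1: "1 \<le> fst q" "snd q < r" using valid_mon_fst[OF v] by auto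
      have "fst q \<le> fst q * m q" using nz by simp
      then have "fst q \<le> N" using b[of q] by (rule order_trans)
      then show False using that 1 by (cases q) auto
    qed
    have le: "m q \<le> N" if "q \<in> ?Q" for q
    proof -
      have "m q \<le> fst q * m q" using that by (cases q) simp
      then show ?thesis using b[of q] by (rule order_trans)
    qed
    have "m = (\<lambda>q. if q \<in> ?Q then restrict m ?Q q else 0)" using z by (auto simp: fun_eq_iff)
    moreover have "restrict m ?Q \<in> PiE ?Q (\<lambda>_. {..N})" using le by (auto simp del: mem_Sigma_iff)
    ultimately show "m \<in> (\<lambda>f. \<lambda>q. if q \<in> ?Q then f q else 0) ` PiE ?Q (\<lambda>_. {..N})" by blast
  qed
  then show ?thesis by (rule finite_subset) (rule finite_imageI, rule finite_PiE, auto)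
qed

definition sord :: "nat \<Rightarrow> ser \<Rightarrow> bool" where
  "sord N f \<longleftrightarrow> (\<forall>m. cf f m \<noteq> 0 \<longrightarrow> N \<le> mdeg m)"

lemma sord_times: "sord a f \<Longrightarrow> sord b g \<Longrightarrow> sord (a + b) (f * g)"
  unfolding sord_def
proof (intro allI impI)
  fix m assume f: "\<forall>m. cf f m \<noteq> 0 \<longrightarrow> a \<le> mdeg m" and g: "\<forall>m. cf g m \<noteq> 0 \<longrightarrow> b \<le> mdeg m"
    and nz: "cf (f * g) m \<noteq> 0"
  have fin: "finite (msupp m)" using nz cf_infinite by blast
  have "\<exists>m1\<in>mdn m. cf f m1 * cf g (\<lambda>q. m q - m1 q) \<noteq> 0"
    using nz unfolding cf_times by (meson sum.neutral)
  then obtain m1 where m1: "m1 \<in> mdn m" "cf f m1 \<noteq> 0" "cf g (\<lambda>q. m q - m1 q) \<noteq> 0" by auto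
  have "mdeg m = mdeg (\<lambda>q. m1 q + (m q - m1 q))" using mdn_le[OF m1(1)] by simp
  also have "\<dots> = mdeg m1 + mdeg (\<lambda>q. m q - m1 q)"
    using cf_infinite[of m1 f] cf_infinite[of "\<lambda>q. m q - m1 q" g] m1(2,3) by (intro mdeg_add) blast+
  finally show "a + b \<le> mdeg m" using f g m1 by (simp add: add_mono)
qed

lemma sord_one: "sord 0 1"
  by (simp add: sord_def)

lemma sord_power: "sord a f \<Longrightarrow> sord (a * n) (f ^ n)"
  by (induction n) (simp_all add: sord_one sord_times)

lemma sord_prod: "finite Q \<Longrightarrow> (\<And>q. q \<in> Q \<Longrightarrow> sord (a q) (f q)) \<Longrightarrow> sord (\<Sum>q\<in>Q. a q) (\<Prod>q\<in>Q. f q)"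
  by (induction Q rule: finite_induct) (simp_all add: sord_one sord_times)

lemma cf_Ser_Aser: "f \<in> Aser r \<Longrightarrow> cf (Ser f) = f"
  by (rule cf_Ser) (auto simp: Aser_def valid_mon_def)

lemma Aplus_Aser: "g \<in> Aplus \<Longrightarrow> g \<in> Aser 1"
  by (simp add: Aplus_def)

lemma cf_Ser_Aplus: "g \<in> Aplus \<Longrightarrow> cf (Ser g) = g"
  using cf_Ser_Aser Aplus_Aser by blast

text \<open>Without constant term every monomial of \<open>g\<close> has degree at least 1, and the
  substitution multiplies degrees by \<open>fst q\<close>. For this reason each coefficient of a
  plethysm is a finite sum.\<close>

lemma sord_psub:
  assumes g: "g \<in> Aplus"
  shows "sord (fst q) (psub r q (Ser g))"
  unfolding sord_def
proof (intro allI impI)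
  fix m assume nz: "cf (psub r q (Ser g)) m \<noteq> 0"
  then have fin: "finite (msupp m)" using cf_infinite by blast
  let ?l = "ppull r q m"
  have "g ?l \<noteq> 0" using nz by (simp add: cf_psub cf_Ser_Aplus[OF g] split: if_splits)
  then have l: "valid_mon 1 ?l" "?l \<noteq> (\<lambda>_. 0)" using g by (auto simp: Aplus_def Aser_def)
  then obtain p where p: "?l p \<noteq> 0" using mon_neq_0 by blast
  then have p1: "1 \<le> fst p" using valid_mon_fst[OF l(1)] by blast
  have mp: "m (fst q * fst p, (snd q * fst p) mod r) \<noteq> 0" using p by (simp add: ppull_def split: if_splits)
  have "fst q * 1 \<le> fst q * fst p" using p1 by (rule mult_le_mono2)
  also have "fst q * fst p * 1 \<le> fst q * fst p * m (fst q * fst p, (snd q * fst p) mod r)"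
    using mp by (intro mult_le_mono2) simp
  also have "\<dots> \<le> mdeg m" using mdeg_ge[OF fin, of "(fst q * fst p, (snd q * fst p) mod r)"] by simp
  finally show "fst q \<le> mdeg m" by simp
qed

section \<open>The explicit plethysm\<close>

definition pmon :: "nat \<Rightarrow> ser \<Rightarrow> ((nat \<times> nat) \<Rightarrow> nat) \<Rightarrow> ser" where
  "pmon r g m = (\<Prod>q\<in>msupp m. psub r q g ^ m q)"

lemma pmon_superset: "finite Q \<Longrightarrow> msupp m \<subseteq> Q \<Longrightarrow> pmon r g m = (\<Prod>q\<in>Q. psub r q g ^ m q)"
  unfolding pmon_def by (rule prod.mono_neutral_left) auto

lemma pmon_add:
  assumes "finite (msupp m1)" "finite (msupp m2)"
  shows "pmon r g (\<lambda>q. m1 q + m2 q) = pmon r g m1 * pmon r g m2"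
proof -
  let ?Q = "msupp m1 \<union> msupp m2"
  have f: "finite ?Q" using assms by blast
  have "pmon r g (\<lambda>q. m1 q + m2 q) = (\<Prod>q\<in>?Q. psub r q g ^ (m1 q + m2 q))"
    by (rule pmon_superset[OF f]) auto
  also have "\<dots> = (\<Prod>q\<in>?Q. psub r q g ^ m1 q) * (\<Prod>q\<in>?Q. psub r q g ^ m2 q)"
    by (simp add: power_add prod.distrib)
  also have "\<dots> = pmon r g m1 * pmon r g m2"
    by (subst (1 2) pmon_superset[OF f]) auto
  finally show ?thesis .
qed

lemma pmon_0: "pmon r g (\<lambda>_. 0) = 1"
  by (simp add: pmon_def)

lemma pmon_mdelta: "pmon r g (mdelta q) = psub r q g"
  unfolding pmon_def msupp_mdelta by simp

lemma sord_pmon: "g \<in> Aplus \<Longrightarrow> finite (msupp m) \<Longrightarrow> sord (mdeg m) (pmon r (Ser g) m)"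
  unfolding mdeg_def pmon_def by (rule sord_prod) (auto intro: sord_power sord_psub)

text \<open>Substitution coefficient by coefficient: monomials of degree above that of
  \<open>M\<close> contribute nothing at \<open>M\<close>. The value 0 outside the domain follows
  the last clause of \<open>pleth_props\<close>.\<close>

definition plet :: "nat \<Rightarrow> fps \<Rightarrow> fps \<Rightarrow> fps" where
  "plet r f g = (if f \<in> Aser r \<and> g \<in> Aplus
     then (\<lambda>M. \<Sum>m\<in>monset r (mdeg M). f m * cf (pmon r (Ser g) m) M) else (\<lambda>_. 0))"

text \<open>By degree, the range of summation may be enlarged. Products need one range for several
  coefficients at once.\<close>

lemma plet_eq:
  assumes f: "f \<in> Aser r" and g: "g \<in> Aplus" and D: "finite D" "monset r (mdeg M) \<subseteq> D" "\<And>m. m \<in> D \<Longrightarrow> valid_mon r m"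
  shows "plet r f g M = (\<Sum>m\<in>D. f m * cf (pmon r (Ser g) m) M)"
proof -
  have "plet r f g M = (\<Sum>m\<in>monset r (mdeg M). f m * cf (pmon r (Ser g) m) M)"
    using f g by (simp add: plet_def)
  also have "\<dots> = (\<Sum>m\<in>D. f m * cf (pmon r (Ser g) m) M)"
  proof (rule sum.mono_neutral_left[OF D(1,2)])
    show "\<forall>m\<in>D - monset r (mdeg M). f m * cf (pmon r (Ser g) m) M = 0"
    proof
      fix m assume m: "m \<in> D - monset r (mdeg M)"
      then have v: "valid_mon r m" and "\<not> mdeg m \<le> mdeg M" using D(3) by (auto simp: monset_def)
      then have "cf (pmon r (Ser g) m) M = 0"
        using sord_pmon[OF g valid_mon_finite[OF v], of r] unfolding sord_def by blast
      then show "f m * cf (pmon r (Ser g) m) M = 0" by simp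
    qed
  qed
  finally show ?thesis .
qed

lemma monset_mono: "a \<le> b \<Longrightarrow> monset r a \<subseteq> monset r b"
  by (auto simp: monset_def)

lemma Aser_fadd: "f \<in> Aser r \<Longrightarrow> g \<in> Aser r \<Longrightarrow> fadd f g \<in> Aser r"
  unfolding Aser_def fadd_def by (auto) (metis add.right_neutral)

lemma Aser_fscale: "f \<in> Aser r \<Longrightarrow> fscale c f \<in> Aser r"
  by (auto simp: Aser_def fscale_def)

lemma Aser_fmul: "f \<in> Aser r \<Longrightarrow> g \<in> Aser r \<Longrightarrow> fmul f g \<in> Aser r"
  unfolding Aser_def
proof (rule CollectI, intro allI impI)
  fix m assume f: "f \<in> {f. \<forall>m. f m \<noteq> 0 \<longrightarrow> valid_mon r m}" and g: "g \<in> {f. \<forall>m. f m \<noteq> 0 \<longrightarrow> valid_mon r m}"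
    and "fmul f g m \<noteq> 0"
  then have "\<exists>m1\<in>mdn m. f m1 * g (\<lambda>q. m q - m1 q) \<noteq> 0" unfolding fmul_mdn by (meson sum.neutral)
  then obtain m1 where m1: "m1 \<in> mdn m" "f m1 \<noteq> 0" "g (\<lambda>q. m q - m1 q) \<noteq> 0" by auto
  then have "valid_mon r (\<lambda>q. m1 q + (m q - m1 q))" using f g by (intro valid_mon_add) auto
  then show "valid_mon r m" using mdn_le[OF m1(1)] by simp
qed

lemma Aser_fone: "fone \<in> Aser r"
  by (auto simp: Aser_def fone_def valid_mon_0)

lemma Aser_pvar: "1 \<le> i \<Longrightarrow> k < r \<Longrightarrow> pvar i k \<in> Aser r"
  by (auto simp: Aser_def pvar_def valid_mon_mdelta)

lemma Aplus_fadd: "f \<in> Aplus \<Longrightarrow> g \<in> Aplus \<Longrightarrow> fadd f g \<in> Aplus"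
  using Aser_fadd by (auto simp: Aplus_def fadd_def)

lemma Aplus_fscale: "f \<in> Aplus \<Longrightarrow> fscale c f \<in> Aplus"
  using Aser_fscale by (auto simp: Aplus_def fscale_def)

lemma Aplus_fmul: "f \<in> Aplus \<Longrightarrow> g \<in> Aplus \<Longrightarrow> fmul f g \<in> Aplus"
proof -
  assume f: "f \<in> Aplus" and g: "g \<in> Aplus"
  have "mdn (\<lambda>_. 0) = {\<lambda>_. 0}" by (auto simp: mdn_def)
  then have "fmul f g (\<lambda>_. 0) = 0" using f by (simp add: fmul_mdn Aplus_def)
  then show ?thesis using Aser_fmul[of f 1 g] f g by (simp add: Aplus_def)
qed

lemma Aplus_pvar: "1 \<le> i \<Longrightarrow> pvar i 0 \<in> Aplus"
  using Aser_pvar[of i 0 1] by (auto simp: Aplus_def pvar_def fun_eq_iff)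

lemma Ser_fmul: "f \<in> Aser r \<Longrightarrow> g \<in> Aser r \<Longrightarrow> Ser (fmul f g) = Ser f * Ser g"
  by (metis Aser_fmul cf_Ser_Aser cf_inverse times_ser.rep_eq)

lemma Ser_pvar: "1 \<le> i \<Longrightarrow> k < r \<Longrightarrow> Ser (pvar i k) = pv (i, k)"
proof -
  assume "1 \<le> i" "k < r"
  then have "cf (Ser (pvar i k)) = pvar i k" by (intro cf_Ser_Aser[of _ r] Aser_pvar)
  then have "cf (Ser (pvar i k)) = cf (pv (i, k))" by (simp add: pv.rep_eq pvar_def fun_eq_iff)
  then show ?thesis by (simp add: cf_inject)
qed

text \<open>At \<open>M\<close> both factors are expanded over one range \<open>?D\<close>. Pairs of
  monomials with product outside \<open>?D\<close> have too high a degree to contribute, and the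
  remaining pairs are the factorisations of the monomials in \<open>?D\<close>.\<close>

lemma plet_fmul:
  assumes f1: "f1 \<in> Aser r" and f2: "f2 \<in> Aser r" and g: "g \<in> Aplus"
  shows "plet r (fmul f1 f2) g = fmul (plet r f1 g) (plet r f2 g)"
proof
  fix M
  let ?\<Phi> = "pmon r (Ser g)"
  show "plet r (fmul f1 f2) g M = fmul (plet r f1 g) (plet r f2 g) M"
  proof (cases "finite (msupp M)")
    case False
    have "plet r (fmul f1 f2) g M = 0" by (simp add: plet_def cf_infinite[OF False])
    then show ?thesis by (simp add: fmul_infinite[OF False])
  next
    case True
    let ?D = "monset r (mdeg M)"
    have finD: "finite ?D" by (rule finite_monset)
    have vD: "valid_mon r m" if "m \<in> ?D" for m using that by (simp add: monset_def)
    have finm: "finite (msupp m)" if "m \<in> ?D" for m using vD[OF that] by (rule valid_mon_finite)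
    have deg: "mdeg m1 \<le> mdeg m \<and> mdeg (\<lambda>q. m q - m1 q) \<le> mdeg m" if "finite (msupp m)" "m1 \<in> mdn m" for m m1
    proof -
      have "mdeg m = mdeg (\<lambda>q. m1 q + (m q - m1 q))" using mdn_le[OF that(2)] by simp
      also have "\<dots> = mdeg m1 + mdeg (\<lambda>q. m q - m1 q)"
        by (rule mdeg_add) (rule finite_subset[OF msupp_mdn that(1)], use that mdn_diff in blast)+
      finally show ?thesis by simp
    qed
    have "fmul (plet r f1 g) (plet r f2 g) M
      = (\<Sum>M1\<in>mdn M. (\<Sum>m1\<in>?D. f1 m1 * cf (?\<Phi> m1) M1) * (\<Sum>m2\<in>?D. f2 m2 * cf (?\<Phi> m2) (\<lambda>q. M q - M1 q)))"
      unfolding fmul_mdn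
    proof (rule sum.cong[OF refl])
      fix M1 assume M1: "M1 \<in> mdn M"
      have "plet r f1 g M1 = (\<Sum>m1\<in>?D. f1 m1 * cf (?\<Phi> m1) M1)"
        by (rule plet_eq[OF f1 g finD monset_mono vD]) (use deg[OF True M1] in auto)
      moreover have "plet r f2 g (\<lambda>q. M q - M1 q) = (\<Sum>m2\<in>?D. f2 m2 * cf (?\<Phi> m2) (\<lambda>q. M q - M1 q))"
        by (rule plet_eq[OF f2 g finD monset_mono vD]) (use deg[OF True M1] in auto)
      ultimately show "plet r f1 g M1 * plet r f2 g (\<lambda>q. M q - M1 q) = (\<Sum>m1\<in>?D. f1 m1 * cf (?\<Phi> m1) M1) * (\<Sum>m2\<in>?D. f2 m2 * cf (?\<Phi> m2) (\<lambda>q. M q - M1 q))"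
        by simp
    qed
    also have "\<dots> = (\<Sum>m1\<in>?D. \<Sum>m2\<in>?D. \<Sum>M1\<in>mdn M. f1 m1 * f2 m2 * (cf (?\<Phi> m1) M1 * cf (?\<Phi> m2) (\<lambda>q. M q - M1 q)))"
      unfolding sum_product
      by (subst sum.swap, rule sum.cong[OF refl], subst sum.swap) (simp add: ac_simps)
    also have "\<dots> = (\<Sum>m1\<in>?D. \<Sum>m2\<in>?D. f1 m1 * f2 m2 * cf (?\<Phi> (\<lambda>q. m1 q + m2 q)) M)"
      by (intro sum.cong refl, subst pmon_add[OF finm finm])
        (simp_all only: cf_times sum_distrib_left)
    also have "\<dots> = (\<Sum>(m1, m2)\<in>?D \<times> ?D. f1 m1 * f2 m2 * cf (?\<Phi> (\<lambda>q. m1 q + m2 q)) M)"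
      by (rule sum.cartesian_product)
    also have "\<dots> = (\<Sum>(m1, m2)\<in>{(m1, m2). m1 \<in> ?D \<and> m2 \<in> ?D \<and> (\<lambda>q. m1 q + m2 q) \<in> ?D}.
        f1 m1 * f2 m2 * cf (?\<Phi> (\<lambda>q. m1 q + m2 q)) M)"
    proof (rule sum.mono_neutral_right)
      show "finite (?D \<times> ?D)" using finD by simp
      show "\<forall>p\<in>?D \<times> ?D - {(m1, m2). m1 \<in> ?D \<and> m2 \<in> ?D \<and> (\<lambda>q. m1 q + m2 q) \<in> ?D}.
        (case p of (m1, m2) \<Rightarrow> f1 m1 * f2 m2 * cf (?\<Phi> (\<lambda>q. m1 q + m2 q)) M) = 0"
      proof
        fix p assume p: "p \<in> ?D \<times> ?D - {(m1, m2). m1 \<in> ?D \<and> m2 \<in> ?D \<and> (\<lambda>q. m1 q + m2 q) \<in> ?D}"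
        obtain m1 m2 where m: "p = (m1, m2)" "m1 \<in> ?D" "m2 \<in> ?D" "(\<lambda>q. m1 q + m2 q) \<notin> ?D" using p by blast
        have v: "valid_mon r (\<lambda>q. m1 q + m2 q)" using vD m by (intro valid_mon_add) auto
        then have "\<not> mdeg (\<lambda>q. m1 q + m2 q) \<le> mdeg M" using m(4) by (simp add: monset_def)
        then have "cf (?\<Phi> (\<lambda>q. m1 q + m2 q)) M = 0"
          using sord_pmon[OF g valid_mon_finite[OF v], of r] unfolding sord_def by blast
        then show "(case p of (m1, m2) \<Rightarrow> f1 m1 * f2 m2 * cf (?\<Phi> (\<lambda>q. m1 q + m2 q)) M) = 0" using m by simp
      qed
    qed auto
    also have "\<dots> = (\<Sum>(m, m1)\<in>Sigma ?D mdn. f1 m1 * f2 (\<lambda>q. m q - m1 q) * cf (?\<Phi> m) M)"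
    proof (rule sum.reindex_bij_witness[of _ "\<lambda>(m, m1). (m1, \<lambda>q. m q - m1 q)" "\<lambda>(m1, m2). (\<lambda>q. m1 q + m2 q, m1)"])
      fix p assume "p \<in> {(m1, m2). m1 \<in> ?D \<and> m2 \<in> ?D \<and> (\<lambda>q. m1 q + m2 q) \<in> ?D}"
      then obtain m1 m2 where m: "p = (m1, m2)" "(\<lambda>q. m1 q + m2 q) \<in> ?D" by blast
      show "(case case p of (m1, m2) \<Rightarrow> (\<lambda>q. m1 q + m2 q, m1) of (m, m1) \<Rightarrow> (m1, \<lambda>q. m q - m1 q)) = p"
        by (simp add: m)
      show "(case p of (m1, m2) \<Rightarrow> (\<lambda>q. m1 q + m2 q, m1)) \<in> Sigma ?D mdn"
        using m by (simp add: mdn_def)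
      show "(case case p of (m1, m2) \<Rightarrow> (\<lambda>q. m1 q + m2 q, m1) of (m, m1) \<Rightarrow> f1 m1 * f2 (\<lambda>q. m q - m1 q) * cf (?\<Phi> m) M)
        = (case p of (m1, m2) \<Rightarrow> f1 m1 * f2 m2 * cf (?\<Phi> (\<lambda>q. m1 q + m2 q)) M)"
        by (simp add: m)
    next
      fix p assume "p \<in> Sigma ?D mdn"
      then obtain m m1 where m: "p = (m, m1)" "m \<in> ?D" "m1 \<in> mdn m" by blast
      have eq: "(\<lambda>q. m1 q + (m q - m1 q)) = m" using mdn_le[OF m(3)] by simp
      show "(case case p of (m, m1) \<Rightarrow> (m1, \<lambda>q. m q - m1 q) of (m1, m2) \<Rightarrow> (\<lambda>q. m1 q + m2 q, m1)) = p"
        by (simp add: m eq)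
      have "m1 \<in> ?D" "(\<lambda>q. m q - m1 q) \<in> ?D"
        using deg[OF finm[OF m(2)] m(3)] valid_mon_mdn[OF vD[OF m(2)] m(3)] valid_mon_mdn[OF vD[OF m(2)] mdn_diff[of m m1]] m(2)
        by (auto simp: monset_def)
      then show "(case p of (m, m1) \<Rightarrow> (m1, \<lambda>q. m q - m1 q)) \<in> {(m1, m2). m1 \<in> ?D \<and> m2 \<in> ?D \<and> (\<lambda>q. m1 q + m2 q) \<in> ?D}"
        using m by (simp add: eq)
    qed
    also have "\<dots> = (\<Sum>m\<in>?D. \<Sum>m1\<in>mdn m. f1 m1 * f2 (\<lambda>q. m q - m1 q) * cf (?\<Phi> m) M)"
      by (rule sum.Sigma[symmetric]) (use finD finm in \<open>auto intro: finite_mdn\<close>)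
    also have "\<dots> = plet r (fmul f1 f2) g M"
      using Aser_fmul[OF f1 f2] g by (simp add: plet_def fmul_mdn sum_distrib_right)
    finally show ?thesis ..
  qed
qed

lemma plet_pvar:
  assumes "1 \<le> i" "k < r" "g \<in> Aplus"
  shows "plet r (pvar i k) g = cf (psub r (i, k) (Ser g))"
proof
  fix M
  \<comment> \<open>The variable may have larger degree than \<open>M\<close>; its term is then 0,
    but it must belong to the range to be picked out.\<close>
  let ?D = "insert (mdelta (i, k)) (monset r (mdeg M))"
  have "plet r (pvar i k) g M = (\<Sum>m\<in>?D. pvar i k m * cf (pmon r (Ser g) m) M)"
    by (rule plet_eq) (use assms Aser_pvar finite_monset valid_mon_mdelta in \<open>auto simp: monset_def\<close>)
  also have "\<dots> = (\<Sum>m\<in>?D. if m = mdelta (i, k) then cf (psub r (i, k) (Ser g)) M else 0)"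
    by (rule sum.cong) (auto simp: pvar_def pmon_mdelta)
  also have "\<dots> = cf (psub r (i, k) (Ser g)) M" using finite_monset by simp
  finally show "plet r (pvar i k) g M = cf (psub r (i, k) (Ser g)) M" .
qed

text \<open>The image of the substitution consists of the monomials in certain variables, hence is
  closed under divisors.\<close>

lemma ppush_ppull_mdn:
  assumes "1 \<le> fst q" and m: "m = ppush r q (ppull r q m)" and m1: "m1 \<in> mdn m"
  shows "m1 = ppush r q (ppull r q m1)"
proof
  fix p
  show "m1 p = ppush r q (ppull r q m1) p"
  proof (cases "fst q dvd fst p \<and> snd p = (snd q * (fst p div fst q)) mod r")
    case True
    then have "p = (fst q * (fst p div fst q), (snd q * (fst p div fst q)) mod r)" by (cases p) simp
    then show ?thesis using True by (simp add: ppush_def ppull_def)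
  next
    case False
    then have "m p = 0" by (subst m) (auto simp: ppush_def)
    then show ?thesis using mdn_le[OF m1, of p] False by (auto simp: ppush_def)
  qed
qed

text \<open>The image of the substitution is closed under products and divisors. So factorisations
  of a monomial in the image correspond to those of its preimage, and a monomial outside is not a
  product of two inside.\<close>

lemma psub_times:
  assumes q: "1 \<le> fst q"
  shows "psub r q (g1 * g2) = psub r q g1 * psub r q g2"
proof -
  have "cf (psub r q (g1 * g2)) M = cf (psub r q g1 * psub r q g2) M" for M
  proof (cases "M = ppush r q (ppull r q M)")
    case False
    have "cf (psub r q g1) m1 * cf (psub r q g2) (\<lambda>p. M p - m1 p) = 0" if m1: "m1 \<in> mdn M" for m1
    proof (rule ccontr)
      assume "\<not> ?thesis"
      then have a: "m1 = ppush r q (ppull r q m1)" and b: "(\<lambda>p. M p - m1 p) = ppush r q (ppull r q (\<lambda>p. M p - m1 p))"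
        by (auto simp: cf_psub split: if_splits)
      have "M p = ppush r q (ppull r q M) p" for p
      proof -
        have "M p = m1 p + (M p - m1 p)" using mdn_le[OF m1, of p] by simp
        also have "\<dots> = ppush r q (ppull r q m1) p + ppush r q (ppull r q (\<lambda>p. M p - m1 p)) p"
          by (rule arg_cong2[of _ _ _ _ "(+)", OF fun_cong[OF a] fun_cong[OF b]])
        also have "\<dots> = ppush r q (ppull r q M) p"
          using mdn_le[OF m1] by (simp add: ppush_def ppull_def)
        finally show ?thesis .
      qed
      then show False using False by blast
    qed
    then have "cf (psub r q g1 * psub r q g2) M = 0" unfolding cf_times by (intro sum.neutral ballI)
    then show ?thesis using False by (simp add: cf_psub)
  next
    case True
    let ?l = "ppull r q M"
    have "cf (psub r q g1 * psub r q g2) M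
      = (\<Sum>m1\<in>mdn M. cf g1 (ppull r q m1) * cf g2 (ppull r q (\<lambda>p. M p - m1 p)))"
      unfolding cf_times
    proof (rule sum.cong[OF refl])
      fix m1 assume m1: "m1 \<in> mdn M"
      show "cf (psub r q g1) m1 * cf (psub r q g2) (\<lambda>p. M p - m1 p) = cf g1 (ppull r q m1) * cf g2 (ppull r q (\<lambda>p. M p - m1 p))"
        unfolding cf_psub using ppush_ppull_mdn[OF q True m1] ppush_ppull_mdn[OF q True mdn_diff[of M m1]] by simp
    qed
    also have "\<dots> = (\<Sum>l1\<in>mdn ?l. cf g1 l1 * cf g2 (\<lambda>p. ?l p - l1 p))"
    proof (rule sum.reindex_bij_witness[of _ "ppush r q" "ppull r q"])
      fix m1 assume m1: "m1 \<in> mdn M"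
      show "ppush r q (ppull r q m1) = m1" using ppush_ppull_mdn[OF q True m1] ..
      show "ppull r q m1 \<in> mdn ?l" using mdn_le[OF m1] by (simp add: mdn_def ppull_def)
      have "(\<lambda>p. ?l p - ppull r q m1 p) = ppull r q (\<lambda>p. M p - m1 p)" by (auto simp: ppull_def)
      then show "cf g1 (ppull r q m1) * cf g2 (\<lambda>p. ?l p - ppull r q m1 p)
        = cf g1 (ppull r q m1) * cf g2 (ppull r q (\<lambda>p. M p - m1 p))" by simp
    next
      fix l1 assume l1: "l1 \<in> mdn ?l"
      show "ppull r q (ppush r q l1) = l1"
      proof (rule ppull_ppush[OF q])
        fix i k :: nat assume "k \<noteq> 0"
        then show "l1 (i, k) = 0" using mdn_le[OF l1, of "(i, k)"] by (simp add: ppull_def)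
      qed
      have "ppush r q l1 p \<le> M p" for p
        using mdn_le[OF l1, of "(fst p div fst q, 0)"] fun_cong[OF True, of p]
        by (simp add: ppush_def split: if_splits)
      then show "ppush r q l1 \<in> mdn M" by (simp add: mdn_def)
    qed
    also have "\<dots> = cf (psub r q (g1 * g2)) M" using True by (simp add: cf_psub cf_times)
    finally show ?thesis ..
  qed
  then show ?thesis by (metis cf_inverse ext)
qed

lemma fconvD: "fconv fs f \<Longrightarrow> eventually (\<lambda>n. fs n m = f m) sequentially"
  by (simp add: fconv_def)

lemma plet_props: "pleth_props r (plet r)"
  unfolding pleth_props_def
proof (intro conjI ballI allI impI)
  fix g assume g: "g \<in> Aplus"
  { fix f1 f2 assume f: "f1 \<in> Aser r" "f2 \<in> Aser r"
    show "plet r (fadd f1 f2) g = fadd (plet r f1 g) (plet r f2 g)"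
      using f g Aser_fadd[OF f] by (simp add: plet_def fun_eq_iff fadd_def[of "\<lambda>M. _ M"])
        (simp add: fadd_def distrib_right sum.distrib)
    show "plet r (fmul f1 f2) g = fmul (plet r f1 g) (plet r f2 g)" by (rule plet_fmul[OF f g]) }
  { fix c f assume f: "f \<in> Aser r"
    show "plet r (fscale c f) g = fscale c (plet r f g)"
      using f g Aser_fscale[OF f, of c] by (simp add: plet_def fscale_def sum_distrib_left mult.assoc) }
  show "plet r fone g = fone"
  proof
    fix M
    have "plet r fone g M = (\<Sum>m\<in>monset r (mdeg M). if m = (\<lambda>_. 0) then fone M else 0)"
      using g Aser_fone[of r] unfolding plet_def
      by (auto intro!: sum.cong simp: fone_def pmon_0 cf_one)
    also have "\<dots> = fone M"
      using finite_monset by (simp add: monset_def valid_mon_0 mdeg_def)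
    finally show "plet r fone g M = fone M" .
  qed
  { fix fs f assume a: "(\<forall>n. fs n \<in> Aser r) \<and> f \<in> Aser r \<and> fconv fs f"
    show "fconv (\<lambda>n. plet r (fs n) g) (plet r f g)"
      unfolding fconv_def
    proof
      fix M
      \<comment> \<open>Continuity: the coefficient at \<open>M\<close> involves finitely many
        coefficients of the series.\<close>
      have "eventually (\<lambda>n. \<forall>m\<in>monset r (mdeg M). fs n m = f m) sequentially"
        using a by (intro eventually_ball_finite finite_monset) (auto intro: fconvD)
      then show "eventually (\<lambda>n. plet r (fs n) g M = plet r f g M) sequentially"
        by (rule eventually_mono) (use a g in \<open>auto simp: plet_def intro!: sum.cong\<close>)
    qed }
next
  fix i k :: nat assume ik: "1 \<le> i \<and> k < r"
  then have i: "1 \<le> i" and k: "k < r" by auto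
  { fix g1 g2 assume g: "g1 \<in> Aplus" "g2 \<in> Aplus"
    show "plet r (pvar i k) (fadd g1 g2) = fadd (plet r (pvar i k) g1) (plet r (pvar i k) g2)"
      using g unfolding plet_pvar[OF i k g(1)] plet_pvar[OF i k g(2)] plet_pvar[OF i k Aplus_fadd[OF g]]
      by (auto simp: fun_eq_iff cf_psub fadd_def cf_Ser_Aplus Aplus_fadd[OF g, unfolded fadd_def])
    show "plet r (pvar i k) (fmul g1 g2) = fmul (plet r (pvar i k) g1) (plet r (pvar i k) g2)"
      unfolding plet_pvar[OF i k g(1)] plet_pvar[OF i k g(2)] plet_pvar[OF i k Aplus_fmul[OF g]]
        Ser_fmul[OF Aplus_Aser[OF g(1)] Aplus_Aser[OF g(2)]]
      using psub_times[of "(i, k)" r] i by (simp add: times_ser.rep_eq) }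
  { fix c g assume g: "g \<in> Aplus"
    show "plet r (pvar i k) (fscale c g) = fscale c (plet r (pvar i k) g)"
      unfolding plet_pvar[OF i k g] plet_pvar[OF i k Aplus_fscale[OF g]]
      unfolding fscale_def[of c "cf _"] cf_psub cf_Ser_Aplus[OF Aplus_fscale[OF g]] cf_Ser_Aplus[OF g]
      by (auto simp: fun_eq_iff cf_psub cf_Ser_Aplus[OF Aplus_fscale[OF g]] cf_Ser_Aplus[OF g]) (simp add: fscale_def) }
  { fix gs g assume a: "(\<forall>n. gs n \<in> Aplus) \<and> g \<in> Aplus \<and> fconv gs g"
    show "fconv (\<lambda>n. plet r (pvar i k) (gs n)) (plet r (pvar i k) g)"
      unfolding fconv_def
    proof
      fix M
      have e: "plet r (pvar i k) h M = (if M = ppush r (i, k) (ppull r (i, k) M) then h (ppull r (i, k) M) else 0)"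
        if "h \<in> Aplus" for h
        unfolding plet_pvar[OF i k that] cf_psub cf_Ser_Aplus[OF that] ..
      have "eventually (\<lambda>n. gs n (ppull r (i, k) M) = g (ppull r (i, k) M)) sequentially"
        using a by (auto intro: fconvD)
      then show "eventually (\<lambda>n. plet r (pvar i k) (gs n) M = plet r (pvar i k) g M) sequentially"
        by (rule eventually_mono) (use a e in simp)
    qed }
next
  fix i k j :: nat assume a: "1 \<le> i \<and> k < r \<and> 1 \<le> j"
  have "plet r (pvar i k) (pvar j 0) = cf (psub r (i, k) (pv (j, 0)))"
    using a plet_pvar[of i k r "pvar j 0"] Aplus_pvar[of j] Ser_pvar[of j 0 1] by simp
  also have "\<dots> = pvar (i * j) ((k * j) mod r)"
    using a psub_pv[of i k r j] by (simp add: pv.rep_eq pvar_def fun_eq_iff)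
  finally show "plet r (pvar i k) (pvar j 0) = pvar (i * j) ((k * j) mod r)" .
next
  fix f g assume "\<not> (f \<in> Aser r \<and> g \<in> Aplus)"
  then show "plet r f g = (\<lambda>_. 0)" unfolding plet_def by (rule if_not_P)
qed

section \<open>Uniqueness of plethysm\<close>

definition mono1 :: "((nat \<times> nat) \<Rightarrow> nat) \<Rightarrow> fps" where
  "mono1 m = (\<lambda>m'. if m' = m then 1 else 0)"

lemma pvar_mono1: "pvar i k = mono1 (mdelta (i, k))"
  by (simp add: pvar_def mono1_def)

lemma fone_mono1: "fone = mono1 (\<lambda>_. 0)"
  by (simp add: fone_def mono1_def)

lemma fmul_mono1:
  assumes "finite (msupp a)" "finite (msupp b)"
  shows "fmul (mono1 a) (mono1 b) = mono1 (\<lambda>q. a q + b q)"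
proof
  fix M
  show "fmul (mono1 a) (mono1 b) M = mono1 (\<lambda>q. a q + b q) M"
  proof (cases "finite (msupp M)")
    case False
    have "finite (msupp (\<lambda>q. a q + b q))"
      by (rule finite_subset[of _ "msupp a \<union> msupp b"]) (use assms in auto)
    then have "M \<noteq> (\<lambda>q. a q + b q)" using False by metis
    then show ?thesis by (simp add: fmul_infinite[OF False] mono1_def)
  next
    case True
    have "fmul (mono1 a) (mono1 b) M = (\<Sum>m1\<in>mdn M. if m1 = a then mono1 b (\<lambda>q. M q - a q) else 0)"
      unfolding fmul_mdn by (rule sum.cong) (auto simp: mono1_def)
    also have "\<dots> = (if a \<in> mdn M then mono1 b (\<lambda>q. M q - a q) else 0)"
      using finite_mdn[OF True] by simp
    also have "\<dots> = mono1 (\<lambda>q. a q + b q) M"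
    proof -
      have "(a \<in> mdn M \<and> (\<lambda>q. M q - a q) = b) \<longleftrightarrow> M = (\<lambda>q. a q + b q)"
      proof
        assume h: "a \<in> mdn M \<and> (\<lambda>q. M q - a q) = b"
        show "M = (\<lambda>q. a q + b q)"
        proof
          fix q show "M q = a q + b q" using mdn_le[of a M q] fun_cong[of _ b q] h by auto
        qed
      qed (auto simp: mdn_def)
      then show ?thesis by (auto simp: mono1_def)
    qed
    finally show ?thesis .
  qed
qed

text \<open>Induction on the degree, splitting off one variable. \<open>S\<close> is closed under
  nontrivial divisors only, to cover series without constant term, where the monomial 1 is
  missing.\<close>

lemma mono_agree:
  assumes S: "\<And>m. m \<in> S \<Longrightarrow> valid_mon r m"
    and Sm: "\<And>m m1. m \<in> S \<Longrightarrow> m1 \<in> mdn m \<Longrightarrow> m1 \<noteq> (\<lambda>_. 0) \<Longrightarrow> m1 \<in> S"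
    and mul: "\<And>a b. a \<in> S \<Longrightarrow> b \<in> S \<Longrightarrow> D (fmul (mono1 a) (mono1 b)) = fmul (D (mono1 a)) (D (mono1 b))"
    and mul': "\<And>a b. a \<in> S \<Longrightarrow> b \<in> S \<Longrightarrow> D' (fmul (mono1 a) (mono1 b)) = fmul (D' (mono1 a)) (D' (mono1 b))"
    and var: "\<And>i k. 1 \<le> i \<Longrightarrow> k < r \<Longrightarrow> D (pvar i k) = D' (pvar i k)"
  shows "m \<in> S \<Longrightarrow> m \<noteq> (\<lambda>_. 0) \<Longrightarrow> D (mono1 m) = D' (mono1 m)"
proof (induction "mdeg m" arbitrary: m rule: less_induct)
  case less
  have v: "valid_mon r m" using S less.prems by blast
  obtain q where q: "m q \<noteq> 0" using mon_neq_0[OF less.prems(2)] by blast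
  have q1: "1 \<le> fst q" "snd q < r" using valid_mon_fst[OF v q] by auto
  have dq: "mdelta q \<in> mdn m" using q by (auto simp: mdn_def)
  have vq: "mdelta q \<noteq> (\<lambda>_. 0)" by (auto simp: fun_eq_iff)
  have dS: "mdelta q \<in> S" by (rule Sm[OF less.prems(1) dq vq])
  have Dq: "D (mono1 (mdelta q)) = D' (mono1 (mdelta q))"
    using var[OF q1] by (simp add: pvar_mono1)
  let ?m = "\<lambda>p. m p - mdelta q p"
  have eq: "(\<lambda>p. ?m p + mdelta q p) = m" using q by (auto simp: fun_eq_iff)
  show ?case
  \<comment> \<open>The quotient 1 may lie outside \<open>S\<close>; in that case \<open>m\<close>
    is itself a variable.\<close>
  proof (cases "?m = (\<lambda>_. 0)")
    case True
    then have "m p = mdelta q p" for p using fun_cong[OF eq, of p] fun_cong[OF True, of p] by simp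
    then have "m = mdelta q" by blast
    then show ?thesis using Dq by simp
  next
    case False
    have mS: "?m \<in> S" by (rule Sm[OF less.prems(1) mdn_diff False])
    have fin: "finite (msupp ?m)" "finite (msupp (mdelta q))"
      using valid_mon_finite[OF S[OF mS]] unfolding msupp_mdelta by auto
    have "mdeg m = mdeg ?m + fst q" using mdeg_add[OF fin] unfolding eq mdeg_mdelta .
    then have "mdeg ?m < mdeg m" using q1 by simp
    from less.hyps[OF this mS False] have Dm: "D (mono1 ?m) = D' (mono1 ?m)" .
    have mm: "mono1 m = fmul (mono1 ?m) (mono1 (mdelta q))" unfolding fmul_mono1[OF fin] eq ..
    show ?thesis unfolding mm mul[OF mS dS] mul'[OF mS dS] Dm Dq ..
  qed
qed

text \<open>A series is the limit of its truncations by degree, which are finite combinations of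
  monomials; linearity and continuity do the rest.\<close>

lemma series_agree:
  assumes S: "\<And>m. m \<in> S \<Longrightarrow> valid_mon r m" and A: "A = {f. \<forall>m. f m \<noteq> 0 \<longrightarrow> m \<in> S}"
    and add: "\<And>f g. f \<in> A \<Longrightarrow> g \<in> A \<Longrightarrow> D (fadd f g) = fadd (D f) (D g)"
    and add': "\<And>f g. f \<in> A \<Longrightarrow> g \<in> A \<Longrightarrow> D' (fadd f g) = fadd (D' f) (D' g)"
    and sc: "\<And>c f. f \<in> A \<Longrightarrow> D (fscale c f) = fscale c (D f)"
    and sc': "\<And>c f. f \<in> A \<Longrightarrow> D' (fscale c f) = fscale c (D' f)"
    and con: "\<And>fs f. (\<forall>n. fs n \<in> A) \<and> f \<in> A \<and> fconv fs f \<Longrightarrow> fconv (\<lambda>n. D (fs n)) (D f)"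
    and con': "\<And>fs f. (\<forall>n. fs n \<in> A) \<and> f \<in> A \<and> fconv fs f \<Longrightarrow> fconv (\<lambda>n. D' (fs n)) (D' f)"
    and mon: "\<And>m. m \<in> S \<Longrightarrow> D (mono1 m) = D' (mono1 m)"
    and f: "f \<in> A"
  shows "D f = D' f"
proof -
  have z: "(\<lambda>_. 0) \<in> A" by (simp add: A)
  have z0: "D (\<lambda>_. 0) = D' (\<lambda>_. 0)"
    using sc[OF z, of 0] sc'[OF z, of 0] by (simp add: fscale_def)
  have fin: "D (\<lambda>m. if m \<in> F then f m else 0) = D' (\<lambda>m. if m \<in> F then f m else 0)"
    if "finite F" "F \<subseteq> S" for F
    using that
  proof (induction F rule: finite_induct)
    case empty
    then show ?case using z0 by simp
  next
    case (insert a F)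
    let ?h = "\<lambda>m. if m \<in> F then f m else 0"
    have hA: "?h \<in> A" using insert.prems by (auto simp: A)
    have mA: "mono1 a \<in> A" using insert.prems by (auto simp: A mono1_def)
    have sA: "fscale (f a) (mono1 a) \<in> A" using mA by (auto simp: A fscale_def)
    have eq: "(\<lambda>m. if m \<in> insert a F then f m else 0) = fadd (fscale (f a) (mono1 a)) ?h"
      by (rule ext) (use insert.hyps in \<open>auto simp: fadd_def fscale_def mono1_def\<close>)
    show ?case
      unfolding eq add[OF sA hA] add'[OF sA hA] sc[OF mA] sc'[OF mA]
      using insert mon[of a] by simp
  qed
  define fs where "fs n = (\<lambda>m. if m \<in> S \<inter> monset r n then f m else 0)" for n
  have fsA: "fs n \<in> A" for n by (auto simp: A fs_def)
  have conv: "fconv fs f"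
    unfolding fconv_def
  proof
    fix m
    show "eventually (\<lambda>n. fs n m = f m) sequentially"
    proof (rule eventually_sequentiallyI)
      fix n assume "mdeg m \<le> n"
      then show "fs n m = f m" using f S by (auto simp: fs_def A monset_def)
    qed
  qed
  have eqn: "D (fs n) = D' (fs n)" for n
    unfolding fs_def by (rule fin) (use finite_monset in auto)
  show ?thesis
  proof
    fix m
    have "eventually (\<lambda>n. D (fs n) m = D f m) sequentially" "eventually (\<lambda>n. D' (fs n) m = D' f m) sequentially"
      using con[of fs f] con'[of fs f] fsA f conv by (auto intro: fconvD)
    then have "eventually (\<lambda>n. D f m = D' f m) sequentially"
      by eventually_elim (simp add: eqn)
    then show "D f m = D' f m" by simp
  qed
qed

lemma pleth_propsD:
  assumes "pleth_props r P"
  shows "\<And>g f1 f2. g \<in> Aplus \<Longrightarrow> f1 \<in> Aser r \<Longrightarrow> f2 \<in> Aser r \<Longrightarrow> P (fadd f1 f2) g = fadd (P f1 g) (P f2 g)"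
    "\<And>g f1 f2. g \<in> Aplus \<Longrightarrow> f1 \<in> Aser r \<Longrightarrow> f2 \<in> Aser r \<Longrightarrow> P (fmul f1 f2) g = fmul (P f1 g) (P f2 g)"
    "\<And>g c f. g \<in> Aplus \<Longrightarrow> f \<in> Aser r \<Longrightarrow> P (fscale c f) g = fscale c (P f g)"
    "\<And>g. g \<in> Aplus \<Longrightarrow> P fone g = fone"
    "\<And>g fs f. g \<in> Aplus \<Longrightarrow> (\<forall>n. fs n \<in> Aser r) \<and> f \<in> Aser r \<and> fconv fs f \<Longrightarrow> fconv (\<lambda>n. P (fs n) g) (P f g)"
    "\<And>i k g1 g2. 1 \<le> i \<Longrightarrow> k < r \<Longrightarrow> g1 \<in> Aplus \<Longrightarrow> g2 \<in> Aplus \<Longrightarrow> P (pvar i k) (fadd g1 g2) = fadd (P (pvar i k) g1) (P (pvar i k) g2)"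
    "\<And>i k g1 g2. 1 \<le> i \<Longrightarrow> k < r \<Longrightarrow> g1 \<in> Aplus \<Longrightarrow> g2 \<in> Aplus \<Longrightarrow> P (pvar i k) (fmul g1 g2) = fmul (P (pvar i k) g1) (P (pvar i k) g2)"
    "\<And>i k c g. 1 \<le> i \<Longrightarrow> k < r \<Longrightarrow> g \<in> Aplus \<Longrightarrow> P (pvar i k) (fscale c g) = fscale c (P (pvar i k) g)"
    "\<And>i k gs g. 1 \<le> i \<Longrightarrow> k < r \<Longrightarrow> (\<forall>n. gs n \<in> Aplus) \<and> g \<in> Aplus \<and> fconv gs g \<Longrightarrow> fconv (\<lambda>n. P (pvar i k) (gs n)) (P (pvar i k) g)"
    "\<And>i k j. 1 \<le> i \<Longrightarrow> k < r \<Longrightarrow> 1 \<le> j \<Longrightarrow> P (pvar i k) (pvar j 0) = pvar (i * j) ((k * j) mod r)"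
    "\<And>f g. \<not> (f \<in> Aser r \<and> g \<in> Aplus) \<Longrightarrow> P f g = (\<lambda>_. 0)"
  using assms unfolding pleth_props_def by simp_all

text \<open>The properties act in two stages: with a variable on the left, the homomorphism in the
  right argument fixes all p_i(zeta) o g; then, with g fixed, the homomorphism in the left argument
  fixes the rest.\<close>

lemma pleth_unique:
  assumes P: "pleth_props r P" and Q: "pleth_props r Q"
  shows "P = Q"
proof (intro ext)
  fix f g M
  note p = pleth_propsD[OF P] and q = pleth_propsD[OF Q]
  have var: "P (pvar i k) g = Q (pvar i k) g" if i: "1 \<le> i" and k: "k < r" and g: "g \<in> Aplus" for i k g
  proof -
    let ?S = "{m. valid_mon 1 m \<and> m \<noteq> (\<lambda>_. 0)}"
    have Sv: "\<And>m. m \<in> ?S \<Longrightarrow> valid_mon 1 m" by blast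
    have AS: "Aplus = {f. \<forall>m. f m \<noteq> 0 \<longrightarrow> m \<in> ?S}" by (auto simp: Aplus_def Aser_def)
    have mA: "mono1 m \<in> Aplus" if "m \<in> ?S" for m using that unfolding AS by (simp add: mono1_def)
    have mon: "P (pvar i k) (mono1 m) = Q (pvar i k) (mono1 m)" if m: "m \<in> ?S" for m
    proof (rule mono_agree[OF Sv, of ?S "P (pvar i k)" "Q (pvar i k)"])
      show "m1 \<in> ?S" if "m \<in> ?S" "m1 \<in> mdn m" "m1 \<noteq> (\<lambda>_. 0)" for m m1
        using valid_mon_mdn[of 1 m m1] that by blast
      show "P (pvar i k) (pvar j l) = Q (pvar i k) (pvar j l)" if "1 \<le> j" "l < 1" for j l
        using p(10)[OF i k that(1)] q(10)[OF i k that(1)] that by simp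
    next
      fix a b assume "a \<in> ?S" "b \<in> ?S"
      then have ab: "mono1 a \<in> Aplus" "mono1 b \<in> Aplus" using mA by blast+
      show "P (pvar i k) (fmul (mono1 a) (mono1 b)) = fmul (P (pvar i k) (mono1 a)) (P (pvar i k) (mono1 b))"
        by (rule p(7)[OF i k ab])
      show "Q (pvar i k) (fmul (mono1 a) (mono1 b)) = fmul (Q (pvar i k) (mono1 a)) (Q (pvar i k) (mono1 b))"
        by (rule q(7)[OF i k ab])
    qed (use m in auto)
    show ?thesis
      by (rule series_agree[OF Sv AS, of "P (pvar i k)" "Q (pvar i k)"])
        (use g in \<open>auto intro: p(6,8,9)[OF i k] q(6,8,9)[OF i k] mon\<close>)
  qed
  show "P f g M = Q f g M"
  proof (cases "f \<in> Aser r \<and> g \<in> Aplus")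
    case False
    show ?thesis unfolding p(11)[OF False] q(11)[OF False] ..
  next
    case True
    then have f: "f \<in> Aser r" and g: "g \<in> Aplus" by auto
    let ?S = "{m. valid_mon r m}"
    have Sv: "\<And>m. m \<in> ?S \<Longrightarrow> valid_mon r m" by blast
    have AS: "Aser r = {f. \<forall>m. f m \<noteq> 0 \<longrightarrow> m \<in> ?S}" by (auto simp: Aser_def)
    have mA: "mono1 m \<in> Aser r" if "m \<in> ?S" for m using that unfolding AS by (simp add: mono1_def)
    have mon: "P (mono1 m) g = Q (mono1 m) g" if m: "m \<in> ?S" for m
    proof (cases "m = (\<lambda>_. 0)")
      case True
      then show ?thesis using p(4)[OF g] q(4)[OF g] by (simp add: fone_mono1)
    next
      case False
      show ?thesis
      proof (rule mono_agree[OF Sv, of ?S "\<lambda>f. P f g" "\<lambda>f. Q f g"])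
        show "m1 \<in> ?S" if "m \<in> ?S" "m1 \<in> mdn m" "m1 \<noteq> (\<lambda>_. 0)" for m m1
          using valid_mon_mdn[of r m m1] that by blast
        show "P (pvar i k) g = Q (pvar i k) g" if "1 \<le> i" "k < r" for i k
          by (rule var[OF that g])
      next
        fix a b assume "a \<in> ?S" "b \<in> ?S"
        then have ab: "mono1 a \<in> Aser r" "mono1 b \<in> Aser r" using mA by blast+
        show "P (fmul (mono1 a) (mono1 b)) g = fmul (P (mono1 a) g) (P (mono1 b) g)" by (rule p(2)[OF g ab])
        show "Q (fmul (mono1 a) (mono1 b)) g = fmul (Q (mono1 a) g) (Q (mono1 b) g)" by (rule q(2)[OF g ab])
      qed (use m False in auto)
    qed
    have "P f g = Q f g"
      by (rule series_agree[OF Sv AS, of "\<lambda>f. P f g" "\<lambda>f. Q f g"])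
        (use f in \<open>auto intro: p(1,3,5)[OF g] q(1,3,5)[OF g] mon\<close>)
    then show ?thesis by simp
  qed
qed

theorem pleth_plet: "pleth r = plet r"
  unfolding pleth_def by (rule the_equality) (use plet_props pleth_unique in blast)+

section \<open>Characters of modules\<close>

text \<open>\<open>free_obj\<close> says that \<open>t\<close> maps \<open>I\<close> into itself;
  injectivity comes from \<open>t ^^ r\<close> being the identity there, and surjectivity from
  finiteness.\<close>

lemma free_obj_gset:
  assumes "1 \<le> r"
  shows "free_obj r (I, t) \<longleftrightarrow> gset r I t id \<and> (\<forall>x. x \<notin> I \<longrightarrow> t x = x)"
proof
  assume f: "free_obj r (I, t)"
  then have fin: "finite I" and tI: "t ` I \<subseteq> I" and tr: "\<forall>x\<in>I. (t ^^ r) x = x"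
    by (auto simp: free_obj_def Let_def)
  have "inj_on t I"
  proof (rule inj_onI)
    fix x y assume xy: "x \<in> I" "y \<in> I" "t x = t y"
    obtain r' where r': "r = Suc r'" using assms by (cases r) auto
    have "(t ^^ r) x = (t ^^ r) y" unfolding r' funpow_Suc_right comp_apply xy(3) ..
    then show "x = y" using tr xy by simp
  qed
  then have "bij_betw t I I" using endo_inj_surj[OF fin tI] by (simp add: bij_betw_def)
  then show "gset r I t id \<and> (\<forall>x. x \<notin> I \<longrightarrow> t x = x)"
    using f assms by (simp add: gset_def free_obj_def Let_def)
next
  assume g: "gset r I t id \<and> (\<forall>x. x \<notin> I \<longrightarrow> t x = x)"
  interpret gset r I t id using g by blast
  show "free_obj r (I, t)"
    unfolding free_obj_def Let_def using g fin tr free by (auto simp del: bij_betw_imp_surj_on)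
qed

lemma morph_gset: "gset r I t s \<Longrightarrow> morph (I, t) (I, t) s"
  by (simp add: gset_def morph_def)

lemma free_obj_1: "free_obj 1 (J, id) \<longleftrightarrow> finite J"
  by (auto simp: free_obj_def Let_def)

lemma morph_1: "morph (J, id) (J', id) f \<longleftrightarrow> bij_betw f J J'"
  by (simp add: morph_def)

definition mchar :: "(obj \<Rightarrow> ('i \<Rightarrow> complex) set)
     \<Rightarrow> (obj \<Rightarrow> obj \<Rightarrow> (nat \<Rightarrow> nat) \<Rightarrow> ('i \<Rightarrow> complex) \<Rightarrow> ('i \<Rightarrow> complex)) \<Rightarrow> obj \<Rightarrow> (nat \<Rightarrow> nat) \<Rightarrow> complex" where
  "mchar sp mp X f = trace (sp X) (mp X X f)"

locale bmod =
  fixes r :: nat and sp :: "obj \<Rightarrow> ('i \<Rightarrow> complex) set"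
    and mp :: "obj \<Rightarrow> obj \<Rightarrow> (nat \<Rightarrow> nat) \<Rightarrow> ('i \<Rightarrow> complex) \<Rightarrow> ('i \<Rightarrow> complex)"
  assumes r1: "1 \<le> r" and mod: "is_module r sp mp"
begin

lemma sp: "free_obj r X \<Longrightarrow> subspc (sp X)" "free_obj r X \<Longrightarrow> findim (sp X)"
  using mod unfolding is_module_def by simp_all

lemma mp_lin: "free_obj r X \<Longrightarrow> free_obj r Y \<Longrightarrow> morph X Y f \<Longrightarrow> linmap (sp X) (mp X Y f)"
  using mod unfolding is_module_def by simp

lemma mp_in: "free_obj r X \<Longrightarrow> free_obj r Y \<Longrightarrow> morph X Y f \<Longrightarrow> v \<in> sp X \<Longrightarrow> mp X Y f v \<in> sp Y"
  using mod unfolding is_module_def by simp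

lemma mp_cong: "free_obj r X \<Longrightarrow> free_obj r Y \<Longrightarrow> morph X Y f \<Longrightarrow> (\<And>x. x \<in> fst X \<Longrightarrow> f x = g x) \<Longrightarrow> v \<in> sp X
    \<Longrightarrow> mp X Y f v = mp X Y g v"
  using mod unfolding is_module_def by simp

lemma morph_id: "morph X X id"
  by (simp add: morph_def)

lemma mp_id: "free_obj r X \<Longrightarrow> (\<And>x. x \<in> fst X \<Longrightarrow> f x = x) \<Longrightarrow> v \<in> sp X \<Longrightarrow> mp X X f v = v"
  using mod mp_cong[of X X id f v] morph_id[of X] unfolding is_module_def by simp

lemma mp_comp: "free_obj r X \<Longrightarrow> free_obj r Y \<Longrightarrow> free_obj r Z \<Longrightarrow> morph X Y f \<Longrightarrow> morph Y Z g \<Longrightarrow> v \<in> sp X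
    \<Longrightarrow> mp Y Z g (mp X Y f v) = mp X Z (g \<circ> f) v"
  using mod unfolding is_module_def by simp

lemma morph_comp: "morph X Y f \<Longrightarrow> morph Y Z g \<Longrightarrow> morph X Z (g \<circ> f)"
  unfolding morph_def by (auto intro: bij_betw_trans simp: bij_betw_apply)

lemma morph_inv: "free_obj r X \<Longrightarrow> morph X Y f \<Longrightarrow> morph Y X (inv_into (fst X) f)"
proof -
  assume X: "free_obj r X" and f: "morph X Y f"
  have b: "bij_betw f (fst X) (fst Y)" using f by (simp add: morph_def)
  have "inv_into (fst X) f (snd Y y) = snd X (inv_into (fst X) f y)" if y: "y \<in> fst Y" for y
  proof -
    obtain x where x: "x \<in> fst X" "y = f x" using b y by (auto simp: bij_betw_def)
    have "snd X x \<in> fst X" using X x by (auto simp: free_obj_def Let_def)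
    moreover have "snd Y y = f (snd X x)" using f x by (simp add: morph_def)
    ultimately show ?thesis using b x by (simp add: bij_betw_def)
  qed
  then show ?thesis using bij_betw_inv_into[OF b] by (simp add: morph_def)
qed

lemma mchar_iso:
  assumes X: "free_obj r X" "free_obj r X'" and f: "morph X X' f"
    and h: "morph X X h" "morph X' X' h'" and com: "\<And>x. x \<in> fst X \<Longrightarrow> f (h x) = h' (f x)"
  shows "mchar sp mp X' h' = mchar sp mp X h"
  unfolding mchar_def
proof (rule trace_conj[where f = "mp X X' f" and g = "mp X' X (inv_into (fst X) f)"])
  have g: "morph X' X (inv_into (fst X) f)" by (rule morph_inv[OF X(1) f])
  have b: "bij_betw f (fst X) (fst X')" using f by (simp add: morph_def)
  show "subspc (sp X)" "subspc (sp X')" "findim (sp X)" "findim (sp X')" using sp X by auto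
  show "linmap (sp X) (mp X X h)" "linmap (sp X') (mp X' X' h')" "linmap (sp X) (mp X X' f)"
    "linmap (sp X') (mp X' X (inv_into (fst X) f))" using mp_lin X f g h by auto
  fix v
  { assume v: "v \<in> sp X"
    show "mp X X h v \<in> sp X" by (rule mp_in[OF X(1,1) h(1) v])
    show "mp X X' f v \<in> sp X'" by (rule mp_in[OF X f v])
    show "mp X' X (inv_into (fst X) f) (mp X X' f v) = v"
      unfolding mp_comp[OF X X(1) f g v]
      by (rule mp_id[OF X(1) _ v]) (use b in \<open>simp add: bij_betw_def\<close>)
    have hx: "h x \<in> fst X" if "x \<in> fst X" for x using h(1) that by (auto simp: morph_def bij_betw_def)
    show "mp X' X' h' (mp X X' f v) = mp X X' f (mp X X h v)"
      unfolding mp_comp[OF X X(2) f h(2) v] mp_comp[OF X(1,1,2) h(1) f v]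
      by (rule mp_cong[OF X morph_comp[OF f h(2)] _ v]) (simp add: com) }
  { assume v: "v \<in> sp X'"
    show "mp X' X' h' v \<in> sp X'" by (rule mp_in[OF X(2,2) h(2) v])
    show "mp X' X (inv_into (fst X) f) v \<in> sp X" by (rule mp_in[OF X(2,1) g v])
    show "mp X X' f (mp X' X (inv_into (fst X) f) v) = v"
      unfolding mp_comp[OF X(2,1,2) g f v]
      by (rule mp_id[OF X(2) _ v]) (use b in \<open>simp add: bij_betw_def f_inv_into_f\<close>) }
qed

text \<open>Equal types provide an isomorphism, and functoriality along it conjugates the two
  operators.\<close>

lemma mchar_gtype:
  assumes X: "gset r I t s" "\<And>x. x \<notin> I \<Longrightarrow> t x = x" and Y: "gset r I' t' s'" "\<And>x. x \<notin> I' \<Longrightarrow> t' x = x"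
    and eq: "gtype r I t s = gtype r I' t' s'"
  shows "mchar sp mp (I, t) s = mchar sp mp (I', t') s'"
proof -
  interpret gset_pair r I t s I' t' s' by (intro gset_pair.intro X Y)
  obtain \<phi> where \<phi>: "\<phi> \<in> giso" using giso_ex[OF eq] by blast
  have "mchar sp mp (I', t') s' = mchar sp mp (I, t) s"
  proof (rule mchar_iso)
    show "free_obj r (I, t)" "free_obj r (I', t')"
      using free_obj_gset[OF r1] A.gset_id B.gset_id X(2) Y(2) by auto
    show "morph (I, t) (I', t') \<phi>" using \<phi> by (simp add: giso_def ghom_def morph_def)
    show "morph (I, t) (I, t) s" "morph (I', t') (I', t') s'" using morph_gset X(1) Y(1) by auto
    show "\<phi> (s x) = s' (\<phi> x)" if "x \<in> fst (I, t)" for x using \<phi> that by (simp add: giso_def ghom_def)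
  qed
  then show ?thesis ..
qed

end

section \<open>The space V(O) of an orbit of blocks\<close>

locale bcomp = U: bmod r Usp Ump + V: bmod 1 Vsp Vmp
  for r and Usp :: "obj \<Rightarrow> ('i \<Rightarrow> complex) set" and Ump
    and Vsp :: "obj \<Rightarrow> ('j \<Rightarrow> complex) set" and Vmp +
  fixes I :: "nat set" and t s :: "nat \<Rightarrow> nat"
  assumes gst: "gset r I t s" and tout: "x \<notin> I \<Longrightarrow> t x = x"
begin

interpretation gset r I t s by (rule gst)
interpretation Z: gset r I t id by (rule gset_id)

abbreviation "orbs \<pi> \<equiv> orbits t \<pi>"
abbreviation "prts \<equiv> gparts r I t id"

lemma parts_eq: "parts r (I, t) = prts"
  unfolding parts_def gparts_def by auto

lemma gparts_stable: "gparts r I t s = {\<pi> \<in> prts. (`) s ` \<pi> = \<pi>}"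
proof (intro equalityI subsetI)
  fix \<pi> assume p: "\<pi> \<in> gparts r I t s"
  interpret P: gset r \<pi> "(`) t" "(`) s" by (rule gset_gpart[OF p])
  have "\<pi> \<in> prts" using p unfolding gparts_def by auto
  moreover have "(`) s ` \<pi> = \<pi>" using P.sbij by (simp add: bij_betw_def)
  ultimately show "\<pi> \<in> {\<pi> \<in> prts. (`) s ` \<pi> = \<pi>}" by blast
next
  fix \<pi> assume p: "\<pi> \<in> {\<pi> \<in> prts. (`) s ` \<pi> = \<pi>}"
  then have "\<forall>J\<in>\<pi>. s ` J \<in> \<pi>" by blast
  then show "\<pi> \<in> gparts r I t s" using p unfolding gparts_def by auto
qed

text \<open>Orbits under \<open>t\<close> alone are joint orbits for the automorphism
  \<open>id\<close>, so the theory of commuting pairs covers them.\<close>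

lemma orbs_cyc: "orbs \<pi> = cyc ((`) t) ((`) id) \<pi>"
proof -
  have "orb ((`) t) ((`) id) J = {(t ^^ k) ` J | k. True}" for J
    unfolding orb_def image_funpow by simp
  then show ?thesis unfolding orbits_def cyc_def by auto
qed

lemma orb_t: "orb ((`) t) ((`) id) J = {(t ^^ k) ` J | k. True}"
  unfolding orb_def image_funpow by simp

context
  fixes \<pi> assumes \<pi>: "\<pi> \<in> prts"
begin

interpretation P: gset r \<pi> "(`) t" "(`) id" by (rule Z.gset_gpart[OF \<pi>])

lemma orb_block: "Ob \<in> orbs \<pi> \<Longrightarrow> J \<in> Ob \<Longrightarrow> J \<in> \<pi> \<and> Ob = {(t ^^ k) ` J | k. True}"
  unfolding orbs_cyc using P.cyc_mem[of Ob J] orb_t by simp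

lemma block_I: "Ob \<in> orbs \<pi> \<Longrightarrow> J \<in> Ob \<Longrightarrow> J \<subseteq> I"
  using orb_block Z.block_sub[OF \<pi>] by blast

lemma block_fin: "Ob \<in> orbs \<pi> \<Longrightarrow> J \<in> Ob \<Longrightarrow> finite J"
  by (rule finite_subset[OF block_I fin])

lemma block_free: "Ob \<in> orbs \<pi> \<Longrightarrow> J \<in> Ob \<Longrightarrow> free_obj 1 (J, id)"
  using block_fin free_obj_1 by blast

lemma orb_pow: "Ob \<in> orbs \<pi> \<Longrightarrow> J \<in> Ob \<Longrightarrow> (t ^^ k) ` J \<in> Ob"
  using orb_block by blast

lemma orb_t1: "Ob \<in> orbs \<pi> \<Longrightarrow> J \<in> Ob \<Longrightarrow> t ` J \<in> Ob"
  using orb_pow[of Ob J 1] by simp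

lemma orb_ne: "Ob \<in> orbs \<pi> \<Longrightarrow> Ob \<noteq> {}"
  unfolding orbs_cyc by (rule P.cyc_ne)

lemma finite_orbs: "finite (orbs \<pi>)"
  unfolding orbs_cyc by (rule P.finite_cyc)

lemma morph_pow: "J \<subseteq> I \<Longrightarrow> morph (J, id) ((t ^^ k) ` J, id) (t ^^ k)"
  unfolding morph_1 using bij_betw_funpow[OF tbij, of k] by (auto simp: bij_betw_def intro: inj_on_subset)

lemma morph_t: "J \<subseteq> I \<Longrightarrow> morph (J, id) (t ` J, id) t"
  using morph_pow[of J 1] by simp

lemma morph_s: "J \<subseteq> I \<Longrightarrow> morph (J, id) (s ` J, id) s"
  unfolding morph_1 using sbij by (auto simp: bij_betw_def intro: inj_on_subset)

text \<open>\<open>t\<close> acts freely on blocks as well as on points, so powers that agree on a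
  block have congruent exponents and agree on all points. This makes the extension of a vector along
  its orbit well defined.\<close>

lemma pow_eq:
  assumes "J \<in> \<pi>" "(t ^^ a) ` J = (t ^^ b) ` J" "x \<in> I"
  shows "(t ^^ a) x = (t ^^ b) x"
proof -
  have "((`) t ^^ a) J = ((`) t ^^ b) J" using assms by (simp add: image_funpow)
  then show ?thesis using P.t_eq_iff[OF assms(1)] t_eq_iff[OF assms(3)] by simp
qed

text \<open>The inverse of the evaluation of V(Ob) at a block J0 of the orbit Ob.\<close>
definition vext :: "nat set \<Rightarrow> nat set set \<Rightarrow> ('j \<Rightarrow> complex) \<Rightarrow> nat set \<times> 'j \<Rightarrow> complex" where
  "vext J0 Ob v = (\<lambda>(J, j). if J \<in> Ob then
      Vmp (J0, id) (J, id) (t ^^ (LEAST a. (t ^^ a) ` J0 = J)) v j else 0)"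

abbreviation "VOO Ob \<equiv> VO Vsp Vmp t Ob"

lemma VO_D:
  assumes "F \<in> VOO Ob"
  shows "J \<in> Ob \<Longrightarrow> (\<lambda>j. F (J, j)) \<in> Vsp (J, id)" "J \<notin> Ob \<Longrightarrow> F (J, j) = 0"
    "J \<in> Ob \<Longrightarrow> (\<lambda>j. F (t ` J, j)) = Vmp (J, id) (t ` J, id) t (\<lambda>j. F (J, j))"
  using assms unfolding VO_def by auto

lemma VO_I:
  assumes "\<And>J. J \<in> Ob \<Longrightarrow> (\<lambda>j. F (J, j)) \<in> Vsp (J, id)" "\<And>J j. J \<notin> Ob \<Longrightarrow> F (J, j) = 0"
    "\<And>J. J \<in> Ob \<Longrightarrow> (\<lambda>j. F (t ` J, j)) = Vmp (J, id) (t ` J, id) t (\<lambda>j. F (J, j))"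
  shows "F \<in> VOO Ob"
  using assms unfolding VO_def by auto

context
  fixes Ob assumes Ob: "Ob \<in> orbs \<pi>"
begin

lemma VO_pow:
  assumes F: "F \<in> VOO Ob" and J: "J \<in> Ob"
  shows "(\<lambda>j. F ((t ^^ k) ` J, j)) = Vmp (J, id) ((t ^^ k) ` J, id) (t ^^ k) (\<lambda>j. F (J, j))"
proof (induction k)
  case 0
  show ?case using V.mp_id[OF block_free[OF Ob J] _ VO_D(1)[OF F J], of id] by (simp add: id_def)
next
  case (Suc k)
  let ?J = "(t ^^ k) ` J"
  have J': "?J \<in> Ob" by (rule orb_pow[OF Ob J])
  have J'': "t ` ?J \<in> Ob" by (rule orb_t1[OF Ob J'])
  have IH: "(\<lambda>j. F (?J, j)) = Vmp (J, id) (?J, id) (t ^^ k) (\<lambda>j. F (J, j))"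
    using Suc by (simp add: id_def)
  have "(\<lambda>j. F (t ` ?J, j)) = Vmp (?J, id) (t ` ?J, id) t (Vmp (J, id) (?J, id) (t ^^ k) (\<lambda>j. F (J, j)))"
    unfolding VO_D(3)[OF F J'] IH ..
  also have "\<dots> = Vmp (J, id) (t ` ?J, id) (t \<circ> (t ^^ k)) (\<lambda>j. F (J, j))"
    by (rule V.mp_comp[OF block_free[OF Ob J] block_free[OF Ob J'] block_free[OF Ob J'']
      morph_pow[OF block_I[OF Ob J]] morph_t[OF block_I[OF Ob J']] VO_D(1)[OF F J]])
  also have "t ` ?J = (t ^^ Suc k) ` J" by (simp add: image_comp)
  finally show ?case by simp
qed

lemma VO_subspc: "subspc (VOO Ob)"
  unfolding subspc_def
proof (intro conjI ballI allI)
  have lin: "linmap (Vsp (J, id)) (Vmp (J, id) (t ` J, id) t)" if "J \<in> Ob" for J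
    by (rule V.mp_lin[OF block_free[OF Ob that] block_free[OF Ob orb_t1[OF Ob that]] morph_t[OF block_I[OF Ob that]]])
  have sub: "subspc (Vsp (J, id))" if "J \<in> Ob" for J using V.sp(1)[OF block_free[OF Ob that]] .
  show "(\<lambda>_. 0) \<in> VOO Ob"
    by (rule VO_I) (use sub linmap_zero[OF sub lin] in \<open>auto simp: subspc_def\<close>)
  have comb: "(\<lambda>p. c * u p + d * v p) \<in> VOO Ob" if u: "u \<in> VOO Ob" and v: "v \<in> VOO Ob" for u v c d
  proof (rule VO_I)
    fix J assume J: "J \<in> Ob"
    show "(\<lambda>j. c * u (J, j) + d * v (J, j)) \<in> Vsp (J, id)"
      by (rule subspc_lin[OF sub[OF J] VO_D(1)[OF u J] VO_D(1)[OF v J]])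
    show "(\<lambda>j. c * u (t ` J, j) + d * v (t ` J, j)) = Vmp (J, id) (t ` J, id) t (\<lambda>j. c * u (J, j) + d * v (J, j))"
      using lin[OF J] VO_D(1)[OF u J] VO_D(1)[OF v J]
        fun_cong[OF VO_D(3)[OF u J]] fun_cong[OF VO_D(3)[OF v J]] unfolding linmap_def by simp
  next
    fix J j assume "J \<notin> Ob"
    then show "c * u (J, j) + d * v (J, j) = 0" using VO_D(2)[OF u] VO_D(2)[OF v] by simp
  qed
  fix u assume u: "u \<in> VOO Ob"
  { fix v assume v: "v \<in> VOO Ob" show "(\<lambda>i. u i + v i) \<in> VOO Ob" using comb[OF u v, of 1 1] by simp }
  fix c show "(\<lambda>i. c * u i) \<in> VOO Ob" using comb[OF u u, of c 0] by simp
qed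

context
  fixes J0 assumes J0: "J0 \<in> Ob"
begin

lemma J0_obj: "J0 \<in> \<pi>" "J0 \<subseteq> I" "free_obj 1 (J0, id)"
  using orb_block[OF Ob J0] block_I[OF Ob J0] block_free[OF Ob J0] by auto

lemma least_pow: "J \<in> Ob \<Longrightarrow> (t ^^ (LEAST a. (t ^^ a) ` J0 = J)) ` J0 = J"
proof -
  assume "J \<in> Ob"
  then have "\<exists>a. (t ^^ a) ` J0 = J" using orb_block[OF Ob J0] by auto
  then show ?thesis by (rule LeastI_ex)
qed

text \<open>By \<open>pow_eq\<close> the least exponent in \<open>vext\<close> can be replaced by
  any exponent that leads to the same block.\<close>

lemma vext_pow: "v \<in> Vsp (J0, id) \<Longrightarrow> (\<lambda>j. vext J0 Ob v ((t ^^ k) ` J0, j)) = Vmp (J0, id) ((t ^^ k) ` J0, id) (t ^^ k) v"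
proof -
  assume v: "v \<in> Vsp (J0, id)"
  let ?J = "(t ^^ k) ` J0" and ?a = "LEAST a. (t ^^ a) ` J0 = (t ^^ k) ` J0"
  have J: "?J \<in> Ob" by (rule orb_pow[OF Ob J0])
  have eq: "(t ^^ ?a) ` J0 = ?J" by (rule least_pow[OF J])
  have "Vmp (J0, id) (?J, id) (t ^^ k) v = Vmp (J0, id) (?J, id) (t ^^ ?a) v"
  proof (rule V.mp_cong[OF J0_obj(3) block_free[OF Ob J] morph_pow[OF J0_obj(2)] _ v])
    fix x assume "x \<in> fst (J0, id :: nat \<Rightarrow> nat)"
    then have "x \<in> I" using J0_obj by auto
    then show "(t ^^ k) x = (t ^^ ?a) x" using pow_eq[OF J0_obj(1) eq] by simp
  qed
  then show ?thesis using J by (simp add: vext_def)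
qed

lemma vext_0: "v \<in> Vsp (J0, id) \<Longrightarrow> (\<lambda>j. vext J0 Ob v (J0, j)) = v"
  using vext_pow[of v 0] V.mp_id[OF J0_obj(3), of id v] by simp

lemma vext_in: "v \<in> Vsp (J0, id) \<Longrightarrow> vext J0 Ob v \<in> VOO Ob"
proof (rule VO_I)
  assume v: "v \<in> Vsp (J0, id)"
  fix J assume J: "J \<in> Ob"
  obtain k where k: "J = (t ^^ k) ` J0" using orb_block[OF Ob J0] J by auto
  have fJ: "free_obj 1 (J, id)" "free_obj 1 (t ` J, id)" using block_free[OF Ob] J orb_t1[OF Ob J] by auto
  have mk: "morph (J0, id) (J, id) (t ^^ k)" unfolding k by (rule morph_pow[OF J0_obj(2)])
  show "(\<lambda>j. vext J0 Ob v (J, j)) \<in> Vsp (J, id)"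
    using V.mp_in[OF J0_obj(3) fJ(1) mk v] vext_pow[OF v, of k] k by simp
  have tJ: "t ` J = (t ^^ Suc k) ` J0" unfolding k by (simp add: image_comp)
  have "(\<lambda>j. vext J0 Ob v (t ` J, j)) = Vmp (J0, id) (t ` J, id) (t ^^ Suc k) v"
    unfolding tJ by (rule vext_pow[OF v])
  also have "\<dots> = Vmp (J, id) (t ` J, id) t (Vmp (J0, id) (J, id) (t ^^ k) v)"
    using V.mp_comp[OF J0_obj(3) fJ mk morph_t[OF block_I[OF Ob J]] v] by simp
  also have "Vmp (J0, id) (J, id) (t ^^ k) v = (\<lambda>j. vext J0 Ob v (J, j))"
    unfolding k by (rule vext_pow[OF v, symmetric])
  finally show "(\<lambda>j. vext J0 Ob v (t ` J, j)) = Vmp (J, id) (t ` J, id) t (\<lambda>j. vext J0 Ob v (J, j))" .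
qed (simp add: vext_def)

lemma vext_restr: "F \<in> VOO Ob \<Longrightarrow> vext J0 Ob (\<lambda>j. F (J0, j)) = F"
proof
  fix p :: "nat set \<times> 'j" assume F: "F \<in> VOO Ob"
  obtain J j where p: "p = (J, j)" by (cases p)
  show "vext J0 Ob (\<lambda>j. F (J0, j)) p = F p"
  proof (cases "J \<in> Ob")
    case True
    then obtain k where k: "J = (t ^^ k) ` J0" using orb_block[OF Ob J0] by auto
    show ?thesis unfolding p k
      using fun_cong[OF vext_pow[OF VO_D(1)[OF F J0], of k], of j] fun_cong[OF VO_pow[OF F J0, of k], of j] by simp
  next
    case False
    then show ?thesis using VO_D(2)[OF F] by (simp add: p vext_def)
  qed
qed

lemma vext_lin: "linmap (Vsp (J0, id)) (vext J0 Ob)"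
  unfolding linmap_def
proof (intro ballI allI ext)
  fix u v c d and p :: "nat set \<times> 'j" assume u: "u \<in> Vsp (J0, id)" and v: "v \<in> Vsp (J0, id)"
  obtain J j where p: "p = (J, j)" by (cases p)
  show "vext J0 Ob (\<lambda>i. c * u i + d * v i) p = c * vext J0 Ob u p + d * vext J0 Ob v p"
  proof (cases "J \<in> Ob")
    case True
    then obtain k where k: "J = (t ^^ k) ` J0" using orb_block[OF Ob J0] by auto
    have l: "linmap (Vsp (J0, id)) (Vmp (J0, id) ((t ^^ k) ` J0, id) (t ^^ k))"
      by (rule V.mp_lin[OF J0_obj(3) block_free[OF Ob orb_pow[OF Ob J0]] morph_pow[OF J0_obj(2)]])
    have uv: "(\<lambda>i. c * u i + d * v i) \<in> Vsp (J0, id)" by (rule subspc_lin[OF V.sp(1)[OF J0_obj(3)] u v])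
    show ?thesis
      unfolding p k
      using fun_cong[OF vext_pow[OF u, of k], of j] fun_cong[OF vext_pow[OF v, of k], of j]
        fun_cong[OF vext_pow[OF uv, of k], of j] l u v unfolding linmap_def by simp
  next
    case False
    then show ?thesis by (simp add: p vext_def)
  qed
qed

text \<open>Evaluation at \<open>J0\<close> identifies V(Ob) with V(J0). An echelon basis of V(J0)
  extends along the orbit, and its pivots, placed in the component \<open>J0\<close>, remain
  pivots.\<close>

lemma VO_eframe_ex: "\<exists>K b. eframe (VOO Ob) K b"
proof -
  obtain K b where f: "eframe (Vsp (J0, id)) K b" using ex_eframe[OF V.sp(2)[OF J0_obj(3)]] by blast
  have "eframe (VOO Ob) (Pair J0 ` K) (\<lambda>p. vext J0 Ob (b (snd p)))"
    unfolding eframe_def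
  proof (intro conjI ballI)
    show "finite (Pair J0 ` K)" using eframeD(1)[OF f] by simp
    show "vext J0 Ob (b (snd p)) \<in> VOO Ob" if "p \<in> Pair J0 ` K" for p
      using that vext_in eframeD(2)[OF f] by auto
    show "vext J0 Ob (b (snd p)) q = (if p = q then 1 else 0)" if pq: "p \<in> Pair J0 ` K" "q \<in> Pair J0 ` K" for p q
    proof -
      obtain k where k: "p = (J0, k)" "k \<in> K" using pq(1) by (rule imageE)
      obtain l where l: "q = (J0, l)" "l \<in> K" using pq(2) by (rule imageE)
      note kl = k(1) l(1) k(2) l(2)
      show ?thesis
        using fun_cong[OF vext_0[OF eframeD(2)[OF f kl(3)]], of l] eframeD(4)[OF f kl(3,4)] kl by simp
    qed
    fix F assume F: "F \<in> VOO Ob"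
    have F0: "(\<lambda>j. F (J0, j)) \<in> Vsp (J0, id)" by (rule VO_D(1)[OF F J0])
    have "F = vext J0 Ob (\<lambda>j. F (J0, j))" by (rule vext_restr[OF F, symmetric])
    also have "(\<lambda>j. F (J0, j)) = (\<lambda>j. \<Sum>k\<in>K. F (J0, k) * b k j)"
      by (rule ext) (rule eframeD(3)[OF f F0])
    also have "vext J0 Ob \<dots> = (\<lambda>i. \<Sum>k\<in>K. F (J0, k) * vext J0 Ob (b k) i)"
      by (rule linmap_sum[OF V.sp(1)[OF J0_obj(3)] vext_lin]) (use eframeD[OF f] in auto)
    also have "\<dots> = (\<lambda>i. \<Sum>p\<in>Pair J0 ` K. F p * vext J0 Ob (b (snd p)) i)"
      by (subst sum.reindex) (auto simp: inj_on_def)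
    finally show "F = (\<lambda>i. \<Sum>p\<in>Pair J0 ` K. F p * vext J0 Ob (b (snd p)) i)" .
  qed
  then show ?thesis by blast
qed

text \<open>Under the same identification, the component at \<open>J0\<close> of \<open>T\<close>
  determines its trace.\<close>

lemma VO_trace:
  assumes T: "linmap (VOO Ob) T" "\<And>F. F \<in> VOO Ob \<Longrightarrow> T F \<in> VOO Ob"
    and h: "bij_betw h J0 J0"
    and com: "\<And>F. F \<in> VOO Ob \<Longrightarrow> (\<lambda>j. T F (J0, j)) = Vmp (J0, id) (J0, id) h (\<lambda>j. F (J0, j))"
  shows "trace (VOO Ob) T = mchar Vsp Vmp (J0, id) h"
  unfolding mchar_def
proof (rule trace_conj[where f = "vext J0 Ob" and g = "\<lambda>F j. F (J0, j)"])
  have hm: "morph (J0, id) (J0, id) h" using h by (simp add: morph_1)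
  show "subspc (Vsp (J0, id))" "findim (Vsp (J0, id))" using V.sp[OF J0_obj(3)] by auto
  show "subspc (VOO Ob)" by (rule VO_subspc)
  show "findim (VOO Ob)" using VO_eframe_ex findim_eframe[OF VO_subspc] by blast
  show "linmap (Vsp (J0, id)) (Vmp (J0, id) (J0, id) h)" by (rule V.mp_lin[OF J0_obj(3,3) hm])
  show "linmap (VOO Ob) T" by (rule T)
  show "linmap (Vsp (J0, id)) (vext J0 Ob)" by (rule vext_lin)
  show "linmap (VOO Ob) (\<lambda>F j. F (J0, j))" by (simp add: linmap_def)
  { fix v assume v: "v \<in> Vsp (J0, id)"
    show hv: "Vmp (J0, id) (J0, id) h v \<in> Vsp (J0, id)" by (rule V.mp_in[OF J0_obj(3,3) hm v])
    show "vext J0 Ob v \<in> VOO Ob" by (rule vext_in[OF v])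
    show "(\<lambda>j. vext J0 Ob v (J0, j)) = v" by (rule vext_0[OF v])
    show "T (vext J0 Ob v) = vext J0 Ob (Vmp (J0, id) (J0, id) h v)"
      using vext_restr[OF T(2)[OF vext_in[OF v]]] com[OF vext_in[OF v]] vext_0[OF v] by simp }
  { fix F assume F: "F \<in> VOO Ob"
    show "T F \<in> VOO Ob" by (rule T(2)[OF F])
    show "(\<lambda>j. F (J0, j)) \<in> Vsp (J0, id)" by (rule VO_D(1)[OF F J0])
    show "vext J0 Ob (\<lambda>j. F (J0, j)) = F" by (rule vext_restr[OF F]) }
qed

end

lemma VO_eframe: "\<exists>K b. eframe (VOO Ob) K b"
  using VO_eframe_ex orb_ne[OF Ob] by blast

end

end

end

section \<open>The trace of a substitution\<close>

lemma pobj_decode: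
  assumes "finite J" "J \<in> \<pi>"
  shows "set_encode J \<in> fst (pobj t \<pi>)" "snd (pobj t \<pi>) (set_encode J) = set_encode (t ` J)"
  using assms by (simp_all add: pobj_def set_encode_inverse)

lemma set_encode_bij: "(\<And>J. J \<in> \<pi> \<Longrightarrow> finite J) \<Longrightarrow> bij_betw set_encode \<pi> (set_encode ` \<pi>)"
  unfolding bij_betw_def inj_on_def by (metis set_encode_inverse)

text \<open>\<open>set_encode\<close> is injective on finite sets, so the coded partition is
  isomorphic to the partition with the permutations induced on blocks.\<close>

lemma pobj_gset:
  assumes "gset r \<pi> ((`) t) ((`) f)" "\<And>J. J \<in> \<pi> \<Longrightarrow> finite J"
  shows "gset r (fst (pobj t \<pi>)) (snd (pobj t \<pi>)) (blockmap f)"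
    "gtype r (fst (pobj t \<pi>)) (snd (pobj t \<pi>)) (blockmap f) = gtype r \<pi> ((`) t) ((`) f)"
proof -
  have b: "bij_betw set_encode \<pi> (fst (pobj t \<pi>))" using set_encode_bij[OF assms(2)] by (simp add: pobj_def)
  have e: "set_encode (t ` J) = snd (pobj t \<pi>) (set_encode J)" "set_encode (f ` J) = blockmap f (set_encode J)" if "J \<in> \<pi>" for J
    using assms(2)[OF that] that by (simp_all add: pobj_decode blockmap_def set_encode_inverse)
  show "gset r (fst (pobj t \<pi>)) (snd (pobj t \<pi>)) (blockmap f)" by (rule gset_iso[OF assms(1) b e])
  show "gtype r (fst (pobj t \<pi>)) (snd (pobj t \<pi>)) (blockmap f) = gtype r \<pi> ((`) t) ((`) f)"
    by (rule gtype_iso[OF assms(1) b e, symmetric])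
qed

section \<open>Transport of partitions, orbits and tensors along the automorphism\<close>

context bcomp
begin

interpretation gset r I t s by (rule gst)
interpretation Z: gset r I t id by (rule gset_id)

abbreviation "si \<equiv> inv_into I s"
abbreviation "simg f \<pi> \<equiv> (\<lambda>J. f ` J) ` \<pi>"

lemma si_s: "x \<in> I \<Longrightarrow> si (s x) = x" "x \<in> I \<Longrightarrow> s (si x) = x" "x \<in> I \<Longrightarrow> si x \<in> I"
  using sbij by (auto simp: bij_betw_def f_inv_into_f inv_into_into)

text \<open>\<open>Phi\<close> and \<open>comp_mp\<close> index target data through preimages, so
  transport is needed along the inverse of \<open>s\<close> too.\<close>

lemma si_gset: "gset r I t si"
proof
  show "1 \<le> r" by (rule r)
  show "finite I" by (rule fin)
  show "bij_betw t I I" by (rule tbij)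
  show "bij_betw si I I" by (rule bij_betw_inv_into[OF sbij])
  fix x assume x: "x \<in> I"
  show "(t ^^ r) x = x" by (rule tr[OF x])
  show "(t ^^ k) x \<noteq> x" if "0 < k" "k < r" for k by (rule free[OF x that])
  have "si (t (s (si x))) = si (s (t (si x)))" using comm[of "si x"] si_s x by simp
  then show "t (si x) = si (t x)" using si_s x by simp
qed

lemma si_img: "J \<subseteq> I \<Longrightarrow> si ` s ` J = J" "J \<subseteq> I \<Longrightarrow> s ` si ` J = J"
  using si_s by (force simp: image_image)+

lemma simg_parts:
  assumes f: "gset r I t f" and \<pi>: "\<pi> \<in> prts"
  shows "simg f \<pi> \<in> prts"
proof -
  interpret F: gset r I t f by (rule f)
  have sub: "J \<subseteq> I" if "J \<in> \<pi>" for J by (rule Z.block_sub[OF \<pi> that])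
  have inj: "J = J'" if "J \<in> \<pi>" "J' \<in> \<pi>" "f ` J = f ` J'" for J J'
    using inj_on_image_eq_iff[of f I J J'] F.sbij sub that by (auto simp: bij_betw_def)
  have fs: "f ` I = I" using F.sbij by (simp add: bij_betw_def)
  have ft: "(t ^^ k) ` f ` J = f ` (t ^^ k) ` J" if "J \<subseteq> I" for J k
    unfolding image_image by (rule image_cong[OF refl]) (use F.comm1 that in auto)
  show ?thesis
    unfolding gparts_def
  proof (rule CollectI, intro conjI ballI impI allI)
    show "\<Union> (simg f \<pi>) = I"
    proof -
      have "\<Union> (simg f \<pi>) = f ` \<Union>\<pi>" by blast
      moreover have "\<Union>\<pi> = I" using \<pi> by (simp add: gparts_def)
      ultimately show ?thesis using fs by simp
    qed
    fix L assume "L \<in> simg f \<pi>"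
    then obtain J where J: "J \<in> \<pi>" "L = f ` J" by (rule imageE)
    show "L \<noteq> {}" using Z.block_ne[OF \<pi> J(1)] J by simp
    show "t ` L \<in> simg f \<pi>" using ft[OF sub[OF J(1)], of 1] Z.block_t[OF \<pi> J(1)] J by simp
    show "id ` L \<in> simg f \<pi>" using J by simp
    { fix L' assume "L' \<in> simg f \<pi>" and ne: "L \<noteq> L'"
      then obtain J' where J': "J' \<in> \<pi>" "L' = f ` J'" by (metis imageE)
      have "J \<inter> J' = {}" using Z.block_eq[OF \<pi> J(1) J'(1)] ne J J' by blast
      moreover have "f ` J \<inter> f ` J' = f ` (J \<inter> J')"
        using inj_on_image_Int[of f I J J'] F.sbij sub J J' by (auto simp: bij_betw_def)
      ultimately show "L \<inter> L' = {}" using J J' by simp }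
    fix k assume k: "0 < k \<and> k < r"
    have tJ: "(t ^^ k) ` J \<in> \<pi>"
    proof -
      interpret P: gset r \<pi> "(`) t" "(`) id" by (rule Z.gset_gpart[OF \<pi>])
      show ?thesis using P.tpX[OF J(1), of k] by (simp add: image_funpow)
    qed
    show "(t ^^ k) ` L \<noteq> L"
    proof
      assume "(t ^^ k) ` L = L"
      then have "(t ^^ k) ` J = J" using ft[OF sub[OF J(1)], of k] inj[OF tJ J(1)] J by simp
      then show False using \<pi> J k unfolding gparts_def by blast
    qed
  qed
qed

lemma simg_inv: "\<pi> \<in> prts \<Longrightarrow> simg si (simg s \<pi>) = \<pi>" "\<pi> \<in> prts \<Longrightarrow> simg s (simg si \<pi>) = \<pi>"
proof -
  assume \<pi>: "\<pi> \<in> prts"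
  have "simg si (simg s \<pi>) = (\<lambda>J. J) ` \<pi>" unfolding image_image[of "(`) si"]
    by (rule image_cong[OF refl]) (rule si_img(1)[OF Z.block_sub[OF \<pi>]])
  then show "simg si (simg s \<pi>) = \<pi>" by simp
  have "simg s (simg si \<pi>) = (\<lambda>J. J) ` \<pi>" unfolding image_image[of "(`) s"]
    by (rule image_cong[OF refl]) (rule si_img(2)[OF Z.block_sub[OF \<pi>]])
  then show "simg s (simg si \<pi>) = \<pi>" by simp
qed

text \<open>\<open>f\<close> gives an isomorphism between the two partitions, seen as free sets with
  trivial automorphism, and isomorphisms induce bijections of orbits.\<close>

lemma simg_orbs_bij:
  assumes f: "gset r I t f" and \<pi>: "\<pi> \<in> prts"
  shows "bij_betw (simg f) (orbs \<pi>) (orbs (simg f \<pi>))"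
proof -
  interpret F: gset r I t f by (rule f)
  note \<pi>' = simg_parts[OF f \<pi>]
  interpret P: gset r \<pi> "(`) t" "(`) id" by (rule Z.gset_gpart[OF \<pi>])
  interpret P': gset r "simg f \<pi>" "(`) t" "(`) id" by (rule Z.gset_gpart[OF \<pi>'])
  interpret Q: gset_pair r \<pi> "(`) t" "(`) id" "simg f \<pi>" "(`) t" "(`) id" ..
  have inj: "inj_on (\<lambda>J. f ` J) \<pi>"
  proof (rule inj_onI)
    fix J J' assume "J \<in> \<pi>" "J' \<in> \<pi>" "f ` J = f ` J'"
    then show "J = J'"
      using inj_on_image_eq_iff[of f I J J'] F.sbij Z.block_sub[OF \<pi>] by (auto simp: bij_betw_def)
  qed
  have ft: "f ` t ` J = t ` f ` J" if "J \<in> \<pi>" for J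
    unfolding image_image by (rule image_cong[OF refl]) (use F.comm Z.block_sub[OF \<pi> that] in auto)
  have "restrict (\<lambda>J. f ` J) \<pi> \<in> Q.giso"
    unfolding Q.giso_def ghom_def
    using inj ft P.tX by (auto simp: bij_betw_def intro: inj_on_restrict_eq[THEN iffD2])
  from Q.giso_cyc_bij[OF this]
  have b: "bij_betw ((`) (restrict (\<lambda>J. f ` J) \<pi>)) (orbs \<pi>) (orbs (simg f \<pi>))" unfolding orbs_cyc .
  have "restrict (\<lambda>J. f ` J) \<pi> ` Ob = simg f Ob" if "Ob \<in> orbs \<pi>" for Ob
    by (rule image_cong[OF refl]) (use orb_block[OF \<pi> that] in auto)
  then show ?thesis using bij_betw_cong[of "orbs \<pi>" "(`) (restrict (\<lambda>J. f ` J) \<pi>)" "simg f"] b by blast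
qed

lemma simg_orb: "gset r I t f \<Longrightarrow> \<pi> \<in> prts \<Longrightarrow> Ob \<in> orbs \<pi> \<Longrightarrow> simg f Ob \<in> orbs (simg f \<pi>)"
  using simg_orbs_bij[of f \<pi>] by (auto simp: bij_betw_def)

abbreviation "VM Ob \<equiv> VOmap Vmp (I, t) s Ob"

context
  fixes \<pi> assumes \<pi>: "\<pi> \<in> prts"
begin

context
  fixes Ob assumes Ob: "Ob \<in> orbs \<pi>"
begin

lemma simg_Ob: "simg s Ob \<in> orbs (simg s \<pi>)"
  by (rule simg_orb[OF gst \<pi> Ob])

lemma sJ_free: "J \<in> Ob \<Longrightarrow> free_obj 1 (s ` J, id)"
  by (rule block_free[OF simg_parts[OF gst \<pi>] simg_Ob]) simp

lemma VM_at: "J \<in> Ob \<Longrightarrow> (\<lambda>j. VM Ob F (s ` J, j)) = Vmp (J, id) (s ` J, id) s (\<lambda>j. F (J, j))"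
proof -
  assume J: "J \<in> Ob"
  have "si ` s ` J = J" by (rule si_img(1)[OF block_I[OF \<pi> Ob J]])
  then show ?thesis using J by (simp add: VOmap_def)
qed

text \<open>Invariance of the family under \<open>t\<close> survives because
  \<open>s \<circ> t\<close> and \<open>t \<circ> s\<close> agree on blocks and V is a
  functor.\<close>

lemma VM_in: "F \<in> VO Vsp Vmp t Ob \<Longrightarrow> VM Ob F \<in> VO Vsp Vmp t (simg s Ob)"
proof (rule VO_I[OF \<pi>])
  assume F: "F \<in> VO Vsp Vmp t Ob"
  fix L assume "L \<in> simg s Ob"
  then obtain J where J: "J \<in> Ob" "L = s ` J" by (rule imageE)
  note JI = block_I[OF \<pi> Ob J(1)] and FJ = VO_D(1)[OF \<pi> F J(1)]
  have fJ: "free_obj 1 (J, id)" "free_obj 1 (s ` J, id)" "free_obj 1 (t ` J, id)" "free_obj 1 (s ` t ` J, id)"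
    using block_free[OF \<pi> Ob] sJ_free J orb_t1[OF \<pi> Ob J(1)] by auto
  have sI: "s ` J \<subseteq> I" using JI by auto
  show "(\<lambda>j. VM Ob F (L, j)) \<in> Vsp (L, id)"
    unfolding J(2) VM_at[OF J(1)] by (rule V.mp_in[OF fJ(1,2) morph_s[OF \<pi> JI] FJ])
  have ts: "t ` s ` J = s ` t ` J" unfolding image_image
    by (rule image_cong[OF refl]) (use comm JI in auto)
  have m: "morph (s ` J, id) (s ` t ` J, id) t" using morph_t[OF \<pi> sI] unfolding ts .
  have tI: "t ` J \<subseteq> I" using JI by auto
  have "(\<lambda>j. VM Ob F (t ` L, j)) = Vmp (t ` J, id) (s ` t ` J, id) s (Vmp (J, id) (t ` J, id) t (\<lambda>j. F (J, j)))"
    unfolding J(2) ts VM_at[OF orb_t1[OF \<pi> Ob J(1)]] VO_D(3)[OF \<pi> F J(1)] ..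
  also have "\<dots> = Vmp (J, id) (s ` t ` J, id) (s \<circ> t) (\<lambda>j. F (J, j))"
    by (rule V.mp_comp[OF fJ(1,3,4) morph_t[OF \<pi> JI] morph_s[OF \<pi> tI] FJ])
  also have "\<dots> = Vmp (J, id) (s ` t ` J, id) (t \<circ> s) (\<lambda>j. F (J, j))"
    by (rule V.mp_cong[OF fJ(1,4) V.morph_comp[OF morph_t[OF \<pi> JI] morph_s[OF \<pi> tI]] _ FJ])
      (use comm JI in auto)
  also have "\<dots> = Vmp (s ` J, id) (s ` t ` J, id) t (Vmp (J, id) (s ` J, id) s (\<lambda>j. F (J, j)))"
    by (rule V.mp_comp[OF fJ(1,2,4) morph_s[OF \<pi> JI] m FJ, symmetric])
  finally show "(\<lambda>j. VM Ob F (t ` L, j)) = Vmp (L, id) (t ` L, id) t (\<lambda>j. VM Ob F (L, j))"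
    unfolding J(2) VM_at[OF J(1)] ts .
next
  show "VM Ob F (L, j) = 0" if "L \<notin> simg s Ob" for L j using that by (simp add: VOmap_def)
qed

lemma VM_lin: "linmap (VO Vsp Vmp t Ob) (VM Ob)"
  unfolding linmap_def
proof (intro ballI allI ext)
  fix u v c d and p :: "nat set \<times> 'j" assume u: "u \<in> VO Vsp Vmp t Ob" and v: "v \<in> VO Vsp Vmp t Ob"
  obtain L j where p: "p = (L, j)" by (cases p)
  show "VM Ob (\<lambda>i. c * u i + d * v i) p = c * VM Ob u p + d * VM Ob v p"
  proof (cases "L \<in> simg s Ob")
    case True
    then obtain J where J: "J \<in> Ob" "L = s ` J" by (metis imageE)
    have "linmap (Vsp (J, id)) (Vmp (J, id) (s ` J, id) s)"
      by (rule V.mp_lin[OF block_free[OF \<pi> Ob J(1)] sJ_free[OF J(1)] morph_s[OF \<pi> block_I[OF \<pi> Ob J(1)]]])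
    then show ?thesis
      unfolding p J(2)
      using fun_cong[OF VM_at[OF J(1), of u], of j] fun_cong[OF VM_at[OF J(1), of v], of j]
        fun_cong[OF VM_at[OF J(1), of "\<lambda>i. c * u i + d * v i"], of j]
        VO_D(1)[OF \<pi> u J(1)] VO_D(1)[OF \<pi> v J(1)] unfolding linmap_def by simp
  next
    case False
    then show ?thesis by (simp add: p VOmap_def)
  qed
qed

end

lemma block_finite: "J \<in> \<pi> \<Longrightarrow> finite J"
  using Z.block_sub[OF \<pi>] fin finite_subset by blast

lemma pobj_free: "free_obj r (pobj t \<pi>)"
proof -
  have "gset r (fst (pobj t \<pi>)) (snd (pobj t \<pi>)) (blockmap id)"
    by (rule pobj_gset(1)[OF Z.gset_gpart[OF \<pi>] block_finite])
  then have "gset r (fst (pobj t \<pi>)) (snd (pobj t \<pi>)) id" by (rule gset.gset_id)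
  moreover have "snd (pobj t \<pi>) c = c" if "c \<notin> fst (pobj t \<pi>)" for c
    using that by (simp add: pobj_def)
  ultimately have "free_obj r (fst (pobj t \<pi>), snd (pobj t \<pi>))" using free_obj_gset[OF r] by blast
  then show ?thesis by simp
qed

end

lemma blockmap_morph:
  assumes \<pi>: "\<pi> \<in> prts"
  shows "morph (pobj t \<pi>) (pobj t (simg s \<pi>)) (blockmap s)"
proof -
  note \<pi>' = simg_parts[OF gst \<pi>]
  have fJ: "finite J" if "J \<in> \<pi>" for J by (rule block_finite[OF \<pi> that])
  have sf: "finite (s ` J)" if "J \<in> \<pi>" for J using fJ[OF that] by simp
  have bm: "blockmap s (set_encode J) = set_encode (s ` J)" if "J \<in> \<pi>" for J
    using fJ[OF that] by (simp add: blockmap_def set_encode_inverse)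
  have inj: "inj_on (blockmap s) (set_encode ` \<pi>)"
  proof (rule inj_onI)
    fix c d assume "c \<in> set_encode ` \<pi>" "d \<in> set_encode ` \<pi>" and eq: "blockmap s c = blockmap s d"
    then obtain J L where J: "J \<in> \<pi>" "c = set_encode J" and L: "L \<in> \<pi>" "d = set_encode L" by blast
    have "s ` J = s ` L" using eq J L bm sf by (metis set_encode_inverse)
    then have "J = L"
      using inj_on_image_eq_iff[of s I J L] sbij Z.block_sub[OF \<pi>] J L by (auto simp: bij_betw_def)
    then show "c = d" using J L by simp
  qed
  have im: "blockmap s ` set_encode ` \<pi> = set_encode ` simg s \<pi>"
    unfolding image_image by (rule image_cong[OF refl]) (rule bm)
  have "blockmap s (snd (pobj t \<pi>) (set_encode J)) = snd (pobj t (simg s \<pi>)) (blockmap s (set_encode J))"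
    if J: "J \<in> \<pi>" for J
  proof -
    have "s ` t ` J = t ` s ` J" unfolding image_image
      by (rule image_cong[OF refl]) (use comm Z.block_sub[OF \<pi> J] in auto)
    then show ?thesis
      using pobj_decode(2)[OF fJ[OF J] J] pobj_decode(2)[OF sf[OF J], of "simg s \<pi>" t] bm J Z.block_t[OF \<pi> J] by simp
  qed
  then show ?thesis unfolding morph_def bij_betw_def using inj im by (auto simp: pobj_def)
qed

abbreviation "CC \<pi> \<equiv> Comp Usp Vsp Vmp (I, t) \<pi>"
abbreviation "PH \<pi> \<equiv> Phi Usp Ump Vsp Vmp (I, t) (I, t) s \<pi>"

text \<open>Turns the description in \<open>Phi\<close> into equations, by
  \<open>tensor_map_ex1\<close> with the bijection of orbits induced by the inverse of
  \<open>s\<close>.\<close>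

lemma Phi_spec:
  assumes \<pi>: "\<pi> \<in> prts"
  shows "linmap (CC \<pi>) (PH \<pi>)"
    and "\<And>u F. u \<in> Usp (pobj t \<pi>) \<Longrightarrow> (\<And>Ob. Ob \<in> orbs \<pi> \<Longrightarrow> F Ob \<in> VO Vsp Vmp t Ob) \<Longrightarrow>
      PH \<pi> (\<lambda>(a, x). u a * ptens (orbs \<pi>) F x) =
      (\<lambda>(a, x). Ump (pobj t \<pi>) (pobj t (simg s \<pi>)) (blockmap s) u a *
         ptens (orbs (simg s \<pi>)) (\<lambda>Ob'. VM (simg si Ob') (F (simg si Ob'))) x)"
proof -
  note \<pi>' = simg_parts[OF gst \<pi>]
  obtain AI bU where U: "eframe (Usp (pobj t \<pi>)) AI bU" using ex_eframe[OF U.sp(2)[OF pobj_free[OF \<pi>]]] by blast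
  have "\<forall>Ob\<in>orbs \<pi>. \<exists>Kb. eframe (VO Vsp Vmp t Ob) (fst Kb) (snd Kb)"
  proof
    fix Ob assume "Ob \<in> orbs \<pi>"
    then obtain K b where "eframe (VO Vsp Vmp t Ob) K b" using VO_eframe[OF \<pi>] by blast
    then show "\<exists>Kb. eframe (VO Vsp Vmp t Ob) (fst Kb) (snd Kb)" by (intro exI[of _ "(K, b)"]) simp
  qed
  from bchoice[OF this] obtain Kb where Kb: "\<And>Ob. Ob \<in> orbs \<pi> \<Longrightarrow> eframe (VO Vsp Vmp t Ob) (fst (Kb Ob)) (snd (Kb Ob))"
    by blast
  have sib: "bij_betw (simg si) (orbs (simg s \<pi>)) (orbs \<pi>)"
    using simg_orbs_bij[OF si_gset \<pi>'] unfolding simg_inv(1)[OF \<pi>] .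
  have ex: "\<exists>!g. (\<forall>v. v \<notin> tens (Usp (pobj t \<pi>)) (orbs \<pi>) (VO Vsp Vmp t) \<longrightarrow> g v = (\<lambda>_. 0)) \<and>
      linmap (tens (Usp (pobj t \<pi>)) (orbs \<pi>) (VO Vsp Vmp t)) g \<and>
     (\<forall>u F. u \<in> Usp (pobj t \<pi>) \<and> (\<forall>Ob\<in>orbs \<pi>. F Ob \<in> VO Vsp Vmp t Ob) \<longrightarrow>
        g (\<lambda>(a, x). u a * ptens (orbs \<pi>) F x) = (\<lambda>(a, x). Ump (pobj t \<pi>) (pobj t (simg s \<pi>)) (blockmap s) u a *
         ptens (orbs (simg s \<pi>)) (\<lambda>Ob'. VM (simg si Ob') (F (simg si Ob'))) x))"
  proof (rule tensor_map_ex1[OF finite_orbs[OF \<pi>] U.sp(1)[OF pobj_free[OF \<pi>]] U VO_subspc[OF \<pi>] Kb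
      U.mp_lin[OF pobj_free[OF \<pi>] pobj_free[OF \<pi>'] blockmap_morph[OF \<pi>]] sib])
    fix Ob' assume "Ob' \<in> orbs (simg s \<pi>)"
    then have "simg si Ob' \<in> orbs \<pi>" using sib by (auto simp: bij_betw_def)
    then show "linmap (VO Vsp Vmp t (simg si Ob')) (VM (simg si Ob'))" by (rule VM_lin[OF \<pi>])
  qed
  from theI'[OF this] have P: "(\<forall>v. v \<notin> CC \<pi> \<longrightarrow> PH \<pi> v = (\<lambda>_. 0)) \<and> linmap (CC \<pi>) (PH \<pi>) \<and>
     (\<forall>u F. u \<in> Usp (pobj t \<pi>) \<and> (\<forall>Ob\<in>orbs \<pi>. F Ob \<in> VO Vsp Vmp t Ob) \<longrightarrow>
        PH \<pi> (\<lambda>(a, x). u a * ptens (orbs \<pi>) F x) = (\<lambda>(a, x). Ump (pobj t \<pi>) (pobj t (simg s \<pi>)) (blockmap s) u a *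
         ptens (orbs (simg s \<pi>)) (\<lambda>Ob'. VM (simg si Ob') (F (simg si Ob'))) x))"
    unfolding Phi_def Comp_tens fst_conv snd_conv .
  then show "linmap (CC \<pi>) (PH \<pi>)" by blast
  fix u F assume "u \<in> Usp (pobj t \<pi>)" "\<And>Ob. Ob \<in> orbs \<pi> \<Longrightarrow> F Ob \<in> VO Vsp Vmp t Ob"
  then show "PH \<pi> (\<lambda>(a, x). u a * ptens (orbs \<pi>) F x) = (\<lambda>(a, x). Ump (pobj t \<pi>) (pobj t (simg s \<pi>)) (blockmap s) u a *
         ptens (orbs (simg s \<pi>)) (\<lambda>Ob'. VM (simg si Ob') (F (simg si Ob'))) x)"
    using P by blast
qed

lemma CC_tens: "CC \<pi> = tens (Usp (pobj t \<pi>)) (orbs \<pi>) (VO Vsp Vmp t)"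
  by (simp add: Comp_tens)

lemma CC_subspc: "subspc (CC \<pi>)"
  unfolding CC_tens by (rule tens_subspc)

text \<open>Landing in the target is a linear condition on \<open>v\<close>, hence tested on pure
  tensors.\<close>

lemma Phi_in:
  assumes \<pi>: "\<pi> \<in> prts" and v: "v \<in> CC \<pi>"
  shows "PH \<pi> v \<in> CC (simg s \<pi>)"
proof -
  note \<pi>' = simg_parts[OF gst \<pi>]
  let ?P = "{v \<in> CC \<pi>. PH \<pi> v \<in> CC (simg s \<pi>)}"
  have sc: "subspc ?P"
  proof -
    have comb: "(\<lambda>i. c * u i + d * v i) \<in> ?P" if "u \<in> ?P" "v \<in> ?P" for u v c d
    proof -
      have "PH \<pi> (\<lambda>i. c * u i + d * v i) = (\<lambda>i. c * PH \<pi> u i + d * PH \<pi> v i)"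
        using Phi_spec(1)[OF \<pi>] that unfolding linmap_def by simp
      then show ?thesis using that subspc_lin[OF CC_subspc] by simp
    qed
    have z: "(\<lambda>_. 0) \<in> ?P"
      using linmap_zero[OF CC_subspc Phi_spec(1)[OF \<pi>]] CC_subspc[of \<pi>] CC_subspc[of "simg s \<pi>"]
      by (simp add: subspc_def)
    show ?thesis unfolding subspc_def
    proof (intro conjI ballI allI z)
      fix u v assume "u \<in> ?P" "v \<in> ?P" from comb[OF this, of 1 1] show "(\<lambda>i. u i + v i) \<in> ?P" by simp
    next
      fix c u assume "u \<in> ?P" from comb[OF this z, of c 0] show "(\<lambda>i. c * u i) \<in> ?P" by simp
    qed
  qed
  have "CC \<pi> \<subseteq> ?P"
    unfolding CC_tens[of \<pi>]
  proof (rule tens_least)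
    show "subspc {v \<in> tens (Usp (pobj t \<pi>)) (orbs \<pi>) (VO Vsp Vmp t). PH \<pi> v \<in> CC (simg s \<pi>)}"
      using sc unfolding CC_tens[of \<pi>] .
    fix u F assume u: "u \<in> Usp (pobj t \<pi>)" and F: "\<And>Ob. Ob \<in> orbs \<pi> \<Longrightarrow> F Ob \<in> VO Vsp Vmp t Ob"
    have e: "PH \<pi> (\<lambda>(a, x). u a * ptens (orbs \<pi>) F x) = (\<lambda>(a, x). Ump (pobj t \<pi>) (pobj t (simg s \<pi>)) (blockmap s) u a *
         ptens (orbs (simg s \<pi>)) (\<lambda>Ob'. VM (simg si Ob') (F (simg si Ob'))) x)"
      by (rule Phi_spec(2)[OF \<pi> u]) (rule F)
    have "PH \<pi> (\<lambda>(a, x). u a * ptens (orbs \<pi>) F x) \<in> CC (simg s \<pi>)"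
      unfolding e CC_tens
    proof (rule tens_pure)
      show "Ump (pobj t \<pi>) (pobj t (simg s \<pi>)) (blockmap s) u \<in> Usp (pobj t (simg s \<pi>))"
        by (rule U.mp_in[OF pobj_free[OF \<pi>] pobj_free[OF \<pi>'] blockmap_morph[OF \<pi>] u])
      fix Ob' assume Ob': "Ob' \<in> orbs (simg s \<pi>)"
      have o: "simg si Ob' \<in> orbs \<pi>" using simg_orb[OF si_gset \<pi>' Ob'] unfolding simg_inv(1)[OF \<pi>] .
      have "simg s (simg si Ob') = (\<lambda>J. J) ` Ob'" unfolding image_image[of "(`) s"]
        by (rule image_cong[OF refl]) (rule si_img(2)[OF block_I[OF \<pi>' Ob']])
      then show "VM (simg si Ob') (F (simg si Ob')) \<in> VO Vsp Vmp t Ob'"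
        using VM_in[OF \<pi> o F[OF o]] by simp
    qed
    moreover have "(\<lambda>(a, x). u a * ptens (orbs \<pi>) F x) \<in> tens (Usp (pobj t \<pi>)) (orbs \<pi>) (VO Vsp Vmp t)"
      by (rule tens_pure[OF u]) (rule F)
    ultimately show "(\<lambda>(a, x). u a * ptens (orbs \<pi>) F x) \<in> {v \<in> tens (Usp (pobj t \<pi>)) (orbs \<pi>) (VO Vsp Vmp t). PH \<pi> v \<in> CC (simg s \<pi>)}"
      by (intro CollectI conjI)
  qed
  then show ?thesis using v by blast
qed

text \<open>\<open>s\<close> permutes the \<open>t\<close>-orbits of blocks, and each cycle of this
  permutation fills one joint orbit \<open>c\<close>. One turn carries a block J to its translate by
  \<open>csh\<close> steps of \<open>t\<close>; read back at the component J of an invariant family,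
  this is the action of \<open>btau c\<close>.\<close>

lemma block_cycles_trace:
  assumes \<pi>: "\<pi> \<in> gparts r I t s"
    and Kb: "\<And>Ob. Ob \<in> orbs \<pi> \<Longrightarrow> eframe (VO Vsp Vmp t Ob) (K Ob) (b Ob)"
  shows "(\<Sum>x\<in>PiE (orbs \<pi>) K. \<Prod>Ob\<in>orbs \<pi>. VM Ob (b Ob (x Ob)) (x (simg s Ob)))
    = (\<Prod>c\<in>cyc ((`) t) ((`) s) \<pi>. mchar Vsp Vmp (SOME J. J \<in> c, id) (btau c))"
proof -
  have \<pi>0: "\<pi> \<in> prts" and st: "simg s \<pi> = \<pi>" using \<pi> unfolding gparts_stable by auto
  interpret P: gset r \<pi> "(`) t" "(`) s" by (rule gset_gpart[OF \<pi>])
  interpret P0: gset r \<pi> "(`) t" "(`) id" by (rule Z.gset_gpart[OF \<pi>0])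
  let ?D = "cyc ((`) t) ((`) s) \<pi>"
  define J where "J d = (SOME J. J \<in> d)" for d :: "nat set set"
  \<comment> \<open>The \<open>t\<close>-orbit at which the turn around \<open>d\<close> starts;
    \<open>cc d\<close> will collect all \<open>t\<close>-orbits inside \<open>d\<close>.\<close>
  define \<rho> where "\<rho> d = {(t ^^ k) ` J d | k. True}" for d
  define cc where "cc d = {Ob \<in> orbs \<pi>. Ob \<subseteq> d}" for d
  have Jd: "J d \<in> d" if "d \<in> ?D" for d unfolding J_def using P.cyc_ne[OF that] some_in_eq by blast
  have J\<pi>: "J d \<in> \<pi>" if "d \<in> ?D" for d using P.cyc_mem[OF that Jd[OF that]] by blast
  have orbJ: "{(t ^^ k) ` L | k. True} \<in> orbs \<pi>" if "L \<in> \<pi>" for L using that unfolding orbits_def by blast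
  have tL: "(t ^^ a) ` (s ^^ b) ` L \<in> d" if "d \<in> ?D" "L \<in> d" for a b d L
    using P.cyc_t[OF that, of a b] by (simp add: image_funpow)
  have sp: "(simg s ^^ k) {(t ^^ a) ` L | a. True} = {(t ^^ a) ` (s ^^ k) ` L | a. True}" if "L \<in> \<pi>" for k L
  proof (induction k)
    case (Suc k)
    have "s ` (t ^^ a) ` (s ^^ k) ` L = (t ^^ a) ` (s ^^ Suc k) ` L" for a
      unfolding image_image
      by (rule image_cong[OF refl]) (use block_sub[OF \<pi> that] in \<open>auto simp: comm1\<close>)
    then have "simg s {(t ^^ a) ` (s ^^ k) ` L | a. True} = {(t ^^ a) ` (s ^^ Suc k) ` L | a. True}" by blast
    then show ?case using Suc by simp
  qed simp
  have ccI: "{(t ^^ a) ` L | a. True} \<in> cc d" if "d \<in> ?D" "L \<in> d" for d L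
    unfolding cc_def using orbJ[of L] P.cyc_mem[OF that] tL[OF that, of _ 0] by auto
  have ccE: "\<exists>L\<in>d. Ob = {(t ^^ a) ` L | a. True}" if o: "Ob \<in> cc d" for Ob d
  proof -
    obtain L where "L \<in> Ob" using orb_ne[OF \<pi>0] o unfolding cc_def by blast
    then show ?thesis using orb_block[OF \<pi>0, of Ob L] o unfolding cc_def by blast
  qed
  have "(\<Sum>x\<in>PiE (orbs \<pi>) K. \<Prod>Ob\<in>orbs \<pi>. VM Ob (b Ob (x Ob)) (x (simg s Ob)))
    = (\<Prod>d\<in>?D. trace (VO Vsp Vmp t (\<rho> d)) (iter_along (simg s) VM (clen r d) (\<rho> d)))"
  proof (rule cycles_trace[where cc = cc])
    show "finite ?D" by (rule P.finite_cyc)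
    show "disjoint_family_on cc ?D"
      unfolding disjoint_family_on_def
    proof (intro ballI impI)
      fix d e assume d: "d \<in> ?D" and e: "e \<in> ?D" and "d \<noteq> e"
      show "cc d \<inter> cc e = {}"
      proof (rule ccontr)
        assume "cc d \<inter> cc e \<noteq> {}"
        then obtain Ob where "Ob \<in> orbs \<pi>" "Ob \<subseteq> d" "Ob \<subseteq> e" unfolding cc_def by blast
        moreover obtain L where "L \<in> Ob" using orb_ne[OF \<pi>0 \<open>Ob \<in> orbs \<pi>\<close>] by blast
        ultimately have "d = e" using P.cyc_eq[OF d e, of L] by blast
        then show False using \<open>d \<noteq> e\<close> by simp
      qed
    qed
    show "orbs \<pi> = (\<Union>d\<in>?D. cc d)"
    proof
      show "(\<Union>d\<in>?D. cc d) \<subseteq> orbs \<pi>" unfolding cc_def by blast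
      show "orbs \<pi> \<subseteq> (\<Union>d\<in>?D. cc d)"
      proof
        fix Ob assume Ob: "Ob \<in> orbs \<pi>"
        obtain L where L: "L \<in> Ob" using orb_ne[OF \<pi>0 Ob] by blast
        have L\<pi>: "L \<in> \<pi>" and Oe: "Ob = {(t ^^ k) ` L | k. True}" using orb_block[OF \<pi>0 Ob L] by auto
        have "Ob \<in> cc (orb ((`) t) ((`) s) L)" unfolding Oe by (rule ccI[OF P.orb_cyc[OF L\<pi>] P.orb_self])
        then show "Ob \<in> (\<Union>d\<in>?D. cc d)" using P.orb_cyc[OF L\<pi>] by blast
      qed
    qed
    show "\<And>Ob. Ob \<in> orbs \<pi> \<Longrightarrow> subspc (VO Vsp Vmp t Ob)" by (rule VO_subspc[OF \<pi>0])
    show "\<And>Ob. Ob \<in> orbs \<pi> \<Longrightarrow> eframe (VO Vsp Vmp t Ob) (K Ob) (b Ob)" by (rule Kb)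
    show "\<And>Ob. Ob \<in> orbs \<pi> \<Longrightarrow> linmap (VO Vsp Vmp t Ob) (VM Ob)" by (rule VM_lin[OF \<pi>0])
    show "\<And>Ob F. Ob \<in> orbs \<pi> \<Longrightarrow> F \<in> VO Vsp Vmp t Ob \<Longrightarrow> VM Ob F \<in> VO Vsp Vmp t (simg s Ob)" by (rule VM_in[OF \<pi>0])
    fix d assume d: "d \<in> ?D"
    let ?n = "clen r d" and ?k = "csh r ((`) t) ((`) s) d"
    note cs = P.cyc_struct[OF d Jd[OF d]]
    show "0 < ?n" by (rule cs(1))
    have \<rho>p: "(simg s ^^ k) (\<rho> d) = {(t ^^ a) ` (s ^^ k) ` J d | a. True}" for k
      unfolding \<rho>_def by (rule sp[OF J\<pi>[OF d]])
    have \<rho>L: "{(t ^^ a) ` (t ^^ e) ` L | a. True} = {(t ^^ a) ` L | a. True}" if "L \<in> \<pi>" for e L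
      using orb_block[OF \<pi>0 orbJ[OF that], of "(t ^^ e) ` L"] by blast
    have "(s ^^ ?n) ` J d = (t ^^ ?k) ` J d" using cs(3) by (simp add: image_funpow)
    then have "(simg s ^^ ?n) (\<rho> d) = {(t ^^ a) ` J d | a. True}"
      unfolding \<rho>p using \<rho>L[OF J\<pi>[OF d], of ?k] by simp
    then show "(simg s ^^ ?n) (\<rho> d) = \<rho> d" unfolding \<rho>_def[symmetric] .
    \<comment> \<open>Coinciding \<open>t\<close>-orbits would give one block two normal forms with
      different powers of \<open>s\<close>.\<close>
    have inj: "inj_on (\<lambda>k. (simg s ^^ k) (\<rho> d)) {..<?n}"
    proof (rule inj_onI)
      fix k k' assume k: "k \<in> {..<?n}" "k' \<in> {..<?n}" and eq: "(simg s ^^ k) (\<rho> d) = (simg s ^^ k') (\<rho> d)"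
      have "(s ^^ k) ` J d \<in> {(t ^^ a) ` (s ^^ k) ` J d | a. True}"
        by (rule CollectI, rule exI[of _ 0]) simp
      then have "(s ^^ k) ` J d \<in> {(t ^^ a) ` (s ^^ k') ` J d | a. True}"
        unfolding eq[unfolded \<rho>p] .
      then obtain a where "(s ^^ k) ` J d = (t ^^ a) ` (s ^^ k') ` J d" by blast
      then have "((`) s ^^ k) (J d) = ((`) t ^^ a) (((`) s ^^ k') (J d))" by (simp add: image_funpow)
      also have "\<dots> = ((`) t ^^ (a mod r)) (((`) s ^^ k') (J d))"
        by (rule P.t_mod[OF P.spX[OF J\<pi>[OF d]], symmetric])
      finally have "(\<lambda>(a, b). ((`) t ^^ a) (((`) s ^^ b) (J d))) (0, k) = (\<lambda>(a, b). ((`) t ^^ a) (((`) s ^^ b) (J d))) (a mod r, k')"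
        by simp
      then have "(0, k) = (a mod r, k')"
        using cs(4) k r unfolding bij_betw_def
        by (intro inj_onD[of "\<lambda>(a, b). ((`) t ^^ a) (((`) s ^^ b) (J d))" "{..<r} \<times> {..<?n}"]) auto
      then show "k = k'" by simp
    qed
    have "(\<lambda>k. (simg s ^^ k) (\<rho> d)) ` {..<?n} = cc d"
    proof
      show "(\<lambda>k. (simg s ^^ k) (\<rho> d)) ` {..<?n} \<subseteq> cc d"
        unfolding \<rho>p using ccI[OF d tL[OF d Jd[OF d], of 0]] by auto
      show "cc d \<subseteq> (\<lambda>k. (simg s ^^ k) (\<rho> d)) ` {..<?n}"
      proof
        fix Ob assume "Ob \<in> cc d"
        then obtain L where L: "L \<in> d" "Ob = {(t ^^ a) ` L | a. True}" using ccE by blast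
        have "L \<in> (\<lambda>(a, b). ((`) t ^^ a) (((`) s ^^ b) (J d))) ` ({..<r} \<times> {..<?n})"
          unfolding bij_betw_imp_surj_on[OF cs(4)] by (rule L(1))
        then obtain a k where ak: "k < ?n" "L = ((`) t ^^ a) (((`) s ^^ k) (J d))"
          by (elim imageE SigmaE) auto
        then have "L = (t ^^ a) ` (s ^^ k) ` J d" by (simp add: image_funpow)
        moreover have "(s ^^ k) ` J d \<in> \<pi>" using P.spX[OF J\<pi>[OF d], of k] by (simp add: image_funpow)
        ultimately have "Ob = (simg s ^^ k) (\<rho> d)" unfolding \<rho>p L(2) using \<rho>L by simp
        then show "Ob \<in> (\<lambda>k. (simg s ^^ k) (\<rho> d)) ` {..<?n}" using ak(1) by blast
      qed
    qed
    then show "bij_betw (\<lambda>k. (simg s ^^ k) (\<rho> d)) {..<?n} (cc d)" using inj by (simp add: bij_betw_def)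
    fix Ob assume "Ob \<in> cc d"
    then obtain L where L: "L \<in> d" "Ob = {(t ^^ a) ` L | a. True}" using ccE by blast
    have L\<pi>: "L \<in> \<pi>" using P.cyc_mem[OF d L(1)] by blast
    have "simg s Ob = {(t ^^ a) ` s ` L | a. True}" using sp[OF L\<pi>, of 1] unfolding L(2) by simp
    then show "simg s Ob \<in> cc d" using ccI[OF d tL[OF d L(1), of 0 1]] by simp
  qed
  also have "\<dots> = (\<Prod>c\<in>?D. mchar Vsp Vmp (SOME J. J \<in> c, id) (btau c))"
  proof (rule prod.cong[OF refl])
    fix d assume d: "d \<in> ?D"
    let ?n = "clen r d" and ?k = "csh r ((`) t) ((`) s) d"
    note cs = P.cyc_struct[OF d Jd[OF d]]
    let ?it = "\<lambda>n. iter_along (simg s) VM n (\<rho> d)"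
    let ?J = "J d"
    have \<rho>o: "\<rho> d \<in> orbs \<pi>" unfolding \<rho>_def by (rule orbJ[OF J\<pi>[OF d]])
    have Jr: "?J \<in> \<rho> d" unfolding \<rho>_def by (rule CollectI, rule exI[of _ 0]) simp
    have JI: "?J \<subseteq> I" by (rule block_I[OF \<pi>0 \<rho>o Jr])
    have fJ: "free_obj 1 (?J, id)" by (rule block_free[OF \<pi>0 \<rho>o Jr])
    have or: "(simg s ^^ n) (\<rho> d) \<in> orbs \<pi>" for n
    proof (induction n)
      case (Suc n)
      then show ?case using simg_orb[OF gst \<pi>0 Suc] unfolding st by simp
    qed (simp add: \<rho>o)
    have sJ: "(s ^^ n) ` ?J \<in> (simg s ^^ n) (\<rho> d)" for n
    proof (induction n)
      case (Suc n)
      have "s ` (s ^^ n) ` ?J = (s ^^ Suc n) ` ?J" by (simp add: image_comp)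
      then show ?case using imageI[OF Suc, of "\<lambda>J. s ` J"] by simp
    qed (simp add: Jr)
    have it_in: "?it n F \<in> VO Vsp Vmp t ((simg s ^^ n) (\<rho> d))" if "F \<in> VO Vsp Vmp t (\<rho> d)" for n F
    proof (induction n)
      case (Suc n)
      then show ?case using VM_in[OF \<pi>0 or Suc] by simp
    qed (simp add: that)
    have it_lin: "linmap (VO Vsp Vmp t (\<rho> d)) (?it n)" for n
    proof (induction n)
      case 0 show ?case by (simp add: linmap_def)
    next
      case (Suc n)
      show ?case unfolding linmap_def
      proof (intro ballI allI)
        fix u v c e assume u: "u \<in> VO Vsp Vmp t (\<rho> d)" and v: "v \<in> VO Vsp Vmp t (\<rho> d)"
        have "?it n (\<lambda>i. c * u i + e * v i) = (\<lambda>i. c * ?it n u i + e * ?it n v i)"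
          using Suc u v unfolding linmap_def by blast
        then show "?it (Suc n) (\<lambda>i. c * u i + e * v i) = (\<lambda>i. c * ?it (Suc n) u i + e * ?it (Suc n) v i)"
          using VM_lin[OF \<pi>0 or[of n]] it_in[OF u, of n] it_in[OF v, of n] unfolding linmap_def by simp
      qed
    qed
    have mor: "morph (?J, id) ((s ^^ n) ` ?J, id) (s ^^ n)" for n
      unfolding morph_1 using bij_betw_funpow[OF sbij, of n] JI by (auto simp: bij_betw_def intro: inj_on_subset)
    have fs: "free_obj 1 ((s ^^ n) ` ?J, id)" for n by (rule block_free[OF \<pi>0 or sJ])
    \<comment> \<open>Functoriality: at the block reached from \<open>?J\<close> after
      \<open>n\<close> steps the iterate is the V-map of \<open>s ^^ n\<close>.\<close>
    have it_at: "(\<lambda>j. ?it n F ((s ^^ n) ` ?J, j)) = Vmp (?J, id) ((s ^^ n) ` ?J, id) (s ^^ n) (\<lambda>j. F (?J, j))"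
      if F: "F \<in> VO Vsp Vmp t (\<rho> d)" for n F
    proof (induction n)
      case 0
      show ?case using V.mp_id[OF fJ _ VO_D(1)[OF \<pi>0 F Jr], of id] by (simp add: id_def)
    next
      case (Suc n)
      have e: "(s ^^ Suc n) ` ?J = s ` (s ^^ n) ` ?J" by (simp add: image_comp)
      have IH: "(\<lambda>j. ?it n F ((s ^^ n) ` ?J, j)) = Vmp (?J, id) ((s ^^ n) ` ?J, id) (s ^^ n) (\<lambda>j. F (?J, j))"
        using Suc by (simp add: id_def)
      have sI: "(s ^^ n) ` ?J \<subseteq> I" using JI by auto
      have f1: "free_obj 1 (s ` (s ^^ n) ` ?J, id)" using fs[of "Suc n"] unfolding e .
      have "(\<lambda>j. ?it (Suc n) F ((s ^^ Suc n) ` ?J, j))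
          = Vmp ((s ^^ n) ` ?J, id) (s ` (s ^^ n) ` ?J, id) s (Vmp (?J, id) ((s ^^ n) ` ?J, id) (s ^^ n) (\<lambda>j. F (?J, j)))"
        unfolding e using VM_at[OF \<pi>0 or sJ, of n "?it n F"] IH by simp
      also have "\<dots> = Vmp (?J, id) (s ` (s ^^ n) ` ?J, id) (s \<circ> (s ^^ n)) (\<lambda>j. F (?J, j))"
        by (rule V.mp_comp[OF fJ fs f1 mor morph_s[OF \<pi>0 sI] VO_D(1)[OF \<pi>0 F Jr]])
      also have "\<dots> = Vmp (?J, id) ((s ^^ Suc n) ` ?J, id) (s ^^ Suc n) (\<lambda>j. F (?J, j))"
        unfolding e by simp
      finally show ?case by (simp add: id_def comp_def)
    qed
    have ret: "(simg s ^^ ?n) (\<rho> d) = \<rho> d"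
    proof -
      have "(s ^^ ?n) ` ?J = (t ^^ ?k) ` ?J" using cs(3) by (simp add: image_funpow)
      then have "(s ^^ ?n) ` ?J \<in> \<rho> d" unfolding \<rho>_def by blast
      then have "\<rho> d = {(t ^^ k) ` (s ^^ ?n) ` ?J | k. True}" by (rule conjunct2[OF orb_block[OF \<pi>0 \<rho>o]])
      moreover have "(simg s ^^ ?n) (\<rho> d) = {(t ^^ k) ` (s ^^ ?n) ` ?J | k. True}"
        by (rule conjunct2[OF orb_block[OF \<pi>0 or sJ]])
      ultimately show ?thesis by (simp only:)
    qed
    interpret T: gset 1 ?J id "btau d" by (rule btau_gset[OF \<pi> d Jd[OF d]])
    have "trace (VO Vsp Vmp t (\<rho> d)) (?it ?n) = mchar Vsp Vmp (?J, id) (btau d)"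
    proof (rule VO_trace[OF \<pi>0 \<rho>o Jr it_lin])
      show "?it ?n F \<in> VO Vsp Vmp t (\<rho> d)" if "F \<in> VO Vsp Vmp t (\<rho> d)" for F
        using it_in[OF that, of ?n] unfolding ret .
      show "bij_betw (btau d) ?J ?J" by (rule T.sbij)
      fix F assume F: "F \<in> VO Vsp Vmp t (\<rho> d)"
      let ?G = "?it ?n F" and ?J' = "(s ^^ ?n) ` ?J"
      have G: "?G \<in> VO Vsp Vmp t (\<rho> d)" using it_in[OF F, of ?n] unfolding ret .
      have J'r: "?J' \<in> \<rho> d" using sJ[of ?n] unfolding ret .
      have im: "?J' = (t ^^ ?k) ` ?J" using cs(3) by (simp add: image_funpow)
      have bk: "(t ^^ (r - ?k)) ` ?J' = ?J"
      proof -
        have "(t ^^ (r - ?k)) ` ?J' = (\<lambda>x. x) ` ?J" unfolding im image_image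
          by (rule image_cong[OF refl]) (use JI tr cs(2) in \<open>auto simp: funpow_app subset_iff\<close>)
        then show ?thesis by simp
      qed
      have J'I: "?J' \<subseteq> I" using JI by auto
      have mb: "morph (?J', id) (?J, id) (t ^^ (r - ?k))" using morph_pow[OF \<pi>0 J'I, of "r - ?k"] unfolding bk .
      \<comment> \<open>By invariance the component at \<open>?J\<close> comes from the one at
        \<open>?J'\<close> through \<open>r - ?k\<close> translations; composed with the power of
        \<open>s\<close> this is \<open>btau d\<close>.\<close>
      have "(\<lambda>j. ?G (?J, j)) = Vmp (?J', id) (?J, id) (t ^^ (r - ?k)) (\<lambda>j. ?G (?J', j))"
        using VO_pow[OF \<pi>0 \<rho>o G J'r, of "r - ?k"] unfolding bk .
      also have "\<dots> = Vmp (?J', id) (?J, id) (t ^^ (r - ?k)) (Vmp (?J, id) (?J', id) (s ^^ ?n) (\<lambda>j. F (?J, j)))"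
        unfolding it_at[OF F] ..
      also have "\<dots> = Vmp (?J, id) (?J, id) (btau d) (\<lambda>j. F (?J, j))"
        unfolding btau_def[OF \<pi>] by (rule V.mp_comp[OF fJ fs fJ mor mb VO_D(1)[OF \<pi>0 F Jr]])
      finally show "(\<lambda>j. ?G (?J, j)) = Vmp (?J, id) (?J, id) (btau d) (\<lambda>j. F (?J, j))" .
    qed
    then show "trace (VO Vsp Vmp t (\<rho> d)) (?it ?n) = mchar Vsp Vmp (SOME J. J \<in> d, id) (btau d)"
      unfolding J_def .
  qed
  finally show ?thesis .
qed

section \<open>The direct sum over partitions\<close>

lemma curry_eta: "(\<lambda>(a, x). H (\<pi>, a, x)) = (\<lambda>q. H (\<pi>, q))"
  by (rule ext) (simp add: case_prod_beta)

lemma comp_sp_iff: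
  "H \<in> comp_sp r Usp Vsp Vmp (I, t) \<longleftrightarrow>
    (\<forall>\<pi> q. \<pi> \<notin> prts \<longrightarrow> H (\<pi>, q) = 0) \<and> (\<forall>\<pi>\<in>prts. (\<lambda>q. H (\<pi>, q)) \<in> CC \<pi>)"
  unfolding comp_sp_def parts_eq curry_eta by (simp add: split_paired_All)

lemma comp_mp_at:
  "comp_mp r Usp Ump Vsp Vmp (I, t) (I, t) s H (\<pi>, q) =
    (if \<pi> \<in> prts then PH (simg si \<pi>) (\<lambda>q. H (simg si \<pi>, q)) q else 0)"
  unfolding comp_mp_def parts_eq Let_def curry_eta by (cases q) simp

text \<open>The operator permutes the summands as \<open>s\<close> permutes partitions, so its
  diagonal comes from the stable ones. There a diagonal entry is one of U times one for each orbit
  of blocks, and the latter contract along cycles.\<close>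

theorem comp_trace:
  "trace (comp_sp r Usp Vsp Vmp (I, t)) (comp_mp r Usp Ump Vsp Vmp (I, t) (I, t) s)
    = (\<Sum>\<pi>\<in>gparts r I t s. mchar Usp Ump (pobj t \<pi>) (blockmap s) *
        (\<Prod>c\<in>cyc ((`) t) ((`) s) \<pi>. mchar Vsp Vmp (SOME J. J \<in> c, id) (btau c)))"
proof -
  let ?W = "comp_sp r Usp Vsp Vmp (I, t)" and ?T = "comp_mp r Usp Ump Vsp Vmp (I, t) (I, t) s"
  define K where "K Ob = fst (SOME Kb. eframe (VO Vsp Vmp t Ob) (fst Kb) (snd Kb))" for Ob
  define b where "b Ob = snd (SOME Kb. eframe (VO Vsp Vmp t Ob) (fst Kb) (snd Kb))" for Ob
  define AI where "AI \<pi> = fst (SOME Kb. eframe (Usp (pobj t \<pi>)) (fst Kb) (snd Kb))" for \<pi>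
  define bU where "bU \<pi> = snd (SOME Kb. eframe (Usp (pobj t \<pi>)) (fst Kb) (snd Kb))" for \<pi>
  have Kb: "eframe (VO Vsp Vmp t Ob) (K Ob) (b Ob)" if "\<pi> \<in> prts" "Ob \<in> orbs \<pi>" for \<pi> Ob
  proof -
    have "\<exists>Kb. eframe (VO Vsp Vmp t Ob) (fst Kb) (snd Kb)" using VO_eframe[OF that] by (metis fst_conv snd_conv)
    from someI_ex[OF this] show ?thesis unfolding K_def b_def .
  qed
  have Ub: "eframe (Usp (pobj t \<pi>)) (AI \<pi>) (bU \<pi>)" if "\<pi> \<in> prts" for \<pi>
  proof -
    have "\<exists>Kb. eframe (Usp (pobj t \<pi>)) (fst Kb) (snd Kb)"
      using ex_eframe[OF U.sp(2)[OF pobj_free[OF that]]] by (metis fst_conv snd_conv)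
    from someI_ex[OF this] show ?thesis unfolding AI_def bU_def .
  qed
  define IX where "IX \<pi> = AI \<pi> \<times> PiE (orbs \<pi>) K" for \<pi>
  define B where "B \<pi> = (\<lambda>(a, x) (a', x'). bU \<pi> a a' * ptens (orbs \<pi>) (\<lambda>Ob. b Ob (x Ob)) x')" for \<pi>
  have CF: "eframe (CC \<pi>) (IX \<pi>) (B \<pi>)" if "\<pi> \<in> prts" for \<pi>
    unfolding CC_tens IX_def B_def by (rule tens_eframe[OF finite_orbs[OF that] Ub[OF that] Kb[OF that]])
  \<comment> \<open>Echelon basis of the direct sum: a basis tensor of one summand, extended by
    zero.\<close>
  define HB where "HB pp = (\<lambda>q. if fst q = fst pp then B (fst pp) (snd pp) (snd q) else 0)" for pp
  let ?S = "Sigma prts IX"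
  have finS: "finite ?S" using Z.finite_gparts eframeD(1)[OF CF] by auto
  have zC: "(\<lambda>_. 0) \<in> CC \<pi>" for \<pi> using CC_subspc[of \<pi>] by (simp add: subspc_def)
  have W: "subspc ?W"
    unfolding subspc_def
  proof (intro conjI ballI allI)
    show "(\<lambda>_. 0) \<in> ?W" unfolding comp_sp_iff using zC by simp
    fix u assume u: "u \<in> ?W"
    { fix v assume v: "v \<in> ?W"
      show "(\<lambda>i. u i + v i) \<in> ?W"
        using u v CC_subspc unfolding comp_sp_iff subspc_def by simp }
    fix c show "(\<lambda>i. c * u i) \<in> ?W"
      using u CC_subspc unfolding comp_sp_iff subspc_def by simp
  qed
  have E: "eframe ?W ?S HB"
    unfolding eframe_def
  proof (intro conjI ballI)
    show "finite ?S" by (rule finS)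
    fix pp assume pp: "pp \<in> ?S"
    obtain \<pi> p where p: "pp = (\<pi>, p)" "\<pi> \<in> prts" "p \<in> IX \<pi>" using pp by blast
    show "HB pp \<in> ?W"
      unfolding comp_sp_iff
    proof (intro conjI allI impI ballI)
      fix \<pi>' q assume "\<pi>' \<notin> prts"
      then show "HB pp (\<pi>', q) = 0" using p by (auto simp: HB_def)
    next
      fix \<pi>' assume "\<pi>' \<in> prts"
      show "(\<lambda>q. HB pp (\<pi>', q)) \<in> CC \<pi>'"
      proof (cases "\<pi>' = \<pi>")
        case True
        then have "(\<lambda>q. HB pp (\<pi>', q)) = B \<pi> p" by (simp add: HB_def p)
        then show ?thesis using eframeD(2)[OF CF[OF p(2)] p(3)] True by simp
      qed (simp add: HB_def p zC)
    qed
    fix qq assume qq: "qq \<in> ?S"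
    obtain \<pi>' q where q: "qq = (\<pi>', q)" "\<pi>' \<in> prts" "q \<in> IX \<pi>'" using qq by blast
    show "HB pp qq = (if pp = qq then 1 else 0)"
      using eframeD(4)[OF CF[OF p(2)] p(3), of q] p q by (auto simp: HB_def)
  next
    fix v assume v: "v \<in> ?W"
    show "v = (\<lambda>i. \<Sum>pp\<in>?S. v pp * HB pp i)"
    proof
      fix i :: "nat set set \<times> 'i \<times> (nat set set \<Rightarrow> nat set \<times> 'j)"
      obtain \<pi>' q where i: "i = (\<pi>', q)" by (cases i)
      have "(\<Sum>pp\<in>?S. v pp * HB pp i) = (\<Sum>\<pi>\<in>prts. \<Sum>p\<in>IX \<pi>. v (\<pi>, p) * HB (\<pi>, p) i)"
        by (subst sum.Sigma) (use Z.finite_gparts eframeD(1)[OF CF] in auto)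
      also have "\<dots> = (\<Sum>\<pi>\<in>prts. if \<pi> = \<pi>' then v i else 0)"
      proof (rule sum.cong[OF refl])
        fix \<pi> assume \<pi>: "\<pi> \<in> prts"
        have "(\<lambda>q. v (\<pi>, q)) \<in> CC \<pi>" using v \<pi> unfolding comp_sp_iff by blast
        from eframeD(3)[OF CF[OF \<pi>] this, of q]
        show "(\<Sum>p\<in>IX \<pi>. v (\<pi>, p) * HB (\<pi>, p) i) = (if \<pi> = \<pi>' then v i else 0)"
          by (auto simp: HB_def i)
      qed
      also have "\<dots> = v i"
        using v Z.finite_gparts unfolding comp_sp_iff i by simp
      finally show "v i = (\<Sum>pp\<in>?S. v pp * HB pp i)" ..
    qed
  qed
  have si_parts: "simg si \<pi> \<in> prts" if "\<pi> \<in> prts" for \<pi> by (rule simg_parts[OF si_gset that])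
  have comp_at: "(\<lambda>q. v (simg si \<pi>, q)) \<in> CC (simg si \<pi>)" if "v \<in> ?W" "\<pi> \<in> prts" for v \<pi>
    using that(1) si_parts[OF that(2)] unfolding comp_sp_iff by blast
  have Tl: "linmap ?W ?T"
    unfolding linmap_def
  proof (intro ballI allI ext)
    fix u v c d and i :: "nat set set \<times> 'i \<times> (nat set set \<Rightarrow> nat set \<times> 'j)"
    assume u: "u \<in> ?W" and v: "v \<in> ?W"
    obtain \<pi> q where i: "i = (\<pi>, q)" by (cases i)
    show "?T (\<lambda>i. c * u i + d * v i) i = c * ?T u i + d * ?T v i"
    proof (cases "\<pi> \<in> prts")
      case True
      have "PH (simg si \<pi>) (\<lambda>q. c * u (simg si \<pi>, q) + d * v (simg si \<pi>, q))
        = (\<lambda>q. c * PH (simg si \<pi>) (\<lambda>q. u (simg si \<pi>, q)) q + d * PH (simg si \<pi>) (\<lambda>q. v (simg si \<pi>, q)) q)"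
        using Phi_spec(1)[OF si_parts[OF True]] comp_at[OF u True] comp_at[OF v True]
        unfolding linmap_def by simp
      then show ?thesis unfolding i comp_mp_at using True by simp
    next
      case False
      then show ?thesis unfolding i comp_mp_at by simp
    qed
  qed
  have Ti: "?T v \<in> ?W" if v: "v \<in> ?W" for v
    unfolding comp_sp_iff
  proof (intro conjI allI impI ballI)
    show "?T v (\<pi>, q) = 0" if "\<pi> \<notin> prts" for \<pi> q using that by (simp add: comp_mp_at)
    fix \<pi> assume \<pi>: "\<pi> \<in> prts"
    have "(\<lambda>q. ?T v (\<pi>, q)) = PH (simg si \<pi>) (\<lambda>q. v (simg si \<pi>, q))"
      using \<pi> by (simp add: comp_mp_at)
    then show "(\<lambda>q. ?T v (\<pi>, q)) \<in> CC \<pi>"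
      using Phi_in[OF si_parts[OF \<pi>] comp_at[OF v \<pi>]] simg_inv(2)[OF \<pi>] by simp
  qed
  have fixed: "simg si \<pi> = \<pi> \<longleftrightarrow> simg s \<pi> = \<pi>" if "\<pi> \<in> prts" for \<pi>
    using simg_inv[OF that] by metis
  have "trace ?W ?T = (\<Sum>pp\<in>?S. ?T (HB pp) pp)" by (rule eframe_trace[OF W Tl Ti E])
  also have "\<dots> = (\<Sum>\<pi>\<in>prts. \<Sum>p\<in>IX \<pi>. ?T (HB (\<pi>, p)) (\<pi>, p))"
    by (subst sum.Sigma) (use Z.finite_gparts eframeD(1)[OF CF] in auto)
  also have "\<dots> = (\<Sum>\<pi>\<in>prts. if simg s \<pi> = \<pi> then \<Sum>p\<in>IX \<pi>. PH \<pi> (B \<pi> p) p else 0)"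
  proof (rule sum.cong[OF refl])
    fix \<pi> assume \<pi>: "\<pi> \<in> prts"
    have "?T (HB (\<pi>, p)) (\<pi>, p) = (if simg s \<pi> = \<pi> then PH \<pi> (B \<pi> p) p else 0)" for p
    proof (cases "simg s \<pi> = \<pi>")
      case True
      then have "simg si \<pi> = \<pi>" using fixed[OF \<pi>] by blast
      then show ?thesis using True \<pi> by (simp add: comp_mp_at HB_def)
    next
      case False
      then have ne: "simg si \<pi> \<noteq> \<pi>" using fixed[OF \<pi>] by blast
      then have "(\<lambda>q. HB (\<pi>, p) (simg si \<pi>, q)) = (\<lambda>_. 0)" by (simp add: HB_def)
      then show ?thesis
        using False \<pi> linmap_zero[OF CC_subspc Phi_spec(1)[OF si_parts[OF \<pi>]]] by (simp add: comp_mp_at)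
    qed
    then show "(\<Sum>p\<in>IX \<pi>. ?T (HB (\<pi>, p)) (\<pi>, p)) = (if simg s \<pi> = \<pi> then \<Sum>p\<in>IX \<pi>. PH \<pi> (B \<pi> p) p else 0)"
      by simp
  qed
  also have "\<dots> = (\<Sum>\<pi>\<in>gparts r I t s. \<Sum>p\<in>IX \<pi>. PH \<pi> (B \<pi> p) p)"
    unfolding gparts_stable by (rule sum.inter_filter[OF Z.finite_gparts, symmetric])
  also have "\<dots> = (\<Sum>\<pi>\<in>gparts r I t s. mchar Usp Ump (pobj t \<pi>) (blockmap s) *
        (\<Prod>c\<in>cyc ((`) t) ((`) s) \<pi>. mchar Vsp Vmp (SOME J. J \<in> c, id) (btau c)))"
  proof (rule sum.cong[OF refl])
    fix \<pi> assume \<pi>s: "\<pi> \<in> gparts r I t s"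
    then have \<pi>: "\<pi> \<in> prts" and st: "simg s \<pi> = \<pi>" unfolding gparts_stable by auto
    let ?A = "Ump (pobj t \<pi>) (pobj t \<pi>) (blockmap s)"
    have ob: "bij_betw (simg s) (orbs \<pi>) (orbs \<pi>)" using simg_orbs_bij[OF gst \<pi>] unfolding st .
    have val: "PH \<pi> (B \<pi> (a, x)) (a, x) = ?A (bU \<pi> a) a * (\<Prod>Ob\<in>orbs \<pi>. VM Ob (b Ob (x Ob)) (x (simg s Ob)))"
      if a: "a \<in> AI \<pi>" and x: "x \<in> PiE (orbs \<pi>) K" for a x
    proof -
      have "PH \<pi> (\<lambda>(a', x'). bU \<pi> a a' * ptens (orbs \<pi>) (\<lambda>Ob. b Ob (x Ob)) x')
        = (\<lambda>(a', x'). ?A (bU \<pi> a) a' * ptens (orbs \<pi>) (\<lambda>Ob'. VM (simg si Ob') (b (simg si Ob') (x (simg si Ob')))) x')"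
        using Phi_spec(2)[OF \<pi> eframeD(2)[OF Ub[OF \<pi>] a], of "\<lambda>Ob. b Ob (x Ob)"] eframeD(2)[OF Kb[OF \<pi>]] x
        unfolding st by (simp add: PiE_iff)
      then have "PH \<pi> (B \<pi> (a, x)) (a, x) = ?A (bU \<pi> a) a *
          (\<Prod>Ob'\<in>orbs \<pi>. VM (simg si Ob') (b (simg si Ob') (x (simg si Ob'))) (x Ob'))"
        by (simp add: B_def ptens_def)
      \<comment> \<open>Passing from target orbits to source orbits gives the summand of
        \<open>block_cycles_trace\<close>.\<close>
      also have "(\<Prod>Ob'\<in>orbs \<pi>. VM (simg si Ob') (b (simg si Ob') (x (simg si Ob'))) (x Ob'))
        = (\<Prod>Ob\<in>orbs \<pi>. VM (simg si (simg s Ob)) (b (simg si (simg s Ob)) (x (simg si (simg s Ob)))) (x (simg s Ob)))"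
        by (rule prod.reindex_bij_betw[OF ob, symmetric])
      also have "\<dots> = (\<Prod>Ob\<in>orbs \<pi>. VM Ob (b Ob (x Ob)) (x (simg s Ob)))"
      proof (rule prod.cong[OF refl])
        fix Ob assume Ob: "Ob \<in> orbs \<pi>"
        have "simg si (simg s Ob) = (\<lambda>J. J) ` Ob" unfolding image_image[of "(`) si"]
          by (rule image_cong[OF refl]) (rule si_img(1)[OF block_I[OF \<pi> Ob]])
        then have "simg si (simg s Ob) = Ob" by simp
        then show "VM (simg si (simg s Ob)) (b (simg si (simg s Ob)) (x (simg si (simg s Ob)))) (x (simg s Ob))
          = VM Ob (b Ob (x Ob)) (x (simg s Ob))" by (simp only:)
      qed
      finally show ?thesis .
    qed
    have Um: "morph (pobj t \<pi>) (pobj t \<pi>) (blockmap s)" using blockmap_morph[OF \<pi>] unfolding st .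
    note pf = pobj_free[OF \<pi>]
    have "(\<Sum>p\<in>IX \<pi>. PH \<pi> (B \<pi> p) p) = (\<Sum>(a, x)\<in>AI \<pi> \<times> PiE (orbs \<pi>) K.
        ?A (bU \<pi> a) a * (\<Prod>Ob\<in>orbs \<pi>. VM Ob (b Ob (x Ob)) (x (simg s Ob))))"
      unfolding IX_def by (rule sum.cong[OF refl]) (use val in auto)
    also have "\<dots> = (\<Sum>a\<in>AI \<pi>. \<Sum>x\<in>PiE (orbs \<pi>) K.
        ?A (bU \<pi> a) a * (\<Prod>Ob\<in>orbs \<pi>. VM Ob (b Ob (x Ob)) (x (simg s Ob))))"
      by (rule sum.cartesian_product[symmetric])
    also have "\<dots> = (\<Sum>a\<in>AI \<pi>. ?A (bU \<pi> a) a) *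
        (\<Sum>x\<in>PiE (orbs \<pi>) K. \<Prod>Ob\<in>orbs \<pi>. VM Ob (b Ob (x Ob)) (x (simg s Ob)))"
      by (rule sum_product[symmetric])
    also have "(\<Sum>a\<in>AI \<pi>. ?A (bU \<pi> a) a) = mchar Usp Ump (pobj t \<pi>) (blockmap s)"
      unfolding mchar_def
      by (rule eframe_trace[OF U.sp(1)[OF pf] U.mp_lin[OF pf pf Um] U.mp_in[OF pf pf Um] Ub[OF \<pi>], symmetric])
    also have "(\<Sum>x\<in>PiE (orbs \<pi>) K. \<Prod>Ob\<in>orbs \<pi>. VM Ob (b Ob (x Ob)) (x (simg s Ob)))
      = (\<Prod>c\<in>cyc ((`) t) ((`) s) \<pi>. mchar Vsp Vmp (SOME J. J \<in> c, id) (btau c))"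
      by (rule block_cycles_trace[OF \<pi>s Kb[OF \<pi>]])
    finally show "(\<Sum>p\<in>IX \<pi>. PH \<pi> (B \<pi> p) p) = mchar Usp Ump (pobj t \<pi>) (blockmap s) *
        (\<Prod>c\<in>cyc ((`) t) ((`) s) \<pi>. mchar Vsp Vmp (SOME J. J \<in> c, id) (btau c))" .
  qed
  finally show ?thesis .
qed

end

section \<open>Wreath products and the characteristic\<close>

abbreviation "stdt r n \<equiv> snd (stdobj r n)"

lemma stdobj_pair: "stdobj r n = (stdset r n, stdt r n)"
  by (simp add: stdobj_def)

lemma std_mem: "prod_encode (j, a) \<in> stdset r n \<longleftrightarrow> j < r \<and> 1 \<le> a \<and> a \<le> n"
  by (auto simp: stdset_def)

lemma stdE:
  assumes "x \<in> stdset r n"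
  obtains j a where "x = prod_encode (j, a)" "j < r" "1 \<le> a" "a \<le> n"
  using assms by (auto simp: stdset_def)

lemma stdt_at: "j < r \<Longrightarrow> 1 \<le> a \<Longrightarrow> a \<le> n \<Longrightarrow> stdt r n (prod_encode (j, a)) = prod_encode ((j + 1) mod r, a)"
  by (simp add: stdobj_def std_mem)

lemma wact_at: "j < r \<Longrightarrow> 1 \<le> a \<Longrightarrow> a \<le> n \<Longrightarrow> wact r n w (prod_encode (j, a)) = prod_encode ((j + fst w a) mod r, snd w a)"
  by (simp add: wact_def std_mem)

lemma stdt_out: "x \<notin> stdset r n \<Longrightarrow> stdt r n x = x"
  by (simp add: stdobj_def)

lemma stdset_image: "stdset r n = prod_encode ` ({..<r} \<times> {1..n})"
  unfolding stdset_def by auto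

lemma finite_stdset: "finite (stdset r n)"
  unfolding stdset_image by simp

lemma card_stdset: "card (stdset r n) = r * n"
  unfolding stdset_image by (subst card_image) (auto intro: inj_on_subset[OF inj_prod_encode])

lemma stdt_pow: "j < r \<Longrightarrow> 1 \<le> a \<Longrightarrow> a \<le> n \<Longrightarrow> (stdt r n ^^ k) (prod_encode (j, a)) = prod_encode ((j + k) mod r, a)"
  by (induction k) (simp_all add: stdt_at mod_Suc_eq)

lemma wreathD:
  assumes "w \<in> wreath r n"
  shows "bij_betw (snd w) {1..n} {1..n}" "a \<notin> {1..n} \<Longrightarrow> snd w a = a" "fst w a < r" "a \<notin> {1..n} \<Longrightarrow> fst w a = 0"
    "1 \<le> a \<Longrightarrow> a \<le> n \<Longrightarrow> 1 \<le> snd w a \<and> snd w a \<le> n"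
proof -
  show b: "bij_betw (snd w) {1..n} {1..n}" "a \<notin> {1..n} \<Longrightarrow> snd w a = a" "fst w a < r" "a \<notin> {1..n} \<Longrightarrow> fst w a = 0"
    using assms by (auto simp: wreath_def)
  show "1 \<le> a \<Longrightarrow> a \<le> n \<Longrightarrow> 1 \<le> snd w a \<and> snd w a \<le> n"
    using bij_betwE[OF b(1)] by auto
qed

lemma mod_add_cancel: "(j + k) mod r = (j' + k) mod r \<Longrightarrow> j < r \<Longrightarrow> j' < r \<Longrightarrow> j = (j' :: nat)"
proof (induction j j' rule: linorder_wlog)
  case (le a b)
  have "r dvd (b + k) - (a + k)"
    using le by (metis mod_eq_dvd_iff_nat add_le_mono1)
  then have "r dvd b - a" by simp
  moreover have "b - a < r" using le by simp
  ultimately have "b - a = 0" using nat_dvd_not_less by blast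
  then show ?case using le by simp
next
  case (sym a b)
  show ?case using sym(1)[OF sym(2)[symmetric] sym(4,3)] by simp
qed

lemma std_gset:
  assumes r: "1 \<le> r" and w: "w \<in> wreath r n"
  shows "gset r (stdset r n) (stdt r n) (wact r n w)"
proof -
  let ?X = "stdset r n" and ?t = "stdt r n" and ?s = "wact r n w"
  note wD = wreathD[OF w]
  have bij: "bij_betw f ?X ?X" if "inj_on f ?X" "f ` ?X \<subseteq> ?X" for f
    using endo_inj_surj[OF finite_stdset that(2,1)] that(1) by (simp add: bij_betw_def)
  show ?thesis
  proof
    show "1 \<le> r" "finite ?X" by (rule r, rule finite_stdset)
    show "bij_betw ?t ?X ?X"
    proof (rule bij)
      show "inj_on ?t ?X"
      proof (rule inj_onI)
        fix x y assume "x \<in> ?X" "y \<in> ?X" and e: "?t x = ?t y"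
        then obtain j a j' a' where x: "x = prod_encode (j, a)" "j < r" "1 \<le> a" "a \<le> n"
          and y: "y = prod_encode (j', a')" "j' < r" "1 \<le> a'" "a' \<le> n" by (elim stdE)
        have "(j + 1) mod r = (j' + 1) mod r" "a = a'" using e x y by (simp_all add: stdt_at prod_encode_eq)
        then show "x = y" using mod_add_cancel[of j 1 r j'] x y by simp
      qed
      show "?t ` ?X \<subseteq> ?X" using r by (auto elim!: stdE simp: stdt_at std_mem)
    qed
    show "bij_betw ?s ?X ?X"
    proof (rule bij)
      show "inj_on ?s ?X"
      proof (rule inj_onI)
        fix x y assume "x \<in> ?X" "y \<in> ?X" and e: "?s x = ?s y"
        then obtain j a j' a' where x: "x = prod_encode (j, a)" "j < r" "1 \<le> a" "a \<le> n"
          and y: "y = prod_encode (j', a')" "j' < r" "1 \<le> a'" "a' \<le> n" by (elim stdE)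
        have e': "(j + fst w a) mod r = (j' + fst w a') mod r" "snd w a = snd w a'"
          using e x y by (simp_all add: wact_at prod_encode_eq)
        have "a = a'" using inj_onD[OF bij_betw_imp_inj_on[OF wD(1)] e'(2)] x y by simp
        then show "x = y" using mod_add_cancel[of j "fst w a" r j'] e' x y by simp
      qed
      show "?s ` ?X \<subseteq> ?X" using r wD(5) by (auto elim!: stdE simp: wact_at std_mem)
    qed
    fix x assume "x \<in> ?X"
    then obtain j a where x: "x = prod_encode (j, a)" "j < r" "1 \<le> a" "a \<le> n" by (rule stdE)
    have r0: "0 < r" using r by simp
    have "(j + fst w a) mod r < r" "(j + 1) mod r < r" using r0 by auto
    moreover have "((j + fst w a) mod r + 1) mod r = ((j + 1) mod r + fst w a) mod r"
      unfolding mod_add_left_eq by (simp only: ac_simps)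
    ultimately show "?t (?s x) = ?s (?t x)"
      using x wD(5)[OF x(3,4)] by (simp only: wact_at stdt_at)
    show "(?t ^^ r) x = x" using x by (simp add: stdt_pow)
    fix k assume k: "0 < k" "k < r"
    show "(?t ^^ k) x \<noteq> x"
    proof
      assume "(?t ^^ k) x = x"
      then have "(k + j) mod r = (0 + j) mod r" using x by (simp add: stdt_pow prod_encode_eq add.commute)
      from mod_add_cancel[OF this] show False using k by simp
    qed
  qed
qed

text \<open>The entries met along the path of \<open>a\<close> add up; over a full cycle their sum
  is the exponent that defines its type.\<close>

lemma wact_pow:
  assumes r: "1 \<le> r" and w: "w \<in> wreath r n" and a: "1 \<le> a" "a \<le> n" "j < r"
  shows "(wact r n w ^^ b) (prod_encode (j, a)) = prod_encode ((j + (\<Sum>i<b. fst w ((snd w ^^ i) a))) mod r, (snd w ^^ b) a)"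
proof -
  have in_n: "1 \<le> (snd w ^^ b) a \<and> (snd w ^^ b) a \<le> n" for b
    by (induction b) (use a wreathD(5)[OF w] in auto)
  show ?thesis
  proof (induction b)
    case (Suc b)
    have "(j + (\<Sum>i<b. fst w ((snd w ^^ i) a))) mod r < r" using r by simp
    then show ?case
      using Suc in_n[of b] by (simp add: wact_at mod_add_left_eq add.assoc)
  qed (use a in simp)
qed

text \<open>Joint orbits on [n]_r are the preimages of the cycles of \<open>snd w\<close>. From (0,
  a), one turn shifts the first coordinate by the sum of the entries, and this shift is what
  \<open>csh\<close> records.\<close>

lemma cyc_type_gtype:
  assumes r: "1 \<le> r" and w: "w \<in> wreath r n"
  shows "cyc_type r n w = gtype r (stdset r n) (stdt r n) (wact r n w)"
proof -
  let ?X = "stdset r n" and ?t = "stdt r n" and ?W = "wact r n w" and ?s = "snd w"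
  interpret A: gset r ?X ?t ?W by (rule std_gset[OF r w])
  note wD = wreathD[OF w]
  interpret N: gset 1 "{1..n}" id ?s
    by unfold_locales (use wD(1) in auto)
  have r0: "0 < r" using r by simp
  have cycles: "cycles ?s n = cyc id ?s {1..n}"
    unfolding cycles_def cyc_def orb_def by auto
  \<comment> \<open>The preimage of \<open>D\<close> under the projection of [n]_r to its second
    coordinate.\<close>
  define E where "E D = {prod_encode (j, a) | j a. j < r \<and> a \<in> D}" for D :: "nat set"
  have Eo: "E (orb id ?s a) = orb ?t ?W (prod_encode (0, a))" if a: "1 \<le> a" "a \<le> n" for a
  proof -
    have in_n: "1 \<le> (?s ^^ b) a \<and> (?s ^^ b) a \<le> n" for b
      by (induction b) (use a wD(5) in auto)
    have tw: "(?t ^^ k) ((?W ^^ b) (prod_encode (0, a)))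
        = prod_encode (((\<Sum>i<b. fst w ((?s ^^ i) a)) + k) mod r, (?s ^^ b) a)" for k b
      using in_n[of b] r0 by (simp add: wact_pow[OF r w a r0] stdt_pow mod_add_left_eq)
    show ?thesis
    proof
      show "E (orb id ?s a) \<subseteq> orb ?t ?W (prod_encode (0, a))"
      proof
        fix x assume "x \<in> E (orb id ?s a)"
        then obtain j b where x: "x = prod_encode (j, (?s ^^ b) a)" "j < r" unfolding E_def orb_def by auto
        \<comment> \<open>The shift accumulated along the way: \<open>r - ?c mod r\<close>
          translations cancel it, and \<open>j\<close> more reach the required coordinate.\<close>
        let ?c = "\<Sum>i<b. fst w ((?s ^^ i) a)"
        have "(?c + (r - ?c mod r + j)) mod r = (?c mod r + (r - ?c mod r + j)) mod r" by (simp add: mod_add_left_eq)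
        also have "?c mod r + (r - ?c mod r + j) = r + j" using mod_less_divisor[OF r0, of ?c] by simp
        finally have "(?c + (r - ?c mod r + j)) mod r = j" using x(2) by simp
        then have "x = (?t ^^ (r - ?c mod r + j)) ((?W ^^ b) (prod_encode (0, a)))" unfolding tw x(1) by simp
        then show "x \<in> orb ?t ?W (prod_encode (0, a))" unfolding orb_def by blast
      qed
      show "orb ?t ?W (prod_encode (0, a)) \<subseteq> E (orb id ?s a)"
      proof
        fix x assume "x \<in> orb ?t ?W (prod_encode (0, a))"
        then obtain k b where "x = (?t ^^ k) ((?W ^^ b) (prod_encode (0, a)))" unfolding orb_def by blast
        then have x: "x = prod_encode (((\<Sum>i<b. fst w ((?s ^^ i) a)) + k) mod r, (?s ^^ b) a)" unfolding tw .
        have "(?s ^^ b) a \<in> orb id ?s a" using N.orbI[of 0 b a] by simp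
        then show "x \<in> E (orb id ?s a)" unfolding x E_def using r0 by auto
      qed
    qed
  qed
  have Ebij: "bij_betw E (cycles ?s n) (cyc ?t ?W ?X)"
    unfolding bij_betw_def
  proof
    show "inj_on E (cycles ?s n)"
    proof (rule inj_onI)
      fix D D' assume "E D = E D'"
      moreover have "D = {a. prod_encode (0, a) \<in> E D}" for D unfolding E_def using r0 by (auto simp: prod_encode_eq)
      ultimately show "D = D'" by metis
    qed
    show "E ` cycles ?s n = cyc ?t ?W ?X"
    proof
      show "E ` cycles ?s n \<subseteq> cyc ?t ?W ?X"
        unfolding cycles cyc_def using Eo r0 by (auto simp: std_mem)
      show "cyc ?t ?W ?X \<subseteq> E ` cycles ?s n"
      proof
        fix C assume C: "C \<in> cyc ?t ?W ?X"
        then obtain x where x: "x \<in> ?X" "C = orb ?t ?W x" unfolding cyc_def by blast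
        then obtain j a where ja: "x = prod_encode (j, a)" "j < r" "1 \<le> a" "a \<le> n" by (elim stdE)
        have "x = (?t ^^ j) ((?W ^^ 0) (prod_encode (0, a)))" using ja r0 by (simp add: stdt_pow)
        then have "x \<in> orb ?t ?W (prod_encode (0, a))" unfolding orb_def by blast
        then have "C = orb ?t ?W (prod_encode (0, a))"
          using A.orb_eq[of "prod_encode (0, a)" x] ja r0 x by (simp add: std_mem)
        then have "C = E (orb id ?s a)" using Eo ja by simp
        then show "C \<in> E ` cycles ?s n" unfolding cycles cyc_def using ja by auto
      qed
    qed
  qed
  have ct: "ctype r ?t ?W (E D) = (card D, (\<Sum>a\<in>D. fst w a) mod r)" if D: "D \<in> cycles ?s n" for D
  proof -
    have Dc: "D \<in> cyc id ?s {1..n}" using D cycles by simp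
    obtain a where a: "a \<in> D" using N.cyc_ne[OF Dc] by blast
    have an: "1 \<le> a" "a \<le> n" using N.cyc_mem[OF Dc a] by auto
    note st = N.cyc_struct[OF Dc a]
    have L: "clen 1 D = card D" by (simp add: clen_def)
    have Do: "D = orb id ?s a" using N.cyc_mem[OF Dc a] by blast
    have EC: "E D \<in> cyc ?t ?W ?X" using D Ebij by (auto simp: bij_betw_def)
    have "E D = prod_encode ` ({..<r} \<times> D)" unfolding E_def by auto
    then have "card (E D) = r * card D"
      by (simp add: card_image[OF inj_prod_encode] card_cartesian_product)
    then have cl: "clen r (E D) = card D" using r0 by (simp add: clen_def)
    have per: "(?s ^^ card D) a = a" using st(2,3) unfolding L by simp
    have "bij_betw (\<lambda>b. (?s ^^ b) a) {..<card D} D"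
    proof -
      have "bij_betw (Pair (0::nat)) {..<card D} ({..<1} \<times> {..<card D})"
        by (auto simp: bij_betw_def inj_on_def)
      from bij_betw_trans[OF this st(4)[unfolded L]] show ?thesis by (simp add: comp_def)
    qed
    then have sm: "(\<Sum>i<card D. fst w ((?s ^^ i) a)) = (\<Sum>a\<in>D. fst w a)"
      by (rule sum.reindex_bij_betw)
    have x: "prod_encode (0, a) \<in> E D" unfolding E_def using a r0 by auto
    have "csh r ?t ?W (E D) = (\<Sum>a\<in>D. fst w a) mod r"
    proof (rule A.csh_eqI[OF EC x])
      show "(\<Sum>a\<in>D. fst w a) mod r < r" using r0 by simp
      show "(?W ^^ clen r (E D)) (prod_encode (0, a)) = (?t ^^ ((\<Sum>a\<in>D. fst w a) mod r)) (prod_encode (0, a))"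
        using an r0 by (simp add: cl wact_pow[OF r w an r0] per sm stdt_pow)
    qed
    then show ?thesis by (simp add: ctype_def cl)
  qed
  show ?thesis
  proof
    fix q :: "nat \<times> nat"
    obtain i k where q: "q = (i, k)" by (cases q)
    let ?A = "{D \<in> cycles ?s n. card D = i \<and> (\<Sum>a\<in>D. fst w a) mod r = k}"
    have "E ` ?A = {C \<in> cyc ?t ?W ?X. ctype r ?t ?W C = q}"
    proof (intro equalityI subsetI)
      fix C assume "C \<in> E ` ?A"
      then obtain D where D: "D \<in> ?A" "C = E D" by (rule imageE)
      then show "C \<in> {C \<in> cyc ?t ?W ?X. ctype r ?t ?W C = q}"
        using ct[of D] bij_betwE[OF Ebij] q by auto
    next
      fix C assume C: "C \<in> {C \<in> cyc ?t ?W ?X. ctype r ?t ?W C = q}"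
      then have "C \<in> E ` cycles ?s n" using bij_betw_imp_surj_on[OF Ebij] by simp
      then obtain D where D: "D \<in> cycles ?s n" "C = E D" by blast
      have "D \<in> ?A" using ct[OF D(1)] C D q by simp
      then show "C \<in> E ` ?A" using D(2) by (rule rev_image_eqI)
    qed
    moreover have "inj_on E ?A"
      by (rule inj_on_subset[OF bij_betw_imp_inj_on[OF Ebij]]) blast
    ultimately have "card {C \<in> cyc ?t ?W ?X. ctype r ?t ?W C = q} = card ?A"
      using card_image[of E ?A] by (simp only:)
    then show "cyc_type r n w q = gtype r ?X ?t ?W q"
      unfolding q cyc_type_def gtype_def tcount_def by simp
  qed
qed

text \<open>Commuting with translations, \<open>f\<close> is determined by its values at the points
  (0, a), whose two coordinates give the entry and the permutation.\<close>

lemma wreath_ex: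
  assumes f: "gset r (stdset r n) (stdt r n) f"
  shows "\<exists>w\<in>wreath r n. \<forall>x\<in>stdset r n. wact r n w x = f x"
proof -
  let ?X = "stdset r n" and ?t = "stdt r n"
  interpret A: gset r ?X ?t f by (rule f)
  have r0: "0 < r" using A.r by simp
  define g where "g a = prod_decode (f (prod_encode (0, a)))" for a
  have gX: "prod_encode (g a) \<in> ?X" if "1 \<le> a" "a \<le> n" for a
    using A.sX[of "prod_encode (0, a)"] that r0 by (simp add: std_mem g_def)
  have gr: "fst (g a) < r" "1 \<le> snd (g a)" "snd (g a) \<le> n" if "1 \<le> a" "a \<le> n" for a
    using gX[OF that] by (cases "g a", simp add: std_mem)+
  define w where "w = (\<lambda>a. if 1 \<le> a \<and> a \<le> n then fst (g a) else 0, \<lambda>a. if 1 \<le> a \<and> a \<le> n then snd (g a) else a)"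
  have fat: "f (prod_encode (j, a)) = prod_encode ((j + fst (g a)) mod r, snd (g a))"
    if ja: "j < r" "1 \<le> a" "a \<le> n" for j a
  proof -
    have x0: "prod_encode (0, a) \<in> ?X" using ja r0 by (simp add: std_mem)
    have "prod_encode (j, a) = (?t ^^ j) (prod_encode (0, a))" using ja r0 by (simp add: stdt_pow)
    then have "f (prod_encode (j, a)) = (?t ^^ j) (f (prod_encode (0, a)))" using A.comm1[OF x0, of j] by simp
    also have "f (prod_encode (0, a)) = prod_encode (fst (g a), snd (g a))" by (simp add: g_def)
    also have "(?t ^^ j) \<dots> = prod_encode ((fst (g a) + j) mod r, snd (g a))"
      by (rule stdt_pow) (use gr ja in auto)
    finally show ?thesis by (simp add: add.commute)
  qed
  have inj: "inj_on (snd w) {1..n}"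
  proof (rule inj_onI)
    fix a a' assume a: "a \<in> {1..n}" "a' \<in> {1..n}" and "snd w a = snd w a'"
    then have e: "snd (g a) = snd (g a')" by (simp add: w_def)
    \<comment> \<open>The translate of (0, a) that \<open>f\<close> would send to the image of (0,
      a'); the summand \<open>r\<close> keeps the subtraction in range.\<close>
    let ?j = "(fst (g a') + (r - fst (g a))) mod r"
    have jr: "?j < r" using r0 by simp
    have "(?j + fst (g a)) mod r = (fst (g a') + (r - fst (g a)) + fst (g a)) mod r"
      by (simp add: mod_add_left_eq)
    also have "\<dots> = fst (g a')" using gr[of a] gr[of a'] a by simp
    finally have "f (prod_encode (?j, a)) = f (prod_encode (0, a'))"
      using fat[OF jr, of a] fat[OF r0, of a'] a e gr(1)[of a'] by simp
    then have "prod_encode (?j, a) = prod_encode (0, a')"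
      by (rule inj_onD[OF bij_betw_imp_inj_on[OF A.sbij]]) (use a jr r0 in \<open>simp_all add: std_mem\<close>)
    then show "a = a'" by (simp add: prod_encode_eq)
  qed
  have "snd w ` {1..n} \<subseteq> {1..n}" using gr by (auto simp: w_def)
  then have "bij_betw (snd w) {1..n} {1..n}"
    using endo_inj_surj[OF _ _ inj] inj by (simp add: bij_betw_def)
  then have "w \<in> wreath r n"
    unfolding wreath_def using gr(1) r0 by (auto simp: w_def)
  moreover have "wact r n w x = f x" if "x \<in> ?X" for x
    using that by (elim stdE) (simp add: wact_at fat w_def)
  ultimately show ?thesis by blast
qed

lemma wact_inj:
  assumes w: "w \<in> wreath r n" and w': "w' \<in> wreath r n" and r: "1 \<le> r"
    and eq: "\<And>x. x \<in> stdset r n \<Longrightarrow> wact r n w x = wact r n w' x"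
  shows "w = w'"
proof -
  have "fst w a = fst w' a \<and> snd w a = snd w' a" for a
  proof (cases "1 \<le> a \<and> a \<le> n")
    case True
    have "wact r n w (prod_encode (0, a)) = wact r n w' (prod_encode (0, a))"
      by (rule eq) (use True r in \<open>simp add: std_mem\<close>)
    then show ?thesis
      using True r wreathD(3)[OF w, of a] wreathD(3)[OF w', of a] by (simp add: wact_at prod_encode_eq)
  next
    case False
    then have "a \<notin> {1..n}" by auto
    then show ?thesis using wreathD(2,4)[OF w] wreathD(2,4)[OF w'] by simp
  qed
  then show ?thesis by (simp add: prod_eq_iff fun_eq_iff)
qed

lemma finite_wreath: "1 \<le> r \<Longrightarrow> finite (wreath r n)"
proof -
  assume r: "1 \<le> r"
  have "inj_on (\<lambda>w. restrict (wact r n w) (stdset r n)) (wreath r n)"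
  proof (rule inj_onI)
    fix w w' assume w: "w \<in> wreath r n" "w' \<in> wreath r n"
      and e: "restrict (wact r n w) (stdset r n) = restrict (wact r n w') (stdset r n)"
    show "w = w'"
      by (rule wact_inj[OF w r]) (use fun_cong[OF e] in \<open>metis restrict_apply'\<close>)
  qed
  moreover have "(\<lambda>w. restrict (wact r n w) (stdset r n)) ` wreath r n \<subseteq> stdset r n \<rightarrow>\<^sub>E stdset r n"
    using gset.sX[OF std_gset[OF r]] by auto
  moreover have "finite (stdset r n \<rightarrow>\<^sub>E stdset r n)" by (simp add: finite_PiE finite_stdset)
  ultimately show ?thesis using finite_imageD finite_subset by blast
qed

lemma gtype_id:
  assumes g: "gset r X t id" and card: "card X = r * n"
  shows "gtype r X t id = (\<lambda>q. if q = (1, 0) then n else 0)"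
proof -
  interpret gset r X t id by (rule g)
  have ct: "ctype r t id C = (1, 0)" if C: "C \<in> cyc t id X" for C
  proof -
    obtain x where x: "x \<in> C" using cyc_ne[OF C] by blast
    have "\<exists>j. 1 = clen r C * j \<and> 0 mod r = (csh r t id C * j) mod r"
      by (rule cyc_stab[OF C x]) simp
    then have cl: "clen r C = 1" by auto
    have "csh r t id C = 0" by (rule csh_eqI[OF C x]) (use r in auto)
    then show ?thesis using cl by (simp add: ctype_def)
  qed
  have "card X = (\<Sum>C\<in>cyc t id X. r * 1)"
    unfolding card_sum by (rule sum.cong[OF refl]) (use ct in \<open>auto simp: ctype_def\<close>)
  then have "n = card (cyc t id X)" using card r by simp
  moreover have "{C \<in> cyc t id X. ctype r t id C = q} = (if q = (1, 0) then cyc t id X else {})" for q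
    using ct by auto
  ultimately show ?thesis by (auto simp: gtype_def tcount_def fun_eq_iff)
qed

text \<open>A double count of the \<open>t\<close>-equivariant bijections from [n]_r to
  \<open>X\<close>. There are r^n n! of them, each carries \<open>s\<close> back to exactly one
  \<open>w\<close>, and each \<open>w\<close> of the right type arises from \<open>zcent\<close> of
  them.\<close>

lemma wreath_count:
  assumes X: "gset r X t s" and card: "card X = r * n"
  shows "of_nat (card {w \<in> wreath r n. cyc_type r n w = gtype r X t s}) * zcent r (gtype r X t s)
    = (of_nat (r ^ n) * fact n :: complex)"
proof -
  interpret A: gset r X t s by (rule X)
  note r = A.r
  let ?Y = "stdset r n" and ?t = "stdt r n"
  have id_w: "(\<lambda>_. 0, \<lambda>a. a) \<in> wreath r n" using r by (auto simp: wreath_def bij_betw_def)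
  have Y0: "gset r ?Y ?t id" by (rule gset.gset_id[OF std_gset[OF r id_w]])
  interpret P0: gset_pair r ?Y ?t id X t id by (intro gset_pair.intro Y0 A.gset_id)
  let ?I = "\<lambda>w. gset_pair.giso ?Y ?t (wact r n w) X t s"
  have pair: "gset_pair r ?Y ?t (wact r n w) X t s" if "w \<in> wreath r n" for w
    by (intro gset_pair.intro std_gset[OF r that] X)
  have mem: "\<phi> \<in> ?I w \<longleftrightarrow> \<phi> \<in> P0.giso \<and> (\<forall>x\<in>?Y. \<phi> (wact r n w x) = s (\<phi> x))" if "w \<in> wreath r n" for w \<phi>
    unfolding gset_pair.giso_def[OF pair[OF that]] P0.giso_def ghom_def by auto
  have "P0.giso = (\<Union>w\<in>wreath r n. ?I w)"
  proof
    show "(\<Union>w\<in>wreath r n. ?I w) \<subseteq> P0.giso" using mem by blast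
    show "P0.giso \<subseteq> (\<Union>w\<in>wreath r n. ?I w)"
    proof
      fix \<phi> assume \<phi>: "\<phi> \<in> P0.giso"
      then have b: "bij_betw \<phi> ?Y X" and ht: "\<And>x. x \<in> ?Y \<Longrightarrow> \<phi> (?t x) = t (\<phi> x)"
        by (auto simp: P0.giso_def ghom_def)
      let ?\<psi> = "inv_into ?Y \<phi>"
      let ?f = "\<lambda>y. ?\<psi> (s (\<phi> y))"
      have \<psi>\<phi>: "?\<psi> (\<phi> y) = y" if "y \<in> ?Y" for y using b that by (simp add: bij_betw_def)
      have \<phi>\<psi>: "\<phi> (?\<psi> x) = x" "?\<psi> x \<in> ?Y" if "x \<in> X" for x
        using b that by (auto simp: bij_betw_def f_inv_into_f inv_into_into)
      have "gset r ?Y ?t ?f"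
      proof (rule gset_iso[OF X bij_betw_inv_into[OF b]])
        fix x assume x: "x \<in> X"
        show "?\<psi> (t x) = ?t (?\<psi> x)" using ht[OF \<phi>\<psi>(2)[OF x]] \<phi>\<psi>[OF x] \<psi>\<phi>[OF P0.A.tX[OF \<phi>\<psi>(2)[OF x]]] by simp
        show "?\<psi> (s x) = ?f (?\<psi> x)" using \<phi>\<psi>[OF x] by simp
      qed
      then obtain w where w: "w \<in> wreath r n" "\<And>x. x \<in> ?Y \<Longrightarrow> wact r n w x = ?f x" using wreath_ex by blast
      have "\<phi> (wact r n w x) = s (\<phi> x)" if "x \<in> ?Y" for x
      proof -
        have "\<phi> x \<in> X" using b that by (auto simp: bij_betw_def)
        then show ?thesis using w(2)[OF that] \<phi>\<psi>(1)[OF A.sX] by simp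
      qed
      then show "\<phi> \<in> (\<Union>w\<in>wreath r n. ?I w)" using mem[OF w(1)] \<phi> w(1) by blast
    qed
  qed
  moreover have "card (\<Union>w\<in>wreath r n. ?I w) = (\<Sum>w\<in>wreath r n. card (?I w))"
  proof (rule card_UN_disjoint[OF finite_wreath[OF r]])
    show "\<forall>w\<in>wreath r n. finite (?I w)"
      using gset_pair.finite_ghom[OF pair] gset_pair.giso_def[OF pair] by auto
    show "\<forall>w\<in>wreath r n. \<forall>w'\<in>wreath r n. w \<noteq> w' \<longrightarrow> ?I w \<inter> ?I w' = {}"
    proof (intro ballI impI)
      fix w w' assume w: "w \<in> wreath r n" "w' \<in> wreath r n" and ne: "w \<noteq> w'"
      show "?I w \<inter> ?I w' = {}"
      proof (rule ccontr)
        assume "?I w \<inter> ?I w' \<noteq> {}"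
        then obtain \<phi> where \<phi>: "\<phi> \<in> ?I w" "\<phi> \<in> ?I w'" by blast
        have b: "inj_on \<phi> ?Y" using \<phi>(1) mem[OF w(1)] by (auto simp: P0.giso_def bij_betw_def)
        have "wact r n w x = wact r n w' x" if x: "x \<in> ?Y" for x
        proof (rule inj_onD[OF b])
          show "\<phi> (wact r n w x) = \<phi> (wact r n w' x)" using \<phi> mem w x by simp
          show "wact r n w x \<in> ?Y" "wact r n w' x \<in> ?Y" using gset.sX[OF std_gset[OF r]] w x by auto
        qed
        then show False using wact_inj[OF w r] ne by blast
      qed
    qed
  qed
  ultimately have "of_nat (card P0.giso) = (\<Sum>w\<in>wreath r n. of_nat (card (?I w)) :: complex)" by simp
  also have "\<dots> = (\<Sum>w\<in>wreath r n. if cyc_type r n w = gtype r X t s then zcent r (gtype r X t s) else 0)"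
  proof (rule sum.cong[OF refl])
    fix w assume w: "w \<in> wreath r n"
    show "of_nat (card (?I w)) = (if cyc_type r n w = gtype r X t s then zcent r (gtype r X t s) else 0)"
      unfolding gset_pair.card_giso[OF pair[OF w]] cyc_type_gtype[OF r w] by simp
  qed
  also have "\<dots> = of_nat (card {w \<in> wreath r n. cyc_type r n w = gtype r X t s}) * zcent r (gtype r X t s)"
    by (subst sum.inter_filter[OF finite_wreath[OF r], symmetric]) simp
  finally have "of_nat (card {w \<in> wreath r n. cyc_type r n w = gtype r X t s}) * zcent r (gtype r X t s) = of_nat (card P0.giso)" ..
  \<comment> \<open>The total number is \<open>card_giso\<close> for the identity automorphisms,
    whose cycles all have type (1, 0).\<close>
  also have "\<dots> = zcent r (\<lambda>q. if q = (1, 0) then n else 0)"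
    unfolding P0.card_giso gtype_id[OF Y0 card_stdset] gtype_id[OF A.gset_id card] by simp
  also have "\<dots> = of_nat (r ^ n) * fact n"
    by (subst zcent_superset[of "{(1, 0)}"]) auto
  finally show ?thesis .
qed

text \<open>The trace is constant on the elements of type \<open>m\<close>, so the normalised sum is
  this constant times class size over group order, the inverse of \<open>zcent\<close>. Any set
  \<open>X\<close> of type \<open>m\<close> can supply the count.\<close>

lemma ch_at:
  assumes X: "gset r X t s" and val: "\<And>w. w \<in> wreath r (mdeg m) \<Longrightarrow> cyc_type r (mdeg m) w = m \<Longrightarrow>
      trace (sp (stdobj r (mdeg m))) (mp (stdobj r (mdeg m)) (stdobj r (mdeg m)) (wact r (mdeg m) w)) = \<chi>"
    and m: "m = gtype r X t s"
  shows "ch r sp mp m * zcent r m = \<chi>"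
proof -
  interpret gset r X t s by (rule X)
  let ?n = "mdeg m"
  have v: "valid_mon r m" unfolding m by (rule gtype_valid)
  have card: "card X = r * ?n" unfolding m by (rule mdeg_gtype[symmetric])
  let ?A = "{w \<in> wreath r ?n. cyc_type r ?n w = m}"
  have cnt: "of_nat (card ?A) * zcent r m = (of_nat (r ^ ?n) * fact ?n :: complex)"
    using wreath_count[OF X card] unfolding m[symmetric] .
  have nz: "(of_nat (r ^ ?n) * fact ?n :: complex) \<noteq> 0" using r by simp
  have "(\<Sum>w\<in>?A. trace (sp (stdobj r ?n)) (mp (stdobj r ?n) (stdobj r ?n) (wact r ?n w))) = (\<Sum>w\<in>?A. \<chi>)"
    by (rule sum.cong) (use val in auto)
  then have "ch r sp mp m = 1 / (of_nat (r ^ ?n) * of_nat (fact ?n)) * (of_nat (card ?A) * \<chi>)"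
    using v by (simp add: ch_def Let_def)
  then have "ch r sp mp m * zcent r m = 1 / (of_nat (r ^ ?n) * fact ?n) * (of_nat (card ?A) * zcent r m) * \<chi>"
    by simp
  then show ?thesis unfolding cnt using nz r by simp
qed

lemma (in bmod) mchar_ch:
  assumes X: "gset r I t s" and out: "\<And>x. x \<notin> I \<Longrightarrow> t x = x"
  shows "mchar sp mp (I, t) s = ch r sp mp (gtype r I t s) * zcent r (gtype r I t s)"
proof (rule ch_at[OF X _ refl, symmetric])
  let ?n = "mdeg (gtype r I t s)"
  fix w assume w: "w \<in> wreath r ?n" and eq: "cyc_type r ?n w = gtype r I t s"
  have "mchar sp mp (stdset r ?n, stdt r ?n) (wact r ?n w) = mchar sp mp (I, t) s"
    by (rule mchar_gtype[OF std_gset[OF r1 w] stdt_out X out]) (use eq cyc_type_gtype[OF r1 w] in auto)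
  then show "trace (sp (stdobj r ?n)) (mp (stdobj r ?n) (stdobj r ?n) (wact r ?n w)) = mchar sp mp (I, t) s"
    unfolding mchar_def stdobj_pair[symmetric] .
qed

section \<open>Models of a prescribed cycle type\<close>

type_synonym mpt = "(nat \<times> nat) \<times> nat \<times> nat \<times> nat"

text \<open>A free set with an automorphism of prescribed cycle type m: the point (q, e, a, j) is the j-th
  translate of the a-th entry in the e-th cycle of type q.\<close>
definition mod_set :: "nat \<Rightarrow> ((nat \<times> nat) \<Rightarrow> nat) \<Rightarrow> mpt set" where
  "mod_set r m = (SIGMA q : msupp m. {..<m q} \<times> {..<fst q} \<times> {..<r})"

definition mod_t :: "nat \<Rightarrow> mpt \<Rightarrow> mpt" where
  "mod_t r = (\<lambda>(q, e, a, j). (q, e, a, (j + 1) mod r))"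

text \<open>The whole twist \<open>snd q\<close> is placed on the step that closes the
  cycle.\<close>

definition mod_s :: "nat \<Rightarrow> mpt \<Rightarrow> mpt" where
  "mod_s r = (\<lambda>(q, e, a, j). if a + 1 < fst q then (q, e, a + 1, j) else (q, e, 0, (j + snd q) mod r))"

lemma mod_set_mem: "(q, e, a, j) \<in> mod_set r m \<longleftrightarrow> e < m q \<and> a < fst q \<and> j < r"
  by (auto simp: mod_set_def)

lemma mod_t_pow: "j < r \<Longrightarrow> (mod_t r ^^ k) (q, e, a, j) = (q, e, a, (j + k) mod r)"
  by (induction k) (simp_all add: mod_t_def mod_Suc_eq)

lemma mod_gset:
  assumes r: "1 \<le> r" and m: "valid_mon r m"
  shows "gset r (mod_set r m) (mod_t r) (mod_s r)"
proof -
  let ?X = "mod_set r m"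
  have r0: "0 < r" using r by simp
  have fin: "finite ?X" unfolding mod_set_def using valid_mon_finite[OF m] by auto
  have bij: "bij_betw f ?X ?X" if "inj_on f ?X" "f ` ?X \<subseteq> ?X" for f
    using endo_inj_surj[OF fin that(2,1)] that(1) by (simp add: bij_betw_def)
  show ?thesis
  proof
    show "1 \<le> r" "finite ?X" by (rule r, rule fin)
    show "bij_betw (mod_t r) ?X ?X"
    proof (rule bij)
      show "inj_on (mod_t r) ?X"
      proof (rule inj_onI)
        fix x y assume x: "x \<in> ?X" and y: "y \<in> ?X" and e: "mod_t r x = mod_t r y"
        obtain q e a j where xx: "x = (q, e, a, j)" by (cases x)
        obtain q' e' a' j' where yy: "y = (q', e', a', j')" by (cases y)
        have "(j + 1) mod r = (j' + 1) mod r" using e xx yy by (simp add: mod_t_def)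
        then show "x = y" using mod_add_cancel[of j 1 r j'] e x y xx yy by (simp add: mod_t_def mod_set_mem)
      qed
      show "mod_t r ` ?X \<subseteq> ?X"
      proof (rule image_subsetI)
        fix x assume x: "x \<in> ?X"
        obtain q e a j where "x = (q, e, a, j)" by (cases x)
        then show "mod_t r x \<in> ?X" using x r0 by (simp add: mod_t_def mod_set_mem)
      qed
    qed
    show "bij_betw (mod_s r) ?X ?X"
    proof (rule bij)
      show "inj_on (mod_s r) ?X"
      proof (rule inj_onI)
        fix x y assume x: "x \<in> ?X" and y: "y \<in> ?X" and e: "mod_s r x = mod_s r y"
        obtain q e a j where xx: "x = (q, e, a, j)" by (cases x)
        obtain q' e' a' j' where yy: "y = (q', e', a', j')" by (cases y)
        have m1: "a < fst q" "j < r" "a' < fst q'" "j' < r" using x y unfolding xx yy mod_set_mem by auto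
        show "x = y"
        proof (cases "a + 1 < fst q")
          case True
          then show ?thesis using e m1 unfolding xx yy by (simp add: mod_s_def split: if_splits)
        next
          case False
          then have "(j + snd q) mod r = (j' + snd q) mod r \<and> q = q' \<and> e = e' \<and> \<not> a' + 1 < fst q'"
            using e m1 unfolding xx yy by (auto simp: mod_s_def split: if_splits)
          moreover from this have "j = j'" using mod_add_cancel[of j "snd q" r j'] m1 by blast
          ultimately show ?thesis using False m1 unfolding xx yy by simp
        qed
      qed
      show "mod_s r ` ?X \<subseteq> ?X"
      proof (rule image_subsetI)
        fix x assume x: "x \<in> ?X"
        obtain q e a j where "x = (q, e, a, j)" by (cases x)
        then show "mod_s r x \<in> ?X" using x r0 by (simp add: mod_s_def mod_set_mem)
      qed
    qed
    fix x assume x: "x \<in> ?X"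
    obtain q e a j where xx: "x = (q, e, a, j)" by (cases x)
    have j: "j < r" using x unfolding xx mod_set_mem by simp
    have "((j + snd q) mod r + 1) mod r = ((j + 1) mod r + snd q) mod r"
      unfolding mod_add_left_eq by (simp only: ac_simps)
    then show "mod_t r (mod_s r x) = mod_s r (mod_t r x)" by (simp add: xx mod_s_def mod_t_def)
    show "(mod_t r ^^ r) x = x" using j by (simp add: xx mod_t_pow)
    fix k assume k: "0 < k" "k < r"
    show "(mod_t r ^^ k) x \<noteq> x"
    proof
      assume "(mod_t r ^^ k) x = x"
      then have "(k + j) mod r = (0 + j) mod r" using j by (simp add: xx mod_t_pow add.commute)
      from mod_add_cancel[OF this] show False using k by simp
    qed
  qed
qed

lemma mod_gtype:
  assumes r: "1 \<le> r" and m: "valid_mon r m"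
  shows "gtype r (mod_set r m) (mod_t r) (mod_s r) = m"
proof -
  let ?X = "mod_set r m" and ?t = "mod_t r" and ?s = "mod_s r"
  interpret gset r ?X ?t ?s by (rule mod_gset[OF r m])
  have r0: "0 < r" using r by simp
  \<comment> \<open>The e-th cycle of type q; one turn takes \<open>fst q\<close> steps and ends
    with the shift \<open>snd q\<close>, so its type is q.\<close>
  define Q where "Q q e = {(q, e, a, j) | a j. a < fst q \<and> j < r}" for q :: "nat \<times> nat" and e :: nat
  have sp: "(?s ^^ b) (q, e, 0, j) = (q, e, b, j)" if "b < fst q" for b q e j
    using that by (induction b) (simp_all add: mod_s_def)
  have orbQ: "orb ?t ?s (q, e, 0, 0) = Q q e" if i: "0 < fst q" for q e
  proof
    have "(?t ^^ a) ((?s ^^ b) (q, e, 0, 0)) \<in> Q q e" for a b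
    proof -
      have "(?s ^^ b) (q, e, 0, 0) \<in> Q q e"
        by (induction b) (use i r0 in \<open>auto simp: Q_def mod_s_def\<close>)
      then show ?thesis by (induction a) (use r0 in \<open>auto simp: Q_def mod_t_def\<close>)
    qed
    then show "orb ?t ?s (q, e, 0, 0) \<subseteq> Q q e" unfolding orb_def by blast
    show "Q q e \<subseteq> orb ?t ?s (q, e, 0, 0)"
    proof
      fix x assume "x \<in> Q q e"
      then obtain b j where x: "x = (q, e, b, j)" "b < fst q" "j < r" unfolding Q_def by blast
      have "x = (?t ^^ j) ((?s ^^ b) (q, e, 0, 0))" using x r0 by (simp add: sp mod_t_pow)
      then show "x \<in> orb ?t ?s (q, e, 0, 0)" unfolding orb_def by blast
    qed
  qed
  have i: "0 < fst q" "snd q < r" if "m q \<noteq> 0" for q using valid_mon_fst[OF m that] by auto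
  have ct: "ctype r ?t ?s (Q q e) = q" if e: "e < m q" for q e
  proof -
    have iq: "0 < fst q" "snd q < r" using i[of q] e by auto
    have x0: "(q, e, 0, 0) \<in> ?X" using iq e r0 by (simp add: mod_set_mem)
    have C: "Q q e \<in> cyc ?t ?s ?X" using orb_cyc[OF x0] orbQ[OF iq(1)] by simp
    have xQ: "(q, e, 0, 0) \<in> Q q e" unfolding Q_def using iq r0 by simp
    have "Q q e = (\<lambda>(a, j). (q, e, a, j)) ` ({..<fst q} \<times> {..<r})" unfolding Q_def by auto
    then have "card (Q q e) = fst q * r"
      by (simp add: card_image inj_on_def card_cartesian_product)
    then have cl: "clen r (Q q e) = fst q" using r0 by (simp add: clen_def)
    have "csh r ?t ?s (Q q e) = snd q"
    proof (rule csh_eqI[OF C xQ iq(2)])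
      obtain i' where i': "fst q = Suc i'" using iq(1) gr0_implies_Suc by blast
      have "(?s ^^ fst q) (q, e, 0, 0) = ?s (q, e, i', 0)" unfolding i' using sp[of i' q e 0] i' by simp
      also have "\<dots> = (q, e, 0, snd q)" using i' iq(2) by (simp add: mod_s_def)
      finally show "(?s ^^ clen r (Q q e)) (q, e, 0, 0) = (?t ^^ snd q) (q, e, 0, 0)"
        using iq r0 by (simp add: cl mod_t_pow)
    qed
    then show ?thesis by (simp add: ctype_def cl)
  qed
  have cycQ: "\<exists>q e. e < m q \<and> C = Q q e" if C: "C \<in> cyc ?t ?s ?X" for C
  proof -
    obtain x where x: "x \<in> C" using cyc_ne[OF C] by blast
    have xX: "x \<in> ?X" and Co: "C = orb ?t ?s x" using cyc_mem[OF C x] by auto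
    obtain q e a j where xx: "x = (q, e, a, j)" by (cases x)
    have l: "e < m q" "a < fst q" "j < r" using xX unfolding xx mod_set_mem by auto
    have x0: "(q, e, 0, 0) \<in> ?X" using l r0 by (simp add: mod_set_mem)
    have "x \<in> orb ?t ?s (q, e, 0, 0)" using orbQ[of q e] l xx unfolding Q_def by simp
    then have "C = Q q e" using orb_eq[OF x0] orbQ[of q e] l Co by simp
    then show ?thesis using l by blast
  qed
  show ?thesis
  proof
    fix q
    have "{C \<in> cyc ?t ?s ?X. ctype r ?t ?s C = q} = Q q ` {..<m q}"
    proof (intro equalityI subsetI)
      fix C assume C: "C \<in> {C \<in> cyc ?t ?s ?X. ctype r ?t ?s C = q}"
      then obtain q' e where "e < m q'" "C = Q q' e" using cycQ by blast
      then show "C \<in> Q q ` {..<m q}" using ct C by auto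
    next
      fix C assume "C \<in> Q q ` {..<m q}"
      then obtain e where e: "e < m q" "C = Q q e" by auto
      have "(q, e, 0, 0) \<in> ?X" using i[of q] e r0 by (simp add: mod_set_mem)
      then have "C \<in> cyc ?t ?s ?X" using orb_cyc orbQ[of q e] i[of q] e by fastforce
      then show "C \<in> {C \<in> cyc ?t ?s ?X. ctype r ?t ?s C = q}" using ct e by simp
    qed
    moreover have "inj_on (Q q) {..<m q}"
    proof (rule inj_onI)
      fix e e' assume e: "e \<in> {..<m q}" and eq: "Q q e = Q q e'"
      have "(q, e, 0, 0) \<in> Q q e" unfolding Q_def using i[of q] e r0 by simp
      then show "e = e'" unfolding eq by (simp add: Q_def)
    qed
    ultimately show "gtype r ?X ?t ?s q = m q" by (simp add: gtype_def tcount_def card_image)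
  qed
qed

section \<open>Support of the plethysm, and the final comparison of coefficients\<close>

lemma pobj_out: "c \<notin> fst (pobj t \<pi>) \<Longrightarrow> snd (pobj t \<pi>) c = c"
  by (simp add: pobj_def)

lemma Aser_ch: "ch r sp mp \<in> Aser r"
  by (simp add: Aser_def ch_def)

lemma cf_prod_Aser:
  "finite Q \<Longrightarrow> (\<And>q. q \<in> Q \<Longrightarrow> cf (f q) \<in> Aser r) \<Longrightarrow> cf (\<Prod>q\<in>Q. f q) \<in> Aser r"
  by (induction Q rule: finite_induct) (simp_all add: one_ser.rep_eq Aser_fone times_ser.rep_eq Aser_fmul)

lemma cf_power_Aser: "cf f \<in> Aser r \<Longrightarrow> cf (f ^ n) \<in> Aser r"
  by (induction n) (simp_all add: one_ser.rep_eq Aser_fone times_ser.rep_eq Aser_fmul)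

lemma cf_psub_Aser:
  assumes g: "g \<in> Aplus" and q: "1 \<le> fst q" and r: "1 \<le> r"
  shows "cf (psub r q (Ser g)) \<in> Aser r"
  unfolding Aser_def
proof (rule CollectI, intro allI impI)
  fix M assume nz: "cf (psub r q (Ser g)) M \<noteq> 0"
  let ?l = "ppull r q M"
  have M: "M = ppush r q ?l" and gl: "g ?l \<noteq> 0"
    using nz by (simp_all add: cf_psub cf_Ser_Aplus[OF g] split: if_splits)
  have l: "valid_mon 1 ?l" using gl g by (auto simp: Aplus_def Aser_def)
  have "finite (msupp M)" using nz cf_infinite by blast
  moreover have "1 \<le> i \<and> k < r" if "M (i, k) \<noteq> 0" for i k
  proof -
    have "ppush r q ?l (i, k) \<noteq> 0" using that M by metis
    then have c: "fst q dvd i" "k = (snd q * (i div fst q)) mod r" "?l (i div fst q, 0) \<noteq> 0"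
      by (auto simp: ppush_def split: if_splits)
    have "1 \<le> i div fst q" using valid_mon_fst[OF l c(3)] by simp
    then have "1 \<le> i" using c(1) q by (cases i) auto
    then show ?thesis using c(2) r by simp
  qed
  ultimately show "valid_mon r M" unfolding valid_mon_def by blast
qed

text \<open>\<open>ch\<close> vanishes at invalid monomials by definition, so plethysm has to vanish
  there as well; it does because variables are sent to series in valid monomials.\<close>

lemma plet_invalid:
  assumes r: "1 \<le> r" and M: "\<not> valid_mon r M"
  shows "plet r f g M = 0"
proof (cases "f \<in> Aser r \<and> g \<in> Aplus")
  case True
  have "cf (pmon r (Ser g) m) M = 0" if "m \<in> monset r (mdeg M)" for m
  proof (rule ccontr)
    assume nz: "cf (pmon r (Ser g) m) M \<noteq> 0"
    have v: "valid_mon r m" using that by (simp add: monset_def)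
    have "cf (pmon r (Ser g) m) \<in> Aser r"
      unfolding pmon_def
      by (rule cf_prod_Aser[OF valid_mon_finite[OF v]], rule cf_power_Aser, rule cf_psub_Aser)
        (use True r valid_mon_fst[OF v] in auto)
    then show False using nz M unfolding Aser_def by blast
  qed
  then show ?thesis using True by (simp add: plet_def)
qed (simp only: plet_def if_False)

theorem theorem4p9:
  fixes r :: nat
    and Usp :: "obj \<Rightarrow> ('i \<Rightarrow> complex) set"
    and Ump :: "obj \<Rightarrow> obj \<Rightarrow> (nat \<Rightarrow> nat) \<Rightarrow> ('i \<Rightarrow> complex) \<Rightarrow> ('i \<Rightarrow> complex)"
    and Vsp :: "obj \<Rightarrow> ('j \<Rightarrow> complex) set"
    and Vmp :: "obj \<Rightarrow> obj \<Rightarrow> (nat \<Rightarrow> nat) \<Rightarrow> ('j \<Rightarrow> complex) \<Rightarrow> ('j \<Rightarrow> complex)"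
  assumes "1 \<le> r"
    and "is_module r Usp Ump"
    and "is_module 1 Vsp Vmp"
    and "Vsp ({}, id) = {\<lambda>_. 0}"
  shows "ch r (comp_sp r Usp Vsp Vmp) (comp_mp r Usp Ump Vsp Vmp)
         = pleth r (ch r Usp Ump) (ch 1 Vsp Vmp)"
proof -
  interpret U: bmod r Usp Ump using assms by unfold_locales
  interpret V: bmod 1 Vsp Vmp using assms by unfold_locales auto
  let ?f = "ch r Usp Ump" and ?g = "ch 1 Vsp Vmp"
  note r = assms(1)
  define u where "u m = ?f m * zcent r m" for m
  define v where "v l = ?g l * zcent 1 l" for l
  have e_gset: "gset 1 {} id (id :: nat \<Rightarrow> nat)" by unfold_locales auto
  \<comment> \<open>The constant term of ch(V) is the trace on the value of V at the empty set,
    where the hypothesis on V enters.\<close>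
  have g0: "?g (\<lambda>_. 0) = 0"
  proof -
    have "gtype 1 {} id (id :: nat \<Rightarrow> nat) = (\<lambda>_. 0)"
      by (simp add: gtype_def cyc_def tcount_def)
    moreover have "mchar Vsp Vmp ({}, id) id = 0"
    proof -
      have fo: "free_obj 1 ({}, id)" unfolding free_obj_1 by simp
      have "eframe (Vsp ({}, id)) {} (\<lambda>_ _. 0)" unfolding assms(4) by (simp add: eframe_def)
      from eframe_trace[OF V.sp(1)[OF fo] V.mp_lin[OF fo fo V.morph_id] V.mp_in[OF fo fo V.morph_id] this]
      show ?thesis by (simp add: mchar_def)
    qed
    ultimately show ?thesis using V.mchar_ch[OF e_gset] by simp
  qed
  have gA: "?g \<in> Aplus" using Aser_ch g0 by (simp add: Aplus_def)
  have v0: "v (\<lambda>_. 0) = 0" using g0 by (simp add: v_def)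
  have gv: "cf (Ser ?g) l = v l / zcent 1 l" if "valid_mon 1 l" for l
    unfolding cf_Ser_Aplus[OF gA] v_def using zcent_nonzero[OF _ that] by simp
  have "ch r (comp_sp r Usp Vsp Vmp) (comp_mp r Usp Ump Vsp Vmp) M = plet r ?f ?g M" for M
  proof (cases "valid_mon r M")
    case False
    then show ?thesis using plet_invalid[OF r] by (simp add: ch_def)
  next
    case M: True
    let ?n = "mdeg M"
    \<comment> \<open>\<open>mod_set r M\<close> is a set of type \<open>M\<close>, so
      \<open>ch_at\<close> reduces the coefficient to the trace of an arbitrary element
      \<open>w\<close> of that type.\<close>
    have "ch r (comp_sp r Usp Vsp Vmp) (comp_mp r Usp Ump Vsp Vmp) M * zcent r M = zcent r M * plet r ?f ?g M"
    proof (rule ch_at[OF mod_gset[OF r M]])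
      show "M = gtype r (mod_set r M) (mod_t r) (mod_s r)" by (rule mod_gtype[OF r M, symmetric])
      fix w assume w: "w \<in> wreath r ?n" and wM: "cyc_type r ?n w = M"
      let ?I = "stdset r ?n" and ?t = "stdt r ?n" and ?s = "wact r ?n w"
      have gs: "gset r ?I ?t ?s" by (rule std_gset[OF r w])
      interpret A: gset r ?I ?t ?s by (rule gs)
      interpret B: bcomp r Usp Ump Vsp Vmp ?I ?t ?s by unfold_locales (rule stdt_out)
      let ?P = "gparts r ?I ?t ?s"
      let ?ty = "\<lambda>\<pi>. gtype r \<pi> ((`) ?t) ((`) ?s)"
      let ?pw = "\<lambda>\<pi>. \<Prod>c\<in>cyc ((`) ?t) ((`) ?s) \<pi>. v (fibtype r (\<lambda>C. (\<lambda>x\<in>?I. blk \<pi> x) ` C) (cyc ?t ?s ?I) c)"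
      have IM: "gtype r ?I ?t ?s = M" using cyc_type_gtype[OF r w] wM by simp
      have fb: "finite J" if "\<pi> \<in> ?P" "J \<in> \<pi>" for \<pi> J
        using A.block_sub[OF that] finite_stdset finite_subset by blast
      have "trace (comp_sp r Usp Vsp Vmp (stdobj r ?n)) (comp_mp r Usp Ump Vsp Vmp (stdobj r ?n) (stdobj r ?n) ?s)
        = (\<Sum>\<pi>\<in>?P. mchar Usp Ump (pobj ?t \<pi>) (blockmap ?s) *
          (\<Prod>c\<in>cyc ((`) ?t) ((`) ?s) \<pi>. mchar Vsp Vmp (SOME J. J \<in> c, id) (A.btau c)))"
        using B.comp_trace unfolding stdobj_pair[symmetric] .
      also have "\<dots> = (\<Sum>\<pi>\<in>?P. u (?ty \<pi>) * ?pw \<pi>)"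
      proof (rule sum.cong[OF refl])
        fix \<pi> assume \<pi>: "\<pi> \<in> ?P"
        interpret P: gset r \<pi> "(`) ?t" "(`) ?s" by (rule A.gset_gpart[OF \<pi>])
        have pg: "gset r (fst (pobj ?t \<pi>)) (snd (pobj ?t \<pi>)) (blockmap ?s)"
          "gtype r (fst (pobj ?t \<pi>)) (snd (pobj ?t \<pi>)) (blockmap ?s) = ?ty \<pi>"
          by (rule pobj_gset[OF A.gset_gpart[OF \<pi>]], erule fb[OF \<pi>])+
        have "mchar Usp Ump (fst (pobj ?t \<pi>), snd (pobj ?t \<pi>)) (blockmap ?s)
          = u (gtype r (fst (pobj ?t \<pi>)) (snd (pobj ?t \<pi>)) (blockmap ?s))"
          unfolding u_def by (rule U.mchar_ch[OF pg(1)]) (rule pobj_out)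
        then have "mchar Usp Ump (pobj ?t \<pi>) (blockmap ?s) = u (?ty \<pi>)" unfolding pg(2) by simp
        \<comment> \<open>The trace on a block is the value of \<open>v\<close> at the type of the
          stabiliser generator, which \<open>fibtype_quo\<close> reads off the orbits above
          \<open>c\<close>.\<close>
        moreover have "mchar Vsp Vmp (SOME J. J \<in> c, id) (A.btau c)
          = v (fibtype r (\<lambda>C. (\<lambda>x\<in>?I. blk \<pi> x) ` C) (cyc ?t ?s ?I) c)" if c: "c \<in> cyc ((`) ?t) ((`) ?s) \<pi>" for c
        proof -
          have J: "(SOME J. J \<in> c) \<in> c" using P.cyc_ne[OF c] some_in_eq by blast
          show ?thesis unfolding A.fibtype_quo[OF \<pi> c J] v_def
            by (rule V.mchar_ch[OF A.btau_gset[OF \<pi> c J]]) simp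
        qed
        ultimately show "mchar Usp Ump (pobj ?t \<pi>) (blockmap ?s) *
          (\<Prod>c\<in>cyc ((`) ?t) ((`) ?s) \<pi>. mchar Vsp Vmp (SOME J. J \<in> c, id) (A.btau c)) = u (?ty \<pi>) * ?pw \<pi>"
          by simp
      qed
      also have "\<dots> = (\<Sum>m\<in>monset r ?n. \<Sum>\<pi>\<in>{\<pi> \<in> ?P. ?ty \<pi> = m}. u (?ty \<pi>) * ?pw \<pi>)"
      proof (rule sum.group[symmetric, OF A.finite_gparts finite_monset])
        show "?ty ` ?P \<subseteq> monset r ?n"
        proof (rule image_subsetI)
          fix \<pi> assume \<pi>: "\<pi> \<in> ?P"
          interpret P: gset r \<pi> "(`) ?t" "(`) ?s" by (rule A.gset_gpart[OF \<pi>])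
          \<comment> \<open>There are at most as many blocks as points; this bounds the degree of
            the type of \<open>\<pi>\<close> and yields the range of summation in
            \<open>plet\<close>.\<close>
          have "\<pi> \<subseteq> blk \<pi> ` ?I"
          proof
            fix J assume J: "J \<in> \<pi>"
            obtain x where "x \<in> J" using A.block_ne[OF \<pi> J] by blast
            then show "J \<in> blk \<pi> ` ?I" using A.blk_eq[OF \<pi> J] A.block_sub[OF \<pi> J] by blast
          qed
          then have "card \<pi> \<le> card ?I"
            using surj_card_le[OF finite_stdset] by blast
          then have "r * mdeg (?ty \<pi>) \<le> r * ?n" using P.mdeg_gtype by (simp add: card_stdset)
          then show "?ty \<pi> \<in> monset r ?n" using r P.gtype_valid by (simp add: monset_def)
        qed
      qed
      also have "\<dots> = (\<Sum>m\<in>monset r ?n. zcent r M * (?f m * cf (pmon r (Ser ?g) m) M))"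
      proof (rule sum.cong[OF refl])
        fix m assume "m \<in> monset r ?n"
        then have m: "valid_mon r m" by (simp add: monset_def)
        interpret Q: gset_pair r ?I ?t ?s "mod_set r m" "mod_t r" "mod_s r"
          by (intro gset_pair.intro gs mod_gset[OF r m])
        \<comment> \<open>Over a model of type \<open>m\<close> the product of the substituted
          series is the image of the monomial \<open>m\<close> under plethysm.\<close>
        have pm: "(\<Prod>c\<in>cyc (mod_t r) (mod_s r) (mod_set r m). psub r (ctype r (mod_t r) (mod_s r) c) (Ser ?g)) = pmon r (Ser ?g) m"
          using prod_tcount[OF Q.B.finite_cyc, of "\<lambda>q. psub r q (Ser ?g)" "ctype r (mod_t r) (mod_s r)"]
          unfolding gtype_def[symmetric] mod_gtype[OF r m] pmon_def .
        \<comment> \<open>The factor \<open>zcent r m\<close> on the left is the one by which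
          \<open>u m\<close> exceeds the coefficient of ch(U).\<close>
        have S: "zcent r m * (\<Sum>\<pi>\<in>{\<pi> \<in> ?P. ?ty \<pi> = m}. ?pw \<pi>) = zcent r M * cf (pmon r (Ser ?g) m) M"
          using Q.gparts_sum[OF gv v0] unfolding Q.part_weight_def mod_gtype[OF r m] IM pm .
        have "(\<Sum>\<pi>\<in>{\<pi> \<in> ?P. ?ty \<pi> = m}. u (?ty \<pi>) * ?pw \<pi>) = (\<Sum>\<pi>\<in>{\<pi> \<in> ?P. ?ty \<pi> = m}. u m * ?pw \<pi>)"
          by (rule sum.cong) auto
        also have "\<dots> = ?f m * (zcent r m * (\<Sum>\<pi>\<in>{\<pi> \<in> ?P. ?ty \<pi> = m}. ?pw \<pi>))"
          by (simp only: u_def sum_distrib_left mult.assoc)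
        also have "\<dots> = zcent r M * (?f m * cf (pmon r (Ser ?g) m) M)"
          unfolding S by (simp only: ac_simps)
        finally show "(\<Sum>\<pi>\<in>{\<pi> \<in> ?P. ?ty \<pi> = m}. u (?ty \<pi>) * ?pw \<pi>) = zcent r M * (?f m * cf (pmon r (Ser ?g) m) M)" .
      qed
      also have "\<dots> = zcent r M * plet r ?f ?g M"
        using Aser_ch[of r Usp Ump] gA by (simp add: plet_def sum_distrib_left)
      finally show "trace (comp_sp r Usp Vsp Vmp (stdobj r ?n)) (comp_mp r Usp Ump Vsp Vmp (stdobj r ?n) (stdobj r ?n) ?s)
        = zcent r M * plet r ?f ?g M" .
    qed
    then show ?thesis using zcent_nonzero[OF r M] by simp
  qed
  then show ?thesis unfolding pleth_plet by blast
qed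

end
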